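(* Let $n\ge2r$ and let $\bm{X}^\star\in\mathbb{R}^{n\times n}$ have rank $r$ with thin SVD $\bm{X}^\star=\bm{U}_r\bm{\Sigma}_r\bm{V}_r^T$, $\bm{U}_r,\bm{V}_r\in\mathbb{R}^{n\times r}$. Let $\widetilde{\bm{U}}_r,\widetilde{\bm{V}}_r\in\mathbb{R}^{n\times r}$ have orthonormal columns (prior information about the column and row spaces). Let $\bm{U}_r^T\widetilde{\bm{U}}_r=\bm{L}_L\cos(\bm{\Gamma})\bm{R}_L^T$ and $\bm{V}_r^T\widetilde{\bm{V}}_r=\bm{L}_R\cos(\bm{H})\bm{R}_R^T$ be SVDs with orthogonal $\bm{L}_L,\bm{R}_L,\bm{L}_R,\bm{R}_R\in\mathbb{R}^{r\times r}$ and diagonal $\bm{\Gamma},\bm{H}$ containing the principal angles between $\mathrm{span}(\bm{U}_r)$ and $\mathrm{span}(\widetilde{\bm{U}}_r)$, resp. $\mathrm{span}(\bm{V}_r)$ and $\mathrm{span}(\widetilde{\bm{V}}_r)$. Define $\bm{A}_{cc}=\bm{L}_L\cos(\bm{\Gamma})\bm{R}_L^T\bm{R}_R\cos(\bm{H})\bm{L}_R^T$, $\bm{A}_{cs}=\bm{L}_L\cos(\bm{\Gamma})\bm{R}_L^T\bm{R}_R\sin(\bm{H})\bm{L}_R^T$, $\bm{A}_{sc}=\bm{L}_L\sin(\bm{\Gamma})\bm{R}_L^T\bm{R}_R\cos(\bm{H})\bm{L}_R^T$, $\bm{A}_{ss}=\bm{L}_L\sin(\bm{\Gamma})\bm{R}_L^T\bm{R}_R\sin(\bm{H})\bm{L}_R^T$.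 Let $\lambda\in[0,1]$, $\bm{\Phi}=\widetilde{\bm{U}}_r\widetilde{\bm{V}}_r^T$, and $$\alpha_1^2=\|\bm{I}_r-\lambda\bm{A}_{cc}\|_F^2+\|\lambda\bm{A}_{cs}\|_F^2+\|\lambda\bm{A}_{sc}\|_F^2,\quad\alpha_2=\|\lambda\bm{A}_{ss}\|,\quad\alpha_3=\|\bm{I}_r-\lambda\bm{A}_{cc}\|+\|\lambda\bm{A}_{sc}\|+\|\lambda\bm{A}_{cs}\|,$$ $$\beta=1\vee\sqrt{2\max_i\frac{\breve{\mu}_i}{\mu_i}}\vee\sqrt{2\max_j\frac{\breve{\nu}_j}{\nu_j}}.$$ If for all $i,j=1,\dots,n$, $$1\ge p_{ij}\gtrsim\max\Big\{\log\Big(\frac{\alpha_1^2n}{r\log n}\Big),1\Big\}\cdot\frac{(\mu_i+\nu_j)r\log n}{n}\cdot\max\{\alpha_3^2\beta^2,1\},$$ and $\alpha_2<\frac{15}{16}$, then with $\bm{Y}=\mathcal{R}_p(\bm{X}^\star)$, with high probability $\bm{X}^\star$ is exactly recovered as the solution of $$\min_{\bm{X}\in\mathbb{R}^{n\times n}}\ \|\bm{X}\|_*-\lambda\langle\bm{\Phi},\bm{X}\rangle\quad\text{s.t. }\bm{Y}=\mathcal{R}_p(\bm{X}).$$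
   Context: Notation: $\|\cdot\|_*$ nuclear norm, $\|\cdot\|$ spectral norm, $\|\cdot\|_F$ Frobenius norm, $\langle\bm{A},\bm{B}\rangle=\mathrm{tr}(\bm{A}^T\bm{B})$, $a\vee b=\max\{a,b\}$, $\bm{e}_i$ standard basis vectors; $\cos(\bm{\Gamma})$, $\sin(\bm{\Gamma})$ act entrywise on the diagonal. Sampling: for $p_{ij}\in(0,1]$, let $\delta_{ij}$ be independent Bernoulli variables with $\Pr(\delta_{ij}=1)=p_{ij}$ and $\mathcal{R}_p(\bm{X})=\sum_{i,j=1}^n\frac{\delta_{ij}}{p_{ij}}X_{ij}\bm{e}_i\bm{e}_j^T$. Leverage scores: for a subspace $\mathcal{S}$ of dimension $d$ with orthonormal basis matrix $\bm{S}$, $\mu_i(\mathcal{S})=\frac{n}{d}\|\bm{S}^T\bm{e}_i\|_2^2$; $\mu_i=\mu_i(\mathrm{span}(\bm{U}_r))$, $\nu_j=\mu_j(\mathrm{span}(\bm{V}_r))$ (assumed positive), $\breve{\mu}_i=\mu_i(\mathrm{span}([\bm{U}_r,\widetilde{\bm{U}}_r]))$, $\breve{\nu}_j=\mu_j(\mathrm{span}([\bm{V}_r,\widetilde{\bm{V}}_r]))$. $f\gtrsim g$ means $f\ge Cg$ for a sufficiently large universal constant $C$; "with high probability" means with failure probability polynomially small in $n$. *)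

theory Defs
  imports "HOL-Analysis.Analysis" "HOL-Probability.Product_PMF"
begin

text \<open>Matrices are functions nat => nat => real; only entries with indices below the
  stated dimensions are meaningful.  Dimensions are passed explicitly.\<close>

type_synonym rmat = "nat \<Rightarrow> nat \<Rightarrow> real"

definition mmul :: "nat \<Rightarrow> rmat \<Rightarrow> rmat \<Rightarrow> rmat" where
  "mmul k A B = (\<lambda>i j. \<Sum>t<k. A i t * B t j)"

definition mtrans :: "rmat \<Rightarrow> rmat" where
  "mtrans A = (\<lambda>i j. A j i)"

definition diagm :: "(nat \<Rightarrow> real) \<Rightarrow> rmat" where
  "diagm d = (\<lambda>i j. if i = j then d i else 0)"

definition idm :: rmat where
  "idm = diagm (\<lambda>_. 1)"

definition msub :: "rmat \<Rightarrow> rmat \<Rightarrow> rmat" where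
  "msub A B = (\<lambda>i j. A i j - B i j)"

definition mscale :: "real \<Rightarrow> rmat \<Rightarrow> rmat" where
  "mscale c A = (\<lambda>i j. c * A i j)"

definition mat_eq :: "nat \<Rightarrow> nat \<Rightarrow> rmat \<Rightarrow> rmat \<Rightarrow> bool" where
  "mat_eq m k A B \<longleftrightarrow> (\<forall>i<m. \<forall>j<k. A i j = B i j)"

definition orthonormal_cols :: "nat \<Rightarrow> nat \<Rightarrow> rmat \<Rightarrow> bool" where
  "orthonormal_cols m k U \<longleftrightarrow>
     (\<forall>a<k. \<forall>b<k. (\<Sum>i<m. U i a * U i b) = (if a = b then 1 else 0))"

definition orthogonal_mat :: "nat \<Rightarrow> rmat \<Rightarrow> bool" where
  "orthogonal_mat k Q \<longleftrightarrow> orthonormal_cols k k Q"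

definition vnorm :: "nat \<Rightarrow> (nat \<Rightarrow> real) \<Rightarrow> real" where
  "vnorm m x = sqrt (\<Sum>i<m. (x i)\<^sup>2)"

definition fro_norm :: "nat \<Rightarrow> nat \<Rightarrow> rmat \<Rightarrow> real" where
  "fro_norm m k A = sqrt (\<Sum>i<m. \<Sum>j<k. (A i j)\<^sup>2)"

definition frob_inner :: "nat \<Rightarrow> nat \<Rightarrow> rmat \<Rightarrow> rmat \<Rightarrow> real" where
  "frob_inner m k A B = (\<Sum>i<m. \<Sum>j<k. A i j * B i j)"

definition spec_norm :: "nat \<Rightarrow> nat \<Rightarrow> rmat \<Rightarrow> real" where
  "spec_norm m k A = Sup {vnorm m (\<lambda>i. \<Sum>j<k. A i j * x j) | x. vnorm k x \<le> 1}"

definition nuc_norm :: "nat \<Rightarrow> rmat \<Rightarrow> real" where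
  "nuc_norm n A = (SOME t. \<exists>P Q s. orthogonal_mat n P \<and> orthogonal_mat n Q \<and>
       (\<forall>k<n. 0 \<le> s k) \<and> mat_eq n n A (mmul n (mmul n P (diagm s)) (mtrans Q)) \<and>
       t = (\<Sum>k<n. s k))"

definition col_span :: "nat \<Rightarrow> nat \<Rightarrow> rmat \<Rightarrow> (nat \<Rightarrow> real) set" where
  "col_span m k M = {v. (\<forall>i\<ge>m. v i = 0) \<and> (\<exists>c. \<forall>i<m. v i = (\<Sum>t<k. M i t * c t))}"

definition lev_score :: "nat \<Rightarrow> (nat \<Rightarrow> real) set \<Rightarrow> nat \<Rightarrow> real" where
  "lev_score m W i = (SOME l. \<exists>d S. orthonormal_cols m d S \<and> col_span m d S = W \<and>
       l = real m / real d * (\<Sum>t<d. (S i t)\<^sup>2))"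

definition hcat :: "nat \<Rightarrow> rmat \<Rightarrow> rmat \<Rightarrow> rmat" where
  "hcat k A B = (\<lambda>i j. if j < k then A i j else B i (j - k))"

text \<open>Sampling operator R_p for a realisation delta of the Bernoulli variables.\<close>
definition sampling_op :: "rmat \<Rightarrow> (nat \<times> nat \<Rightarrow> bool) \<Rightarrow> rmat \<Rightarrow> rmat" where
  "sampling_op p \<delta> X = (\<lambda>i j. if \<delta> (i, j) then X i j / p i j else 0)"

definition bern_sampling :: "nat \<Rightarrow> rmat \<Rightarrow> (nat \<times> nat \<Rightarrow> bool) pmf" where
  "bern_sampling n p = Pi_pmf ({..<n} \<times> {..<n}) False (\<lambda>(i, j). bernoulli_pmf (p i j))"

end

theory Submission
  imports Defs
begin

text \<open>Write \<open>T\<close> for the tangent space at the low-rank matrix and \<open>D = U V\<^sup>T - \<lambda> \<Phi>\<close>. The part of \<open>D\<close> normal to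
  \<open>T\<close> has spectral norm \<open>\<alpha>\<^sub>2 < 15/16\<close>, so by the subgradient inequality of the nuclear norm it suffices to
  bound the inner product of the tangential part \<open>W\<close> of \<open>D\<close> with a feasible perturbation \<open>H\<close> by a small
  multiple of the nuclear norm of the normal part of \<open>H\<close>. This is done by golfing, with \<open>K\<close> of order \<open>log n\<close>
  independent batches whose union is dominated by the actual sample.

  The certificate is averaged over all orders of the batches. The term with \<open>t + 1\<close> factors is then also an
  average over products in which single batches are replaced by blocks of \<open>K div (t + 1)\<close> batches, and each
  block contracts at a constant rate in the moment of order \<open>2 * (K div (t + 1))\<close>. Hence every term is
  controlled with probability polynomially close to 1 at the sampling rate \<open>log n\<close> times the leverage scores,
  starting from entrywise, row and column bounds on \<open>W\<close> by \<open>\<alpha>\<^sub>3 \<beta>\<close> times the leverage scores.\<close>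

section \<open>Expectations over independent bits\<close>

text \<open>The obstacle is the missing logarithm. With K of order \<open>ln n\<close> batches and a
  total rate of \<open>ln n\<close> times the leverage scores, a single batch is sampled only at a
  constant multiple of the leverage scores. One golfing step with it contracts in mean square, but
  not with probability close to 1, while a fixed order of larger batches would cost a further
  logarithm. Blocks trade length for size: with t + 1 blocks of m batches each, the m-th moment sees
  the ratio of m to a block rate proportional to m, a constant, and the exponents multiply to
  \<open>m * (t + 1) > K / 2\<close>. The total gain is therefore polynomial in n for short and long
  products alike, and Markov's inequality finishes. The blocks exist only as a device for estimating
  the average over orders; the certificate itself uses single batches.

  The moment bounds come from flipping one bit at a time. This needs only quantitative monotonicity
  of the gradient of an even power, for vectors and for singular values. Expectations are finite
  sums over subsets, so that one bit can be averaged out by algebra.\<close>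

definition bexp :: "'i set \<Rightarrow> ('i \<Rightarrow> real) \<Rightarrow> (('i \<Rightarrow> bool) \<Rightarrow> real) \<Rightarrow> real" where
  "bexp I p f = (\<Sum>A\<in>Pow I. (\<Prod>i\<in>A. p i) * (\<Prod>i\<in>I - A. 1 - p i) * f (\<lambda>i. i \<in> A))"

lemma bexp_add: "bexp I p (\<lambda>\<eta>. f \<eta> + g \<eta>) = bexp I p f + bexp I p g"
  by (simp add: bexp_def distrib_left sum.distrib)

lemma bexp_cmult: "bexp I p (\<lambda>\<eta>. c * f \<eta>) = c * bexp I p f"
  by (simp add: bexp_def sum_distrib_left mult.left_commute)

lemma bexp_diff: "bexp I p (\<lambda>\<eta>. f \<eta> - g \<eta>) = bexp I p f - bexp I p g"
  by (simp add: bexp_def right_diff_distrib sum_subtractf)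

lemma bexp_sum: "bexp I p (\<lambda>\<eta>. \<Sum>j\<in>J. f j \<eta>) = (\<Sum>j\<in>J. bexp I p (f j))"
  unfolding bexp_def sum_distrib_left by (rule sum.swap)

lemma bexp_empty [simp]: "bexp {} p f = f (\<lambda>i. False)"
  by (simp add: bexp_def)

lemma bexp_insert:
  assumes "finite I" "x \<notin> I"
  shows "bexp (insert x I) p f =
    p x * bexp I p (\<lambda>\<eta>. f (\<eta>(x := True))) + (1 - p x) * bexp I p (\<lambda>\<eta>. f (\<eta>(x := False)))"
proof -
  let ?g = "\<lambda>A. (\<Prod>i\<in>A. p i) * (\<Prod>i\<in>insert x I - A. 1 - p i) * f (\<lambda>i. i \<in> A)"
  have inj: "inj_on (insert x) (Pow I)"
    using assms(2) by (auto simp: inj_on_def)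
  have "bexp (insert x I) p f = sum ?g (Pow I) + sum ?g (insert x ` Pow I)"
    unfolding bexp_def Pow_insert by (rule sum.union_disjoint) (use assms in auto)
  also have "sum ?g (insert x ` Pow I) = (\<Sum>A\<in>Pow I. ?g (insert x A))"
    by (simp add: sum.reindex[OF inj])
  also have "\<dots> = p x * bexp I p (\<lambda>\<eta>. f (\<eta>(x := True)))"
    unfolding bexp_def sum_distrib_left
  proof (rule sum.cong[OF refl])
    fix A assume A: "A \<in> Pow I"
    then have 1: "finite A" "x \<notin> A" using assms finite_subset by auto
    have 2: "insert x I - insert x A = I - A" using assms by auto
    have 3: "(\<lambda>i. i \<in> insert x A) = (\<lambda>i. i \<in> A)(x := True)" by (auto simp: fun_eq_iff)
    show "?g (insert x A) = p x * ((\<Prod>i\<in>A. p i) * (\<Prod>i\<in>I - A. 1 - p i) * f ((\<lambda>i. i \<in> A)(x := True)))"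
      unfolding 2 3 using 1 by (simp add: mult.assoc)
  qed
  also have "sum ?g (Pow I) = (1 - p x) * bexp I p (\<lambda>\<eta>. f (\<eta>(x := False)))"
    unfolding bexp_def sum_distrib_left
  proof (rule sum.cong[OF refl])
    fix A assume A: "A \<in> Pow I"
    have 2: "insert x I - A = insert x (I - A)" using A assms by auto
    have 3: "(\<lambda>i. i \<in> A) = (\<lambda>i. i \<in> A)(x := False)" using A assms by (auto simp: fun_eq_iff)
    show "?g A = (1 - p x) * ((\<Prod>i\<in>A. p i) * (\<Prod>i\<in>I - A. 1 - p i) * f ((\<lambda>i. i \<in> A)(x := False)))"
      unfolding 2 3[symmetric] using assms by (simp add: mult_ac)
  qed
  finally show ?thesis by linarith
qed

lemma bexp_const: "finite I \<Longrightarrow> bexp I p (\<lambda>\<eta>. c) = c"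
  by (induction I rule: finite_induct) (simp_all add: bexp_insert algebra_simps)

lemma bexp_mono:
  assumes "\<And>i. i \<in> I \<Longrightarrow> 0 \<le> p i \<and> p i \<le> 1" "\<And>\<eta>. f \<eta> \<le> g \<eta>"
  shows "bexp I p f \<le> bexp I p g"
  unfolding bexp_def
proof (rule sum_mono, rule mult_left_mono)
  fix A assume "A \<in> Pow I"
  then show "0 \<le> (\<Prod>i\<in>A. p i) * (\<Prod>i\<in>I - A. 1 - p i)"
    using assms(1) by (intro mult_nonneg_nonneg prod_nonneg) auto
qed (rule assms)

lemma bexp_nonneg:
  assumes "\<And>i. i \<in> I \<Longrightarrow> 0 \<le> p i \<and> p i \<le> 1" "\<And>\<eta>. 0 \<le> f \<eta>"
  shows "0 \<le> bexp I p f"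
  unfolding bexp_def
  by (intro sum_nonneg mult_nonneg_nonneg prod_nonneg) (use assms in auto)

text \<open>Averages out the bit x but leaves it in the index set, so that two integrands may be
  compared after averaging over one bit.\<close>

lemma bexp_split:
  assumes "finite I" "x \<in> I"
  shows "bexp I p f = bexp I p (\<lambda>\<eta>. p x * f (\<eta>(x := True)) + (1 - p x) * f (\<eta>(x := False)))"
proof -
  obtain I' where I: "I = insert x I'" "x \<notin> I'" "finite I'"
    using assms by (metis Diff_iff finite_Diff insertI1 insert_Diff)
  show ?thesis
    unfolding I(1) bexp_insert[OF I(3,2)]
    by (simp add: bexp_add bexp_cmult) (simp add: algebra_simps)
qed

lemma bexp_mono_bit:
  assumes "finite I" "\<And>i. i \<in> I \<Longrightarrow> 0 \<le> p i \<and> p i \<le> 1" "x \<in> I"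
    and "\<And>\<eta>. p x * f (\<eta>(x := True)) + (1 - p x) * f (\<eta>(x := False))
      \<le> p x * g (\<eta>(x := True)) + (1 - p x) * g (\<eta>(x := False))"
  shows "bexp I p f \<le> bexp I p g"
  unfolding bexp_split[OF assms(1,3), of p f] bexp_split[OF assms(1,3), of p g]
  by (rule bexp_mono) (use assms in auto)

section \<open>Elementary inequalities for powers and for the gradient of an even power of the
  norm\<close>

lemma young_power:
  fixes z t :: real
  assumes "0 \<le> z" "0 \<le> t" "1 \<le> m"
  shows "real m * (z * t ^ (m - 1)) \<le> z ^ m + (real m - 1) * t ^ m"
proof (cases "t = 0")
  case True
  then show ?thesis using assms by (cases m) (auto simp: power_0_left)
next
  case False
  then have t: "t > 0" using assms by simp
  \<comment> \<open>Young's inequality is Bernoulli's inequality for the ratio \<open>z / t\<close>,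
    multiplied by \<open>t ^ m\<close>.\<close>
  have "1 + real m * (z / t - 1) \<le> (1 + (z / t - 1)) ^ m"
    by (rule Bernoulli_inequality) (use assms t in simp)
  then have "(1 + real m * (z / t - 1)) * t ^ m \<le> (z / t) ^ m * t ^ m"
    using t by (intro mult_right_mono) auto
  also have "\<dots> = z ^ m" using t by (simp add: power_divide)
  finally have *: "(1 + real m * (z / t - 1)) * t ^ m \<le> z ^ m" .
  have "t ^ m = t * t ^ (m - 1)" using assms by (cases m) auto
  then have "(1 + real m * (z / t - 1)) * t ^ m = t ^ m + real m * (z * t ^ (m - 1)) - real m * t ^ m"
    using t by (simp add: field_simps)
  with * show ?thesis by (simp add: algebra_simps)
qed

lemma power_add_le:
  fixes a b :: real
  assumes "0 \<le> a" "0 \<le> b"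
  shows "(a + b) ^ m \<le> 2 ^ m * (a ^ m + b ^ m)"
proof -
  have "(a + b) ^ m \<le> (2 * max a b) ^ m"
    by (rule power_mono) (use assms in auto)
  also have "\<dots> = 2 ^ m * max a b ^ m" by (simp add: power_mult_distrib)
  also have "max a b ^ m \<le> a ^ m + b ^ m"
    using assms by (auto simp: max_def)
  finally show ?thesis by simp
qed

text \<open>Splitting at \<open>b = a / m\<close> keeps the coefficient of the main part free of m,
  because \<open>(1 + 1 / m) ^ m\<close> stays below e and hence below 3. All growth in m is moved
  to the power of b.\<close>

lemma power_add_le_weighted:
  fixes a b :: real
  assumes "0 \<le> a" "0 \<le> b" "1 \<le> m"
  shows "(a + b) ^ (m - 1) \<le> 3 * a ^ (m - 1) + (real m + 1) ^ (m - 1) * b ^ (m - 1)"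
proof (cases "b \<le> a / real m")
  case True
  have e: "(1 + 1 / real m) ^ (m - 1) \<le> 3"
  proof -
    have "(1 + 1 / real m) ^ (m - 1) \<le> (1 + 1 / real m) ^ m"
      by (rule power_increasing) auto
    also have "\<dots> \<le> exp (1 / real m) ^ m"
      by (intro power_mono exp_ge_add_one_self) auto
    also have "\<dots> = exp 1" using assms by (simp flip: exp_of_nat_mult)
    also have "\<dots> \<le> 3" using exp_le by simp
    finally show ?thesis .
  qed
  have "(a + b) ^ (m - 1) \<le> ((1 + 1 / real m) * a) ^ (m - 1)"
    by (rule power_mono) (use True assms in \<open>auto simp: field_simps\<close>)
  also have "\<dots> \<le> 3 * a ^ (m - 1)"
    using e assms by (simp add: power_mult_distrib mult_right_mono)
  finally show ?thesis using assms by (smt (verit) mult_nonneg_nonneg zero_le_power of_nat_0_le_iff)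
next
  case False
  then have "a \<le> real m * b" using assms by (simp add: field_simps)
  then have "(a + b) ^ (m - 1) \<le> ((real m + 1) * b) ^ (m - 1)"
    by (intro power_mono) (use assms in \<open>auto simp: algebra_simps\<close>)
  then show ?thesis using assms by (simp add: power_mult_distrib) (smt (verit) zero_le_power)
qed

definition nsq :: "'d set \<Rightarrow> ('d \<Rightarrow> real) \<Rightarrow> real" where
  "nsq D x = (\<Sum>d\<in>D. (x d)\<^sup>2)"

lemma nsq_nonneg [simp]: "0 \<le> nsq D x"
  by (simp add: nsq_def sum_nonneg)

lemma power_diff_le:
  fixes a b :: real
  assumes "0 \<le> b" "b \<le> a"
  shows "a ^ q - b ^ q \<le> real q * (a - b) * a ^ (q - 1)"
proof (cases q)
  case (Suc n)
  have "a ^ q - b ^ q = (a - b) * (\<Sum>i<Suc n. a ^ i * b ^ (n - i))"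
    unfolding Suc using diff_power_eq_sum[of a n b] by simp
  moreover have "(\<Sum>i<Suc n. a ^ i * b ^ (n - i)) \<le> (\<Sum>i<Suc n. a ^ n)"
  proof (rule sum_mono)
    fix i assume "i \<in> {..<Suc n}"
    then have "a ^ i * b ^ (n - i) \<le> a ^ i * a ^ (n - i)"
      using assms by (intro mult_left_mono power_mono) auto
    then show "a ^ i * b ^ (n - i) \<le> a ^ n"
      using \<open>i \<in> _\<close> by (simp flip: power_add)
  qed
  ultimately have "a ^ q - b ^ q \<le> (a - b) * (\<Sum>i<Suc n. a ^ n)"
    using assms by (simp add: mult_left_mono)
  also have "\<dots> = real q * (a - b) * a ^ (q - 1)" using Suc by simp
  finally show ?thesis .
qed simp

text \<open>Up to a factor, \<open>nsq D x ^ (m - 1) * x d\<close> is the gradient of the m-th power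
  of \<open>nsq\<close>. Its increment paired with \<open>x - y\<close> is bounded linearly in m,
  which later yields moments of subgaussian type.\<close>

lemma nsq_power_monotone:
  assumes "finite D" "1 \<le> m"
  shows "(\<Sum>d\<in>D. (x d - y d) * (nsq D x ^ (m - 1) * x d - nsq D y ^ (m - 1) * y d))
    \<le> 2 * real m * nsq D (\<lambda>d. x d - y d) * (nsq D x ^ (m - 1) + nsq D y ^ (m - 1))"
proof -
  define a b N c where "a = nsq D x" and "b = nsq D y" and "N = nsq D (\<lambda>d. x d - y d)"
    and "c = (\<Sum>d\<in>D. x d * y d)"
  define A B where "A = a ^ (m - 1)" and "B = b ^ (m - 1)"
  have nn: "0 \<le> a" "0 \<le> b" "0 \<le> N" "0 \<le> A" "0 \<le> B"
    by (auto simp: a_def b_def N_def A_def B_def)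
  have N: "N = a + b - 2 * c"
    by (simp add: N_def a_def b_def c_def nsq_def power2_diff sum.distrib sum_subtractf
        sum_distrib_left mult.assoc)
  have lhs: "(\<Sum>d\<in>D. (x d - y d) * (A * x d - B * y d)) = A * a + B * b - c * (A + B)"
    by (simp add: a_def b_def c_def nsq_def sum_distrib_left sum_distrib_right algebra_simps
        sum.distrib sum_subtractf power2_eq_square)
  have cs: "(a - b)\<^sup>2 \<le> N * (2 * (a + b))"
  proof -
    have "a - b = (\<Sum>d\<in>D. (x d - y d) * (x d + y d))"
      by (simp add: a_def b_def nsq_def algebra_simps power2_eq_square sum_subtractf sum.distrib)
    then have "(a - b)\<^sup>2 \<le> N * (\<Sum>d\<in>D. (x d + y d)\<^sup>2)"
      by (simp add: N_def nsq_def Cauchy_Schwarz_ineq_sum)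
    also have "(\<Sum>d\<in>D. (x d + y d)\<^sup>2) \<le> (\<Sum>d\<in>D. 2 * ((x d)\<^sup>2 + (y d)\<^sup>2))"
      by (rule sum_mono) (smt (verit) power2_sum sum_squares_bound)
    also have "\<dots> = 2 * (a + b)"
      by (simp add: a_def b_def nsq_def sum.distrib sum_distrib_left)
    finally show ?thesis using nn by (simp add: mult_left_mono)
  qed
  \<comment> \<open>Both factors have the same sign, so the estimate may be proved for the ordered
    pair and used in either order.\<close>
  have key: "(A - B) * (a - b) \<le> 4 * (real m - 1) * N * (A + B)"
  proof -
    have main: "(u ^ (m - 1) - v ^ (m - 1)) * (u - v) \<le> 4 * (real m - 1) * N * (u ^ (m - 1) + v ^ (m - 1))"
      if "0 \<le> v" "v \<le> u" "(u - v)\<^sup>2 \<le> N * (2 * (u + v))" for u v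
    proof (cases "m - 1")
      case 0
      then have "m = 1" using assms by simp
      then show ?thesis by simp
    next
      case (Suc q)
      have "(u ^ (m - 1) - v ^ (m - 1)) * (u - v) \<le> real (m - 1) * (u - v) * u ^ (m - 1 - 1) * (u - v)"
        by (rule mult_right_mono[OF power_diff_le]) (use that in auto)
      also have "\<dots> = (real m - 1) * u ^ (m - 1 - 1) * (u - v)\<^sup>2"
        using assms by (simp add: power2_eq_square of_nat_diff)
      also have "\<dots> \<le> (real m - 1) * u ^ (m - 1 - 1) * (N * (4 * u))"
      proof (rule mult_left_mono)
        have "N * (2 * (u + v)) \<le> N * (4 * u)"
          using that nn by (intro mult_left_mono) auto
        then show "(u - v)\<^sup>2 \<le> N * (4 * u)" using that by linarith
      qed (use assms that in auto)
      also have "\<dots> = 4 * (real m - 1) * N * u ^ (m - 1)"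
        using Suc by (simp add: algebra_simps)
      also have "\<dots> \<le> 4 * (real m - 1) * N * (u ^ (m - 1) + v ^ (m - 1))"
        using assms nn that by (intro mult_left_mono) auto
      finally show ?thesis .
    qed
    show ?thesis
    proof (cases "b \<le> a")
      case True
      then show ?thesis using main[of b a] nn cs by (simp add: A_def B_def)
    next
      case False
      then show ?thesis using main[of a b] nn cs
        by (simp add: A_def B_def power2_commute add.commute algebra_simps)
    qed
  qed
  \<comment> \<open>Polarisation: the mixed term c is eliminated in favour of the squared distance
    N.\<close>
  have "A * a + B * b - c * (A + B) = (A + B) * N / 2 + (A - B) * (a - b) / 2"
    unfolding N by (simp add: field_simps)
  also have "\<dots> \<le> (A + B) * N / 2 + 4 * (real m - 1) * N * (A + B) / 2"
    using key by simp
  also have "\<dots> = (2 * real m - 3/2) * (N * (A + B))"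
    by (simp add: field_simps)
  also have "\<dots> \<le> (2 * real m) * (N * (A + B))"
    using nn by (intro mult_right_mono) auto
  finally show ?thesis
    using lhs unfolding A_def B_def a_def b_def N_def by (simp add: algebra_simps)
qed

section \<open>Moment inequalities for weighted sums of bits\<close>

text \<open>Under a bit of probability \<open>p j\<close> this has mean 0 and variance
  \<open>(1 - p j) / p j\<close>.\<close>

definition zeta :: "('i \<Rightarrow> real) \<Rightarrow> 'i \<Rightarrow> ('i \<Rightarrow> bool) \<Rightarrow> real" where
  "zeta p j \<eta> = of_bool (\<eta> j) / p j - 1"

definition indep_bits :: "'i set \<Rightarrow> (('i \<Rightarrow> bool) \<Rightarrow> 'b) \<Rightarrow> bool" where
  "indep_bits J f \<longleftrightarrow> (\<forall>i\<in>J. \<forall>\<eta> v. f (\<eta>(i := v)) = f \<eta>)"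

lemma indep_bitsD: "indep_bits J f \<Longrightarrow> i \<in> J \<Longrightarrow> f (\<eta>(i := v)) = f \<eta>"
  by (auto simp: indep_bits_def)

lemma zeta_upd_same [simp]: "zeta p j (\<eta>(j := v)) = of_bool v / p j - 1"
  by (simp add: zeta_def)

lemma zeta_upd_other [simp]: "i \<noteq> j \<Longrightarrow> zeta p j (\<eta>(i := v)) = zeta p j \<eta>"
  by (simp add: zeta_def)

text \<open>J indexes the bits over which a sum runs, I all bits. Coefficients may depend on the
  bits outside J, so statements in this locale contain a conditioning on those bits.\<close>

locale bits =
  fixes I J :: "'i set" and p :: "'i \<Rightarrow> real"
  assumes finI: "finite I" and JI: "J \<subseteq> I"
    and p01: "\<And>i. i \<in> I \<Longrightarrow> 0 < p i \<and> p i \<le> 1"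
begin

lemma finJ: "finite J"
  using finI JI finite_subset by blast

lemma p01': "i \<in> I \<Longrightarrow> 0 \<le> p i \<and> p i \<le> 1"
  using p01 less_imp_le by blast

lemma pJ: "j \<in> J \<Longrightarrow> 0 < p j \<and> p j \<le> 1"
  using p01 JI by blast

lemma pJ0: "j \<in> J \<Longrightarrow> 0 \<le> p j"
  using pJ less_imp_le by blast

text \<open>The second moment of the weights: averaging \<open>(zeta\<^sup>2 + (1 - p) / p) f\<close> over one bit gives
  \<open>(1 - p) / p * (f 1 + f 0)\<close>, which symmetrises the exchangeable pair.\<close>

lemma bexp_zeta_le:
  assumes j: "j \<in> J"
    and le: "\<And>\<eta>. (F (\<eta>(j := True)) - F (\<eta>(j := False))) / p j
      \<le> c (\<eta>(j := True)) / (p j)\<^sup>2 * (G (\<eta>(j := True)) + G (\<eta>(j := False)))"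
    and c: "\<And>\<eta> v. c (\<eta>(j := v)) = c \<eta>"
  shows "bexp I p (\<lambda>\<eta>. zeta p j \<eta> * F \<eta>)
    \<le> bexp I p (\<lambda>\<eta>. ((zeta p j \<eta>)\<^sup>2 + (1 - p j) / p j) * (c \<eta> * G \<eta>))"
proof (rule bexp_mono_bit[OF finI p01'])
  show "j \<in> I" using j JI by blast
  fix \<eta>
  let ?t = "\<eta>(j := True)" and ?f = "\<eta>(j := False)"
  have p: "0 < p j" "p j \<le> 1" using pJ[OF j] by auto
  have "p j * (zeta p j ?t * F ?t) + (1 - p j) * (zeta p j ?f * F ?f) = (1 - p j) * p j * ((F ?t - F ?f) / p j)"
    using p by (simp add: field_simps)
  also have "\<dots> \<le> (1 - p j) * p j * (c ?t / (p j)\<^sup>2 * (G ?t + G ?f))"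
    using p by (intro mult_left_mono le) auto
  also have "\<dots> = p j * (((zeta p j ?t)\<^sup>2 + (1 - p j) / p j) * (c ?t * G ?t))
     + (1 - p j) * (((zeta p j ?f)\<^sup>2 + (1 - p j) / p j) * (c ?f * G ?f))"
    unfolding c using p by (simp add: field_simps power2_eq_square)
  finally show "p j * (zeta p j ?t * F ?t) + (1 - p j) * (zeta p j ?f * F ?f)
    \<le> p j * (((zeta p j ?t)\<^sup>2 + (1 - p j) / p j) * (c ?t * G ?t))
     + (1 - p j) * (((zeta p j ?f)\<^sup>2 + (1 - p j) / p j) * (c ?f * G ?f))" .
qed (use p01' in auto)

text \<open>Observed plus expected quadratic variation: \<open>(1 - p j) / p j\<close> is the mean
  of the square of \<open>zeta p j\<close>.\<close>

definition qvar :: "('i \<Rightarrow> ('i \<Rightarrow> bool) \<Rightarrow> real) \<Rightarrow> ('i \<Rightarrow> bool) \<Rightarrow> real" where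
  "qvar h \<eta> = (\<Sum>j\<in>J. ((zeta p j \<eta>)\<^sup>2 + (1 - p j) / p j) * h j \<eta>)"

lemma qvar_nonneg: "(\<And>j. j \<in> J \<Longrightarrow> 0 \<le> h j \<eta>) \<Longrightarrow> 0 \<le> qvar h \<eta>"
  unfolding qvar_def by (intro sum_nonneg mult_nonneg_nonneg add_nonneg_nonneg)
    (use pJ in \<open>auto intro!: divide_nonneg_nonneg dest: less_imp_le\<close>)

text \<open>A Burkholder inequality by exchangeable pairs. One factor of the power is expanded as a
  sum of \<open>zeta p j\<close> times \<open>F j\<close>; flipping bit j changes S by
  \<open>a j / p j\<close>, so \<open>nsq_power_monotone\<close> controls the change of
  \<open>F j\<close>. Young's inequality then moves the remaining power of \<open>nsq\<close> to the
  left-hand side.\<close>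

lemma moment_le_qvar:
  assumes D: "finite D" and m: "1 \<le> m"
    and ind: "\<And>j. j \<in> J \<Longrightarrow> indep_bits J (a j)"
    and S: "\<And>\<eta> d. S \<eta> d = (\<Sum>j\<in>J. zeta p j \<eta> * a j \<eta> d)"
  shows "bexp I p (\<lambda>\<eta>. nsq D (S \<eta>) ^ m)
    \<le> bexp I p (\<lambda>\<eta>. (2 * real m * qvar (\<lambda>j \<eta>. nsq D (a j \<eta>)) \<eta>) ^ m)"
proof -
  let ?V = "qvar (\<lambda>j \<eta>. nsq D (a j \<eta>))"
  define F where "F j \<eta> = (\<Sum>d\<in>D. a j \<eta> d * (nsq D (S \<eta>) ^ (m - 1) * S \<eta> d))" for j \<eta>
  have eq: "nsq D (S \<eta>) ^ m = (\<Sum>j\<in>J. zeta p j \<eta> * F j \<eta>)" for \<eta>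
  proof -
    have "(\<Sum>d\<in>D. S \<eta> d * (N * S \<eta> d)) = N * nsq D (S \<eta>)" for N
      by (simp add: nsq_def sum_distrib_left power2_eq_square mult_ac)
    then have "nsq D (S \<eta>) ^ m = (\<Sum>d\<in>D. S \<eta> d * (nsq D (S \<eta>) ^ (m - 1) * S \<eta> d))"
      by (simp only: power_minus_mult m less_le_trans[OF zero_less_one])
    also have "\<dots> = (\<Sum>d\<in>D. \<Sum>j\<in>J. zeta p j \<eta> * (a j \<eta> d * (nsq D (S \<eta>) ^ (m - 1) * S \<eta> d)))"
    proof (rule sum.cong[OF refl])
      fix d
      show "S \<eta> d * x = (\<Sum>j\<in>J. zeta p j \<eta> * (a j \<eta> d * x))" for x
        by (simp add: S sum_distrib_right mult.assoc)
    qed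
    also have "\<dots> = (\<Sum>j\<in>J. zeta p j \<eta> * F j \<eta>)"
      by (subst sum.swap) (simp add: F_def sum_distrib_left)
    finally show ?thesis .
  qed
  have step: "bexp I p (\<lambda>\<eta>. zeta p j \<eta> * F j \<eta>)
      \<le> bexp I p (\<lambda>\<eta>. ((zeta p j \<eta>)\<^sup>2 + (1 - p j) / p j) * (2 * real m * nsq D (a j \<eta>) * nsq D (S \<eta>) ^ (m - 1)))"
    if j: "j \<in> J" for j
  proof (rule bexp_zeta_le[OF j])
    fix \<eta>
    let ?t = "\<eta>(j := True)" and ?f = "\<eta>(j := False)"
    have aj: "a i (\<eta>(j := v)) = a i \<eta>" if "i \<in> J" for i v
      using ind[OF that] j by (simp add: indep_bitsD)
    have p: "0 < p j" using pJ[OF j] by auto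
    have diff: "S ?t d - S ?f d = a j \<eta> d / p j" for d
    proof -
      have "S ?t d - S ?f d = (\<Sum>i\<in>J. (zeta p i ?t - zeta p i ?f) * a i \<eta> d)"
        unfolding S by (simp add: aj sum_subtractf[symmetric] algebra_simps cong: sum.cong)
      also have "\<dots> = (\<Sum>i\<in>J. if i = j then a j \<eta> d / p j else 0)"
        by (rule sum.cong) auto
      finally show ?thesis using j finJ by simp
    qed
    have "(F j ?t - F j ?f) / p j = (\<Sum>d\<in>D. (S ?t d - S ?f d) *
        (nsq D (S ?t) ^ (m - 1) * S ?t d - nsq D (S ?f) ^ (m - 1) * S ?f d))"
      unfolding F_def diff aj[OF j] by (simp add: sum_subtractf[symmetric] sum_divide_distrib algebra_simps diff_divide_distrib)
    also have "\<dots> \<le> 2 * real m * nsq D (\<lambda>d. S ?t d - S ?f d) * (nsq D (S ?t) ^ (m - 1) + nsq D (S ?f) ^ (m - 1))"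
      by (rule nsq_power_monotone[OF D m])
    also have "nsq D (\<lambda>d. S ?t d - S ?f d) = nsq D (a j \<eta>) / (p j)\<^sup>2"
      unfolding diff by (simp add: nsq_def power_divide sum_divide_distrib)
    finally show "(F j ?t - F j ?f) / p j \<le> 2 * real m * nsq D (a j ?t) / (p j)\<^sup>2 *
        (nsq D (S ?t) ^ (m - 1) + nsq D (S ?f) ^ (m - 1))"
      by (simp only: aj[OF j] times_divide_eq_right times_divide_eq_left)
  next
    show "2 * real m * nsq D (a j (\<eta>(j := v))) = 2 * real m * nsq D (a j \<eta>)" for \<eta> v
      using ind[OF j] j by (simp add: indep_bitsD)
  qed
  have "bexp I p (\<lambda>\<eta>. nsq D (S \<eta>) ^ m) = (\<Sum>j\<in>J. bexp I p (\<lambda>\<eta>. zeta p j \<eta> * F j \<eta>))"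
    unfolding eq by (rule bexp_sum)
  also have "\<dots> \<le> (\<Sum>j\<in>J. bexp I p (\<lambda>\<eta>. ((zeta p j \<eta>)\<^sup>2 + (1 - p j) / p j) * (2 * real m * nsq D (a j \<eta>) * nsq D (S \<eta>) ^ (m - 1))))"
    by (rule sum_mono[OF step])
  also have "\<dots> = bexp I p (\<lambda>\<eta>. (2 * real m * ?V \<eta>) * nsq D (S \<eta>) ^ (m - 1))"
    unfolding bexp_sum[symmetric] qvar_def by (simp only: sum_distrib_left sum_distrib_right mult_ac)
  finally have "real m * bexp I p (\<lambda>\<eta>. nsq D (S \<eta>) ^ m)
      \<le> bexp I p (\<lambda>\<eta>. real m * ((2 * real m * ?V \<eta>) * nsq D (S \<eta>) ^ (m - 1)))"
    by (simp add: bexp_cmult mult_left_mono)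
  also have "\<dots> \<le> bexp I p (\<lambda>\<eta>. (2 * real m * ?V \<eta>) ^ m + (real m - 1) * nsq D (S \<eta>) ^ m)"
    by (intro bexp_mono young_power p01' m mult_nonneg_nonneg qvar_nonneg) auto
  also have "\<dots> = bexp I p (\<lambda>\<eta>. (2 * real m * ?V \<eta>) ^ m) + (real m - 1) * bexp I p (\<lambda>\<eta>. nsq D (S \<eta>) ^ m)"
    by (simp add: bexp_add bexp_cmult)
  finally show ?thesis by (simp add: algebra_simps)
qed

text \<open>One factor of the power is expanded. When bit j is on, the rest of the power is that of
  \<open>V ?f + g j\<close>, which the weighted splitting separates into a mean part and a jump
  part.\<close>

lemma bernoulli_sum_moment:
  assumes m: "1 \<le> m"
    and ind: "\<And>j. j \<in> J \<Longrightarrow> indep_bits J (g j)"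
    and g0: "\<And>j \<eta>. j \<in> J \<Longrightarrow> 0 \<le> g j \<eta>"
  shows "bexp I p (\<lambda>\<eta>. (\<Sum>j\<in>J. of_bool (\<eta> j) * g j \<eta>) ^ m)
    \<le> bexp I p (\<lambda>\<eta>. (3 * (\<Sum>j\<in>J. p j * g j \<eta>)) ^ m)
      + (2 * real m) ^ m * bexp I p (\<lambda>\<eta>. \<Sum>j\<in>J. p j * g j \<eta> ^ m)"
proof -
  define V where "V \<eta> = (\<Sum>j\<in>J. of_bool (\<eta> j) * g j \<eta>)" for \<eta>
  define T where "T \<eta> = 3 * (\<Sum>j\<in>J. p j * g j \<eta>)" for \<eta>
  define Q where "Q \<eta> = (\<Sum>j\<in>J. p j * g j \<eta> ^ m)" for \<eta>
  have V0: "0 \<le> V \<eta>" and T0: "0 \<le> T \<eta>" and Q0: "0 \<le> Q \<eta>" for \<eta>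
    using g0 pJ0 by (auto simp: V_def T_def Q_def intro!: sum_nonneg mult_nonneg_nonneg)
  have step: "bexp I p (\<lambda>\<eta>. of_bool (\<eta> j) * g j \<eta> * V \<eta> ^ (m - 1))
      \<le> bexp I p (\<lambda>\<eta>. 3 * (p j * g j \<eta>) * V \<eta> ^ (m - 1) + (real m + 1) ^ (m - 1) * (p j * g j \<eta> ^ m))"
    if j: "j \<in> J" for j
  proof (rule bexp_mono_bit[OF finI p01'])
    show "j \<in> I" using j JI by blast
    fix \<eta>
    let ?t = "\<eta>(j := True)" and ?f = "\<eta>(j := False)"
    have p: "0 < p j" "p j \<le> 1" using pJ[OF j] by auto
    have gj: "g i (\<eta>(j := v)) = g i \<eta>" if "i \<in> J" for i v
      using ind[OF that] j by (simp add: indep_bitsD)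
    have Vt: "V ?t = V ?f + g j \<eta>"
    proof -
      have "V ?t - V ?f = (\<Sum>i\<in>J. (of_bool (?t i) - of_bool (?f i)) * g i \<eta>)"
        unfolding V_def by (simp add: gj sum_subtractf[symmetric] algebra_simps cong: sum.cong)
      also have "\<dots> = (\<Sum>i\<in>J. if i = j then g j \<eta> else 0)"
        by (rule sum.cong) auto
      finally show ?thesis using j finJ by simp
    qed
    have gp: "g j \<eta> ^ m = g j \<eta> * g j \<eta> ^ (m - 1)" using m by (cases m) auto
    have nn: "0 \<le> p j * g j \<eta>" using p g0[OF j] by simp
    have "p j * (of_bool (?t j) * g j ?t * V ?t ^ (m - 1)) + (1 - p j) * (of_bool (?f j) * g j ?f * V ?f ^ (m - 1))
        = p j * g j \<eta> * (V ?f + g j \<eta>) ^ (m - 1)"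
      by (simp add: gj[OF j] Vt)
    also have "\<dots> \<le> p j * g j \<eta> * (3 * V ?f ^ (m - 1) + (real m + 1) ^ (m - 1) * g j \<eta> ^ (m - 1))"
      by (intro mult_left_mono power_add_le_weighted V0 g0 j m nn)
    also have "\<dots> = p j * (3 * (p j * g j \<eta>) * V ?f ^ (m - 1)) + (1 - p j) * (3 * (p j * g j \<eta>) * V ?f ^ (m - 1))
       + (real m + 1) ^ (m - 1) * (p j * g j \<eta> ^ m)"
      by (simp add: gp algebra_simps)
    \<comment> \<open>Enlarging \<open>V ?f\<close> to \<open>V ?t\<close> in the share of weight
      \<open>p j\<close> restores a full average over bit j.\<close>
    also have "\<dots> \<le> p j * (3 * (p j * g j \<eta>) * V ?t ^ (m - 1)) + (1 - p j) * (3 * (p j * g j \<eta>) * V ?f ^ (m - 1))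
       + (real m + 1) ^ (m - 1) * (p j * g j \<eta> ^ m)"
      using p nn V0 Vt g0[OF j] by (intro add_right_mono mult_left_mono power_mono) auto
    also have "\<dots> = p j * (3 * (p j * g j ?t) * V ?t ^ (m - 1) + (real m + 1) ^ (m - 1) * (p j * g j ?t ^ m)) +
      (1 - p j) * (3 * (p j * g j ?f) * V ?f ^ (m - 1) + (real m + 1) ^ (m - 1) * (p j * g j ?f ^ m))"
      by (simp add: gj[OF j] algebra_simps)
    finally show "p j * (of_bool (?t j) * g j ?t * V ?t ^ (m - 1)) + (1 - p j) * (of_bool (?f j) * g j ?f * V ?f ^ (m - 1))
       \<le> \<dots>" .
  qed (use p01' in auto)
  have "bexp I p (\<lambda>\<eta>. V \<eta> ^ m) = (\<Sum>j\<in>J. bexp I p (\<lambda>\<eta>. of_bool (\<eta> j) * g j \<eta> * V \<eta> ^ (m - 1)))"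
    unfolding bexp_sum[symmetric] sum_distrib_right[symmetric] V_def[symmetric]
    using m by (cases m) auto
  also have "\<dots> \<le> (\<Sum>j\<in>J. bexp I p (\<lambda>\<eta>. 3 * (p j * g j \<eta>) * V \<eta> ^ (m - 1) + (real m + 1) ^ (m - 1) * (p j * g j \<eta> ^ m)))"
    by (rule sum_mono[OF step])
  also have "\<dots> = bexp I p (\<lambda>\<eta>. T \<eta> * V \<eta> ^ (m - 1)) + (real m + 1) ^ (m - 1) * bexp I p Q"
    unfolding bexp_sum[symmetric] bexp_add[symmetric] bexp_cmult[symmetric] T_def Q_def
    by (simp add: sum.distrib sum_distrib_left sum_distrib_right mult_ac)
  finally have "real m * bexp I p (\<lambda>\<eta>. V \<eta> ^ m)
      \<le> bexp I p (\<lambda>\<eta>. real m * (T \<eta> * V \<eta> ^ (m - 1))) + real m * (real m + 1) ^ (m - 1) * bexp I p Q"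
    by (simp add: bexp_cmult mult_left_mono distrib_left[symmetric] mult.assoc)
  also have "bexp I p (\<lambda>\<eta>. real m * (T \<eta> * V \<eta> ^ (m - 1)))
      \<le> bexp I p (\<lambda>\<eta>. T \<eta> ^ m + (real m - 1) * V \<eta> ^ m)"
    by (intro bexp_mono young_power p01' m T0 V0) auto
  also have "\<dots> = bexp I p (\<lambda>\<eta>. T \<eta> ^ m) + (real m - 1) * bexp I p (\<lambda>\<eta>. V \<eta> ^ m)"
    by (simp add: bexp_add bexp_cmult)
  finally have "bexp I p (\<lambda>\<eta>. V \<eta> ^ m) \<le> bexp I p (\<lambda>\<eta>. T \<eta> ^ m) + real m * (real m + 1) ^ (m - 1) * bexp I p Q"
    by (simp add: algebra_simps)
  also have "real m * (real m + 1) ^ (m - 1) * bexp I p Q \<le> (2 * real m) ^ m * bexp I p Q"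
  proof (rule mult_right_mono)
    have "real m * (real m + 1) ^ (m - 1) \<le> (2 * real m) * (2 * real m) ^ (m - 1)"
      using m by (intro mult_mono power_mono) auto
    also have "\<dots> = (2 * real m) ^ m" using m by (cases m) auto
    finally show "real m * (real m + 1) ^ (m - 1) \<le> (2 * real m) ^ m" .
    show "0 \<le> bexp I p Q" by (intro bexp_nonneg Q0 p01')
  qed
  finally show ?thesis by (simp add: V_def T_def Q_def[abs_def])
qed

text \<open>The weights are at most \<open>1 / p j\<close> plus the bit divided by the square of
  \<open>p j\<close>, that is, a mean part plus a Bernoulli sum. The base 8 is \<open>2 * 4\<close>,
  from \<open>1 + 3 ^ m <= 4 ^ m\<close>.\<close>

lemma qvar_moment:
  assumes m: "1 \<le> m"
    and ind: "\<And>j. j \<in> J \<Longrightarrow> indep_bits J (h j)"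
    and h0: "\<And>j \<eta>. j \<in> J \<Longrightarrow> 0 \<le> h j \<eta>"
  shows "bexp I p (\<lambda>\<eta>. qvar h \<eta> ^ m) \<le>
    8 ^ m * bexp I p (\<lambda>\<eta>. (\<Sum>j\<in>J. h j \<eta> / p j) ^ m)
    + (4 * real m) ^ m * bexp I p (\<lambda>\<eta>. \<Sum>j\<in>J. h j \<eta> ^ m / p j ^ (2 * m - 1))"
proof -
  define U where "U \<eta> = (\<Sum>j\<in>J. h j \<eta> / p j)" for \<eta>
  define V where "V \<eta> = (\<Sum>j\<in>J. of_bool (\<eta> j) * (h j \<eta> / (p j)\<^sup>2))" for \<eta>
  define Q where "Q \<eta> = (\<Sum>j\<in>J. h j \<eta> ^ m / p j ^ (2 * m - 1))" for \<eta>
  have U0: "0 \<le> U \<eta>" and V0: "0 \<le> V \<eta>" for \<eta>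
    using h0 pJ0 by (auto simp: U_def V_def intro!: sum_nonneg mult_nonneg_nonneg divide_nonneg_nonneg)
  have le: "qvar h \<eta> \<le> U \<eta> + V \<eta>" for \<eta>
    unfolding qvar_def U_def V_def sum.distrib[symmetric]
  proof (rule sum_mono)
    fix j assume j: "j \<in> J"
    have p: "0 < p j" "p j \<le> 1" using pJ[OF j] by auto
    have "(zeta p j \<eta>)\<^sup>2 + (1 - p j) / p j \<le> 1 / p j + of_bool (\<eta> j) / (p j)\<^sup>2"
      using p by (cases "\<eta> j") (auto simp: zeta_def field_simps power2_eq_square)
    then have "((zeta p j \<eta>)\<^sup>2 + (1 - p j) / p j) * h j \<eta> \<le> (1 / p j + of_bool (\<eta> j) / (p j)\<^sup>2) * h j \<eta>"
      using h0[OF j] by (rule mult_right_mono)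
    then show "((zeta p j \<eta>)\<^sup>2 + (1 - p j) / p j) * h j \<eta> \<le> h j \<eta> / p j + of_bool (\<eta> j) * (h j \<eta> / (p j)\<^sup>2)"
      by (simp add: algebra_simps)
  qed
  have pg: "p j * (h j \<eta> / (p j)\<^sup>2) = h j \<eta> / p j" "p j * (h j \<eta> / (p j)\<^sup>2) ^ m = h j \<eta> ^ m / p j ^ (2 * m - 1)"
    if "j \<in> J" for j \<eta>
  proof -
    have "p j ^ (2 * m) = p j * p j ^ (2 * m - 1)" using m by (cases m) auto
    then show "p j * (h j \<eta> / (p j)\<^sup>2) ^ m = h j \<eta> ^ m / p j ^ (2 * m - 1)"
      using pJ[OF that] by (simp add: power_divide power_mult[symmetric])
    show "p j * (h j \<eta> / (p j)\<^sup>2) = h j \<eta> / p j"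
      using pJ[OF that] by (simp add: power2_eq_square)
  qed
  have "bexp I p (\<lambda>\<eta>. V \<eta> ^ m) \<le> bexp I p (\<lambda>\<eta>. (3 * U \<eta>) ^ m) + (2 * real m) ^ m * bexp I p Q"
  proof -
    have "bexp I p (\<lambda>\<eta>. V \<eta> ^ m) \<le> bexp I p (\<lambda>\<eta>. (3 * (\<Sum>j\<in>J. p j * (h j \<eta> / (p j)\<^sup>2))) ^ m)
      + (2 * real m) ^ m * bexp I p (\<lambda>\<eta>. \<Sum>j\<in>J. p j * (h j \<eta> / (p j)\<^sup>2) ^ m)"
      unfolding V_def by (rule bernoulli_sum_moment[OF m])
        (use ind h0 in \<open>auto simp: indep_bits_def\<close>)
    also have "\<dots> = bexp I p (\<lambda>\<eta>. (3 * U \<eta>) ^ m) + (2 * real m) ^ m * bexp I p Q"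
      unfolding U_def Q_def by (simp only: pg cong: sum.cong)
    finally show ?thesis .
  qed
  then have 1: "bexp I p (\<lambda>\<eta>. V \<eta> ^ m) \<le> 3 ^ m * bexp I p (\<lambda>\<eta>. U \<eta> ^ m) + (2 * real m) ^ m * bexp I p Q"
    by (simp add: power_mult_distrib bexp_cmult)
  have "bexp I p (\<lambda>\<eta>. qvar h \<eta> ^ m) \<le> bexp I p (\<lambda>\<eta>. 2 ^ m * (U \<eta> ^ m + V \<eta> ^ m))"
  proof (rule bexp_mono[OF p01'])
    fix \<eta>
    have "qvar h \<eta> ^ m \<le> (U \<eta> + V \<eta>) ^ m"
      by (intro power_mono le qvar_nonneg h0)
    also have "\<dots> \<le> 2 ^ m * (U \<eta> ^ m + V \<eta> ^ m)" by (intro power_add_le U0 V0)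
    finally show "qvar h \<eta> ^ m \<le> 2 ^ m * (U \<eta> ^ m + V \<eta> ^ m)" .
  qed auto
  also have "\<dots> = 2 ^ m * (bexp I p (\<lambda>\<eta>. U \<eta> ^ m) + bexp I p (\<lambda>\<eta>. V \<eta> ^ m))"
    by (simp add: bexp_cmult bexp_add)
  also have "\<dots> \<le> 2 ^ m * (bexp I p (\<lambda>\<eta>. U \<eta> ^ m) + (3 ^ m * bexp I p (\<lambda>\<eta>. U \<eta> ^ m) + (2 * real m) ^ m * bexp I p Q))"
    using 1 by (intro mult_left_mono add_left_mono) auto
  also have "\<dots> = (2 ^ m * (1 + 3 ^ m)) * bexp I p (\<lambda>\<eta>. U \<eta> ^ m) + (4 * real m) ^ m * bexp I p Q"
  proof -
    have "(4::real) ^ m = 2 ^ m * 2 ^ m" by (simp flip: power_mult_distrib)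
    then show ?thesis by (simp add: algebra_simps power_mult_distrib)
  qed
  also have "\<dots> \<le> 8 ^ m * bexp I p (\<lambda>\<eta>. U \<eta> ^ m) + (4 * real m) ^ m * bexp I p Q"
  proof (rule add_right_mono, rule mult_right_mono)
    have "1 + 3 ^ m \<le> (4::real) ^ m"
    proof (use m in \<open>induction m rule: dec_induct\<close>)
      case (step k)
      have "0 \<le> (3::real) ^ k" by simp
      with step.IH show ?case unfolding power_Suc by linarith
    qed simp
    then have "2 ^ m * (1 + 3 ^ m) \<le> 2 ^ m * (4::real) ^ m" by simp
    then show "2 ^ m * (1 + 3 ^ m) \<le> (8::real) ^ m" by (simp flip: power_mult_distrib)
    show "0 \<le> bexp I p (\<lambda>\<eta>. U \<eta> ^ m)" by (intro bexp_nonneg p01' zero_le_power U0)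
  qed
  finally show ?thesis by (simp add: U_def Q_def[abs_def])
qed

text \<open>Rosenthal's inequality for vector-valued sums: the variance enters with a factor m, the
  largest jumps with the square of m. The constants are \<open>16 = 2 * 8\<close> and
  \<open>8 = 2 * 4\<close>.\<close>

lemma rosenthal:
  assumes D: "finite D" and m: "1 \<le> m"
    and ind: "\<And>j. j \<in> J \<Longrightarrow> indep_bits J (a j)"
    and S: "\<And>\<eta> d. S \<eta> d = (\<Sum>j\<in>J. zeta p j \<eta> * a j \<eta> d)"
  shows "bexp I p (\<lambda>\<eta>. nsq D (S \<eta>) ^ m) \<le>
    (16 * real m) ^ m * bexp I p (\<lambda>\<eta>. (\<Sum>j\<in>J. nsq D (a j \<eta>) / p j) ^ m)
    + (8 * (real m)\<^sup>2) ^ m * bexp I p (\<lambda>\<eta>. \<Sum>j\<in>J. nsq D (a j \<eta>) ^ m / p j ^ (2 * m - 1))"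
proof -
  let ?U = "bexp I p (\<lambda>\<eta>. (\<Sum>j\<in>J. nsq D (a j \<eta>) / p j) ^ m)"
  let ?Q = "bexp I p (\<lambda>\<eta>. \<Sum>j\<in>J. nsq D (a j \<eta>) ^ m / p j ^ (2 * m - 1))"
  have "bexp I p (\<lambda>\<eta>. nsq D (S \<eta>) ^ m)
      \<le> (2 * real m) ^ m * bexp I p (\<lambda>\<eta>. qvar (\<lambda>j \<eta>. nsq D (a j \<eta>)) \<eta> ^ m)"
    using moment_le_qvar[OF D m ind S] by (simp add: power_mult_distrib bexp_cmult)
  also have "\<dots> \<le> (2 * real m) ^ m * (8 ^ m * ?U + (4 * real m) ^ m * ?Q)"
    by (intro mult_left_mono qvar_moment m) (use ind in \<open>auto simp: indep_bits_def\<close>)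
  also have "\<dots> = (2 * real m * 8) ^ m * ?U + (2 * real m * (4 * real m)) ^ m * ?Q"
  proof -
    have "A ^ m * (8 ^ m * u + B ^ m * v) = (A * 8) ^ m * u + (A * B) ^ m * v" for A B u v :: real
      by (simp only: power_mult_distrib distrib_left mult.assoc)
    then show ?thesis .
  qed
  also have "\<dots> = (16 * real m) ^ m * ?U + (8 * (real m)\<^sup>2) ^ m * ?Q"
    by (simp add: power2_eq_square mult_ac)
  finally show ?thesis .
qed

end

section \<open>Singular values and Schatten norms\<close>

definition bil :: "nat \<Rightarrow> rmat \<Rightarrow> (nat \<Rightarrow> real) \<Rightarrow> (nat \<Rightarrow> real) \<Rightarrow> real" where
  "bil n A x y = (\<Sum>i<n. \<Sum>j<n. x i * A i j * y j)"

lemma bil_add_left: "bil n A (\<lambda>i. c * x i + d * x' i) y = c * bil n A x y + d * bil n A x' y"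
  by (simp add: bil_def sum_distrib_left sum.distrib algebra_simps)

lemma bil_add_right: "bil n A x (\<lambda>i. c * y i + d * y' i) = c * bil n A x y + d * bil n A x y'"
  by (simp add: bil_def sum_distrib_left sum.distrib algebra_simps)

lemma bil_diff_left: "bil n A (\<lambda>i. c * x i - d * x' i) y = c * bil n A x y - d * bil n A x' y"
  by (simp add: bil_def sum_distrib_left sum_subtractf algebra_simps)

lemma bil_diff_right: "bil n A x (\<lambda>i. c * y i - d * y' i) = c * bil n A x y - d * bil n A x y'"
  by (simp add: bil_def sum_distrib_left sum_subtractf algebra_simps)

lemma orthonormal_colsD:
  "orthonormal_cols m k U \<Longrightarrow> a < k \<Longrightarrow> b < k \<Longrightarrow> (\<Sum>i<m. U i a * U i b) = (if a = b then 1 else 0)"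
  by (simp add: orthonormal_cols_def)

lemma bessel:
  assumes "orthonormal_cols m k U"
  shows "(\<Sum>t<k. (\<Sum>i<m. U i t * x i)\<^sup>2) \<le> (\<Sum>i<m. (x i)\<^sup>2)"
proof -
  define c where "c t = (\<Sum>i<m. U i t * x i)" for t
  have 1: "(\<Sum>i<m. x i * (\<Sum>t<k. c t * U i t)) = (\<Sum>t<k. (c t)\<^sup>2)"
    unfolding sum_distrib_left by (subst sum.swap)
      (simp add: c_def power2_eq_square sum_distrib_left sum_distrib_right mult_ac)
  have "(\<Sum>i<m. (\<Sum>t<k. c t * U i t)\<^sup>2) = (\<Sum>i<m. \<Sum>t<k. \<Sum>u<k. c t * c u * (U i t * U i u))"
    by (simp add: power2_eq_square sum_product mult_ac)
  also have "\<dots> = (\<Sum>t<k. \<Sum>u<k. c t * c u * (\<Sum>i<m. U i t * U i u))"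
    by (subst sum.swap, subst (2) sum.swap) (simp add: sum_distrib_left sum.swap[of _ "{..<m}"])
  also have "\<dots> = (\<Sum>t<k. \<Sum>u<k. if u = t then (c t)\<^sup>2 else 0)"
    by (intro sum.cong refl) (auto simp: orthonormal_colsD[OF assms] power2_eq_square)
  also have "\<dots> = (\<Sum>t<k. (c t)\<^sup>2)" by simp
  finally have 2: "(\<Sum>i<m. (\<Sum>t<k. c t * U i t)\<^sup>2) = (\<Sum>t<k. (c t)\<^sup>2)" .
  have "0 \<le> (\<Sum>i<m. (x i - (\<Sum>t<k. c t * U i t))\<^sup>2)" by (simp add: sum_nonneg)
  also have "\<dots> = (\<Sum>i<m. (x i)\<^sup>2) - 2 * (\<Sum>i<m. x i * (\<Sum>t<k. c t * U i t)) + (\<Sum>i<m. (\<Sum>t<k. c t * U i t)\<^sup>2)"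
    by (simp add: power2_diff sum.distrib sum_subtractf sum_distrib_left mult.assoc)
  finally show ?thesis unfolding 1 2 by (simp add: c_def)
qed

text \<open>A square matrix with orthonormal columns has orthonormal rows: \<open>Q Q\<^sup>T\<close> is a projection whose
  diagonal entries are at most 1 and sum to \<open>n\<close>.\<close>

lemma orthonormal_rows:
  assumes "orthonormal_cols n n Q" "i < n" "j < n"
  shows "(\<Sum>a<n. Q i a * Q j a) = (if i = j then 1 else 0)"
proof -
  define B where "B i j = (\<Sum>a<n. Q i a * Q j a)" for i j
  have idem: "(\<Sum>k<n. B i k * B k j) = B i j" for i j
  proof -
    have "(\<Sum>k<n. B i k * B k j) = (\<Sum>k<n. \<Sum>a<n. \<Sum>b<n. Q i a * Q j b * (Q k a * Q k b))"
      by (simp add: B_def sum_product mult_ac)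
    also have "\<dots> = (\<Sum>a<n. \<Sum>k<n. \<Sum>b<n. Q i a * Q j b * (Q k a * Q k b))"
      by (rule sum.swap)
    also have "\<dots> = (\<Sum>a<n. \<Sum>b<n. \<Sum>k<n. Q i a * Q j b * (Q k a * Q k b))"
      by (intro sum.cong refl sum.swap)
    also have "\<dots> = (\<Sum>a<n. \<Sum>b<n. Q i a * Q j b * (if a = b then 1 else 0))"
      by (simp only: sum_distrib_left[symmetric]) (intro sum.cong refl, simp add: orthonormal_colsD[OF assms(1)])
    also have "\<dots> = B i j" by (simp add: B_def if_distrib cong: if_cong)
    finally show ?thesis .
  qed
  have sym: "B i j = B j i" for i j by (simp add: B_def mult.commute)
  have sq: "(\<Sum>k<n. (B i k)\<^sup>2) = B i i" for i
    using idem[of i i] sym by (metis (no_types, lifting) power2_eq_square sum.cong)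
  have le: "B i i \<le> 1" if "i < n" for i
  proof -
    have "(B i i)\<^sup>2 \<le> (\<Sum>k<n. (B i k)\<^sup>2)"
      using that by (intro member_le_sum) auto
    moreover have "x \<le> 1" if "x\<^sup>2 \<le> x" for x :: real
    proof (rule ccontr)
      assume "\<not> x \<le> 1"
      then have "x * 1 < x * x" by (intro mult_strict_left_mono) auto
      with that show False by (simp add: power2_eq_square)
    qed
    ultimately show ?thesis unfolding sq by blast
  qed
  have "(\<Sum>i<n. B i i) = (\<Sum>a<n. \<Sum>i<n. Q i a * Q i a)"
    unfolding B_def by (rule sum.swap)
  also have "\<dots> = real n" using orthonormal_colsD[OF assms(1)] by simp
  finally have "(\<Sum>i<n. 1 - B i i) = 0" by (simp add: sum_subtractf)
  then have one: "B i i = 1" if "i < n" for i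
    using le that by (subst (asm) sum_nonneg_eq_0_iff) auto
  show ?thesis
  proof (cases "i = j")
    case True then show ?thesis using one assms by (simp add: B_def)
  next
    case False
    have "(B i i)\<^sup>2 + (B i j)\<^sup>2 = (\<Sum>k\<in>{i, j}. (B i k)\<^sup>2)" using False by simp
    also have "\<dots> \<le> (\<Sum>k<n. (B i k)\<^sup>2)" using assms by (intro sum_mono2) auto
    finally have "(B i j)\<^sup>2 \<le> 0" using sq[of i] one assms by simp
    then show ?thesis using False by (simp add: B_def)
  qed
qed

text \<open>Optimality of a block with diagonal x, y and off-diagonal u, v under rotations from both
  sides. Rotating one side gives first-order conditions, which are void for \<open>x = y\<close> or
  \<open>x = - y\<close>; rotations of both sides by 45 degrees settle those cases.\<close>

lemma two_by_two_diag:
  fixes x y u v :: real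
  assumes max: "\<And>c s c' s'. c\<^sup>2 + s\<^sup>2 = 1 \<Longrightarrow> c'\<^sup>2 + s'\<^sup>2 = 1 \<Longrightarrow>
     (c * c' * x + c * s' * u + s * c' * v + s * s' * y)\<^sup>2
     + (s * s' * x - s * c' * u - c * s' * v + c * c' * y)\<^sup>2 \<le> x\<^sup>2 + y\<^sup>2"
  shows "u = 0 \<and> v = 0"
proof -
  have lin: "E = 0" if EF: "\<And>c s::real. c\<^sup>2 + s\<^sup>2 = 1 \<Longrightarrow> s\<^sup>2 * F + 2 * c * s * E \<le> 0" for E F :: real
  proof (rule ccontr)
    assume "E \<noteq> 0"
    \<comment> \<open>The size makes \<open>e * (\<bar>F\<bar> + \<bar>E\<bar>)\<close> half of
      \<open>\<bar>E\<bar>\<close>, too small for the second-order term to offset the first-order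
      one. The sign of t is that of E.\<close>
    define e where "e = \<bar>E\<bar> / (2 * (\<bar>F\<bar> + \<bar>E\<bar>))"
    have e: "0 < e" "e \<le> 1 / 2" using \<open>E \<noteq> 0\<close> by (auto simp: e_def field_simps)
    define t where "t = sgn E * e"
    have tE: "t * E = e * \<bar>E\<bar>" and t2: "t\<^sup>2 = e\<^sup>2"
      using \<open>E \<noteq> 0\<close> by (auto simp: t_def sgn_if power_mult_distrib)
    \<comment> \<open>Rational parametrisation of the unit circle.\<close>
    define c s where "c = (1 - t\<^sup>2) / (1 + t\<^sup>2)" and "s = 2 * t / (1 + t\<^sup>2)"
    have pos: "1 + t\<^sup>2 > 0" by (smt (verit) zero_le_power2)
    have "((1 - t\<^sup>2)\<^sup>2 + (2 * t)\<^sup>2) / (1 + t\<^sup>2)\<^sup>2 = 1"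
    proof -
      have "(1 - t\<^sup>2)\<^sup>2 + (2 * t)\<^sup>2 = (1 + t\<^sup>2)\<^sup>2" by (simp add: power2_eq_square algebra_simps)
      then show ?thesis using pos by simp
    qed
    then have "c\<^sup>2 + s\<^sup>2 = 1" by (simp add: c_def s_def power_divide add_divide_distrib)
    then have "s\<^sup>2 * F + 2 * c * s * E \<le> 0" by (rule EF)
    moreover have "s\<^sup>2 * F + 2 * c * s * E = (4 * t\<^sup>2 * F + 4 * (1 - t\<^sup>2) * (t * E)) / (1 + t\<^sup>2)\<^sup>2"
      using pos by (simp add: c_def s_def power_divide power_mult_distrib add_divide_distrib power2_eq_square)
    ultimately have "4 * (t\<^sup>2 * F + (1 - t\<^sup>2) * (t * E)) \<le> 0"
      using pos by (simp add: divide_le_0_iff algebra_simps)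
    then have "t\<^sup>2 * F + (1 - t\<^sup>2) * (t * E) \<le> 0" by simp
    then have "e * (e * F + (1 - e\<^sup>2) * \<bar>E\<bar>) \<le> 0" unfolding tE t2 by (simp add: power2_eq_square algebra_simps)
    then have "e * F + (1 - e\<^sup>2) * \<bar>E\<bar> \<le> 0" using e by (simp add: mult_le_0_iff)
    moreover have "e * \<bar>F\<bar> + e * \<bar>E\<bar> = \<bar>E\<bar> / 2"
    proof -
      have "\<bar>F\<bar> + \<bar>E\<bar> \<noteq> 0" using \<open>E \<noteq> 0\<close> by linarith
      moreover have "x / (2 * g) * g = x / 2" if "g \<noteq> 0" for x g :: real using that by simp
      ultimately have "e * (\<bar>F\<bar> + \<bar>E\<bar>) = \<bar>E\<bar> / 2" unfolding e_def by blast
      then show ?thesis by (simp add: distrib_left)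
    qed
    moreover have "e * F \<ge> - (e * \<bar>F\<bar>)" using e by (smt (verit) mult_minus_right mult_left_mono)
    moreover have "e\<^sup>2 * \<bar>E\<bar> \<le> e * \<bar>E\<bar>" using e by (intro mult_right_mono) (auto simp: power2_eq_square)
    ultimately have "\<bar>E\<bar> / 2 \<le> 0" by (simp add: algebra_simps)
    then show False using \<open>E \<noteq> 0\<close> by simp
  qed
  have 1: "x * v - y * u = 0"
  proof (rule lin[of "u\<^sup>2 + v\<^sup>2 - x\<^sup>2 - y\<^sup>2"])
    fix c s :: real assume cs: "c\<^sup>2 + s\<^sup>2 = 1"
    have "(c * x + s * v)\<^sup>2 + (c * y - s * u)\<^sup>2 \<le> (c\<^sup>2 + s\<^sup>2) * (x\<^sup>2 + y\<^sup>2)"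
      using max[of c s 1 0] cs by (simp add: algebra_simps)
    then show "s\<^sup>2 * (u\<^sup>2 + v\<^sup>2 - x\<^sup>2 - y\<^sup>2) + 2 * c * s * (x * v - y * u) \<le> 0"
      by (simp add: power2_eq_square algebra_simps)
  qed
  have 2: "x * u - y * v = 0"
  proof (rule lin[of "u\<^sup>2 + v\<^sup>2 - x\<^sup>2 - y\<^sup>2"])
    fix c s :: real assume cs: "c\<^sup>2 + s\<^sup>2 = 1"
    have "(c * x + s * u)\<^sup>2 + (c * y - s * v)\<^sup>2 \<le> (c\<^sup>2 + s\<^sup>2) * (x\<^sup>2 + y\<^sup>2)"
      using max[of 1 0 c s] cs by (simp add: algebra_simps)
    then show "s\<^sup>2 * (u\<^sup>2 + v\<^sup>2 - x\<^sup>2 - y\<^sup>2) + 2 * c * s * (x * u - y * v) \<le> 0"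
      by (simp add: power2_eq_square algebra_simps)
  qed
  define h where "h = sqrt (1 / 2)"
  have h: "h * h = 1 / 2" by (simp add: h_def)
  have "((x + u + v + y) / 2)\<^sup>2 + ((x - u - v + y) / 2)\<^sup>2 \<le> x\<^sup>2 + y\<^sup>2"
    using max[of h h h h] h by (simp add: power2_eq_square add_divide_distrib diff_divide_distrib)
  then have a: "(u + v)\<^sup>2 \<le> (x - y)\<^sup>2" by (simp add: power2_eq_square field_simps)
  have "((x - u + v - y) / 2)\<^sup>2 + ((- x - u + v + y) / 2)\<^sup>2 \<le> x\<^sup>2 + y\<^sup>2"
    using max[of h h h "- h"] h by (simp add: power2_eq_square add_divide_distrib diff_divide_distrib)
  then have b: "(v - u)\<^sup>2 \<le> (x + y)\<^sup>2" by (simp add: power2_eq_square field_simps)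
  have "(x - y) * (u + v) = 0" "(x + y) * (v - u) = 0" using 1 2 by (auto simp: algebra_simps)
  then have "u + v = 0" "v - u = 0" using a b by (auto simp: )
  then show ?thesis by simp
qed

definition rot :: "nat \<Rightarrow> nat \<Rightarrow> real \<Rightarrow> real \<Rightarrow> rmat \<Rightarrow> rmat" where
  "rot a b c s P = (\<lambda>i k. if k = a then c * P i a + s * P i b else if k = b then c * P i b + (- s) * P i a else P i k)"

lemma orthonormal_rot:
  assumes P: "orthonormal_cols n n P" and ab: "a < n" "b < n" "a \<noteq> b" and cs: "c\<^sup>2 + s\<^sup>2 = 1"
  shows "orthonormal_cols n n (rot a b c s P)"
proof -
  have lin1: "(\<Sum>i<n. (c * f i + d * g i) * h i) = c * (\<Sum>i<n. f i * h i) + d * (\<Sum>i<n. g i * h i)"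
    and lin2: "(\<Sum>i<n. h i * (c * f i + d * g i)) = c * (\<Sum>i<n. h i * f i) + d * (\<Sum>i<n. h i * g i)"
    and lin3: "(\<Sum>i<n. (c * f i - d * g i) * h i) = c * (\<Sum>i<n. f i * h i) - d * (\<Sum>i<n. g i * h i)"
    and lin4: "(\<Sum>i<n. h i * (c * f i - d * g i)) = c * (\<Sum>i<n. h i * f i) - d * (\<Sum>i<n. h i * g i)"
    for c d and f g h :: "nat \<Rightarrow> real"
    by (simp_all add: sum.distrib sum_subtractf sum_distrib_left algebra_simps)
  have cs': "c * c + s * s = 1" using cs by (simp add: power2_eq_square)
  show ?thesis
    unfolding orthonormal_cols_def
  proof (intro allI impI)
    fix k l assume kl: "k < n" "l < n"
    show "(\<Sum>i<n. rot a b c s P i k * rot a b c s P i l) = (if k = l then 1 else 0)"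
      unfolding rot_def using ab cs' kl
      by (cases "k = a"; cases "k = b"; cases "l = a"; cases "l = b")
        (simp_all add: lin1 lin2 lin3 lin4 orthonormal_colsD[OF P] add.commute)
  qed
qed

lemma compact_box: "compact {f :: 'i \<Rightarrow> real. \<forall>i. f i \<in> {-1..1}}"
proof -
  have "compactin (product_topology (\<lambda>_. euclidean) UNIV) (PiE UNIV (\<lambda>_::'i. {-1..1::real}))"
    by (subst compactin_PiE) auto
  moreover have "PiE UNIV (\<lambda>_::'i. {-1..1::real}) = {f. \<forall>i. f i \<in> {-1..1}}" by (auto simp: PiE_def)
  ultimately show ?thesis by (simp add: euclidean_product_topology)
qed

text \<open>Over pairs of orthogonal P and Q the sum of squared diagonal entries of
  \<open>P^T A Q\<close> attains its maximum by compactness. At a maximiser no rotation of two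
  columns of P and Q can help, so the off-diagonal entries vanish.\<close>

lemma svd_exists:
  obtains P Q s where "orthonormal_cols n n P" "orthonormal_cols n n Q" "\<And>k. k < n \<Longrightarrow> 0 \<le> s k"
    "\<And>i j. i < n \<Longrightarrow> j < n \<Longrightarrow> A i j = (\<Sum>k<n. P i k * s k * Q j k)"
proof -
  \<comment> \<open>The Boolean coordinate selects P or Q. Coordinates beyond n are confined only to
    the box, which is compact by Tychonoff's theorem.\<close>
  define K where "K = {f :: bool \<times> nat \<times> nat \<Rightarrow> real. \<forall>i. f i \<in> {-1..1}}
    \<inter> {f. \<forall>z a b. a < n \<longrightarrow> b < n \<longrightarrow> (\<Sum>i<n. f (z, i, a) * f (z, i, b)) = (if a = b then 1 else 0)}"
  define M where "M f a b = bil n A (\<lambda>i. f (False, i, a)) (\<lambda>j. f (True, j, b))" for f :: "bool \<times> nat \<times> nat \<Rightarrow> real" and a b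
  define obj where "obj f = (\<Sum>a<n. (M f a a)\<^sup>2)" for f
  have "closed {f :: bool \<times> nat \<times> nat \<Rightarrow> real. \<forall>z a b. a < n \<longrightarrow> b < n \<longrightarrow> (\<Sum>i<n. f (z, i, a) * f (z, i, b)) = (if a = b then 1 else 0)}"
    by (intro closed_Collect_all closed_Collect_imp open_Collect_const closed_Collect_eq continuous_intros continuous_on_product_coordinates)
  then have "compact K" unfolding K_def by (intro compact_Int_closed compact_box)
  moreover have "continuous_on K obj"
    unfolding obj_def M_def bil_def
    by (intro continuous_intros continuous_on_subset[OF continuous_on_product_coordinates]) auto
  moreover have "(\<lambda>(z, i, a). if i = a then 1 else 0) \<in> K"
  proof -
    have "(\<Sum>i<n. (if i = a then 1 else 0) * (if i = b then 1 else 0)) = (if a = b then 1 else (0::real))" if "a < n" for a b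
    proof -
      have "(\<Sum>i<n. (if i = a then 1 else 0) * (if i = b then 1 else 0)) = (\<Sum>i<n. if i = a then (if a = b then 1 else 0) else (0::real))"
        by (intro sum.cong) auto
      then show ?thesis using that by simp
    qed
    then show ?thesis by (simp add: K_def)
  qed
  ultimately obtain f where f: "f \<in> K" and fmax: "\<And>g. g \<in> K \<Longrightarrow> obj g \<le> obj f"
    using continuous_attains_sup[of K obj] by blast
  define P Q where "P = (\<lambda>i a. f (False, i, a))" and "Q = (\<lambda>i a. f (True, i, a))"
  have P: "orthonormal_cols n n P" and Q: "orthonormal_cols n n Q"
    using f by (auto simp: orthonormal_cols_def P_def Q_def K_def)
  define B where "B a b = bil n A (\<lambda>i. P i a) (\<lambda>j. Q j b)" for a b
  have B_le: "(\<Sum>a<n. (bil n A (\<lambda>i. P' i a) (\<lambda>j. Q' j a))\<^sup>2) \<le> (\<Sum>a<n. (B a a)\<^sup>2)"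
    if P': "orthonormal_cols n n P'" and Q': "orthonormal_cols n n Q'" for P' Q'
  proof -
    define g where "g = (\<lambda>(z, i, a). if i < n \<and> a < n then (if z then Q' i a else P' i a) else (0::real))"
    have bd: "\<bar>R i a\<bar> \<le> 1" if "orthonormal_cols n n R" "i < n" "a < n" for R i a
    proof -
      have "(R i a)\<^sup>2 \<le> (\<Sum>i<n. (R i a)\<^sup>2)" using that by (intro member_le_sum) auto
      also have "\<dots> = 1" using orthonormal_colsD[OF that(1) that(3) that(3)] by (simp add: power2_eq_square)
      finally show ?thesis by (simp add: abs_square_le_1)
    qed
    have "g \<in> K"
      using bd[OF P'] bd[OF Q'] orthonormal_colsD[OF P'] orthonormal_colsD[OF Q']
      by (auto simp: K_def g_def all_bool_eq abs_le_iff minus_le_iff)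
    then have "obj g \<le> obj f" by (rule fmax)
    moreover have "M g a a = bil n A (\<lambda>i. P' i a) (\<lambda>j. Q' j a)" if "a < n" for a
      unfolding M_def bil_def g_def using that by (intro sum.cong) auto
    moreover have "M f a a = B a a" for a by (simp add: M_def B_def P_def Q_def)
    ultimately show ?thesis by (simp add: obj_def)
  qed
  have off: "B a b = 0" if ab: "a < n" "b < n" "a \<noteq> b" for a b
  proof -
    have "B a b = 0 \<and> B b a = 0"
    proof (rule two_by_two_diag[where x = "B a a" and y = "B b b"])
      fix c s c' s' :: real assume cs: "c\<^sup>2 + s\<^sup>2 = 1" "c'\<^sup>2 + s'\<^sup>2 = 1"
      define D where "D k = bil n A (\<lambda>i. rot a b c s P i k) (\<lambda>j. rot a b c' s' Q j k)" for k
      have split: "(\<Sum>k<n. h k) = h a + h b + (\<Sum>k\<in>{..<n} - {a, b}. h k)" for h :: "nat \<Rightarrow> real"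
      proof -
        have "(\<Sum>k<n. h k) = (\<Sum>k\<in>{..<n} - {a, b}. h k) + sum h {a, b}"
          using ab by (intro sum.subset_diff) auto
        then show ?thesis using ab by simp
      qed
      have rest: "(\<Sum>k\<in>{..<n} - {a, b}. (D k)\<^sup>2) = (\<Sum>k\<in>{..<n} - {a, b}. (B k k)\<^sup>2)"
        by (intro sum.cong refl) (auto simp: D_def B_def rot_def)
      have "D a = c * c' * B a a + c * s' * B a b + s * c' * B b a + s * s' * B b b"
        unfolding D_def rot_def B_def using ab by (simp add: bil_add_left bil_add_right algebra_simps)
      moreover have "D b = s * s' * B a a - s * c' * B a b - c * s' * B b a + c * c' * B b b"
        unfolding D_def rot_def B_def using ab
        by (simp add: bil_add_left bil_add_right bil_diff_left bil_diff_right) (simp add: algebra_simps)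
      moreover have "(\<Sum>k<n. (D k)\<^sup>2) \<le> (\<Sum>k<n. (B k k)\<^sup>2)"
        unfolding D_def by (intro B_le orthonormal_rot P Q ab cs)
      ultimately show "(c * c' * B a a + c * s' * B a b + s * c' * B b a + s * s' * B b b)\<^sup>2
         + (s * s' * B a a - s * c' * B a b - c * s' * B b a + c * c' * B b b)\<^sup>2 \<le> (B a a)\<^sup>2 + (B b b)\<^sup>2"
        using rest unfolding split by simp
    qed
    then show ?thesis by simp
  qed
  \<comment> \<open>Negative diagonal entries are made nonnegative by changing the signs of columns
    of Q.\<close>
  define s where "s k = \<bar>B k k\<bar>" for k
  define Q' where "Q' = (\<lambda>j k. (if B k k < 0 then - 1 else 1) * Q j k)"
  have sg: "(if B k k < 0 then - 1 else 1) * B k k = s k" for k by (auto simp: s_def)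
  show ?thesis
  proof (rule that[of P Q' s])
    show "orthonormal_cols n n P" by (rule P)
    show "orthonormal_cols n n Q'"
      unfolding orthonormal_cols_def
    proof (intro allI impI)
      fix k l assume kl: "k < n" "l < n"
      have "(\<Sum>i<n. Q' i k * Q' i l) = (if B k k < 0 then - 1 else 1) * (if B l l < 0 then - 1 else 1) * (\<Sum>i<n. Q i k * Q i l)"
        unfolding sum_distrib_left Q'_def by (intro sum.cong) auto
      then show "(\<Sum>i<n. Q' i k * Q' i l) = (if k = l then 1 else 0)"
        using orthonormal_colsD[OF Q kl] by auto
    qed
    show "0 \<le> s k" for k by (simp add: s_def)
    fix i j assume ij: "i < n" "j < n"
    have "(\<Sum>k<n. P i k * s k * Q' j k) = (\<Sum>k<n. P i k * B k k * Q j k)"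
      by (intro sum.cong) (auto simp: s_def Q'_def)
    also have "\<dots> = (\<Sum>k<n. \<Sum>l<n. if l = k then P i k * B k l * Q j l else 0)" by simp
    also have "\<dots> = (\<Sum>k<n. \<Sum>l<n. P i k * B k l * Q j l)"
      by (intro sum.cong refl) (auto simp: off)
    also have "\<dots> = (\<Sum>k<n. \<Sum>l<n. \<Sum>u<n. \<Sum>v<n. A u v * (P i k * P u k) * (Q j l * Q v l))"
      by (simp add: B_def bil_def sum_distrib_left sum_distrib_right mult_ac)
    also have "\<dots> = (\<Sum>u<n. \<Sum>v<n. \<Sum>k<n. \<Sum>l<n. A u v * (P i k * P u k) * (Q j l * Q v l))"
    proof -
      have "(\<Sum>k<n. \<Sum>l<n. \<Sum>u<n. \<Sum>v<n. h k l u v) = (\<Sum>u<n. \<Sum>v<n. \<Sum>k<n. \<Sum>l<n. h k l u v)"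
        for h :: "nat \<Rightarrow> nat \<Rightarrow> nat \<Rightarrow> nat \<Rightarrow> real"
      proof -
        have "(\<Sum>k<n. \<Sum>l<n. \<Sum>u<n. \<Sum>v<n. h k l u v) = (\<Sum>k<n. \<Sum>u<n. \<Sum>l<n. \<Sum>v<n. h k l u v)"
          by (intro sum.cong refl sum.swap)
        also have "\<dots> = (\<Sum>u<n. \<Sum>k<n. \<Sum>l<n. \<Sum>v<n. h k l u v)" by (rule sum.swap)
        also have "\<dots> = (\<Sum>u<n. \<Sum>k<n. \<Sum>v<n. \<Sum>l<n. h k l u v)"
          by (intro sum.cong refl sum.swap)
        also have "\<dots> = (\<Sum>u<n. \<Sum>v<n. \<Sum>k<n. \<Sum>l<n. h k l u v)"
          by (intro sum.cong refl sum.swap)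
        finally show ?thesis .
      qed
      then show ?thesis .
    qed
    also have "\<dots> = (\<Sum>u<n. \<Sum>v<n. A u v * (\<Sum>k<n. P i k * P u k) * (\<Sum>l<n. Q j l * Q v l))"
      by (simp add: sum_distrib_left sum_distrib_right mult_ac)
    also have "\<dots> = (\<Sum>u<n. \<Sum>v<n. if v = j then (if u = i then A u v else 0) else 0)"
      by (intro sum.cong refl) (use ij in \<open>auto simp: orthonormal_rows[OF P] orthonormal_rows[OF Q]\<close>)
    also have "\<dots> = A i j" using ij by simp
    finally show "A i j = (\<Sum>k<n. P i k * s k * Q' j k)" by simp
  qed
qed

definition is_svd :: "nat \<Rightarrow> rmat \<Rightarrow> rmat \<Rightarrow> rmat \<Rightarrow> (nat \<Rightarrow> real) \<Rightarrow> bool" where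
  "is_svd n A P Q s \<longleftrightarrow> orthonormal_cols n n P \<and> orthonormal_cols n n Q \<and> (\<forall>k<n. 0 \<le> s k) \<and>
    (\<forall>i<n. \<forall>j<n. A i j = (\<Sum>k<n. s k * P i k * Q j k))"

text \<open>One decomposition is fixed per matrix, so that the singular vectors of a random matrix
  become functions of the bits.\<close>

definition svd :: "nat \<Rightarrow> rmat \<Rightarrow> rmat \<times> rmat \<times> (nat \<Rightarrow> real)" where
  "svd n A = (SOME (P, Q, s). is_svd n A P Q s)"

definition svl :: "nat \<Rightarrow> rmat \<Rightarrow> rmat" where "svl n A = fst (svd n A)"
definition svr :: "nat \<Rightarrow> rmat \<Rightarrow> rmat" where "svr n A = fst (snd (svd n A))"
definition svv :: "nat \<Rightarrow> rmat \<Rightarrow> nat \<Rightarrow> real" where "svv n A = snd (snd (svd n A))"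

lemma is_svd_svd: "is_svd n A (svl n A) (svr n A) (svv n A)"
proof -
  obtain P Q s where "is_svd n A P Q s"
    by (rule svd_exists[of n A]) (auto simp: is_svd_def mult_ac)
  then have "(case (P, Q, s) of (P, Q, s) \<Rightarrow> is_svd n A P Q s)" by simp
  then have "(case svd n A of (P, Q, s) \<Rightarrow> is_svd n A P Q s)"
    unfolding svd_def by (rule someI)
  then show ?thesis by (simp add: svl_def svr_def svv_def case_prod_beta)
qed

lemma is_svdD:
  assumes "is_svd n A P Q s"
  shows "orthonormal_cols n n P" "orthonormal_cols n n Q" "k < n \<Longrightarrow> 0 \<le> s k"
    "i < n \<Longrightarrow> j < n \<Longrightarrow> A i j = (\<Sum>k<n. s k * P i k * Q j k)"
  using assms by (auto simp: is_svd_def)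

lemma sum_swap4:
  "(\<Sum>i\<in>A. \<Sum>j\<in>B. \<Sum>a\<in>C. \<Sum>b\<in>D. h i j a b) = (\<Sum>a\<in>C. \<Sum>b\<in>D. \<Sum>i\<in>A. \<Sum>j\<in>B. h i j a b)"
  for h :: "'a \<Rightarrow> 'b \<Rightarrow> 'c \<Rightarrow> 'd \<Rightarrow> real"
proof -
  have "(\<Sum>i\<in>A. \<Sum>j\<in>B. \<Sum>a\<in>C. \<Sum>b\<in>D. h i j a b) = (\<Sum>i\<in>A. \<Sum>a\<in>C. \<Sum>j\<in>B. \<Sum>b\<in>D. h i j a b)"
    by (intro sum.cong refl sum.swap)
  also have "\<dots> = (\<Sum>a\<in>C. \<Sum>i\<in>A. \<Sum>j\<in>B. \<Sum>b\<in>D. h i j a b)" by (rule sum.swap)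
  also have "\<dots> = (\<Sum>a\<in>C. \<Sum>i\<in>A. \<Sum>b\<in>D. \<Sum>j\<in>B. h i j a b)"
    by (intro sum.cong refl sum.swap)
  also have "\<dots> = (\<Sum>a\<in>C. \<Sum>b\<in>D. \<Sum>i\<in>A. \<Sum>j\<in>B. h i j a b)"
    by (intro sum.cong refl sum.swap)
  finally show ?thesis .
qed

text \<open>With l equal to 1 this also evaluates bilinear forms, which is how it is mostly
  used.\<close>

lemma inner_low_rank:
  fixes u w :: "nat \<Rightarrow> real" and P Q P' Q' :: rmat
  shows "(\<Sum>i<n. \<Sum>j<n. (\<Sum>a<k. u a * P i a * Q j a) * (\<Sum>b<l. w b * P' i b * Q' j b))
    = (\<Sum>a<k. \<Sum>b<l. u a * w b * (\<Sum>i<n. P i a * P' i b) * (\<Sum>j<n. Q j a * Q' j b))"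
proof -
  have "(\<Sum>i<n. \<Sum>j<n. (\<Sum>a<k. u a * P i a * Q j a) * (\<Sum>b<l. w b * P' i b * Q' j b))
    = (\<Sum>i<n. \<Sum>j<n. \<Sum>a<k. \<Sum>b<l. u a * w b * (P i a * P' i b) * (Q j a * Q' j b))"
    by (simp add: sum_product mult_ac)
  also have "\<dots> = (\<Sum>a<k. \<Sum>b<l. \<Sum>i<n. \<Sum>j<n. u a * w b * (P i a * P' i b) * (Q j a * Q' j b))"
    by (rule sum_swap4)
  also have "\<dots> = (\<Sum>a<k. \<Sum>b<l. u a * w b * (\<Sum>i<n. P i a * P' i b) * (\<Sum>j<n. Q j a * Q' j b))"
    by (simp add: sum_distrib_left sum_distrib_right mult_ac)
  finally show ?thesis .
qed

lemma bil_svd: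
  assumes "is_svd n A P Q s"
  shows "bil n A x y = (\<Sum>k<n. s k * (\<Sum>i<n. P i k * x i) * (\<Sum>j<n. Q j k * y j))"
proof -
  have "bil n A x y = (\<Sum>i<n. \<Sum>j<n. (\<Sum>k<n. s k * P i k * Q j k) * (\<Sum>b<Suc 0. 1 * x i * y j))"
    unfolding bil_def by (intro sum.cong refl) (simp add: is_svdD(4)[OF assms])
  also have "\<dots> = (\<Sum>k<n. s k * (\<Sum>i<n. P i k * x i) * (\<Sum>j<n. Q j k * y j))"
    unfolding inner_low_rank by simp
  finally show ?thesis .
qed

lemma bil_svd_left:
  assumes "is_svd n A P Q s" "a < n"
  shows "bil n A (\<lambda>i. P i a) y = s a * (\<Sum>j<n. Q j a * y j)"
proof -
  have "bil n A (\<lambda>i. P i a) y = (\<Sum>k<n. if k = a then s a * (\<Sum>j<n. Q j a * y j) else 0)"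
    unfolding bil_svd[OF assms(1)] using assms(2)
    by (intro sum.cong) (auto simp: orthonormal_colsD[OF is_svdD(1)[OF assms(1)]])
  then show ?thesis using assms(2) by simp
qed

lemma bil_svd_right:
  assumes "is_svd n A P Q s" "a < n"
  shows "bil n A x (\<lambda>j. Q j a) = s a * (\<Sum>i<n. P i a * x i)"
proof -
  have "bil n A x (\<lambda>j. Q j a) = (\<Sum>k<n. if k = a then s a * (\<Sum>i<n. P i a * x i) else 0)"
    unfolding bil_svd[OF assms(1)] using assms(2)
    by (intro sum.cong) (auto simp: orthonormal_colsD[OF is_svdD(2)[OF assms(1)]])
  then show ?thesis using assms(2) by simp
qed

lemma parseval:
  assumes "orthonormal_cols n n P"
  shows "(\<Sum>b<n. (\<Sum>i<n. P i b * x i)\<^sup>2) = (\<Sum>i<n. (x i)\<^sup>2)"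
proof -
  have "(\<Sum>b<n. (\<Sum>i<n. P i b * x i)\<^sup>2) = (\<Sum>b<n. \<Sum>i<n. \<Sum>j<n. x i * x j * (P i b * P j b))"
    by (simp add: power2_eq_square sum_product mult_ac)
  also have "\<dots> = (\<Sum>i<n. \<Sum>b<n. \<Sum>j<n. x i * x j * (P i b * P j b))"
    by (rule sum.swap)
  also have "\<dots> = (\<Sum>i<n. \<Sum>j<n. \<Sum>b<n. x i * x j * (P i b * P j b))"
    by (intro sum.cong refl sum.swap)
  also have "\<dots> = (\<Sum>i<n. \<Sum>j<n. if j = i then (x i)\<^sup>2 else 0)"
    by (intro sum.cong refl)
      (auto simp: sum_distrib_left[symmetric] orthonormal_rows[OF assms] power2_eq_square)
  also have "\<dots> = (\<Sum>i<n. (x i)\<^sup>2)" by simp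
  finally show ?thesis .
qed

section \<open>Even Schatten norms and the monotonicity of their gradients\<close>

definition schatten :: "nat \<Rightarrow> nat \<Rightarrow> rmat \<Rightarrow> real" where
  "schatten n m A = (\<Sum>k<n. ((svv n A k)\<^sup>2) ^ m)"

text \<open>This is the gradient of \<open>schatten n m\<close> at A divided by
  \<open>2 * m\<close>; for \<open>m = 1\<close> it is A itself.\<close>

definition sgrad :: "nat \<Rightarrow> nat \<Rightarrow> rmat \<Rightarrow> rmat" where
  "sgrad n m A = (\<lambda>i j. \<Sum>k<n. (((svv n A k)\<^sup>2) ^ (m - 1) * svv n A k) * svl n A i k * svr n A j k)"

text \<open>The i-th diagonal entry of \<open>(A A^T)^(m-1)\<close> if P is \<open>svl n A\<close>,
  and of \<open>(A^T A)^(m-1)\<close> if P is \<open>svr n A\<close>.\<close>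

definition growth :: "nat \<Rightarrow> nat \<Rightarrow> rmat \<Rightarrow> rmat \<Rightarrow> nat \<Rightarrow> real" where
  "growth n m A P i = (\<Sum>k<n. ((svv n A k)\<^sup>2) ^ (m - 1) * (P i k)\<^sup>2)"

text \<open>The scalar monotonicity inequalities at (x, y) and at (x, -y) are combined with weights
  \<open>(\<alpha> + \<beta>)^2\<close> and \<open>(\<alpha> - \<beta>)^2\<close>. Later x and y are
  singular values of two matrices, and \<alpha> and \<beta> the overlaps of their left and right
  singular vectors.\<close>

lemma pair_inequality:
  fixes x y \<alpha> \<beta> :: real
  assumes "1 \<le> m"
  shows "((x\<^sup>2) ^ m + (y\<^sup>2) ^ m) * (\<alpha>\<^sup>2 + \<beta>\<^sup>2) - 2 * (x * ((y\<^sup>2) ^ (m - 1) * y) + y * ((x\<^sup>2) ^ (m - 1) * x)) * \<alpha> * \<beta>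
    \<le> 2 * real m * ((x\<^sup>2) ^ (m - 1) + (y\<^sup>2) ^ (m - 1)) * ((x * \<beta> - y * \<alpha>)\<^sup>2 + (x * \<alpha> - y * \<beta>)\<^sup>2)"
proof -
  define X Y M where "X = (x\<^sup>2) ^ (m - 1)" and "Y = (y\<^sup>2) ^ (m - 1)" and "M = 2 * real m"
  have pw: "(x\<^sup>2) ^ m = X * x * x" "(y\<^sup>2) ^ m = Y * y * y"
    using assms by (cases m; simp add: X_def Y_def power2_eq_square mult_ac)+
  have 1: "(x - y) * (X * x - Y * y) \<le> M * (x - y)\<^sup>2 * (X + Y)"
    using nsq_power_monotone[of "{()}" m "\<lambda>_. x" "\<lambda>_. y"] assms by (simp add: nsq_def X_def Y_def M_def)
  have 2: "(x + y) * (X * x + Y * y) \<le> M * (x + y)\<^sup>2 * (X + Y)"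
    using nsq_power_monotone[of "{()}" m "\<lambda>_. x" "\<lambda>_. - y"] assms by (simp add: nsq_def X_def Y_def M_def)
  have "(\<alpha> + \<beta>)\<^sup>2 * ((x - y) * (X * x - Y * y)) + (\<alpha> - \<beta>)\<^sup>2 * ((x + y) * (X * x + Y * y))
    \<le> (\<alpha> + \<beta>)\<^sup>2 * (M * (x - y)\<^sup>2 * (X + Y)) + (\<alpha> - \<beta>)\<^sup>2 * (M * (x + y)\<^sup>2 * (X + Y))"
    using 1 2 by (intro add_mono mult_left_mono) auto
  moreover have "(\<alpha> + \<beta>)\<^sup>2 * ((x - y) * (X * x - Y * y)) + (\<alpha> - \<beta>)\<^sup>2 * ((x + y) * (X * x + Y * y))
    = 2 * ((X * x * x + Y * y * y) * (\<alpha>\<^sup>2 + \<beta>\<^sup>2) - 2 * (x * (Y * y) + y * (X * x)) * \<alpha> * \<beta>)"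
    by (simp add: power2_eq_square algebra_simps)
  moreover have "(\<alpha> + \<beta>)\<^sup>2 * (M * (x - y)\<^sup>2 * (X + Y)) + (\<alpha> - \<beta>)\<^sup>2 * (M * (x + y)\<^sup>2 * (X + Y))
    = 2 * (M * (X + Y) * ((x * \<beta> - y * \<alpha>)\<^sup>2 + (x * \<alpha> - y * \<beta>)\<^sup>2))"
    by (simp add: power2_eq_square algebra_simps)
  moreover have "c \<le> d" if "a \<le> b" "a = 2 * c" "b = 2 * d" for a b c d :: real
    using that by simp
  ultimately show ?thesis unfolding pw X_def[symmetric] Y_def[symmetric] M_def[symmetric] by blast
qed

lemma sgrad_inner:
  assumes "1 \<le> m"
  shows "(\<Sum>i<n. \<Sum>j<n. A i j * sgrad n m A i j) = schatten n m A"
proof -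
  let ?P = "svl n A" and ?Q = "svr n A" and ?s = "svv n A"
  note sv = is_svdD[OF is_svd_svd[of n A]]
  have "(\<Sum>i<n. \<Sum>j<n. A i j * sgrad n m A i j) =
    (\<Sum>i<n. \<Sum>j<n. (\<Sum>a<n. ?s a * ?P i a * ?Q j a) * (\<Sum>b<n. ((?s b)\<^sup>2 ^ (m - 1) * ?s b) * ?P i b * ?Q j b))"
    by (intro sum.cong refl) (use sv(4) in \<open>simp add: sgrad_def\<close>)
  also have "\<dots> = (\<Sum>a<n. \<Sum>b<n. if b = a then ((?s a)\<^sup>2) ^ m else 0)"
    unfolding inner_low_rank
    by (intro sum.cong refl) (use assms in \<open>auto simp: orthonormal_colsD[OF sv(1)] orthonormal_colsD[OF sv(2)] power_eq_if power2_eq_square\<close>)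
  finally show ?thesis by (simp add: schatten_def)
qed

text \<open>Monotonicity of the gradient of \<open>A \<mapsto> tr (A A\<^sup>T)\<^sup>m\<close> under a change of one entry.\<close>

lemma sgrad_entry:
  assumes m: "1 \<le> m" and ij: "i < n" "j < n"
    and AB: "\<And>k l. k < n \<Longrightarrow> l < n \<Longrightarrow> A k l - B k l = (if k = i \<and> l = j then c else 0)"
  shows "c * (sgrad n m A i j - sgrad n m B i j) \<le>
    real m * c\<^sup>2 * ((growth n m A (svl n A) i + growth n m A (svr n A) j) + (growth n m B (svl n B) i + growth n m B (svr n B) j))"
proof -
  define P Q x where "P = svl n A" and "Q = svr n A" and "x = svv n A"
  define P' Q' y where "P' = svl n B" and "Q' = svr n B" and "y = svv n B"
  note sA = is_svdD[OF is_svd_svd[of n A], folded P_def Q_def x_def]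
  note sB = is_svdD[OF is_svd_svd[of n B], folded P'_def Q'_def y_def]
  define \<alpha> where "\<alpha> a b = (\<Sum>i<n. P i a * P' i b)" for a b
  define \<beta> where "\<beta> a b = (\<Sum>j<n. Q j a * Q' j b)" for a b
  define X Y where "X a = ((x a)\<^sup>2) ^ (m - 1)" and "Y b = ((y b)\<^sup>2) ^ (m - 1)" for a b
  have row1: "(\<Sum>b<n. (\<alpha> a b)\<^sup>2) = 1" "(\<Sum>b<n. (\<beta> a b)\<^sup>2) = 1" if "a < n" for a
    using parseval[OF sB(1), of "\<lambda>i. P i a"] parseval[OF sB(2), of "\<lambda>i. Q i a"]
      orthonormal_colsD[OF sA(1) that that] orthonormal_colsD[OF sA(2) that that]
    by (simp_all add: \<alpha>_def \<beta>_def mult.commute power2_eq_square)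
  have col1: "(\<Sum>a<n. (\<alpha> a b)\<^sup>2) = 1" "(\<Sum>a<n. (\<beta> a b)\<^sup>2) = 1" if "b < n" for b
    using parseval[OF sA(1), of "\<lambda>i. P' i b"] parseval[OF sA(2), of "\<lambda>i. Q' i b"]
      orthonormal_colsD[OF sB(1) that that] orthonormal_colsD[OF sB(2) that that]
    by (simp_all add: \<alpha>_def \<beta>_def power2_eq_square)
  let ?FA = "sgrad n m A" and ?FB = "sgrad n m B"
  have AFB: "(\<Sum>k<n. \<Sum>l<n. A k l * ?FB k l) = (\<Sum>a<n. \<Sum>b<n. x a * (Y b * y b) * \<alpha> a b * \<beta> a b)"
    unfolding \<alpha>_def \<beta>_def inner_low_rank[symmetric] sgrad_def P'_def[symmetric] Q'_def[symmetric] y_def[symmetric] Y_def[symmetric]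
    by (intro sum.cong refl) (use sA(4) in simp)
  have BFA: "(\<Sum>k<n. \<Sum>l<n. ?FA k l * B k l) = (\<Sum>a<n. \<Sum>b<n. (X a * x a) * y b * \<alpha> a b * \<beta> a b)"
    unfolding \<alpha>_def \<beta>_def inner_low_rank[symmetric] sgrad_def P_def[symmetric] Q_def[symmetric] x_def[symmetric] X_def[symmetric]
    by (intro sum.cong refl) (use sB(4) in simp)
  \<comment> \<open>Squared overlaps sum to 1 along rows and columns, so each Schatten sum becomes a
    double sum over pairs of singular triples. The left and right overlaps contribute equally,
    whence the division by 2.\<close>
  have sA2: "schatten n m A = (\<Sum>a<n. \<Sum>b<n. ((x a)\<^sup>2) ^ m * ((\<alpha> a b)\<^sup>2 + (\<beta> a b)\<^sup>2)) / 2"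
    unfolding sum_distrib_left[symmetric] sum.distrib by (simp add: row1 schatten_def x_def sum_divide_distrib)
  have sB2: "schatten n m B = (\<Sum>a<n. \<Sum>b<n. ((y b)\<^sup>2) ^ m * ((\<alpha> a b)\<^sup>2 + (\<beta> a b)\<^sup>2)) / 2"
    by (subst sum.swap) (unfold sum_distrib_left[symmetric] sum.distrib, simp add: col1 schatten_def y_def sum_divide_distrib)
  have bd: "bil n A u v - bil n B u v = c * u i * v j" for u v
  proof -
    have "bil n A u v - bil n B u v = (\<Sum>k<n. \<Sum>l<n. (A k l - B k l) * (u k * v l))"
      unfolding bil_def sum_subtractf[symmetric] by (intro sum.cong refl) (simp add: algebra_simps)
    also have "\<dots> = (\<Sum>k<n. \<Sum>l<n. if l = j then (if k = i then c * u i * v j else 0) else 0)"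
      by (intro sum.cong refl) (auto simp: AB)
    finally show ?thesis using ij by simp
  qed
  note svA = is_svd_svd[of n A, folded P_def Q_def x_def] and svB = is_svd_svd[of n B, folded P'_def Q'_def y_def]
  \<comment> \<open>Since \<open>A - B\<close> is a multiple of a matrix unit, its values on pairs
    of singular vectors factor.\<close>
  have e1: "c * P i a * Q' j b = x a * \<beta> a b - y b * \<alpha> a b" if "a < n" "b < n" for a b
    using bd[of "\<lambda>i. P i a" "\<lambda>j. Q' j b"]
    unfolding bil_svd_left[OF svA that(1)] bil_svd_right[OF svB that(2)] \<alpha>_def \<beta>_def
    by (simp add: mult.commute)
  have e2: "c * P' i b * Q j a = x a * \<alpha> a b - y b * \<beta> a b" if "a < n" "b < n" for a b
    using bd[of "\<lambda>i. P' i b" "\<lambda>j. Q j a"]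
    unfolding bil_svd_right[OF svA that(1)] bil_svd_left[OF svB that(2)] \<alpha>_def \<beta>_def
    by (simp add: mult.commute)
  have "2 * (c * (?FA i j - ?FB i j)) = 2 * (\<Sum>k<n. \<Sum>l<n. (A k l - B k l) * (?FA k l - ?FB k l))"
  proof -
    have "(\<Sum>k<n. \<Sum>l<n. (A k l - B k l) * (?FA k l - ?FB k l)) = (\<Sum>k<n. \<Sum>l<n. if l = j then (if k = i then c * (?FA i j - ?FB i j) else 0) else 0)"
      by (intro sum.cong refl) (auto simp: AB)
    then show ?thesis using ij by simp
  qed
  also have "(\<Sum>k<n. \<Sum>l<n. (A k l - B k l) * (?FA k l - ?FB k l)) =
     schatten n m A + schatten n m B - (\<Sum>k<n. \<Sum>l<n. A k l * ?FB k l) - (\<Sum>k<n. \<Sum>l<n. ?FA k l * B k l)"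
    unfolding sgrad_inner[OF m, symmetric] by (simp add: algebra_simps sum_subtractf sum.distrib)
  also have "2 * \<dots> = (\<Sum>a<n. \<Sum>b<n. (((x a)\<^sup>2) ^ m + ((y b)\<^sup>2) ^ m) * ((\<alpha> a b)\<^sup>2 + (\<beta> a b)\<^sup>2)
      - 2 * (x a * (Y b * y b) + y b * (X a * x a)) * \<alpha> a b * \<beta> a b)"
  proof -
    have "(\<Sum>a<n. \<Sum>b<n. (((x a)\<^sup>2) ^ m + ((y b)\<^sup>2) ^ m) * ((\<alpha> a b)\<^sup>2 + (\<beta> a b)\<^sup>2)
        - 2 * (x a * (Y b * y b) + y b * (X a * x a)) * \<alpha> a b * \<beta> a b)
      = (\<Sum>a<n. \<Sum>b<n. ((x a)\<^sup>2) ^ m * ((\<alpha> a b)\<^sup>2 + (\<beta> a b)\<^sup>2)) + (\<Sum>a<n. \<Sum>b<n. ((y b)\<^sup>2) ^ m * ((\<alpha> a b)\<^sup>2 + (\<beta> a b)\<^sup>2))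
        - 2 * (\<Sum>a<n. \<Sum>b<n. x a * (Y b * y b) * \<alpha> a b * \<beta> a b) - 2 * (\<Sum>a<n. \<Sum>b<n. (X a * x a) * y b * \<alpha> a b * \<beta> a b)"
      unfolding sum_distrib_left sum.distrib[symmetric] sum_subtractf[symmetric]
      by (intro sum.cong refl) (simp add: algebra_simps)
    then show ?thesis unfolding sA2 sB2 AFB BFA by simp
  qed
  also have "\<dots> \<le> (\<Sum>a<n. \<Sum>b<n. 2 * real m * (X a + Y b) * ((x a * \<beta> a b - y b * \<alpha> a b)\<^sup>2 + (x a * \<alpha> a b - y b * \<beta> a b)\<^sup>2))"
    unfolding X_def Y_def by (intro sum_mono pair_inequality m)
  also have "\<dots> = (\<Sum>a<n. \<Sum>b<n. 2 * real m * (X a + Y b) * ((c * P i a * Q' j b)\<^sup>2 + (c * P' i b * Q j a)\<^sup>2))"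
    by (intro sum.cong refl) (simp add: e1 e2)
  also have "\<dots> = 2 * real m * c\<^sup>2 * (\<Sum>a<n. \<Sum>b<n. X a * (P i a)\<^sup>2 * (Q' j b)\<^sup>2 + X a * (Q j a)\<^sup>2 * (P' i b)\<^sup>2
      + (Y b * (P' i b)\<^sup>2 * (Q j a)\<^sup>2 + Y b * (Q' j b)\<^sup>2 * (P i a)\<^sup>2))"
    unfolding sum_distrib_left by (intro sum.cong refl) (simp add: power2_eq_square algebra_simps)
  also have "(\<Sum>a<n. \<Sum>b<n. X a * (P i a)\<^sup>2 * (Q' j b)\<^sup>2 + X a * (Q j a)\<^sup>2 * (P' i b)\<^sup>2
      + (Y b * (P' i b)\<^sup>2 * (Q j a)\<^sup>2 + Y b * (Q' j b)\<^sup>2 * (P i a)\<^sup>2))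
     = growth n m A P i + growth n m A Q j + (growth n m B P' i + growth n m B Q' j)"
  proof -
    have un: "(\<Sum>b<n. (R k b)\<^sup>2) = 1" if "orthonormal_cols n n R" "k < n" for R k
      using orthonormal_rows[OF that(1) that(2) that(2)] by (simp add: power2_eq_square)
    have s: "(\<Sum>a<n. \<Sum>b<n. f a * g b) = sum f {..<n} * sum g {..<n}" "(\<Sum>a<n. \<Sum>b<n. g b * f a) = sum g {..<n} * sum f {..<n}" for f g :: "nat \<Rightarrow> real"
      by (simp add: sum_product) (subst sum.swap, simp add: sum_product)
    show ?thesis
      unfolding sum.distrib s un[OF sA(1) ij(1)] un[OF sA(2) ij(2)] un[OF sB(1) ij(1)] un[OF sB(2) ij(2)] growth_def X_def Y_def x_def y_def
      by simp
  qed
  finally show ?thesis unfolding P_def Q_def P'_def Q'_def by simp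
qed

section \<open>Schatten moments of random matrices\<close>

lemma schatten_nonneg: "0 \<le> schatten n m A"
  by (simp add: schatten_def sum_nonneg)

text \<open>The squared entries of P form a doubly stochastic matrix, so Young's inequality can be
  applied entry by entry and summed.\<close>

lemma young_growth:
  assumes m: "1 \<le> m" and z: "\<And>i. 0 \<le> z i" and P: "orthonormal_cols n n P"
  shows "real m * (\<Sum>i<n. z i * growth n m A P i) \<le> (\<Sum>i<n. z i ^ m) + (real m - 1) * schatten n m A"
proof -
  have "real m * (\<Sum>i<n. z i * growth n m A P i) =
      (\<Sum>i<n. \<Sum>k<n. (P i k)\<^sup>2 * (real m * (z i * ((svv n A k)\<^sup>2) ^ (m - 1))))"
    by (simp add: growth_def sum_distrib_left mult_ac)
  also have "\<dots> \<le> (\<Sum>i<n. \<Sum>k<n. (P i k)\<^sup>2 * (z i ^ m + (real m - 1) * ((svv n A k)\<^sup>2) ^ m))"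
    by (intro sum_mono mult_left_mono young_power m z) auto
  also have "\<dots> = (\<Sum>i<n. \<Sum>k<n. z i ^ m * (P i k)\<^sup>2) + (\<Sum>k<n. \<Sum>i<n. (real m - 1) * ((svv n A k)\<^sup>2) ^ m * (P i k)\<^sup>2)"
    by (subst (2) sum.swap) (simp add: algebra_simps sum.distrib sum_subtractf)
  also have "\<dots> = (\<Sum>i<n. z i ^ m) + (\<Sum>k<n. (real m - 1) * ((svv n A k)\<^sup>2) ^ m)"
  proof -
    have "(\<Sum>k<n. (P i k)\<^sup>2) = 1" "(\<Sum>k<n. (P k i)\<^sup>2) = 1" if "i < n" for i
      using orthonormal_rows[OF P that that] orthonormal_colsD[OF P that that] by (simp_all add: power2_eq_square)
    then show ?thesis
      by (intro arg_cong2[where f = "(+)"] sum.cong refl) (simp_all add: sum_distrib_left[symmetric])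
  qed
  finally show ?thesis by (simp add: schatten_def sum_distrib_left)
qed

text \<open>Matrix counterpart of \<open>moment_le_qvar\<close>. Each summand is a multiple of a
  matrix unit, so the quadratic variation is diagonal on either side and only its row sums and
  column sums remain.\<close>

lemma (in bits) schatten_moment_qvar:
  assumes m: "1 \<le> m"
    and pos: "\<And>j. j \<in> J \<Longrightarrow> r j < n \<and> c j < n"
    and ind: "\<And>j. j \<in> J \<Longrightarrow> indep_bits J (a j)"
    and S: "\<And>\<eta> k l. S \<eta> k l = (\<Sum>j\<in>J. zeta p j \<eta> * (if k = r j \<and> l = c j then a j \<eta> else 0))"
  shows "2 * bexp I p (\<lambda>\<eta>. schatten n m (S \<eta>)) \<le>
      (\<Sum>i<n. bexp I p (\<lambda>\<eta>. (2 * real m * (\<Sum>j | j \<in> J \<and> r j = i. ((zeta p j \<eta>)\<^sup>2 + (1 - p j) / p j) * (a j \<eta>)\<^sup>2)) ^ m))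
    + (\<Sum>i<n. bexp I p (\<lambda>\<eta>. (2 * real m * (\<Sum>j | j \<in> J \<and> c j = i. ((zeta p j \<eta>)\<^sup>2 + (1 - p j) / p j) * (a j \<eta>)\<^sup>2)) ^ m))"
proof -
  let ?L = "\<lambda>\<eta>. svl n (S \<eta>)" and ?R = "\<lambda>\<eta>. svr n (S \<eta>)"
  define G where "G j \<eta> = growth n m (S \<eta>) (?L \<eta>) (r j) + growth n m (S \<eta>) (?R \<eta>) (c j)" for j \<eta>
  define v where "v j \<eta> = ((zeta p j \<eta>)\<^sup>2 + (1 - p j) / p j) * (a j \<eta>)\<^sup>2" for j \<eta>
  define Vr where "Vr i \<eta> = (\<Sum>j | j \<in> J \<and> r j = i. v j \<eta>)" for i \<eta>
  define Vc where "Vc i \<eta> = (\<Sum>j | j \<in> J \<and> c j = i. v j \<eta>)" for i \<eta>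
  define F where "F j \<eta> = a j \<eta> * sgrad n m (S \<eta>) (r j) (c j)" for j \<eta>
  have v0: "0 \<le> v j \<eta>" if "j \<in> J" for j \<eta>
    using pJ[OF that] by (simp add: v_def)
  have eq: "schatten n m (S \<eta>) = (\<Sum>j\<in>J. zeta p j \<eta> * F j \<eta>)" for \<eta>
  proof -
    have "schatten n m (S \<eta>) = (\<Sum>k<n. \<Sum>l<n. \<Sum>j\<in>J. zeta p j \<eta> * (if k = r j \<and> l = c j then a j \<eta> else 0) * sgrad n m (S \<eta>) k l)"
      unfolding sgrad_inner[OF m, symmetric]
      by (intro sum.cong refl) (subst S, simp add: sum_distrib_right)
    also have "\<dots> = (\<Sum>j\<in>J. \<Sum>k<n. \<Sum>l<n. zeta p j \<eta> * (if k = r j \<and> l = c j then a j \<eta> else 0) * sgrad n m (S \<eta>) k l)"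
      by (simp add: sum.swap[of _ J])
    also have "\<dots> = (\<Sum>j\<in>J. \<Sum>k<n. \<Sum>l<n. if l = c j then (if k = r j then zeta p j \<eta> * F j \<eta> else 0) else 0)"
      by (intro sum.cong refl) (auto simp: F_def)
    also have "\<dots> = (\<Sum>j\<in>J. zeta p j \<eta> * F j \<eta>)"
      by (intro sum.cong refl) (use pos in auto)
    finally show ?thesis .
  qed
  have step: "bexp I p (\<lambda>\<eta>. zeta p j \<eta> * F j \<eta>)
      \<le> bexp I p (\<lambda>\<eta>. ((zeta p j \<eta>)\<^sup>2 + (1 - p j) / p j) * (real m * (a j \<eta>)\<^sup>2 * G j \<eta>))"
    if j: "j \<in> J" for j
  proof (rule bexp_zeta_le[OF j])
    fix \<eta>
    let ?t = "\<eta>(j := True)" and ?f = "\<eta>(j := False)"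
    have aj: "a i (\<eta>(j := v)) = a i \<eta>" if "i \<in> J" for i v
      using ind[OF that] j by (simp add: indep_bitsD)
    have p: "0 < p j" using pJ[OF j] by auto
    have diff: "S ?t k l - S ?f k l = (if k = r j \<and> l = c j then a j \<eta> / p j else 0)" for k l
    proof -
      have "S ?t k l - S ?f k l = (\<Sum>i\<in>J. (zeta p i ?t - zeta p i ?f) * (if k = r i \<and> l = c i then a i \<eta> else 0))"
        unfolding S sum_subtractf[symmetric] by (intro sum.cong refl) (simp add: aj algebra_simps)
      also have "\<dots> = (\<Sum>i\<in>J. if i = j then (if k = r j \<and> l = c j then a j \<eta> / p j else 0) else 0)"
        by (rule sum.cong) auto
      finally show ?thesis using j finJ by simp
    qed
    have "(F j ?t - F j ?f) / p j = (a j \<eta> / p j) * (sgrad n m (S ?t) (r j) (c j) - sgrad n m (S ?f) (r j) (c j))"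
      unfolding F_def aj[OF j] by (simp add: right_diff_distrib diff_divide_distrib)
    also have "\<dots> \<le> real m * (a j \<eta> / p j)\<^sup>2 * (G j ?t + G j ?f)"
      unfolding G_def by (rule sgrad_entry[OF m]) (use pos[OF j] diff in auto)
    also have "\<dots> = real m * (a j ?t)\<^sup>2 / (p j)\<^sup>2 * (G j ?t + G j ?f)"
      by (simp only: aj[OF j] power_divide times_divide_eq_right times_divide_eq_left)
    finally show "(F j ?t - F j ?f) / p j \<le> real m * (a j ?t)\<^sup>2 / (p j)\<^sup>2 * (G j ?t + G j ?f)" .
  next
    show "real m * (a j (\<eta>(j := v)))\<^sup>2 = real m * (a j \<eta>)\<^sup>2" for \<eta> v
      using ind[OF j] j by (simp add: indep_bitsD)
  qed
  have grp: "(\<Sum>j\<in>J. v j \<eta> * g (q j)) = (\<Sum>i<n. (\<Sum>j | j \<in> J \<and> q j = i. v j \<eta>) * g i)"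
    if "\<And>j. j \<in> J \<Longrightarrow> q j < n" for q and g :: "nat \<Rightarrow> real" and \<eta>
  proof -
    have "(\<Sum>j\<in>J. v j \<eta> * g (q j)) = (\<Sum>i\<in>{..<n}. \<Sum>j | j \<in> J \<and> q j = i. v j \<eta> * g (q j))"
      by (rule sum.group[symmetric]) (use finJ that in auto)
    also have "\<dots> = (\<Sum>i<n. (\<Sum>j | j \<in> J \<and> q j = i. v j \<eta>) * g i)"
      by (intro sum.cong refl) (simp add: sum_distrib_right)
    finally show ?thesis .
  qed
  have "2 * real m * bexp I p (\<lambda>\<eta>. schatten n m (S \<eta>)) = 2 * real m * (\<Sum>j\<in>J. bexp I p (\<lambda>\<eta>. zeta p j \<eta> * F j \<eta>))"
    unfolding eq by (simp add: bexp_sum)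
  also have "\<dots> \<le> 2 * real m * (\<Sum>j\<in>J. bexp I p (\<lambda>\<eta>. ((zeta p j \<eta>)\<^sup>2 + (1 - p j) / p j) * (real m * (a j \<eta>)\<^sup>2 * G j \<eta>)))"
    by (intro mult_left_mono sum_mono step) auto
  also have "\<dots> = bexp I p (\<lambda>\<eta>. real m * (\<Sum>j\<in>J. v j \<eta> * (2 * real m * G j \<eta>)))"
    unfolding bexp_sum[symmetric] bexp_cmult[symmetric] v_def by (simp only: sum_distrib_left mult_ac)
  also have "\<dots> = bexp I p (\<lambda>\<eta>. real m * (\<Sum>i<n. (2 * real m * Vr i \<eta>) * growth n m (S \<eta>) (?L \<eta>) i)
      + real m * (\<Sum>i<n. (2 * real m * Vc i \<eta>) * growth n m (S \<eta>) (?R \<eta>) i))"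
  proof -
    have "(\<Sum>j\<in>J. v j \<eta> * (2 * real m * G j \<eta>)) =
      (\<Sum>j\<in>J. v j \<eta> * (2 * real m * growth n m (S \<eta>) (?L \<eta>) (r j))) + (\<Sum>j\<in>J. v j \<eta> * (2 * real m * growth n m (S \<eta>) (?R \<eta>) (c j)))" for \<eta>
      unfolding sum.distrib[symmetric] by (intro sum.cong refl) (simp add: G_def algebra_simps)
    also have "\<dots> \<eta> = (\<Sum>i<n. Vr i \<eta> * (2 * real m * growth n m (S \<eta>) (?L \<eta>) i)) + (\<Sum>i<n. Vc i \<eta> * (2 * real m * growth n m (S \<eta>) (?R \<eta>) i))" for \<eta>
      unfolding Vr_def Vc_def using pos by (simp add: grp[where g = "\<lambda>i. 2 * real m * growth n m (S \<eta>) (?L \<eta>) i"]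
         grp[where g = "\<lambda>i. 2 * real m * growth n m (S \<eta>) (?R \<eta>) i"])
    finally show ?thesis by (simp add: mult_ac distrib_left)
  qed
  also have "\<dots> \<le> bexp I p (\<lambda>\<eta>. ((\<Sum>i<n. (2 * real m * Vr i \<eta>) ^ m) + (real m - 1) * schatten n m (S \<eta>))
      + ((\<Sum>i<n. (2 * real m * Vc i \<eta>) ^ m) + (real m - 1) * schatten n m (S \<eta>)))"
    by (intro bexp_mono p01' add_mono young_growth m is_svdD[OF is_svd_svd])
      (auto simp: Vr_def Vc_def v0 intro!: sum_nonneg mult_nonneg_nonneg)
  also have "\<dots> = (\<Sum>i<n. bexp I p (\<lambda>\<eta>. (2 * real m * Vr i \<eta>) ^ m)) + (\<Sum>i<n. bexp I p (\<lambda>\<eta>. (2 * real m * Vc i \<eta>) ^ m))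
      + 2 * (real m - 1) * bexp I p (\<lambda>\<eta>. schatten n m (S \<eta>))"
    unfolding bexp_add bexp_cmult bexp_sum by (simp add: algebra_simps)
  finally show ?thesis unfolding Vr_def Vc_def v_def by (simp add: algebra_simps)
qed

text \<open>Each row or column sum is the scalar \<open>qvar\<close> of a subset of the bits. There
  are n bounds for rows and n for columns, against the factor 2 on the left.\<close>

lemma (in bits) schatten_moment:
  assumes m: "1 \<le> m"
    and pos: "\<And>j. j \<in> J \<Longrightarrow> r j < n \<and> c j < n"
    and ind: "\<And>j. j \<in> J \<Longrightarrow> indep_bits J (a j)"
    and S: "\<And>\<eta> k l. S \<eta> k l = (\<Sum>j\<in>J. zeta p j \<eta> * (if k = r j \<and> l = c j then a j \<eta> else 0))"
    and bd: "\<And>q i. q = r \<or> q = c \<Longrightarrow> i < n \<Longrightarrow>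
       (16 * real m) ^ m * bexp I p (\<lambda>\<eta>. (\<Sum>j | j \<in> J \<and> q j = i. (a j \<eta>)\<^sup>2 / p j) ^ m)
       + (8 * (real m)\<^sup>2) ^ m * bexp I p (\<lambda>\<eta>. \<Sum>j | j \<in> J \<and> q j = i. ((a j \<eta>)\<^sup>2) ^ m / p j ^ (2 * m - 1)) \<le> z"
  shows "bexp I p (\<lambda>\<eta>. schatten n m (S \<eta>)) \<le> real n * z"
proof -
  have V: "bexp I p (\<lambda>\<eta>. (2 * real m * (\<Sum>j | j \<in> J \<and> q j = i. ((zeta p j \<eta>)\<^sup>2 + (1 - p j) / p j) * (a j \<eta>)\<^sup>2)) ^ m) \<le> z"
    if q: "q = r \<or> q = c" "i < n" for q i
  proof -
    interpret R: bits I "{j \<in> J. q j = i}" p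
      by standard (use finI JI p01 in auto)
    let ?U = "bexp I p (\<lambda>\<eta>. (\<Sum>j | j \<in> J \<and> q j = i. (a j \<eta>)\<^sup>2 / p j) ^ m)"
    let ?Q = "bexp I p (\<lambda>\<eta>. \<Sum>j | j \<in> J \<and> q j = i. ((a j \<eta>)\<^sup>2) ^ m / p j ^ (2 * m - 1))"
    have "bexp I p (\<lambda>\<eta>. R.qvar (\<lambda>j \<eta>. (a j \<eta>)\<^sup>2) \<eta> ^ m) \<le> 8 ^ m * ?U + (4 * real m) ^ m * ?Q"
      by (rule R.qvar_moment[OF m]) (use ind in \<open>auto simp: indep_bits_def\<close>)
    then have "(2 * real m) ^ m * bexp I p (\<lambda>\<eta>. R.qvar (\<lambda>j \<eta>. (a j \<eta>)\<^sup>2) \<eta> ^ m) \<le> (2 * real m) ^ m * (8 ^ m * ?U + (4 * real m) ^ m * ?Q)"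
      by (intro mult_left_mono) auto
    also have "\<dots> = (2 * real m * 8) ^ m * ?U + (2 * real m * (4 * real m)) ^ m * ?Q"
    proof -
      have "A ^ m * (8 ^ m * u + B ^ m * v) = (A * 8) ^ m * u + (A * B) ^ m * v" for A B u v :: real
        by (simp only: power_mult_distrib distrib_left mult.assoc)
      then show ?thesis .
    qed
    also have "\<dots> = (16 * real m) ^ m * ?U + (8 * (real m)\<^sup>2) ^ m * ?Q"
      by (simp add: power2_eq_square mult_ac)
    also have "\<dots> \<le> z" by (rule bd[OF q])
    finally show ?thesis by (simp add: R.qvar_def power_mult_distrib bexp_cmult)
  qed
  note schatten_moment_qvar[OF m pos ind S]
  also have "(\<Sum>i<n. bexp I p (\<lambda>\<eta>. (2 * real m * (\<Sum>j | j \<in> J \<and> r j = i. ((zeta p j \<eta>)\<^sup>2 + (1 - p j) / p j) * (a j \<eta>)\<^sup>2)) ^ m))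
    + (\<Sum>i<n. bexp I p (\<lambda>\<eta>. (2 * real m * (\<Sum>j | j \<in> J \<and> c j = i. ((zeta p j \<eta>)\<^sup>2 + (1 - p j) / p j) * (a j \<eta>)\<^sup>2)) ^ m))
    \<le> (\<Sum>i<n. z) + (\<Sum>i<n. z)"
    by (intro add_mono sum_mono V) auto
  finally show ?thesis by (simp add: mult.commute)
qed

section \<open>Tangent space kernels\<close>

text \<open>Jensen's inequality for the m-th power; \<open>young_power\<close> at the weighted mean
  t is the tangent line.\<close>

lemma weighted_power_mean:
  fixes \<beta> X :: "'c \<Rightarrow> real"
  assumes fin: "finite C" and m: "1 \<le> m"
    and \<beta>: "\<And>c. c \<in> C \<Longrightarrow> 0 \<le> \<beta> c" and X: "\<And>c. c \<in> C \<Longrightarrow> 0 \<le> X c"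
  shows "(\<Sum>c\<in>C. \<beta> c * X c) ^ m \<le> (\<Sum>c\<in>C. \<beta> c) ^ (m - 1) * (\<Sum>c\<in>C. \<beta> c * X c ^ m)"
proof (cases "(\<Sum>c\<in>C. \<beta> c) = 0")
  case True
  then have "\<beta> c = 0" if "c \<in> C" for c
    using sum_nonneg_eq_0_iff[of C \<beta>] fin \<beta> that by auto
  then show ?thesis using m by (simp add: power_0_left)
next
  case False
  define b where "b = (\<Sum>c\<in>C. \<beta> c)"
  have b: "b > 0" using False \<beta> by (simp add: b_def order_less_le sum_nonneg)
  define t where "t = (\<Sum>c\<in>C. \<beta> c * X c) / b"
  have bt: "(\<Sum>c\<in>C. \<beta> c * X c) = b * t" using b by (simp add: t_def)
  have t: "0 \<le> t" unfolding t_def using b \<beta> X by (intro divide_nonneg_pos sum_nonneg mult_nonneg_nonneg) auto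
  have "(\<Sum>c\<in>C. \<beta> c * (real m * (X c * t ^ (m - 1)))) \<le> (\<Sum>c\<in>C. \<beta> c * (X c ^ m + (real m - 1) * t ^ m))"
    by (intro sum_mono mult_left_mono young_power X t m \<beta>)
  moreover have "(\<Sum>c\<in>C. \<beta> c * (real m * (X c * t ^ (m - 1)))) = real m * t ^ (m - 1) * (\<Sum>c\<in>C. \<beta> c * X c)"
    by (simp add: sum_distrib_left mult_ac)
  moreover have "(\<Sum>c\<in>C. \<beta> c * (X c ^ m + (real m - 1) * t ^ m)) = (\<Sum>c\<in>C. \<beta> c * X c ^ m) + (real m - 1) * t ^ m * b"
    unfolding distrib_left sum.distrib sum_distrib_right[symmetric] b_def by (simp add: mult.commute)
  moreover have "t ^ m = t ^ (m - 1) * t" using m by (cases m) auto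
  ultimately have "b * t ^ m \<le> (\<Sum>c\<in>C. \<beta> c * X c ^ m)"
    unfolding bt by (simp add: algebra_simps)
  then have "b ^ (m - 1) * (b * t ^ m) \<le> b ^ (m - 1) * (\<Sum>c\<in>C. \<beta> c * X c ^ m)"
    using b by (intro mult_left_mono) auto
  moreover have "b ^ (m - 1) * (b * t ^ m) = (b * t) ^ m"
    using m by (cases m) (auto simp: power_mult_distrib)
  ultimately show ?thesis unfolding bt b_def by simp
qed

lemma (in bits) bexp_weighted_power:
  assumes fin: "finite C" and m: "1 \<le> m"
    and \<beta>: "\<And>c. c \<in> C \<Longrightarrow> 0 \<le> \<beta> c" and X: "\<And>c \<eta>. c \<in> C \<Longrightarrow> 0 \<le> X c \<eta>"
    and N: "(\<Sum>c\<in>C. \<beta> c) \<le> N" and x: "\<And>c. c \<in> C \<Longrightarrow> bexp I p (\<lambda>\<eta>. X c \<eta> ^ m) \<le> x" and x0: "0 \<le> x"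
  shows "bexp I p (\<lambda>\<eta>. (\<Sum>c\<in>C. \<beta> c * X c \<eta>) ^ m) \<le> N ^ m * x"
proof -
  let ?b = "\<Sum>c\<in>C. \<beta> c"
  have b0: "0 \<le> ?b" by (intro sum_nonneg \<beta>)
  have "bexp I p (\<lambda>\<eta>. (\<Sum>c\<in>C. \<beta> c * X c \<eta>) ^ m) \<le> bexp I p (\<lambda>\<eta>. ?b ^ (m - 1) * (\<Sum>c\<in>C. \<beta> c * X c \<eta> ^ m))"
    by (intro bexp_mono p01' weighted_power_mean fin m \<beta> X)
  also have "\<dots> = ?b ^ (m - 1) * (\<Sum>c\<in>C. \<beta> c * bexp I p (\<lambda>\<eta>. X c \<eta> ^ m))"
    by (simp add: bexp_cmult bexp_sum)
  also have "\<dots> \<le> ?b ^ (m - 1) * (\<Sum>c\<in>C. \<beta> c * x)"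
    using b0 by (intro mult_left_mono sum_mono x \<beta>) auto
  also have "\<dots> = ?b ^ m * x" using m by (cases m) (auto simp: sum_distrib_right[symmetric])
  also have "\<dots> \<le> N ^ m * x" using b0 N x0 by (intro mult_right_mono power_mono) auto
  finally show ?thesis .
qed

text \<open>Orthogonal projections. For the projection onto an r-dimensional span,
  \<open>A i i\<close> is \<open>r / n\<close> times the leverage score of row i; positivity permits
  division by it.\<close>

locale proj =
  fixes n :: nat and A :: rmat
  assumes sym: "\<And>i j. A i j = A j i"
    and idem: "\<And>i j. i < n \<Longrightarrow> j < n \<Longrightarrow> (\<Sum>k<n. A i k * A k j) = A i j"
    and pos: "\<And>i. i < n \<Longrightarrow> 0 < A i i"
begin

lemma row_sq: "i < n \<Longrightarrow> (\<Sum>k<n. (A i k)\<^sup>2) = A i i"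
  using idem[of i i] sym by (metis (no_types, lifting) power2_eq_square sum.cong)

lemma diag_le_1: "i < n \<Longrightarrow> A i i \<le> 1"
proof -
  assume i: "i < n"
  have "(A i i)\<^sup>2 \<le> (\<Sum>k<n. (A i k)\<^sup>2)" using i by (intro member_le_sum) auto
  then have "A i i * A i i \<le> A i i * 1" using row_sq[OF i] by (simp add: power2_eq_square)
  then show ?thesis using pos[OF i] by (simp only: mult_le_cancel_left_pos)
qed

lemma entry_sq_le: "i < n \<Longrightarrow> k < n \<Longrightarrow> (A i k)\<^sup>2 \<le> A i i * A k k"
proof -
  assume ik: "i < n" "k < n"
  have "(\<Sum>l<n. A i l * A l k)\<^sup>2 \<le> (\<Sum>l<n. (A i l)\<^sup>2) * (\<Sum>l<n. (A l k)\<^sup>2)"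
    by (rule Cauchy_Schwarz_ineq_sum)
  moreover have "(\<Sum>l<n. (A l k)\<^sup>2) = (\<Sum>l<n. (A k l)\<^sup>2)" by (subst sym) simp
  ultimately show ?thesis using idem[OF ik] row_sq ik by simp
qed

end

text \<open>The matrix of the tangent projection \<open>A Z + Z B - A Z B\<close> in the basis of
  matrix units.\<close>

definition ker :: "rmat \<Rightarrow> rmat \<Rightarrow> nat \<Rightarrow> nat \<Rightarrow> nat \<Rightarrow> nat \<Rightarrow> real" where
  "ker A B i j k l = (if j = l then A i k else 0) + (if i = k then B j l else 0) - A i k * B j l"

lemma ker_transpose: "ker A B i j k l = ker B A j i l k"
  by (simp add: ker_def mult.commute)

locale proj2 = A: proj n A + B: proj n B for n and A B :: rmat
begin

lemma swap: "proj2 n B A" ..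

lemma ker_sq_le:
  assumes "i < n" "j < n" "k < n" "l < n"
  shows "(ker A B i j k l)\<^sup>2 \<le> 3 * ((if j = l then (A i k)\<^sup>2 else 0) + (if i = k then (B j l)\<^sup>2 else 0) + (A i k)\<^sup>2 * (B j l)\<^sup>2)"
proof -
  have "(a + b - c)\<^sup>2 \<le> 3 * (a\<^sup>2 + b\<^sup>2 + c\<^sup>2)" for a b c :: real
  proof -
    have "0 \<le> (a - b)\<^sup>2 + (a + c)\<^sup>2 + (b + c)\<^sup>2" by simp
    then show ?thesis by (simp add: power2_eq_square algebra_simps)
  qed
  then show ?thesis unfolding ker_def by (smt (verit) power_mult_distrib power_zero_numeral)
qed

text \<open>For the projections onto the two singular subspaces this is
  \<open>(\<mu> k + \<nu> l) * r / n\<close>, the leverage part of the sampling rate.\<close>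

definition lam :: "nat \<Rightarrow> nat \<Rightarrow> real" where "lam k l = A k k + B l l"

lemma lam_pos: "k < n \<Longrightarrow> l < n \<Longrightarrow> 0 < lam k l"
  unfolding lam_def using A.pos B.pos by (simp add: add_pos_pos)

lemma ratio_le:
  assumes "k < n" "l < n"
  shows "A k k / lam k l \<le> 1" "B l l / lam k l \<le> 1" "A k k * B l l / lam k l \<le> A k k" "A k k * B l l / lam k l \<le> B l l"
    "A k k * B l l / (lam k l)\<^sup>2 \<le> 1"
proof -
  have p: "0 < A k k" "0 < B l l" using assms A.pos B.pos by auto
  then have l: "0 < lam k l" "A k k \<le> lam k l" "B l l \<le> lam k l" by (auto simp: lam_def)
  then show "A k k / lam k l \<le> 1" "B l l / lam k l \<le> 1" by simp_all
  show "A k k * B l l / lam k l \<le> A k k" "A k k * B l l / lam k l \<le> B l l"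
    using l p by (simp_all add: divide_le_eq mult_left_mono mult_right_mono)
  have "A k k * B l l \<le> lam k l * lam k l" using l p by (intro mult_mono) auto
  then show "A k k * B l l / (lam k l)\<^sup>2 \<le> 1" using l by (simp add: power2_eq_square)
qed

text \<open>The largest jump and the total variance of one entry of the projected noise, for a
  matrix whose squared entries are \<open>A k k * B l l\<close> and a rate \<open>lam k l\<close>.
  Both reproduce the profile \<open>A i i * B j j\<close>; the 9 is 3 from squaring three terms
  times 3 terms.\<close>

lemma ker_entry_bounds:
  assumes ij: "i < n" "j < n"
  shows "\<And>k l. k < n \<Longrightarrow> l < n \<Longrightarrow> A k k * B l l * (ker A B i j k l)\<^sup>2 / (lam k l)\<^sup>2 \<le> 9 * (A i i * B j j)"
    and "(\<Sum>k<n. \<Sum>l<n. A k k * B l l * (ker A B i j k l)\<^sup>2 / lam k l) \<le> 9 * (A i i * B j j)"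
proof -
  have p: "0 < A i i" "0 < B j j" using ij A.pos B.pos by auto
  fix k l assume kl: "k < n" "l < n"
  have pk: "0 < A k k" "0 < B l l" "0 < lam k l" using kl A.pos B.pos lam_pos by auto
  have r: "A k k / lam k l \<le> 1" "B l l / lam k l \<le> 1" using ratio_le[OF kl] by auto
  have r0: "0 \<le> A k k / lam k l" "0 \<le> B l l / lam k l" using pk by auto
  have "A k k * B l l * (ker A B i j k l)\<^sup>2 / (lam k l)\<^sup>2 \<le>
      A k k * B l l * (3 * ((if j = l then (A i k)\<^sup>2 else 0) + (if i = k then (B j l)\<^sup>2 else 0) + (A i k)\<^sup>2 * (B j l)\<^sup>2)) / (lam k l)\<^sup>2"
    using pk by (intro divide_right_mono mult_left_mono ker_sq_le ij kl) auto
  also have "\<dots> \<le> A k k * B l l * (3 * ((if j = l then A i i * A k k else 0) + (if i = k then B j j * B l l else 0) + (A i i * A k k) * (B j j * B l l))) / (lam k l)\<^sup>2"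
    using pk p A.entry_sq_le[OF ij(1) kl(1)] B.entry_sq_le[OF ij(2) kl(2)]
    by (intro divide_right_mono mult_left_mono add_mono mult_mono) auto
  also have "\<dots> = 3 * (A i i * B j j) * ((if j = l then (A k k / lam k l)\<^sup>2 else 0) + (if i = k then (B l l / lam k l)\<^sup>2 else 0)
      + (A k k / lam k l)\<^sup>2 * (B l l * B l l))"
    using pk by (simp add: power2_eq_square field_simps)
  also have "\<dots> \<le> 3 * (A i i * B j j) * (1 + 1 + 1 * (1 * 1))"
    using p r r0 pk B.diag_le_1[OF kl(2)]
    by (intro mult_left_mono add_mono mult_mono) (auto simp: power_le_one)
  finally show "A k k * B l l * (ker A B i j k l)\<^sup>2 / (lam k l)\<^sup>2 \<le> 9 * (A i i * B j j)" by simp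
next
  have p: "0 < A i i" "0 < B j j" using ij A.pos B.pos by auto
  have "(\<Sum>k<n. \<Sum>l<n. A k k * B l l * (ker A B i j k l)\<^sup>2 / lam k l) \<le>
     (\<Sum>k<n. \<Sum>l<n. 3 * ((if j = l then B j j * (A i k)\<^sup>2 else 0) + (if i = k then A i i * (B j l)\<^sup>2 else 0) + (A i k)\<^sup>2 * (B j l)\<^sup>2))"
  proof (intro sum_mono)
    fix k l assume "k \<in> {..<n}" "l \<in> {..<n}"
    then have kl: "k < n" "l < n" by auto
    define w where "w = A k k * B l l / lam k l"
    have w: "0 \<le> w" "w \<le> A k k" "w \<le> B l l"
      using ratio_le(3,4)[OF kl] A.pos[OF kl(1)] B.pos[OF kl(2)] lam_pos[OF kl] by (auto simp: w_def)
    then have "w \<le> 1" using A.diag_le_1[OF kl(1)] by linarith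
    have "A k k * B l l * (ker A B i j k l)\<^sup>2 / lam k l = w * (ker A B i j k l)\<^sup>2" by (simp add: w_def)
    also have "\<dots> \<le> w * (3 * ((if j = l then (A i k)\<^sup>2 else 0) + (if i = k then (B j l)\<^sup>2 else 0) + (A i k)\<^sup>2 * (B j l)\<^sup>2))"
      using w by (intro mult_left_mono ker_sq_le ij kl)
    also have "\<dots> = 3 * ((if j = l then w * (A i k)\<^sup>2 else 0) + (if i = k then w * (B j l)\<^sup>2 else 0) + w * ((A i k)\<^sup>2 * (B j l)\<^sup>2))"
      by (simp add: algebra_simps)
    also have "\<dots> \<le> 3 * ((if j = l then B j j * (A i k)\<^sup>2 else 0) + (if i = k then A i i * (B j l)\<^sup>2 else 0) + 1 * ((A i k)\<^sup>2 * (B j l)\<^sup>2))"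
      using w \<open>w \<le> 1\<close> by (intro mult_left_mono add_mono) (auto intro!: mult_right_mono mult_left_le_one_le)
    finally show "A k k * B l l * (ker A B i j k l)\<^sup>2 / lam k l \<le>
      3 * ((if j = l then B j j * (A i k)\<^sup>2 else 0) + (if i = k then A i i * (B j l)\<^sup>2 else 0) + (A i k)\<^sup>2 * (B j l)\<^sup>2)" by simp
  qed
  also have "\<dots> = 3 * (B j j * (\<Sum>k<n. (A i k)\<^sup>2) + A i i * (\<Sum>l<n. (B j l)\<^sup>2) + (\<Sum>k<n. (A i k)\<^sup>2) * (\<Sum>l<n. (B j l)\<^sup>2))"
  proof -
    have "(\<Sum>k<n. \<Sum>l<n. if j = l then B j j * (A i k)\<^sup>2 else 0) = B j j * (\<Sum>k<n. (A i k)\<^sup>2)"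
      using ij by (simp add: sum_distrib_left)
    moreover have "(\<Sum>k<n. \<Sum>l<n. if i = k then A i i * (B j l)\<^sup>2 else 0) = A i i * (\<Sum>l<n. (B j l)\<^sup>2)"
      using ij by (subst sum.swap) (simp add: sum_distrib_left)
    moreover have "(\<Sum>k<n. \<Sum>l<n. (A i k)\<^sup>2 * (B j l)\<^sup>2) = (\<Sum>k<n. (A i k)\<^sup>2) * (\<Sum>l<n. (B j l)\<^sup>2)"
      by (simp add: sum_product)
    ultimately show ?thesis by (simp add: sum_distrib_left[symmetric] sum.distrib)
  qed
  also have "\<dots> = 9 * (A i i * B j j)" using A.row_sq[OF ij(1)] B.row_sq[OF ij(2)] by simp
  finally show "(\<Sum>k<n. \<Sum>l<n. A k k * B l l * (ker A B i j k l)\<^sup>2 / lam k l) \<le> 9 * (A i i * B j j)" .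
qed

text \<open>In row i the image of a matrix unit is \<open>A i k\<close> times the complement of
  column l of B plus a multiple of that column. These parts are orthogonal, so the cross terms
  cancel.\<close>

lemma ker_row_sq:
  assumes "i < n" "k < n" "l < n"
  shows "(\<Sum>j<n. (ker A B i j k l)\<^sup>2) \<le> (A i k)\<^sup>2 + (if i = k then B l l else 0)"
proof -
  define d where "d = (if i = k then 1 else (0::real))"
  have k: "ker A B i j k l = A i k * ((if j = l then 1 else 0) - B j l) + d * B j l" for j
    by (simp add: ker_def d_def algebra_simps)
  have s1: "(\<Sum>j<n. (B j l)\<^sup>2) = B l l" using B.row_sq[OF assms(3)] B.sym by (metis (no_types, lifting) sum.cong)
  have s2: "(\<Sum>j<n. if j = l then B j l else 0) = B l l" using assms by simp
  have "(\<Sum>j<n. (ker A B i j k l)\<^sup>2) = (\<Sum>j<n. (A i k)\<^sup>2 * (if j = l then 1 else 0) + ((d - A i k)\<^sup>2) * (B j l)\<^sup>2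
      + 2 * (A i k * (d - A i k)) * (if j = l then B j l else 0))"
    unfolding k by (intro sum.cong refl) (auto simp: power2_eq_square algebra_simps)
  also have "\<dots> = (A i k)\<^sup>2 + (d - A i k)\<^sup>2 * B l l + 2 * (A i k * (d - A i k)) * B l l"
    unfolding sum.distrib sum_distrib_left[symmetric] s1 s2 using assms by simp
  also have "\<dots> = (A i k)\<^sup>2 * (1 - B l l) + d\<^sup>2 * B l l"
    by (simp add: power2_eq_square algebra_simps)
  also have "\<dots> \<le> (A i k)\<^sup>2 * 1 + d\<^sup>2 * B l l"
    using B.pos[OF assms(3)] by (intro add_mono mult_left_mono) auto
  also have "d\<^sup>2 * B l l = (if i = k then B l l else 0)" by (simp add: d_def)
  finally show ?thesis by simp
qed

text \<open>The counterpart for whole rows. The third bound divides by \<open>A k k\<close> alone,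
  so that the row sums of the squared matrix can be used.\<close>

lemma row_bounds:
  assumes i: "i < n"
  defines "Q \<equiv> \<lambda>k l. (A i k)\<^sup>2 + (if i = k then B l l else 0)"
  shows "\<And>k l. k < n \<Longrightarrow> l < n \<Longrightarrow> A k k * B l l * Q k l / (lam k l)\<^sup>2 \<le> 2 * A i i"
    and "(\<Sum>k<n. \<Sum>l<n. A k k * B l l * Q k l / lam k l) \<le> 2 * A i i * (\<Sum>l<n. B l l)"
    and "\<And>k l. k < n \<Longrightarrow> l < n \<Longrightarrow> Q k l / lam k l \<le> ((A i k)\<^sup>2 + (if i = k then A i i else 0)) / A k k"
proof -
  have p: "0 < A i i" using i A.pos by auto
  fix k l assume kl: "k < n" "l < n"
  have pk: "0 < A k k" "0 < B l l" "0 < lam k l" using kl A.pos B.pos lam_pos by auto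
  have r: "A k k / lam k l \<le> 1" "B l l / lam k l \<le> 1" using ratio_le[OF kl] by auto
  have r0: "0 \<le> A k k / lam k l" "0 \<le> B l l / lam k l" using pk by auto
  have "A k k * B l l * Q k l / (lam k l)\<^sup>2 \<le> A k k * B l l * (A i i * A k k + (if i = k then B l l else 0)) / (lam k l)\<^sup>2"
    unfolding Q_def using pk A.entry_sq_le[OF i kl(1)] by (intro divide_right_mono mult_left_mono add_mono) auto
  also have "\<dots> = A i i * ((A k k / lam k l)\<^sup>2 * B l l + (if i = k then (B l l / lam k l)\<^sup>2 else 0))"
    using pk by (simp add: power2_eq_square field_simps)
  also have "\<dots> \<le> A i i * (1 * 1 + 1)"
    using p r r0 pk B.diag_le_1[OF kl(2)] by (intro mult_left_mono add_mono mult_mono) (auto simp: power_le_one)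
  finally show "A k k * B l l * Q k l / (lam k l)\<^sup>2 \<le> 2 * A i i" by simp
  have "(A i k)\<^sup>2 / lam k l \<le> (A i k)\<^sup>2 / A k k"
    using pk by (intro divide_left_mono) (auto simp: lam_def)
  moreover have "(if i = k then B l l else 0) / lam k l \<le> (if i = k then A i i else 0) / A k k"
    using pk r by auto
  ultimately show "Q k l / lam k l \<le> ((A i k)\<^sup>2 + (if i = k then A i i else 0)) / A k k"
    unfolding Q_def add_divide_distrib by linarith
next
  have p: "0 < A i i" using i A.pos by auto
  have "(\<Sum>k<n. \<Sum>l<n. A k k * B l l * Q k l / lam k l) \<le> (\<Sum>k<n. \<Sum>l<n. (A i k)\<^sup>2 * B l l + (if i = k then A i i * B l l else 0))"
  proof (intro sum_mono)
    fix k l assume "k \<in> {..<n}" "l \<in> {..<n}"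
    then have kl: "k < n" "l < n" by auto
    have pk: "0 < A k k" "0 < B l l" "0 < lam k l" using kl A.pos B.pos lam_pos by auto
    define w where "w = A k k * B l l / lam k l"
    have w: "0 \<le> w" "w \<le> A k k" "w \<le> B l l"
      using ratio_le(3,4)[OF kl] pk by (auto simp: w_def)
    have "A k k * B l l * Q k l / lam k l = w * Q k l" by (simp add: w_def)
    also have "\<dots> = w * (A i k)\<^sup>2 + (if i = k then w * B l l else 0)"
      by (simp add: Q_def algebra_simps)
    also have "\<dots> \<le> B l l * (A i k)\<^sup>2 + (if i = k then A k k * B l l else 0)"
      using w pk by (intro add_mono) (auto intro!: mult_right_mono)
    finally show "A k k * B l l * Q k l / lam k l \<le> (A i k)\<^sup>2 * B l l + (if i = k then A i i * B l l else 0)"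
      by (auto simp: mult.commute)
  qed
  also have "\<dots> = 2 * A i i * (\<Sum>l<n. B l l)"
  proof -
    have "(\<Sum>k<n. \<Sum>l<n. (A i k)\<^sup>2 * B l l) = A i i * (\<Sum>l<n. B l l)"
      by (simp add: sum_product[symmetric] A.row_sq[OF i])
    moreover have "(\<Sum>k<n. \<Sum>l<n. if i = k then A i i * B l l else 0) = A i i * (\<Sum>l<n. B l l)"
      using i by (subst sum.swap) (simp add: sum_distrib_left)
    ultimately show ?thesis by (simp add: sum.distrib)
  qed
  finally show "(\<Sum>k<n. \<Sum>l<n. A k k * B l l * Q k l / lam k l) \<le> 2 * A i i * (\<Sum>l<n. B l l)" .
qed

end

section \<open>Batched sampling\<close>

definition PT :: "nat \<Rightarrow> rmat \<Rightarrow> rmat \<Rightarrow> rmat \<Rightarrow> rmat" where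
  "PT n A B Z = (\<lambda>i j. \<Sum>k<n. \<Sum>l<n. ker A B i j k l * Z k l)"

definition had :: "rmat \<Rightarrow> rmat \<Rightarrow> rmat" where
  "had X Z = (\<lambda>i j. X i j * Z i j)"

text \<open>K is the number of batches and \<rho> the rate of each. All batches share the same
  rates, so the estimates do not depend on which batches form a block.\<close>

locale sampling = proj2 +
  fixes K :: nat and \<rho> :: rmat
  assumes \<rho>01: "\<And>i j. i < n \<Longrightarrow> j < n \<Longrightarrow> 0 < \<rho> i j \<and> \<rho> i j \<le> 1"
begin

definition idx :: "(nat \<times> nat \<times> nat) set" where
  "idx = {..<K} \<times> {..<n} \<times> {..<n}"

definition rt :: "nat \<times> nat \<times> nat \<Rightarrow> real" where
  "rt = (\<lambda>(s, i, j). \<rho> i j)"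

abbreviation EE :: "((nat \<times> nat \<times> nat \<Rightarrow> bool) \<Rightarrow> real) \<Rightarrow> real" where
  "EE \<equiv> bexp idx rt"

definition cells :: "nat set \<Rightarrow> (nat \<times> nat \<times> nat) set" where
  "cells G = G \<times> {..<n} \<times> {..<n}"

text \<open>Centred sampling weights averaged over the batches in G; \<open>1 + xi G\<close>
  averages the normalised sampling weights themselves.\<close>

definition xi :: "nat set \<Rightarrow> (nat \<times> nat \<times> nat \<Rightarrow> bool) \<Rightarrow> rmat" where
  "xi G \<eta> = (\<lambda>i j. (\<Sum>s\<in>G. zeta rt (s, i, j) \<eta>) / real (card G))"

lemma bits_cells: "G \<subseteq> {..<K} \<Longrightarrow> bits idx (cells G) rt"
  by standard (use \<rho>01 in \<open>auto simp: idx_def cells_def rt_def\<close>)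

lemma bits_idx: "bits idx {} rt"
  using bits_cells[of "{}"] by (simp add: cells_def)

lemmas EE_mono = bexp_mono[OF bits.p01'[OF bits_idx]]
lemmas EE_nonneg = bexp_nonneg[OF bits.p01'[OF bits_idx]]

lemma sum_cells: "(\<Sum>j\<in>cells G. f j) = (\<Sum>s\<in>G. \<Sum>k<n. \<Sum>l<n. f (s, k, l))"
  by (simp add: cells_def sum.cartesian_product[symmetric] split_def)
    (simp add: sum.cartesian_product)

lemma xi_linear:
  "(\<Sum>k<n. \<Sum>l<n. xi G \<eta> k l * f k l) = (\<Sum>j\<in>cells G. zeta rt j \<eta> * (case j of (s, k, l) \<Rightarrow> f k l / real (card G)))"
proof -
  have "(\<Sum>k<n. \<Sum>l<n. xi G \<eta> k l * f k l) = (\<Sum>k<n. \<Sum>l<n. \<Sum>s\<in>G. zeta rt (s, k, l) \<eta> * (f k l / real (card G)))"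
    by (simp add: xi_def sum_distrib_right sum_divide_distrib)
  also have "\<dots> = (\<Sum>s\<in>G. \<Sum>k<n. \<Sum>l<n. zeta rt (s, k, l) \<eta> * (f k l / real (card G)))"
    by (simp add: sum.swap[of _ G])
  finally show ?thesis by (simp add: sum_cells)
qed

text \<open>The right-hand side of Rosenthal's inequality for a block. In both terms the average of
  \<open>card G\<close> batches acts like one batch of rate \<open>card G * \<rho>\<close>. Q stands
  for the squared size of the images of the matrix units.\<close>

definition main_term :: "nat set \<Rightarrow> nat \<Rightarrow> ((nat \<times> nat \<times> nat \<Rightarrow> bool) \<Rightarrow> rmat) \<Rightarrow> (nat \<Rightarrow> nat \<Rightarrow> real) \<Rightarrow> real" where
  "main_term G m W Q = (16 * real m) ^ m * EE (\<lambda>\<eta>. (\<Sum>k<n. \<Sum>l<n. (W \<eta> k l)\<^sup>2 * Q k l / (real (card G) * \<rho> k l)) ^ m)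
    + (8 * (real m)\<^sup>2) ^ m * EE (\<lambda>\<eta>. \<Sum>k<n. \<Sum>l<n. ((W \<eta> k l)\<^sup>2) ^ m * Q k l ^ m / (real (card G) * \<rho> k l) ^ (2 * m - 1))"

lemma cells_weights:
  assumes G: "finite G" "G \<noteq> {}" and m: "1 \<le> m"
  shows "(\<Sum>j\<in>cells G. (case j of (s, k, l) \<Rightarrow> w k l / (real (card G))\<^sup>2) / rt j) = (\<Sum>k<n. \<Sum>l<n. w k l / (real (card G) * \<rho> k l))"
    and "(\<Sum>j\<in>cells G. (case j of (s, k, l) \<Rightarrow> w k l / (real (card G))\<^sup>2) ^ m / rt j ^ (2 * m - 1)) =
      (\<Sum>k<n. \<Sum>l<n. w k l ^ m / (real (card G) * \<rho> k l) ^ (2 * m - 1))"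
proof -
  define g where "g = real (card G)"
  have g: "g > 0" using G by (simp add: g_def card_gt_0_iff)
  have pw: "g * x / (g\<^sup>2 * r) = x / (g * r)" for x r using g by (simp add: power2_eq_square)
  show "(\<Sum>j\<in>cells G. (case j of (s, k, l) \<Rightarrow> w k l / (real (card G))\<^sup>2) / rt j) = (\<Sum>k<n. \<Sum>l<n. w k l / (real (card G) * \<rho> k l))"
    unfolding sum_cells rt_def g_def[symmetric] using G
    by (simp add: g_def[symmetric] sum_distrib_left pw)
  have "g ^ (2 * m) = g * g ^ (2 * m - 1)" using m by (cases m) auto
  then have pw: "g * (x / g\<^sup>2) ^ m / r ^ (2 * m - 1) = x ^ m / (g * r) ^ (2 * m - 1)" for x r
    using g by (simp add: power_divide power_mult_distrib power_mult[symmetric])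
  show "(\<Sum>j\<in>cells G. (case j of (s, k, l) \<Rightarrow> w k l / (real (card G))\<^sup>2) ^ m / rt j ^ (2 * m - 1)) =
      (\<Sum>k<n. \<Sum>l<n. w k l ^ m / (real (card G) * \<rho> k l) ^ (2 * m - 1))"
    unfolding sum_cells rt_def g_def[symmetric] using G
    by (simp add: g_def[symmetric] sum_distrib_left pw del: One_nat_def)
qed

lemma linear_moment:
  assumes G: "G \<subseteq> {..<K}" "G \<noteq> {}" and D: "finite D" and m: "1 \<le> m"
    and W: "indep_bits (cells G) W"
  shows "EE (\<lambda>\<eta>. nsq D (\<lambda>d. \<Sum>k<n. \<Sum>l<n. t d k l * (xi G \<eta> k l * W \<eta> k l)) ^ m)
    \<le> main_term G m W (\<lambda>k l. nsq D (\<lambda>d. t d k l))"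
proof -
  interpret bits idx "cells G" rt by (rule bits_cells[OF G(1)])
  have fG: "finite G" using G(1) finite_subset by blast
  define a where "a = (\<lambda>(s::nat, k, l) \<eta> d. W \<eta> k l * t d k l / real (card G))"
  have ns: "nsq D (a j \<eta>) = (case j of (s, k, l) \<Rightarrow> (W \<eta> k l)\<^sup>2 * nsq D (\<lambda>d. t d k l) / (real (card G))\<^sup>2)" for j \<eta>
    by (cases j) (simp add: a_def nsq_def power_divide power_mult_distrib sum_divide_distrib sum_distrib_left)
  have eq: "(\<Sum>k<n. \<Sum>l<n. t d k l * (xi G \<eta> k l * W \<eta> k l)) = (\<Sum>j\<in>cells G. zeta rt j \<eta> * a j \<eta> d)" for d \<eta>
    using xi_linear[of G \<eta> "\<lambda>k l. W \<eta> k l * t d k l"]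
    by (simp add: a_def split_def mult_ac)
  have "EE (\<lambda>\<eta>. nsq D (\<lambda>d. \<Sum>k<n. \<Sum>l<n. t d k l * (xi G \<eta> k l * W \<eta> k l)) ^ m) \<le>
    (16 * real m) ^ m * EE (\<lambda>\<eta>. (\<Sum>j\<in>cells G. nsq D (a j \<eta>) / rt j) ^ m)
    + (8 * (real m)\<^sup>2) ^ m * EE (\<lambda>\<eta>. \<Sum>j\<in>cells G. nsq D (a j \<eta>) ^ m / rt j ^ (2 * m - 1))"
    by (rule rosenthal[OF D m _ eq]) (use W in \<open>auto simp: indep_bits_def a_def\<close>)
  then show ?thesis
    unfolding ns cells_weights[OF fG G(2) m] main_term_def by (simp add: power_mult_distrib)
qed

lemma schatten_linear_moment:
  assumes G: "G \<subseteq> {..<K}" "G \<noteq> {}" and m: "1 \<le> m"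
    and W: "indep_bits (cells G) W"
    and zr: "\<And>i. i < n \<Longrightarrow> main_term G m W (\<lambda>k l. if k = i then 1 else 0) \<le> z"
    and zc: "\<And>i. i < n \<Longrightarrow> main_term G m W (\<lambda>k l. if l = i then 1 else 0) \<le> z"
  shows "EE (\<lambda>\<eta>. schatten n m (had (xi G \<eta>) (W \<eta>))) \<le> real n * z"
proof -
  interpret bits idx "cells G" rt by (rule bits_cells[OF G(1)])
  have fG: "finite G" using G(1) finite_subset by blast
  define a where "a = (\<lambda>(s::nat, k, l) \<eta>. W \<eta> k l / real (card G))"
  define S where "S = (\<lambda>\<eta> k l. \<Sum>j\<in>cells G. zeta rt j \<eta> * (if k = fst (snd j) \<and> l = snd (snd j) then a j \<eta> else 0))"
  have SW: "S \<eta> k l = had (xi G \<eta>) (W \<eta>) k l" if "k < n" "l < n" for k l \<eta>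
  proof -
    have "S \<eta> k l = (\<Sum>k'<n. \<Sum>l'<n. xi G \<eta> k' l' * (if k = k' \<and> l = l' then W \<eta> k l else 0))"
      unfolding S_def a_def xi_linear by (intro sum.cong refl) (auto simp: split_def)
    also have "\<dots> = (\<Sum>k'<n. \<Sum>l'<n. if l' = l then (if k' = k then xi G \<eta> k l * W \<eta> k l else 0) else 0)"
      by (intro sum.cong refl) auto
    finally show ?thesis using that by (simp add: had_def)
  qed
  have "EE (\<lambda>\<eta>. schatten n m (S \<eta>)) \<le> real n * z"
  proof (rule schatten_moment[OF m, where r = "\<lambda>j. fst (snd j)" and c = "\<lambda>j. snd (snd j)" and a = a])
    show "fst (snd j) < n \<and> snd (snd j) < n" if "j \<in> cells G" for j using that by (auto simp: cells_def)
    show "indep_bits (cells G) (a j)" for j using W by (auto simp: indep_bits_def a_def split: prod.split)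
    show "S \<eta> k l = (\<Sum>j\<in>cells G. zeta rt j \<eta> * (if k = fst (snd j) \<and> l = snd (snd j) then a j \<eta> else 0))" for \<eta> k l
      by (simp add: S_def)
    fix q :: "nat \<times> nat \<times> nat \<Rightarrow> nat" and i
    assume q: "q = (\<lambda>j. fst (snd j)) \<or> q = (\<lambda>j. snd (snd j))" and i: "i < n"
    define q' where "q' k l = q (0, k, l)" for k l
    define Q where "Q = (\<lambda>k l. if q' k l = i then 1 else (0::real))"
    have q0: "q (s, k, l) = q' k l" for s k l using q by (auto simp: q'_def)
    have Qm: "Q k l ^ m = Q k l" for k l using m by (simp add: Q_def)
    have fin: "finite (cells G)" by (rule finJ)
    have 1: "(\<Sum>j | j \<in> cells G \<and> q j = i. (a j \<eta>)\<^sup>2 / rt j) = (\<Sum>k<n. \<Sum>l<n. (W \<eta> k l)\<^sup>2 * Q k l / (real (card G) * \<rho> k l))" for \<eta>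
      unfolding cells_weights(1)[OF fG G(2) m, symmetric]
      by (subst sum.inter_filter[OF fin]) (auto intro!: sum.cong simp: Q_def q0 a_def power_divide split: prod.split)
    have 2: "(\<Sum>j | j \<in> cells G \<and> q j = i. ((a j \<eta>)\<^sup>2) ^ m / rt j ^ (2 * m - 1)) =
        (\<Sum>k<n. \<Sum>l<n. ((W \<eta> k l)\<^sup>2) ^ m * Q k l ^ m / (real (card G) * \<rho> k l) ^ (2 * m - 1))" for \<eta>
      unfolding power_mult_distrib[symmetric] cells_weights(2)[OF fG G(2) m, symmetric]
      using m by (subst sum.inter_filter[OF fin]) (auto intro!: sum.cong simp: Q_def q0 a_def power_divide power_0_left split: prod.split)
    have "main_term G m W Q \<le> z" using q zr[OF i] zc[OF i] by (auto simp: Q_def q'_def)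
    then show "(16 * real m) ^ m * EE (\<lambda>\<eta>. (\<Sum>j | j \<in> cells G \<and> q j = i. (a j \<eta>)\<^sup>2 / rt j) ^ m)
       + (8 * (real m)\<^sup>2) ^ m * EE (\<lambda>\<eta>. \<Sum>j | j \<in> cells G \<and> q j = i. ((a j \<eta>)\<^sup>2) ^ m / rt j ^ (2 * m - 1)) \<le> z"
      unfolding 1 2 main_term_def .
  qed
  \<comment> \<open>The choice in \<open>svd\<close> depends only on entries with indices below n,
    where the two matrices agree.\<close>
  moreover have "schatten n m (S \<eta>) = schatten n m (had (xi G \<eta>) (W \<eta>))" for \<eta>
  proof -
    have "svd n (S \<eta>) = svd n (had (xi G \<eta>) (W \<eta>))"
      unfolding svd_def is_svd_def by (simp add: SW cong: conj_cong)
    then show ?thesis by (simp add: schatten_def svv_def)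
  qed
  ultimately show ?thesis by simp
qed

text \<open>\<kappa> is the rate of the block in units of \<open>lam\<close>, and \<tau> bounds
  \<open>m / \<kappa>\<close>. U bounds the variance term; M bounds the single jumps and N their
  sum, so \<open>M ^ (m - 1) * N\<close> bounds the sum of m-th powers of the jumps.\<close>

lemma main_term_le:
  assumes G: "G \<subseteq> {..<K}" "G \<noteq> {}" and m: "1 \<le> m"
    and \<kappa>: "0 < \<kappa>" "\<And>k l. k < n \<Longrightarrow> l < n \<Longrightarrow> \<kappa> * lam k l \<le> real (card G) * \<rho> k l"
    and \<tau>: "real m \<le> \<tau> * \<kappa>" "\<tau> \<le> 1"
    and x: "\<And>k l. k < n \<Longrightarrow> l < n \<Longrightarrow> EE (\<lambda>\<eta>. ((W \<eta> k l)\<^sup>2) ^ m) \<le> x * (A k k * B l l) ^ m" "0 \<le> x"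
    and Q: "\<And>k l. k < n \<Longrightarrow> l < n \<Longrightarrow> 0 \<le> Q k l"
    and M: "\<And>k l. k < n \<Longrightarrow> l < n \<Longrightarrow> A k k * B l l * Q k l / (lam k l)\<^sup>2 \<le> M" "0 \<le> M"
    and N: "(\<Sum>k<n. \<Sum>l<n. A k k * B l l * Q k l / lam k l) \<le> N"
    and U: "EE (\<lambda>\<eta>. (\<Sum>k<n. \<Sum>l<n. (W \<eta> k l)\<^sup>2 * Q k l / lam k l) ^ m) \<le> U"
  shows "main_term G m W Q \<le> (16 * \<tau>) ^ m * (U + x * M ^ (m - 1) * N)"
proof -
  have mk: "real m / \<kappa> \<le> \<tau>" using \<tau> \<kappa>(1) by (simp add: divide_le_eq)
  have \<tau>0: "0 \<le> \<tau>" using mk \<kappa>(1) by (smt (verit) divide_nonneg_pos of_nat_0_le_iff)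
  have lp: "0 < lam k l" "0 < A k k" "0 < B l l" if "k < n" "l < n" for k l
    using lam_pos A.pos B.pos that by auto
  let ?g = "real (card G)"
  have gl: "0 < \<kappa> * lam k l" if "k < n" "l < n" for k l using lp[OF that] \<kappa>(1) by simp
  have "EE (\<lambda>\<eta>. (\<Sum>k<n. \<Sum>l<n. (W \<eta> k l)\<^sup>2 * Q k l / (?g * \<rho> k l)) ^ m) \<le>
      EE (\<lambda>\<eta>. (\<Sum>k<n. \<Sum>l<n. (W \<eta> k l)\<^sup>2 * Q k l / (\<kappa> * lam k l)) ^ m)"
  proof (rule EE_mono)
    fix \<eta>
    have le: "(W \<eta> k l)\<^sup>2 * Q k l / (?g * \<rho> k l) \<le> (W \<eta> k l)\<^sup>2 * Q k l / (\<kappa> * lam k l)"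
      and nn: "0 \<le> (W \<eta> k l)\<^sup>2 * Q k l / (?g * \<rho> k l)" if kl: "k < n" "l < n" for k l
    proof -
      have "0 < ?g * \<rho> k l" using gl[OF kl] \<kappa>(2)[OF kl] by linarith
      then show "(W \<eta> k l)\<^sup>2 * Q k l / (?g * \<rho> k l) \<le> (W \<eta> k l)\<^sup>2 * Q k l / (\<kappa> * lam k l)"
        by (intro divide_left_mono \<kappa>(2)[OF kl] mult_nonneg_nonneg Q[OF kl] mult_pos_pos[of "?g * \<rho> k l"] gl[OF kl]) auto
      show "0 \<le> (W \<eta> k l)\<^sup>2 * Q k l / (?g * \<rho> k l)"
        using \<open>0 < ?g * \<rho> k l\<close> Q[OF kl] by (intro divide_nonneg_pos mult_nonneg_nonneg) auto
    qed
    show "(\<Sum>k<n. \<Sum>l<n. (W \<eta> k l)\<^sup>2 * Q k l / (?g * \<rho> k l)) ^ m \<le> (\<Sum>k<n. \<Sum>l<n. (W \<eta> k l)\<^sup>2 * Q k l / (\<kappa> * lam k l)) ^ m"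
      by (intro power_mono sum_mono sum_nonneg le nn) auto
  qed auto
  also have "\<dots> = EE (\<lambda>\<eta>. (1 / \<kappa>) ^ m * (\<Sum>k<n. \<Sum>l<n. (W \<eta> k l)\<^sup>2 * Q k l / lam k l) ^ m)"
  proof -
    have "(\<Sum>k<n. \<Sum>l<n. (W \<eta> k l)\<^sup>2 * Q k l / (\<kappa> * lam k l)) = 1 / \<kappa> * (\<Sum>k<n. \<Sum>l<n. (W \<eta> k l)\<^sup>2 * Q k l / lam k l)" for \<eta>
      by (simp add: sum_distrib_left)
    then show ?thesis by (simp only: power_mult_distrib)
  qed
  also have "\<dots> \<le> (1 / \<kappa>) ^ m * U"
    unfolding bexp_cmult using \<kappa> by (intro mult_left_mono U) auto
  finally have "(16 * real m) ^ m * EE (\<lambda>\<eta>. (\<Sum>k<n. \<Sum>l<n. (W \<eta> k l)\<^sup>2 * Q k l / (?g * \<rho> k l)) ^ m) \<le> (16 * real m) ^ m * ((1 / \<kappa>) ^ m * U)"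
    by (intro mult_left_mono) auto
  also have "\<dots> = (16 * (real m / \<kappa>)) ^ m * U"
    by (simp add: power_mult_distrib power_divide)
  also have "\<dots> \<le> (16 * \<tau>) ^ m * U"
  proof (rule mult_right_mono)
    show "(16 * (real m / \<kappa>)) ^ m \<le> (16 * \<tau>) ^ m"
      using mk \<kappa>(1) by (intro power_mono mult_left_mono) auto
    have "0 \<le> EE (\<lambda>\<eta>. (\<Sum>k<n. \<Sum>l<n. (W \<eta> k l)\<^sup>2 * Q k l / lam k l) ^ m)"
    proof (intro EE_nonneg zero_le_power sum_nonneg)
      fix \<eta> k l assume "k \<in> {..<n}" "l \<in> {..<n}"
      then have "0 \<le> Q k l" "0 < lam k l" using Q lam_pos by auto
      then show "0 \<le> (W \<eta> k l)\<^sup>2 * Q k l / lam k l" by simp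
    qed
    then show "0 \<le> U" using U by linarith
  qed
  finally have part1: "(16 * real m) ^ m * EE (\<lambda>\<eta>. (\<Sum>k<n. \<Sum>l<n. (W \<eta> k l)\<^sup>2 * Q k l / (?g * \<rho> k l)) ^ m) \<le> (16 * \<tau>) ^ m * U" .
  have "EE (\<lambda>\<eta>. \<Sum>k<n. \<Sum>l<n. ((W \<eta> k l)\<^sup>2) ^ m * Q k l ^ m / (?g * \<rho> k l) ^ (2 * m - 1))
      = (\<Sum>k<n. \<Sum>l<n. (Q k l ^ m / (?g * \<rho> k l) ^ (2 * m - 1)) * EE (\<lambda>\<eta>. ((W \<eta> k l)\<^sup>2) ^ m))"
    unfolding bexp_cmult[symmetric] bexp_sum[symmetric] by (simp add: mult.commute)
  also have "\<dots> \<le> (\<Sum>k<n. \<Sum>l<n. (Q k l ^ m / (\<kappa> * lam k l) ^ (2 * m - 1)) * (x * (A k k * B l l) ^ m))"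
  proof (intro sum_mono mult_mono)
    fix k l assume "k \<in> {..<n}" "l \<in> {..<n}"
    then have kl: "k < n" "l < n" by auto
    show "EE (\<lambda>\<eta>. ((W \<eta> k l)\<^sup>2) ^ m) \<le> x * (A k k * B l l) ^ m" by (rule x(1)[OF kl])
    show "Q k l ^ m / (?g * \<rho> k l) ^ (2 * m - 1) \<le> Q k l ^ m / (\<kappa> * lam k l) ^ (2 * m - 1)"
      using gl[OF kl] Q[OF kl] by (intro frac_le power_mono zero_less_power zero_le_power \<kappa>(2)[OF kl] order_refl) auto
    show "0 \<le> Q k l ^ m / (\<kappa> * lam k l) ^ (2 * m - 1)" using gl[OF kl] Q[OF kl] by simp
  qed (auto intro!: EE_nonneg)
  also have "\<dots> \<le> (\<Sum>k<n. \<Sum>l<n. x / \<kappa> ^ (2 * m - 1) * (M ^ (m - 1) * (A k k * B l l * Q k l / lam k l)))"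
  proof (intro sum_mono)
    fix k l assume "k \<in> {..<n}" "l \<in> {..<n}"
    then have kl: "k < n" "l < n" by auto
    define b where "b = A k k * B l l * Q k l"
    have b: "0 \<le> b" using lp[OF kl] Q[OF kl] by (simp add: b_def)
    have "lam k l ^ (2 * m - 1) = ((lam k l)\<^sup>2) ^ (m - 1) * lam k l"
      using m by (cases m) (auto simp: power_mult[symmetric])
    moreover have "b ^ m = b ^ (m - 1) * b" using m by (cases m) auto
    ultimately have "b ^ m / lam k l ^ (2 * m - 1) = (b / (lam k l)\<^sup>2) ^ (m - 1) * (b / lam k l)"
      by (simp add: power_divide)
    also have "\<dots> \<le> M ^ (m - 1) * (b / lam k l)"
      using b lp[OF kl] M(1)[OF kl] by (intro mult_right_mono power_mono) (auto simp: b_def)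
    finally have "x / \<kappa> ^ (2 * m - 1) * (b ^ m / lam k l ^ (2 * m - 1)) \<le> x / \<kappa> ^ (2 * m - 1) * (M ^ (m - 1) * (b / lam k l))"
      using x(2) \<kappa>(1) by (intro mult_left_mono) auto
    then show "(Q k l ^ m / (\<kappa> * lam k l) ^ (2 * m - 1)) * (x * (A k k * B l l) ^ m) \<le>
       x / \<kappa> ^ (2 * m - 1) * (M ^ (m - 1) * (A k k * B l l * Q k l / lam k l))"
      by (simp add: b_def power_mult_distrib mult_ac)
  qed
  also have "\<dots> = x / \<kappa> ^ (2 * m - 1) * (M ^ (m - 1) * (\<Sum>k<n. \<Sum>l<n. A k k * B l l * Q k l / lam k l))"
    by (simp add: sum_distrib_left)
  also have "\<dots> \<le> x / \<kappa> ^ (2 * m - 1) * (M ^ (m - 1) * N)"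
    using x(2) \<kappa>(1) M(2) by (intro mult_left_mono N) auto
  finally have "(8 * (real m)\<^sup>2) ^ m * EE (\<lambda>\<eta>. \<Sum>k<n. \<Sum>l<n. ((W \<eta> k l)\<^sup>2) ^ m * Q k l ^ m / (?g * \<rho> k l) ^ (2 * m - 1))
     \<le> (8 * (real m)\<^sup>2) ^ m * (x / \<kappa> ^ (2 * m - 1) * (M ^ (m - 1) * N))"
    by (intro mult_left_mono) auto
  also have "\<dots> = (8 * (real m)\<^sup>2) ^ m / \<kappa> ^ (2 * m - 1) * (x * M ^ (m - 1) * N)" by simp
  also have "\<dots> \<le> (16 * \<tau>) ^ m * (x * M ^ (m - 1) * N)"
  proof (rule mult_right_mono)
    \<comment> \<open>One factor m is left over beyond the powers of \<open>m / \<kappa>\<close>; it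
      is absorbed by \<open>m <= 2 ^ m\<close>, and \<open>8 * 2 = 16\<close>. Surplus powers of
      \<tau> are dropped because \<tau> is at most 1.\<close>
    have "(8 * (real m)\<^sup>2) ^ m / \<kappa> ^ (2 * m - 1) = 8 ^ m * (real m * (real m / \<kappa>) ^ (2 * m - 1))"
    proof -
      have "y ^ (2 * m) = y * y ^ (2 * m - 1)" for y :: real using m by (cases m) auto
      then have "((real m)\<^sup>2) ^ m = real m * real m ^ (2 * m - 1)" by (simp only: power_mult[symmetric])
      then show ?thesis by (simp add: power_mult_distrib power_divide)
    qed
    also have "\<dots> \<le> 8 ^ m * (2 ^ m * \<tau> ^ m)"
    proof (intro mult_left_mono mult_mono)
      show "real m \<le> 2 ^ m" using of_nat_less_two_power[of m, where 'a = real] by simp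
      have "(real m / \<kappa>) ^ (2 * m - 1) \<le> \<tau> ^ (2 * m - 1)" using mk \<kappa>(1) by (intro power_mono) auto
      also have "\<dots> \<le> \<tau> ^ m" using \<tau>(2) \<tau>0 m by (intro power_decreasing) auto
      finally show "(real m / \<kappa>) ^ (2 * m - 1) \<le> \<tau> ^ m" .
    qed (use \<kappa>(1) in auto)
    also have "\<dots> = (16 * \<tau>) ^ m" unfolding power_mult_distrib[symmetric] by simp
    finally show "(8 * (real m)\<^sup>2) ^ m / \<kappa> ^ (2 * m - 1) \<le> (16 * \<tau>) ^ m" .
    have "0 \<le> (\<Sum>k<n. \<Sum>l<n. A k k * B l l * Q k l / lam k l)"
      using Q lp by (intro sum_nonneg divide_nonneg_pos mult_nonneg_nonneg) (auto intro: less_imp_le)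
    then show "0 \<le> x * M ^ (m - 1) * N" using N x(2) M(2) by simp
  qed
  finally show ?thesis unfolding main_term_def distrib_left by (rule add_mono[OF part1])
qed

end

text \<open>The golfing residual: for tangential Z, subtracting the projection of
  \<open>(1 + X) Z\<close> (entrywise product) from Z leaves exactly minus the projection of
  \<open>X Z\<close>.\<close>

definition step :: "nat \<Rightarrow> rmat \<Rightarrow> rmat \<Rightarrow> rmat \<Rightarrow> rmat \<Rightarrow> rmat" where
  "step n A B X Z = (\<lambda>i j. - PT n A B (had X Z) i j)"

section \<open>Moments of entries, rows and columns under one golfing step\<close>

context sampling
begin

text \<open>The profile that a step preserves: entries measured against the product of the two
  leverage terms by x, rows and columns against one of them by y.\<close>

definition moments :: "nat \<Rightarrow> ((nat \<times> nat \<times> nat \<Rightarrow> bool) \<Rightarrow> rmat) \<Rightarrow> real \<Rightarrow> real \<Rightarrow> bool" where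
  "moments m W x y \<longleftrightarrow> 0 \<le> x \<and> 0 \<le> y \<and>
    (\<forall>k<n. \<forall>l<n. EE (\<lambda>\<eta>. ((W \<eta> k l)\<^sup>2) ^ m) \<le> x * (A k k * B l l) ^ m) \<and>
    (\<forall>k<n. EE (\<lambda>\<eta>. (\<Sum>l<n. (W \<eta> k l)\<^sup>2) ^ m) \<le> y * A k k ^ m) \<and>
    (\<forall>l<n. EE (\<lambda>\<eta>. (\<Sum>k<n. (W \<eta> k l)\<^sup>2) ^ m) \<le> y * B l l ^ m)"

lemma main_term_mono:
  assumes "\<And>k l. k < n \<Longrightarrow> l < n \<Longrightarrow> 0 \<le> Q k l \<and> Q k l \<le> Q' k l"
  shows "main_term G m W Q \<le> main_term G m W Q'"
proof -
  have r: "0 \<le> real (card G) * \<rho> k l" if "k < n" "l < n" for k l using \<rho>01[OF that] by simp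
  have "EE (\<lambda>\<eta>. (\<Sum>k<n. \<Sum>l<n. (W \<eta> k l)\<^sup>2 * Q k l / (real (card G) * \<rho> k l)) ^ m)
      \<le> EE (\<lambda>\<eta>. (\<Sum>k<n. \<Sum>l<n. (W \<eta> k l)\<^sup>2 * Q' k l / (real (card G) * \<rho> k l)) ^ m)"
  proof (intro EE_mono power_mono sum_mono sum_nonneg)
    fix \<eta> k l assume "k \<in> {..<n}" "l \<in> {..<n}"
    then have kl: "k < n" "l < n" by auto
    show "(W \<eta> k l)\<^sup>2 * Q k l / (real (card G) * \<rho> k l) \<le> (W \<eta> k l)\<^sup>2 * Q' k l / (real (card G) * \<rho> k l)"
      using assms[OF kl] by (intro divide_right_mono mult_left_mono r[OF kl]) auto
    show "0 \<le> (W \<eta> k l)\<^sup>2 * Q k l / (real (card G) * \<rho> k l)"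
      using assms[OF kl] by (intro divide_nonneg_nonneg mult_nonneg_nonneg zero_le_power2 r[OF kl]) auto
  qed auto
  moreover have "EE (\<lambda>\<eta>. \<Sum>k<n. \<Sum>l<n. ((W \<eta> k l)\<^sup>2) ^ m * Q k l ^ m / (real (card G) * \<rho> k l) ^ (2 * m - 1))
      \<le> EE (\<lambda>\<eta>. \<Sum>k<n. \<Sum>l<n. ((W \<eta> k l)\<^sup>2) ^ m * Q' k l ^ m / (real (card G) * \<rho> k l) ^ (2 * m - 1))"
  proof (intro EE_mono sum_mono)
    fix \<eta> k l assume "k \<in> {..<n}" "l \<in> {..<n}"
    then have kl: "k < n" "l < n" by auto
    show "((W \<eta> k l)\<^sup>2) ^ m * Q k l ^ m / (real (card G) * \<rho> k l) ^ (2 * m - 1)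
      \<le> ((W \<eta> k l)\<^sup>2) ^ m * Q' k l ^ m / (real (card G) * \<rho> k l) ^ (2 * m - 1)"
      using assms[OF kl] by (intro divide_right_mono mult_left_mono power_mono zero_le_power[OF r[OF kl]] zero_le_power[OF zero_le_power2] r[OF kl]) auto
  qed auto
  ultimately show ?thesis unfolding main_term_def by (intro add_mono mult_left_mono) auto
qed

lemma le_scaled:
  assumes "0 < a" "EE (\<lambda>\<eta>. f \<eta> ^ m) \<le> y * a ^ m"
  shows "EE (\<lambda>\<eta>. (f \<eta> / a) ^ m) \<le> y"
proof -
  have "EE (\<lambda>\<eta>. (f \<eta> / a) ^ m) = (1 / a) ^ m * EE (\<lambda>\<eta>. f \<eta> ^ m)"
    unfolding bexp_cmult[symmetric] by (simp add: power_divide)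
  also have "\<dots> \<le> (1 / a) ^ m * (y * a ^ m)"
    using assms by (intro mult_left_mono) auto
  also have "\<dots> = y" using assms by (simp add: power_divide)
  finally show ?thesis .
qed

lemma sum_pairs: "(\<Sum>k<n. \<Sum>l<n. f k l) = (\<Sum>c\<in>{..<n} \<times> {..<n}. f (fst c) (snd c))"
  by (simp add: sum.cartesian_product split_def)

lemmas EE_weighted = bits.bexp_weighted_power[OF bits_idx]

context
  fixes G :: "nat set" and m :: nat and \<kappa> \<tau> R :: real
  assumes G: "G \<subseteq> {..<K}" "G \<noteq> {}" and m: "1 \<le> m"
    and \<kappa>: "0 < \<kappa>" "\<And>k l. k < n \<Longrightarrow> l < n \<Longrightarrow> \<kappa> * lam k l \<le> real (card G) * \<rho> k l"
    and \<tau>: "real m \<le> \<tau> * \<kappa>" "\<tau> \<le> 1"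
    and R: "(\<Sum>k<n. A k k) \<le> R" "(\<Sum>l<n. B l l) \<le> R"
begin

lemma \<tau>0: "0 \<le> \<tau>"
proof -
  have "0 \<le> \<tau> * \<kappa>" using \<tau>(1) of_nat_0_le_iff order_trans by blast
  then show ?thesis using \<kappa>(1) by (simp add: zero_le_mult_iff)
qed

text \<open>The variance of a row needs the row bound y; its jumps need the entry bound x,
  multiplied by the trace bound R.\<close>

lemma row_main_term:
  assumes W: "moments m W x y" and i: "i < n"
  shows "main_term G m W (\<lambda>k l. (A i k)\<^sup>2 + (if i = k then B l l else 0)) \<le> (32 * \<tau>) ^ m * (y + R * x) * A i i ^ m"
proof -
  let ?Q = "\<lambda>k l. (A i k)\<^sup>2 + (if i = k then B l l else 0)"
  have x0: "0 \<le> x" "0 \<le> y" using W by (auto simp: moments_def)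
  have p: "0 < A i i" using i A.pos by auto
  have "main_term G m W ?Q \<le> (16 * \<tau>) ^ m * ((2 * A i i) ^ m * y + x * (2 * A i i) ^ (m - 1) * (2 * A i i * R))"
  proof (rule main_term_le[OF G m \<kappa> \<tau>])
    show "EE (\<lambda>\<eta>. ((W \<eta> k l)\<^sup>2) ^ m) \<le> x * (A k k * B l l) ^ m" if "k < n" "l < n" for k l
      using W that by (auto simp: moments_def)
    show "0 \<le> ?Q k l" if "l < n" for k l using B.pos[OF that] by simp
    show "A k k * B l l * ?Q k l / (lam k l)\<^sup>2 \<le> 2 * A i i" if "k < n" "l < n" for k l
      using row_bounds(1)[OF i that] .
    have "(\<Sum>k<n. \<Sum>l<n. A k k * B l l * ?Q k l / lam k l) \<le> 2 * A i i * (\<Sum>l<n. B l l)"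
      using row_bounds(2)[OF i] .
    also have "\<dots> \<le> 2 * A i i * R" using p R(2) by (intro mult_left_mono) auto
    finally show "(\<Sum>k<n. \<Sum>l<n. A k k * B l l * ?Q k l / lam k l) \<le> 2 * A i i * R" .
    have "EE (\<lambda>\<eta>. (\<Sum>k<n. \<Sum>l<n. (W \<eta> k l)\<^sup>2 * ?Q k l / lam k l) ^ m)
       \<le> EE (\<lambda>\<eta>. (\<Sum>k<n. ((A i k)\<^sup>2 + (if i = k then A i i else 0)) * ((\<Sum>l<n. (W \<eta> k l)\<^sup>2) / A k k)) ^ m)"
    proof (rule EE_mono)
      fix \<eta>
      have "(W \<eta> k l)\<^sup>2 * ?Q k l / lam k l \<le> ((A i k)\<^sup>2 + (if i = k then A i i else 0)) * ((W \<eta> k l)\<^sup>2 / A k k)"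
        if "k < n" "l < n" for k l
      proof -
        have "(W \<eta> k l)\<^sup>2 * (?Q k l / lam k l) \<le> (W \<eta> k l)\<^sup>2 * (((A i k)\<^sup>2 + (if i = k then A i i else 0)) / A k k)"
          using row_bounds(3)[OF i that] by (intro mult_left_mono) auto
        then show ?thesis by (simp add: mult.commute)
      qed
      then have "(\<Sum>k<n. \<Sum>l<n. (W \<eta> k l)\<^sup>2 * ?Q k l / lam k l) \<le>
         (\<Sum>k<n. \<Sum>l<n. ((A i k)\<^sup>2 + (if i = k then A i i else 0)) * ((W \<eta> k l)\<^sup>2 / A k k))"
        by (intro sum_mono) auto
      also have "\<dots> = (\<Sum>k<n. ((A i k)\<^sup>2 + (if i = k then A i i else 0)) * ((\<Sum>l<n. (W \<eta> k l)\<^sup>2) / A k k))"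
        by (simp add: sum_distrib_left sum_divide_distrib)
      finally show "(\<Sum>k<n. \<Sum>l<n. (W \<eta> k l)\<^sup>2 * ?Q k l / lam k l) ^ m \<le>
         (\<Sum>k<n. ((A i k)\<^sup>2 + (if i = k then A i i else 0)) * ((\<Sum>l<n. (W \<eta> k l)\<^sup>2) / A k k)) ^ m"
      proof (intro power_mono sum_nonneg)
        fix k l assume "k \<in> {..<n}" "l \<in> {..<n}"
        then have "0 \<le> ?Q k l" "0 < lam k l" using B.pos[of l] lam_pos by auto
        then show "0 \<le> (W \<eta> k l)\<^sup>2 * ?Q k l / lam k l" by (simp del: if_split)
      qed
    qed auto
    also have "\<dots> \<le> (2 * A i i) ^ m * y"
    proof (rule EE_weighted[OF finite_lessThan m])
      show "0 \<le> (A i k)\<^sup>2 + (if i = k then A i i else 0)" for k using p by auto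
      show "0 \<le> (\<Sum>l<n. (W \<eta> k l)\<^sup>2) / A k k" if "k \<in> {..<n}" for k \<eta>
        using A.pos that by (intro divide_nonneg_pos sum_nonneg) auto
      show "(\<Sum>k<n. (A i k)\<^sup>2 + (if i = k then A i i else 0)) \<le> 2 * A i i"
        using i by (simp add: sum.distrib A.row_sq)
      show "EE (\<lambda>\<eta>. ((\<Sum>l<n. (W \<eta> k l)\<^sup>2) / A k k) ^ m) \<le> y" if "k \<in> {..<n}" for k
        using W A.pos that by (intro le_scaled) (auto simp: moments_def)
    qed (rule x0)
    finally show "EE (\<lambda>\<eta>. (\<Sum>k<n. \<Sum>l<n. (W \<eta> k l)\<^sup>2 * ?Q k l / lam k l) ^ m) \<le> (2 * A i i) ^ m * y" .
  qed (use p x0 in auto)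
  also have "\<dots> = (32 * \<tau>) ^ m * (y + R * x) * A i i ^ m"
  proof -
    have "(2 * A i i) ^ (m - 1) * (2 * A i i * R) = (2 * A i i) ^ m * R" using m by (cases m) auto
    then have e1: "(2 * A i i) ^ m * y + x * (2 * A i i) ^ (m - 1) * (2 * A i i * R) = (2 * A i i) ^ m * (y + R * x)"
      by (simp add: mult.assoc distrib_left)
    have e2: "(16 * \<tau>) ^ m * (2 * A i i) ^ m = (32 * \<tau>) ^ m * A i i ^ m"
      unfolding power_mult_distrib[symmetric] by (simp add: mult_ac)
    have "p * (q * v) = r * s * v" if "p * q = r * s" for p q r s v :: real
      using that by (metis mult.assoc)
    from this[OF e2] show ?thesis unfolding e1 by (simp only: mult_ac)
  qed
  finally show ?thesis .
qed

text \<open>Mirror image of the row estimate, with the roles of the two projections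
  exchanged.\<close>

lemma col_main_term:
  assumes W: "moments m W x y" and j: "j < n"
  shows "main_term G m W (\<lambda>k l. (B j l)\<^sup>2 + (if j = l then A k k else 0)) \<le> (32 * \<tau>) ^ m * (y + R * x) * B j j ^ m"
proof -
  interpret sw: proj2 n B A by (rule swap)
  have swl: "sw.lam l k = lam k l" for k l by (simp add: sw.lam_def lam_def)
  let ?Q = "\<lambda>k l. (B j l)\<^sup>2 + (if j = l then A k k else 0)"
  have x0: "0 \<le> x" "0 \<le> y" using W by (auto simp: moments_def)
  have p: "0 < B j j" using j B.pos by auto
  have "main_term G m W ?Q \<le> (16 * \<tau>) ^ m * ((2 * B j j) ^ m * y + x * (2 * B j j) ^ (m - 1) * (2 * B j j * R))"
  proof (rule main_term_le[OF G m \<kappa> \<tau>])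
    show "EE (\<lambda>\<eta>. ((W \<eta> k l)\<^sup>2) ^ m) \<le> x * (A k k * B l l) ^ m" if "k < n" "l < n" for k l
      using W that by (auto simp: moments_def)
    show "0 \<le> ?Q k l" if "k < n" for k l using A.pos[OF that] by simp
    show "A k k * B l l * ?Q k l / (lam k l)\<^sup>2 \<le> 2 * B j j" if "k < n" "l < n" for k l
      using sw.row_bounds(1)[OF j that(2,1)] by (simp add: swl mult.commute)
    have "(\<Sum>k<n. \<Sum>l<n. A k k * B l l * ?Q k l / lam k l) \<le> 2 * B j j * (\<Sum>k<n. A k k)"
      using sw.row_bounds(2)[OF j] by (subst sum.swap) (simp add: swl mult.commute)
    also have "\<dots> \<le> 2 * B j j * R" using p R(1) by (intro mult_left_mono) auto
    finally show "(\<Sum>k<n. \<Sum>l<n. A k k * B l l * ?Q k l / lam k l) \<le> 2 * B j j * R" .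
    have "EE (\<lambda>\<eta>. (\<Sum>k<n. \<Sum>l<n. (W \<eta> k l)\<^sup>2 * ?Q k l / lam k l) ^ m)
       \<le> EE (\<lambda>\<eta>. (\<Sum>l<n. ((B j l)\<^sup>2 + (if j = l then B j j else 0)) * ((\<Sum>k<n. (W \<eta> k l)\<^sup>2) / B l l)) ^ m)"
    proof (rule EE_mono)
      fix \<eta>
      have "(W \<eta> k l)\<^sup>2 * ?Q k l / lam k l \<le> ((B j l)\<^sup>2 + (if j = l then B j j else 0)) * ((W \<eta> k l)\<^sup>2 / B l l)"
        if "k < n" "l < n" for k l
      proof -
        have "(W \<eta> k l)\<^sup>2 * (?Q k l / lam k l) \<le> (W \<eta> k l)\<^sup>2 * (((B j l)\<^sup>2 + (if j = l then B j j else 0)) / B l l)"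
          using sw.row_bounds(3)[OF j that(2,1)] by (intro mult_left_mono) (auto simp: swl)
        then show ?thesis by (simp add: mult.commute)
      qed
      then have "(\<Sum>k<n. \<Sum>l<n. (W \<eta> k l)\<^sup>2 * ?Q k l / lam k l) \<le>
         (\<Sum>k<n. \<Sum>l<n. ((B j l)\<^sup>2 + (if j = l then B j j else 0)) * ((W \<eta> k l)\<^sup>2 / B l l))"
        by (intro sum_mono) auto
      also have "\<dots> = (\<Sum>l<n. ((B j l)\<^sup>2 + (if j = l then B j j else 0)) * ((\<Sum>k<n. (W \<eta> k l)\<^sup>2) / B l l))"
        by (subst sum.swap) (simp add: sum_distrib_left sum_divide_distrib)
      finally show "(\<Sum>k<n. \<Sum>l<n. (W \<eta> k l)\<^sup>2 * ?Q k l / lam k l) ^ m \<le>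
         (\<Sum>l<n. ((B j l)\<^sup>2 + (if j = l then B j j else 0)) * ((\<Sum>k<n. (W \<eta> k l)\<^sup>2) / B l l)) ^ m"
      proof (intro power_mono sum_nonneg)
        fix k l assume "k \<in> {..<n}" "l \<in> {..<n}"
        then have "0 \<le> ?Q k l" "0 < lam k l" using A.pos[of k] lam_pos by auto
        then show "0 \<le> (W \<eta> k l)\<^sup>2 * ?Q k l / lam k l" by (simp del: if_split)
      qed
    qed auto
    also have "\<dots> \<le> (2 * B j j) ^ m * y"
    proof (rule EE_weighted[OF finite_lessThan m])
      show "0 \<le> (B j k)\<^sup>2 + (if j = k then B j j else 0)" for k using p by auto
      show "0 \<le> (\<Sum>k<n. (W \<eta> k l)\<^sup>2) / B l l" if "l \<in> {..<n}" for l \<eta>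
        using B.pos that by (intro divide_nonneg_pos sum_nonneg) auto
      show "(\<Sum>k<n. (B j k)\<^sup>2 + (if j = k then B j j else 0)) \<le> 2 * B j j"
        using j by (simp add: sum.distrib B.row_sq)
      show "EE (\<lambda>\<eta>. ((\<Sum>k<n. (W \<eta> k l)\<^sup>2) / B l l) ^ m) \<le> y" if "l \<in> {..<n}" for l
        using W B.pos that by (intro le_scaled) (auto simp: moments_def)
    qed (rule x0)
    finally show "EE (\<lambda>\<eta>. (\<Sum>k<n. \<Sum>l<n. (W \<eta> k l)\<^sup>2 * ?Q k l / lam k l) ^ m) \<le> (2 * B j j) ^ m * y" .
  qed (use p x0 in auto)
  also have "\<dots> = (32 * \<tau>) ^ m * (y + R * x) * B j j ^ m"
  proof -
    have "(2 * B j j) ^ (m - 1) * (2 * B j j * R) = (2 * B j j) ^ m * R" using m by (cases m) auto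
    then have e1: "(2 * B j j) ^ m * y + x * (2 * B j j) ^ (m - 1) * (2 * B j j * R) = (2 * B j j) ^ m * (y + R * x)"
      by (simp add: mult.assoc distrib_left)
    have e2: "(16 * \<tau>) ^ m * (2 * B j j) ^ m = (32 * \<tau>) ^ m * B j j ^ m"
      unfolding power_mult_distrib[symmetric] by (simp add: mult_ac)
    have "p * (q * v) = r * s * v" if "p * q = r * s" for p q r s v :: real
      using that by (metis mult.assoc)
    from this[OF e2] show ?thesis unfolding e1 by (simp only: mult_ac)
  qed
  finally show ?thesis .
qed

text \<open>Both the variance and the jumps of an entry are controlled by entries again, so x
  contracts without reference to y.\<close>

lemma entry_main_term:
  assumes W: "moments m W x y" and ij: "i < n" "j < n"
  shows "main_term G m W (\<lambda>k l. (ker A B i j k l)\<^sup>2) \<le> (288 * \<tau>) ^ m * x * (A i i * B j j) ^ m"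
proof -
  let ?Q = "\<lambda>k l. (ker A B i j k l)\<^sup>2"
  define c where "c = A i i * B j j"
  have x0: "0 \<le> x" using W by (auto simp: moments_def)
  have c: "0 < c" using ij A.pos B.pos by (simp add: c_def)
  have "main_term G m W ?Q \<le> (16 * \<tau>) ^ m * ((9 * c) ^ m * x + x * (9 * c) ^ (m - 1) * (9 * c))"
  proof (rule main_term_le[OF G m \<kappa> \<tau>])
    show xm: "EE (\<lambda>\<eta>. ((W \<eta> k l)\<^sup>2) ^ m) \<le> x * (A k k * B l l) ^ m" if "k < n" "l < n" for k l
      using W that by (auto simp: moments_def)
    show "A k k * B l l * ?Q k l / (lam k l)\<^sup>2 \<le> 9 * c" if "k < n" "l < n" for k l
      using ker_entry_bounds(1)[OF ij that] by (simp add: c_def)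
    show N: "(\<Sum>k<n. \<Sum>l<n. A k k * B l l * ?Q k l / lam k l) \<le> 9 * c"
      using ker_entry_bounds(2)[OF ij] by (simp add: c_def)
    have "EE (\<lambda>\<eta>. (\<Sum>k<n. \<Sum>l<n. (W \<eta> k l)\<^sup>2 * ?Q k l / lam k l) ^ m) =
      EE (\<lambda>\<eta>. (\<Sum>c\<in>{..<n} \<times> {..<n}. (A (fst c) (fst c) * B (snd c) (snd c) * ?Q (fst c) (snd c) / lam (fst c) (snd c))
        * ((W \<eta> (fst c) (snd c))\<^sup>2 / (A (fst c) (fst c) * B (snd c) (snd c)))) ^ m)"
    proof -
      have eq: "(W \<eta> k l)\<^sup>2 * ?Q k l / lam k l = (A k k * B l l * ?Q k l / lam k l) * ((W \<eta> k l)\<^sup>2 / (A k k * B l l))"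
        if "k < n" "l < n" for k l \<eta>
        using A.pos[OF that(1)] B.pos[OF that(2)] by simp
      show ?thesis unfolding sum_pairs
        by (intro arg_cong[where f = "bexp idx rt"] ext arg_cong[where f = "\<lambda>z. z ^ m"] sum.cong refl eq) auto
    qed
    also have "\<dots> \<le> (9 * c) ^ m * x"
    proof (rule EE_weighted[OF _ m])
      show "finite ({..<n} \<times> {..<n})" by simp
      show "(\<Sum>c\<in>{..<n} \<times> {..<n}. A (fst c) (fst c) * B (snd c) (snd c) * ?Q (fst c) (snd c) / lam (fst c) (snd c)) \<le> 9 * c"
        using N unfolding sum_pairs .
      fix d :: "nat \<times> nat" assume d: "d \<in> {..<n} \<times> {..<n}"
      then have p: "0 < A (fst d) (fst d)" "0 < B (snd d) (snd d)" "0 < lam (fst d) (snd d)"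
        using A.pos B.pos lam_pos by auto
      then show "0 \<le> A (fst d) (fst d) * B (snd d) (snd d) * ?Q (fst d) (snd d) / lam (fst d) (snd d)"
        "\<And>\<eta>. 0 \<le> (W \<eta> (fst d) (snd d))\<^sup>2 / (A (fst d) (fst d) * B (snd d) (snd d))" by auto
      show "EE (\<lambda>\<eta>. ((W \<eta> (fst d) (snd d))\<^sup>2 / (A (fst d) (fst d) * B (snd d) (snd d))) ^ m) \<le> x"
        using d p by (intro le_scaled xm) auto
    qed (rule x0)
    finally show "EE (\<lambda>\<eta>. (\<Sum>k<n. \<Sum>l<n. (W \<eta> k l)\<^sup>2 * ?Q k l / lam k l) ^ m) \<le> (9 * c) ^ m * x" .
  qed (use c x0 in auto)
  also have "\<dots> = (144 * \<tau>) ^ m * (2 * x) * c ^ m"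
  proof -
    have "(9 * c) ^ (m - 1) * (9 * c) = (9 * c) ^ m" using m by (cases m) auto
    then have e1: "(9 * c) ^ m * x + x * (9 * c) ^ (m - 1) * (9 * c) = (9 * c) ^ m * (2 * x)"
      by (simp add: mult.assoc)
    have e2: "(16 * \<tau>) ^ m * (9 * c) ^ m = (144 * \<tau>) ^ m * c ^ m"
      unfolding power_mult_distrib[symmetric] by (simp add: mult_ac)
    have "p * (q * v) = r * s * v" if "p * q = r * s" for p q r s v :: real
      using that by (metis mult.assoc)
    from this[OF e2] show ?thesis unfolding e1 by (simp only: mult_ac)
  qed
  \<comment> \<open>The factor 2 from the variance and jump terms is absorbed into
    \<open>2 ^ m\<close>: \<open>288 = 16 * 9 * 2\<close>.\<close>
  also have "\<dots> \<le> (144 * \<tau>) ^ m * (2 ^ m * x) * c ^ m"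
  proof -
    have "(2::real) ^ 1 \<le> 2 ^ m" using m by (intro power_increasing) auto
    then show ?thesis using x0 \<tau>0 c by (intro mult_right_mono mult_left_mono) auto
  qed
  also have "\<dots> = (288 * \<tau>) ^ m * x * c ^ m"
  proof -
    have "(144 * \<tau>) ^ m * 2 ^ m = (288 * \<tau>) ^ m" unfolding power_mult_distrib[symmetric] by simp
    then show ?thesis by (metis mult.assoc)
  qed
  finally show ?thesis by (simp add: c_def)
qed

lemma step_moments:
  assumes W: "moments m W x y" and ind: "indep_bits (cells G) W"
  shows "moments m (\<lambda>\<eta>. step n A B (xi G \<eta>) (W \<eta>)) ((288 * \<tau>) ^ m * x) ((32 * \<tau>) ^ m * (y + R * x))"
  unfolding moments_def
proof (intro conjI allI impI)
  have x0: "0 \<le> x" "0 \<le> y" using W by (auto simp: moments_def)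
  have R0: "0 \<le> R" using R(1) A.pos by (smt (verit) lessThan_iff sum_nonneg)
  show "0 \<le> (288 * \<tau>) ^ m * x" "0 \<le> (32 * \<tau>) ^ m * (y + R * x)" using x0 R0 \<tau>0 by auto
  have st: "step n A B (xi G \<eta>) (W \<eta>) i j = - (\<Sum>k<n. \<Sum>l<n. ker A B i j k l * (xi G \<eta> k l * W \<eta> k l))" for i j \<eta>
    by (simp add: step_def PT_def had_def)
  fix i assume i: "i < n"
  show "EE (\<lambda>\<eta>. (\<Sum>l<n. (step n A B (xi G \<eta>) (W \<eta>) i l)\<^sup>2) ^ m) \<le> (32 * \<tau>) ^ m * (y + R * x) * A i i ^ m"
  proof -
    have "EE (\<lambda>\<eta>. (\<Sum>l<n. (step n A B (xi G \<eta>) (W \<eta>) i l)\<^sup>2) ^ m)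
      \<le> main_term G m W (\<lambda>k l. nsq {..<n} (\<lambda>j. ker A B i j k l))"
      using linear_moment[OF G finite_lessThan m ind, of n "\<lambda>j. ker A B i j"] by (simp add: st nsq_def)
    also have "\<dots> \<le> main_term G m W (\<lambda>k l. (A i k)\<^sup>2 + (if i = k then B l l else 0))"
      using ker_row_sq[OF i] by (intro main_term_mono conjI nsq_nonneg) (simp add: nsq_def)
    also note row_main_term[OF W i]
    finally show ?thesis .
  qed
  show "EE (\<lambda>\<eta>. (\<Sum>k<n. (step n A B (xi G \<eta>) (W \<eta>) k i)\<^sup>2) ^ m) \<le> (32 * \<tau>) ^ m * (y + R * x) * B i i ^ m"
  proof -
    interpret sw: proj2 n B A by (rule swap)
    have "EE (\<lambda>\<eta>. (\<Sum>k<n. (step n A B (xi G \<eta>) (W \<eta>) k i)\<^sup>2) ^ m)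
      \<le> main_term G m W (\<lambda>k l. nsq {..<n} (\<lambda>j. ker A B j i k l))"
      using linear_moment[OF G finite_lessThan m ind, of n "\<lambda>j. ker A B j i"] by (simp add: st nsq_def)
    also have "\<dots> \<le> main_term G m W (\<lambda>k l. (B i l)\<^sup>2 + (if i = l then A k k else 0))"
      using sw.ker_row_sq[OF i] by (intro main_term_mono conjI nsq_nonneg) (simp add: nsq_def ker_transpose[of A B])
    also note col_main_term[OF W i]
    finally show ?thesis .
  qed
  fix j assume j: "j < n"
  have "EE (\<lambda>\<eta>. ((step n A B (xi G \<eta>) (W \<eta>) i j)\<^sup>2) ^ m)
      \<le> main_term G m W (\<lambda>k l. (ker A B i j k l)\<^sup>2)"
    using linear_moment[OF G _ m ind, of "{()}" "\<lambda>_. ker A B i j"] by (simp add: st nsq_def)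
  also note entry_main_term[OF W i j]
  finally show "EE (\<lambda>\<eta>. ((step n A B (xi G \<eta>) (W \<eta>) i j)\<^sup>2) ^ m) \<le> (288 * \<tau>) ^ m * x * (A i i * B j j) ^ m" .
qed

text \<open>The noise before projection. Its spectral size is governed by its rows and columns,
  hence by y for the variance and by x for the jumps.\<close>

lemma schatten_step:
  assumes W: "moments m W x y" and ind: "indep_bits (cells G) W"
  shows "EE (\<lambda>\<eta>. schatten n m (had (xi G \<eta>) (W \<eta>))) \<le> real n * ((16 * \<tau>) ^ m * (y + R * x))"
proof (rule schatten_linear_moment[OF G m ind])
  have x0: "0 \<le> x" "0 \<le> y" using W by (auto simp: moments_def)
  have xm: "EE (\<lambda>\<eta>. ((W \<eta> k l)\<^sup>2) ^ m) \<le> x * (A k k * B l l) ^ m" if "k < n" "l < n" for k l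
    using W that by (auto simp: moments_def)
  fix i assume i: "i < n"
  have "main_term G m W (\<lambda>k l. if k = i then 1 else 0) \<le> (16 * \<tau>) ^ m * (y + x * 1 ^ (m - 1) * R)"
  proof (rule main_term_le[OF G m \<kappa> \<tau> xm])
    show "A k k * B l l * (if k = i then 1 else 0) / (lam k l)\<^sup>2 \<le> 1" if "k < n" "l < n" for k l
      using ratio_le(5)[OF that] by auto
    have "(\<Sum>k<n. \<Sum>l<n. A k k * B l l * (if k = i then 1 else 0) / lam k l) \<le> (\<Sum>k<n. \<Sum>l<n. if k = i then B l l else 0)"
      using ratio_le(4) by (intro sum_mono) auto
    also have "\<dots> = (\<Sum>l<n. B l l)" using i by (subst sum.swap) simp
    finally show "(\<Sum>k<n. \<Sum>l<n. A k k * B l l * (if k = i then 1 else 0) / lam k l) \<le> R" using R(2) by simp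
    have "EE (\<lambda>\<eta>. (\<Sum>k<n. \<Sum>l<n. (W \<eta> k l)\<^sup>2 * (if k = i then 1 else 0) / lam k l) ^ m)
       \<le> EE (\<lambda>\<eta>. ((\<Sum>l<n. (W \<eta> i l)\<^sup>2) / A i i) ^ m)"
    proof (rule EE_mono)
      fix \<eta>
      have "(\<Sum>k<n. \<Sum>l<n. (W \<eta> k l)\<^sup>2 * (if k = i then 1 else 0) / lam k l) = (\<Sum>k<n. \<Sum>l<n. if k = i then (W \<eta> i l)\<^sup>2 / lam i l else 0)"
        by (intro sum.cong) auto
      also have "\<dots> = (\<Sum>l<n. (W \<eta> i l)\<^sup>2 / lam i l)" using i by (subst sum.swap) simp
      also have "\<dots> \<le> (\<Sum>l<n. (W \<eta> i l)\<^sup>2 / A i i)"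
        using A.pos[OF i] B.pos lam_pos[OF i] by (intro sum_mono divide_left_mono) (auto simp: lam_def intro: less_imp_le)
      finally show "(\<Sum>k<n. \<Sum>l<n. (W \<eta> k l)\<^sup>2 * (if k = i then 1 else 0) / lam k l) ^ m \<le> ((\<Sum>l<n. (W \<eta> i l)\<^sup>2) / A i i) ^ m"
        using lam_pos by (intro power_mono sum_nonneg divide_nonneg_pos) (auto simp: sum_divide_distrib)
    qed auto
    also have "\<dots> \<le> y" using W A.pos i by (intro le_scaled) (auto simp: moments_def)
    finally show "EE (\<lambda>\<eta>. (\<Sum>k<n. \<Sum>l<n. (W \<eta> k l)\<^sup>2 * (if k = i then 1 else 0) / lam k l) ^ m) \<le> y" .
  qed (use x0 in auto)
  then show "main_term G m W (\<lambda>k l. if k = i then 1 else 0) \<le> (16 * \<tau>) ^ m * (y + R * x)" by (simp add: mult.commute)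
  have "main_term G m W (\<lambda>k l. if l = i then 1 else 0) \<le> (16 * \<tau>) ^ m * (y + x * 1 ^ (m - 1) * R)"
  proof (rule main_term_le[OF G m \<kappa> \<tau> xm])
    show "A k k * B l l * (if l = i then 1 else 0) / (lam k l)\<^sup>2 \<le> 1" if "k < n" "l < n" for k l
      using ratio_le(5)[OF that] by auto
    have "(\<Sum>k<n. \<Sum>l<n. A k k * B l l * (if l = i then 1 else 0) / lam k l) \<le> (\<Sum>k<n. \<Sum>l<n. if l = i then A k k else 0)"
      using ratio_le(3) by (intro sum_mono) auto
    also have "\<dots> = (\<Sum>k<n. A k k)" using i by simp
    finally show "(\<Sum>k<n. \<Sum>l<n. A k k * B l l * (if l = i then 1 else 0) / lam k l) \<le> R" using R(1) by simp
    have "EE (\<lambda>\<eta>. (\<Sum>k<n. \<Sum>l<n. (W \<eta> k l)\<^sup>2 * (if l = i then 1 else 0) / lam k l) ^ m)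
       \<le> EE (\<lambda>\<eta>. ((\<Sum>k<n. (W \<eta> k i)\<^sup>2) / B i i) ^ m)"
    proof (rule EE_mono)
      fix \<eta>
      have "(\<Sum>k<n. \<Sum>l<n. (W \<eta> k l)\<^sup>2 * (if l = i then 1 else 0) / lam k l) = (\<Sum>k<n. \<Sum>l<n. if l = i then (W \<eta> k i)\<^sup>2 / lam k i else 0)"
        by (intro sum.cong) auto
      also have "\<dots> = (\<Sum>k<n. (W \<eta> k i)\<^sup>2 / lam k i)" using i by simp
      also have "\<dots> \<le> (\<Sum>k<n. (W \<eta> k i)\<^sup>2 / B i i)"
        using A.pos B.pos[OF i] lam_pos[OF _ i] by (intro sum_mono divide_left_mono) (auto simp: lam_def intro: less_imp_le)
      finally show "(\<Sum>k<n. \<Sum>l<n. (W \<eta> k l)\<^sup>2 * (if l = i then 1 else 0) / lam k l) ^ m \<le> ((\<Sum>k<n. (W \<eta> k i)\<^sup>2) / B i i) ^ m"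
        using lam_pos by (intro power_mono sum_nonneg divide_nonneg_pos) (auto simp: sum_divide_distrib)
    qed auto
    also have "\<dots> \<le> y" using W B.pos i by (intro le_scaled) (auto simp: moments_def)
    finally show "EE (\<lambda>\<eta>. (\<Sum>k<n. \<Sum>l<n. (W \<eta> k l)\<^sup>2 * (if l = i then 1 else 0) / lam k l) ^ m) \<le> y" .
  qed (use x0 in auto)
  then show "main_term G m W (\<lambda>k l. if l = i then 1 else 0) \<le> (16 * \<tau>) ^ m * (y + R * x)" by (simp add: mult.commute)
qed

end

end

section \<open>Golfing chains averaged over batch orders\<close>

fun chain :: "nat \<Rightarrow> rmat \<Rightarrow> rmat \<Rightarrow> rmat list \<Rightarrow> rmat \<Rightarrow> rmat" where
  "chain n A B [] Z = Z"
| "chain n A B (X # Xs) Z = chain n A B Xs (step n A B X Z)"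

lemma chain_append: "chain n A B (Xs @ Ys) Z = chain n A B Ys (chain n A B Xs Z)"
  by (induction Xs arbitrary: Z) auto

lemma sum_swap_mat:
  "(\<Sum>k<n. \<Sum>l<n. f k l * (\<Sum>c\<in>C. z c * g c k l)) = (\<Sum>c\<in>C. z c * (\<Sum>k<n. \<Sum>l<n. f k l * g c k l))"
  for f :: "nat \<Rightarrow> nat \<Rightarrow> real"
proof -
  have "(\<Sum>k<n. \<Sum>l<n. f k l * (\<Sum>c\<in>C. z c * g c k l)) = (\<Sum>k<n. \<Sum>l<n. \<Sum>c\<in>C. z c * (f k l * g c k l))"
    by (simp add: sum_distrib_left mult_ac)
  also have "\<dots> = (\<Sum>c\<in>C. \<Sum>k<n. \<Sum>l<n. z c * (f k l * g c k l))"
    by (simp add: sum.swap[of _ C])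
  finally show ?thesis by (simp add: sum_distrib_left)
qed

lemma PT_sum: "PT n A B (\<lambda>i j. \<Sum>c\<in>C. z c * Z c i j) = (\<lambda>i j. \<Sum>c\<in>C. z c * PT n A B (Z c) i j)"
  unfolding PT_def sum_swap_mat ..

lemma step_sum: "step n A B X (\<lambda>i j. \<Sum>c\<in>C. z c * Z c i j) = (\<lambda>i j. \<Sum>c\<in>C. z c * step n A B X (Z c) i j)"
proof -
  have "had X (\<lambda>i j. \<Sum>c\<in>C. z c * Z c i j) = (\<lambda>i j. \<Sum>c\<in>C. z c * had X (Z c) i j)"
    by (simp add: had_def sum_distrib_left mult_ac)
  then show ?thesis by (simp add: step_def PT_sum sum_negf)
qed

lemma step_sum_left: "step n A B (\<lambda>i j. \<Sum>c\<in>C. z c * X c i j) Z = (\<lambda>i j. \<Sum>c\<in>C. z c * step n A B (X c) Z i j)"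
proof -
  have "had (\<lambda>i j. \<Sum>c\<in>C. z c * X c i j) Z = (\<lambda>i j. \<Sum>c\<in>C. z c * had (X c) Z i j)"
    by (simp add: had_def sum_distrib_right mult.assoc)
  then show ?thesis by (simp add: step_def PT_sum sum_negf)
qed

lemma chain_sum: "chain n A B Xs (\<lambda>i j. \<Sum>c\<in>C. z c * Z c i j) = (\<lambda>i j. \<Sum>c\<in>C. z c * chain n A B Xs (Z c) i j)"
  by (induction Xs arbitrary: Z) (auto simp: step_sum)

text \<open>In every slot the value at a block is the mean of the values at its single batches. This
  holds for expressions that are linear in each averaged weight \<open>xi\<close>.\<close>

definition slot_linear :: "(nat set list \<Rightarrow> real) \<Rightarrow> bool" where
  "slot_linear F \<longleftrightarrow> (\<forall>pre G post. finite G \<longrightarrow> G \<noteq> {} \<longrightarrow>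
     F (pre @ G # post) = (\<Sum>s\<in>G. F (pre @ {s} # post)) / real (card G))"

definition perms :: "nat \<Rightarrow> (nat \<Rightarrow> nat) set" where
  "perms K = {\<sigma>. \<sigma> permutes {..<K}}"

lemma finite_perms [simp]: "finite (perms K)" by (simp add: perms_def finite_permutations)

lemma card_perms: "card (perms K) = fact K"
  by (simp add: perms_def card_permutations[OF refl])

text \<open>Averaged over all relabellings of the batches, a block may be replaced by any one of its
  elements: relabel by the transposition of two elements of the block.\<close>

lemma sum_perms_slot:
  assumes F: "slot_linear F" and G: "G \<subseteq> {..<K}" "a \<in> G"
    and disj: "\<And>G'. G' \<in> set pre \<union> set post \<Longrightarrow> G' \<inter> G = {}"
  shows "(\<Sum>\<sigma>\<in>perms K. F (map ((`) \<sigma>) (pre @ G # post))) = (\<Sum>\<sigma>\<in>perms K. F (map ((`) \<sigma>) (pre @ {a} # post)))"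
proof -
  have fG: "finite G" using G(1) finite_subset by blast
  have c: "card G > 0" using fG G(2) by (auto simp: card_gt_0_iff)
  have swap: "(\<Sum>\<sigma>\<in>perms K. F (map ((`) \<sigma>) (pre @ {b} # post))) = (\<Sum>\<sigma>\<in>perms K. F (map ((`) \<sigma>) (pre @ {a} # post)))"
    if b: "b \<in> G" for b
  proof -
    let ?t = "Transposition.transpose a b"
    have t: "?t permutes {..<K}" using G b by (intro permutes_swap_id) auto
    have img: "(\<sigma> \<circ> ?t) ` G' = \<sigma> ` G'" if "G' \<in> set pre \<union> set post" for G' and \<sigma> :: "nat \<Rightarrow> nat"
    proof -
      have "?t x = x" if "x \<in> G'" for x
      proof -
        have "x \<noteq> a" "x \<noteq> b" using disj[OF \<open>G' \<in> _\<close>] that G b by auto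
        then show ?thesis by (simp add: Transposition.transpose_def)
      qed
      then have "?t ` G' = G'" by (simp cong: image_cong)
      then show ?thesis by (metis image_comp)
    qed
    have "(\<Sum>\<sigma>\<in>perms K. F (map ((`) \<sigma>) (pre @ {a} # post))) = (\<Sum>\<sigma>\<in>perms K. F (map ((`) (\<sigma> \<circ> ?t)) (pre @ {a} # post)))"
    proof (rule sum.reindex_bij_witness[where i = "\<lambda>\<sigma>. \<sigma> \<circ> ?t" and j = "\<lambda>\<sigma>. \<sigma> \<circ> ?t"])
    qed (use t in \<open>auto simp: perms_def comp_assoc permutes_compose\<close>)
    also have "\<dots> = (\<Sum>\<sigma>\<in>perms K. F (map ((`) \<sigma>) (pre @ {b} # post)))"
    proof (rule sum.cong[OF refl])
      fix \<sigma> :: "nat \<Rightarrow> nat"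
      have 1: "map ((`) (\<sigma> \<circ> ?t)) pre = map ((`) \<sigma>) pre" "map ((`) (\<sigma> \<circ> ?t)) post = map ((`) \<sigma>) post"
        using img by (auto simp del: comp_apply)
      have 2: "(\<sigma> \<circ> ?t) ` {a} = \<sigma> ` {b}" by simp
      show "F (map ((`) (\<sigma> \<circ> ?t)) (pre @ {a} # post)) = F (map ((`) \<sigma>) (pre @ {b} # post))"
        unfolding map_append list.map 1 2 ..
    qed
    finally show ?thesis by simp
  qed
  have "(\<Sum>\<sigma>\<in>perms K. F (map ((`) \<sigma>) (pre @ G # post))) = (\<Sum>\<sigma>\<in>perms K. (\<Sum>b\<in>G. F (map ((`) \<sigma>) (pre @ {b} # post))) / real (card G))"
  proof (rule sum.cong[OF refl])
    fix \<sigma> assume "\<sigma> \<in> perms K"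
    then have inj: "inj_on \<sigma> G" by (auto simp: perms_def dest: permutes_inj intro: inj_on_subset)
    have "F (map ((`) \<sigma>) (pre @ G # post)) = (\<Sum>s\<in>\<sigma> ` G. F (map ((`) \<sigma>) pre @ {s} # map ((`) \<sigma>) post)) / real (card (\<sigma> ` G))"
      using F[unfolded slot_linear_def, rule_format, of "\<sigma> ` G" "map ((`) \<sigma>) pre" "map ((`) \<sigma>) post"] fG G(2)
      by auto
    then show "F (map ((`) \<sigma>) (pre @ G # post)) = (\<Sum>b\<in>G. F (map ((`) \<sigma>) (pre @ {b} # post))) / real (card G)"
      using inj by (simp add: sum.reindex card_image)
  qed
  also have "\<dots> = (\<Sum>b\<in>G. \<Sum>\<sigma>\<in>perms K. F (map ((`) \<sigma>) (pre @ {b} # post))) / real (card G)"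
    by (subst sum.swap) (simp add: sum_divide_distrib)
  also have "(\<Sum>b\<in>G. \<Sum>\<sigma>\<in>perms K. F (map ((`) \<sigma>) (pre @ {b} # post))) = (\<Sum>b\<in>G. \<Sum>\<sigma>\<in>perms K. F (map ((`) \<sigma>) (pre @ {a} # post)))"
    by (rule sum.cong[OF refl swap])
  also have "\<dots> / real (card G) = (\<Sum>\<sigma>\<in>perms K. F (map ((`) \<sigma>) (pre @ {a} # post)))"
    using c by simp
  finally show ?thesis .
qed

lemma sum_perms_blocks:
  assumes F: "slot_linear F"
    and G: "\<And>l. l < t \<Longrightarrow> G l \<subseteq> {..<K}" "\<And>l. l < t \<Longrightarrow> a l \<in> G l"
    and disj: "\<And>l l'. l < t \<Longrightarrow> l' < t \<Longrightarrow> l \<noteq> l' \<Longrightarrow> G l \<inter> G l' = {}"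
  shows "(\<Sum>\<sigma>\<in>perms K. F (map (\<lambda>l. \<sigma> ` G l) [0..<t])) = (\<Sum>\<sigma>\<in>perms K. F (map (\<lambda>l. {\<sigma> (a l)}) [0..<t]))"
proof -
  \<comment> \<open>Hybrid argument: the first u slots already hold single representatives, the
    others still hold blocks.\<close>
  define L where "L u = map (\<lambda>l. {a l}) [0..<u] @ map G [u..<t]" for u
  have "(\<Sum>\<sigma>\<in>perms K. F (map ((`) \<sigma>) (L u))) = (\<Sum>\<sigma>\<in>perms K. F (map ((`) \<sigma>) (L 0)))" if "u \<le> t" for u
    using that
  proof (induction u)
    case (Suc u)
    have 1: "L u = map (\<lambda>l. {a l}) [0..<u] @ G u # map G [Suc u..<t]"
      using Suc.prems by (simp add: L_def upt_conv_Cons)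
    have 2: "L (Suc u) = map (\<lambda>l. {a l}) [0..<u] @ {a u} # map G [Suc u..<t]"
      by (simp add: L_def)
    have "(\<Sum>\<sigma>\<in>perms K. F (map ((`) \<sigma>) (L u))) = (\<Sum>\<sigma>\<in>perms K. F (map ((`) \<sigma>) (L (Suc u))))"
      unfolding 1 2
    proof (rule sum_perms_slot[OF F])
      show "G u \<subseteq> {..<K}" "a u \<in> G u" using G Suc.prems by auto
      fix G' assume "G' \<in> set (map (\<lambda>l. {a l}) [0..<u]) \<union> set (map G [Suc u..<t])"
      then have "(\<exists>l<u. G' = {a l}) \<or> (\<exists>l. u < l \<and> l < t \<and> G' = G l)" by (auto simp: Suc_le_eq)
      then consider l where "l < u" "G' = {a l}" | l where "u < l" "l < t" "G' = G l" by blast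
      then show "G' \<inter> G u = {}"
      proof cases
        case 1
        then show ?thesis using disj[of l u] G(2)[of l] Suc.prems by auto
      next
        case 2
        then show ?thesis using disj[of l u] Suc.prems by auto
      qed
    qed
    then show ?case using Suc by simp
  qed simp
  from this[of t] show ?thesis by (simp add: L_def comp_def)
qed

context sampling
begin

lemma xi_avg: "xi G \<eta> = (\<lambda>i j. \<Sum>s\<in>G. (1 / real (card G)) * xi {s} \<eta> i j)"
  by (simp add: xi_def sum_divide_distrib)

definition chainG :: "(nat \<times> nat \<times> nat \<Rightarrow> bool) \<Rightarrow> nat set list \<Rightarrow> rmat \<Rightarrow> rmat" where
  "chainG \<eta> Gs Z = chain n A B (map (\<lambda>G. xi G \<eta>) Gs) Z"

lemma chainG_snoc: "chainG \<eta> (Gs @ [G]) Z = step n A B (xi G \<eta>) (chainG \<eta> Gs Z)"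
  by (simp add: chainG_def chain_append)

lemma chainG_Nil [simp]: "chainG \<eta> [] Z = Z" by (simp add: chainG_def)

lemma chainG_sum: "chainG \<eta> Gs (\<lambda>i j. \<Sum>c\<in>C. z c * Z c i j) = (\<lambda>i j. \<Sum>c\<in>C. z c * chainG \<eta> Gs (Z c) i j)"
  by (simp add: chainG_def chain_sum)

lemma chainG_slot:
  "chainG \<eta> (pre @ G # post) Z = (\<lambda>i j. \<Sum>s\<in>G. (1 / real (card G)) * chainG \<eta> (pre @ {s} # post) Z i j)"
  unfolding chainG_def by (simp add: chain_append) (subst xi_avg, simp only: step_sum_left chain_sum, simp)

text \<open>The noise added in the last step, before projection: it is this matrix, not the
  projected residual, that has a component normal to the tangent space.\<close>

definition incr :: "(nat \<times> nat \<times> nat \<Rightarrow> bool) \<Rightarrow> nat set list \<Rightarrow> rmat \<Rightarrow> rmat" where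
  "incr \<eta> Gs Z = had (xi (last Gs) \<eta>) (chainG \<eta> (butlast Gs) Z)"

lemma slot_linear_incr: "slot_linear (\<lambda>Gs. incr \<eta> Gs Z i j)"
  unfolding slot_linear_def
proof (intro allI impI)
  fix pre post :: "nat set list" and G :: "nat set"
  assume "finite G" "G \<noteq> {}"
  show "incr \<eta> (pre @ G # post) Z i j = (\<Sum>s\<in>G. incr \<eta> (pre @ {s} # post) Z i j) / real (card G)"
  \<comment> \<open>The last slot enters through its own weight, every earlier slot through the
    chain.\<close>
  proof (cases post rule: rev_cases)
    case Nil
    then show ?thesis
      by (simp add: incr_def had_def sum_distrib_right[symmetric] sum_divide_distrib[symmetric]) (simp add: xi_def)
  next
    case (snoc post' G')
    then have "butlast (pre @ S # post) = pre @ S # post'" "last (pre @ S # post) = G'" for S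
      by (auto simp: butlast_append)
    then show ?thesis
      unfolding incr_def by (simp add: had_def) (subst chainG_slot, simp add: sum_distrib_left sum_divide_distrib)
  qed
qed

lemma xi_upd: "s \<notin> G \<Longrightarrow> xi G (\<eta>((s, i, j) := v)) = xi G \<eta>"
proof -
  assume "s \<notin> G"
  then have "zeta rt (s', k, l) (\<eta>((s, i, j) := v)) = zeta rt (s', k, l) \<eta>" if "s' \<in> G" for s' k l
    using that by (intro zeta_upd_other) auto
  then show ?thesis by (simp add: xi_def cong: sum.cong)
qed

lemma chainG_upd: "(\<And>G. G \<in> set Gs \<Longrightarrow> s \<notin> G) \<Longrightarrow> chainG (\<eta>((s, i, j) := v)) Gs Z = chainG \<eta> Gs Z"
  by (induction Gs rule: rev_induct) (auto simp: chainG_snoc xi_upd)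

lemma indep_chainG:
  assumes "\<And>G'. G' \<in> set Gs \<Longrightarrow> G' \<inter> G = {}"
  shows "indep_bits (cells G) (\<lambda>\<eta>. chainG \<eta> Gs Z)"
  unfolding indep_bits_def
proof (intro ballI allI)
  fix c \<eta> v assume "c \<in> cells G"
  then obtain s i j where "c = (s, i, j)" "s \<in> G" by (auto simp: cells_def)
  then show "chainG (\<eta>(c := v)) Gs Z = chainG \<eta> Gs Z"
    using assms by (auto intro!: chainG_upd)
qed

lemma moments_mono:
  assumes W: "moments m W x y" and le: "x \<le> x'" "y \<le> y'"
  shows "moments m W x' y'"
proof -
  have x0: "0 \<le> x" "0 \<le> y" using W by (auto simp: moments_def)
  have up: "u \<le> z' * c ^ m" if "u \<le> z * c ^ m" "z \<le> z'" "0 < c" for u z z' c :: real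
    using that by (meson less_imp_le mult_right_mono order_trans zero_le_power)
  have p: "0 < A k k * B l l" if "k < n" "l < n" for k l using A.pos B.pos that by simp
  show ?thesis
    unfolding moments_def
    using W le x0 unfolding moments_def by (auto intro: up[OF _ le(1) p] up[OF _ le(2) A.pos] up[OF _ le(2) B.pos])
qed

context
  fixes g m :: nat and \<kappa> \<tau> R :: real
  assumes g: "1 \<le> g" and m: "1 \<le> m"
    and \<kappa>: "0 < \<kappa>" "\<And>k l. k < n \<Longrightarrow> l < n \<Longrightarrow> \<kappa> * lam k l \<le> real g * \<rho> k l"
    and \<tau>: "real m \<le> \<tau> * \<kappa>" "\<tau> \<le> 1"
    and R: "(\<Sum>k<n. A k k) \<le> R" "(\<Sum>l<n. B l l) \<le> R"
begin

text \<open>Entries contract on their own, while every step adds one more multiple of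
  \<open>R * x\<close> to the row bound; so the row bound carries a factor that is only linear in
  the length.\<close>

lemma chain_moments:
  assumes Z: "moments m (\<lambda>_. Z) x y"
    and Gs: "\<And>G. G \<in> set Gs \<Longrightarrow> G \<subseteq> {..<K} \<and> card G = g" and disj: "sorted_wrt (\<lambda>G G'. G \<inter> G' = {}) Gs"
  shows "moments m (\<lambda>\<eta>. chainG \<eta> Gs Z) (((288 * \<tau>) ^ m) ^ length Gs * x) (((288 * \<tau>) ^ m) ^ length Gs * (y + real (length Gs) * R * x))"
  using Gs disj
proof (induction Gs rule: rev_induct)
  case Nil
  then show ?case using Z by simp
next
  case (snoc G Gs)
  let ?a = "(288 * \<tau>) ^ m" and ?t = "length Gs"
  have G: "G \<subseteq> {..<K}" "card G = g" "G \<noteq> {}" using snoc.prems(1)[of G] g by auto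
  have \<tau>0: "0 \<le> \<tau>"
  proof -
    have "0 \<le> \<tau> * \<kappa>" using \<tau>(1) of_nat_0_le_iff order_trans by blast
    then show ?thesis using \<kappa>(1) by (simp add: zero_le_mult_iff)
  qed
  have x0: "0 \<le> x" "0 \<le> y" using Z by (auto simp: moments_def)
  have R0: "0 \<le> R" using R(1) A.pos by (smt (verit) lessThan_iff sum_nonneg)
  have \<kappa>': "\<kappa> * lam k l \<le> real (card G) * \<rho> k l" if "k < n" "l < n" for k l
    using \<kappa>(2)[OF that] G by simp
  have "moments m (\<lambda>\<eta>. step n A B (xi G \<eta>) (chainG \<eta> Gs Z)) (?a * (?a ^ ?t * x))
      ((32 * \<tau>) ^ m * (?a ^ ?t * (y + real ?t * R * x) + R * (?a ^ ?t * x)))"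
    by (rule step_moments[OF G(1,3) m \<kappa>(1) \<kappa>' \<tau> R])
      (use snoc in \<open>auto simp: sorted_wrt_append intro!: indep_chainG\<close>)
  then have "moments m (\<lambda>\<eta>. chainG \<eta> (Gs @ [G]) Z) (?a * (?a ^ ?t * x))
      ((32 * \<tau>) ^ m * (?a ^ ?t * (y + real ?t * R * x) + R * (?a ^ ?t * x)))"
    by (simp add: chainG_snoc)
  then show ?case
  proof (rule moments_mono)
    have "(32 * \<tau>) ^ m * (?a ^ ?t * (y + real ?t * R * x) + R * (?a ^ ?t * x)) = (32 * \<tau>) ^ m * (?a ^ ?t * (y + real (Suc ?t) * R * x))"
      by (simp add: algebra_simps)
    \<comment> \<open>The row rate 32 is weakened to the entry rate 288, so that both bounds share
      one contraction factor.\<close>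
    also have "\<dots> \<le> ?a * (?a ^ ?t * (y + real (Suc ?t) * R * x))"
      using \<tau>0 x0 R0 by (intro mult_right_mono power_mono mult_nonneg_nonneg add_nonneg_nonneg) auto
    finally show "(32 * \<tau>) ^ m * (?a ^ ?t * (y + real ?t * R * x) + R * (?a ^ ?t * x))
       \<le> ?a ^ length (Gs @ [G]) * (y + real (length (Gs @ [G])) * R * x)" by (simp add: mult.assoc)
  qed (simp add: mult.assoc)
qed

lemma schatten_incr:
  assumes Z: "moments m (\<lambda>_. Z) x y"
    and Gs: "\<And>G. G \<in> set Gs \<Longrightarrow> G \<subseteq> {..<K} \<and> card G = g" and disj: "sorted_wrt (\<lambda>G G'. G \<inter> G' = {}) Gs"
    and ne: "Gs \<noteq> []"
  shows "EE (\<lambda>\<eta>. schatten n m (incr \<eta> Gs Z)) \<le> real n * (((288 * \<tau>) ^ m) ^ length Gs * (y + real (length Gs) * R * x))"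
proof -
  obtain Gs' G where Gs': "Gs = Gs' @ [G]" using ne by (meson rev_exhaust)
  let ?a = "(288 * \<tau>) ^ m" and ?t = "length Gs'"
  have G: "G \<subseteq> {..<K}" "card G = g" "G \<noteq> {}" using Gs[of G] g Gs' by auto
  have \<tau>0: "0 \<le> \<tau>"
  proof -
    have "0 \<le> \<tau> * \<kappa>" using \<tau>(1) of_nat_0_le_iff order_trans by blast
    then show ?thesis using \<kappa>(1) by (simp add: zero_le_mult_iff)
  qed
  have x0: "0 \<le> x" "0 \<le> y" using Z by (auto simp: moments_def)
  have R0: "0 \<le> R" using R(1) A.pos by (smt (verit) lessThan_iff sum_nonneg)
  have \<kappa>': "\<kappa> * lam k l \<le> real (card G) * \<rho> k l" if "k < n" "l < n" for k l
    using \<kappa>(2)[OF that] G by simp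
  have "EE (\<lambda>\<eta>. schatten n m (had (xi G \<eta>) (chainG \<eta> Gs' Z))) \<le>
      real n * ((16 * \<tau>) ^ m * (?a ^ ?t * (y + real ?t * R * x) + R * (?a ^ ?t * x)))"
    by (rule schatten_step[OF G(1,3) m \<kappa>(1) \<kappa>' \<tau> R chain_moments[OF Z]])
      (use Gs disj Gs' in \<open>auto simp: sorted_wrt_append intro!: indep_chainG\<close>)
  also have "\<dots> = real n * ((16 * \<tau>) ^ m * (?a ^ ?t * (y + real (Suc ?t) * R * x)))"
    by (simp add: algebra_simps)
  also have "\<dots> \<le> real n * (?a * (?a ^ ?t * (y + real (Suc ?t) * R * x)))"
    using \<tau>0 x0 R0 by (intro mult_left_mono mult_right_mono power_mono mult_nonneg_nonneg add_nonneg_nonneg) auto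
  finally show ?thesis by (simp add: incr_def Gs' mult.assoc)
qed

end

text \<open>Mean-square contraction with single batches, where no block is required. The squared
  norm of the image of a matrix unit is at most \<open>lam\<close>, which the rate cancels;
  \<open>24 = 16 + 8\<close> is Rosenthal's constant for \<open>m = 1\<close>.\<close>

lemma chain_fro:
  assumes \<kappa>: "0 < \<kappa>" "\<And>k l. k < n \<Longrightarrow> l < n \<Longrightarrow> \<kappa> * lam k l \<le> \<rho> k l"
    and ss: "distinct ss" "set ss \<subseteq> {..<K}"
  shows "EE (\<lambda>\<eta>. \<Sum>i<n. \<Sum>j<n. (chainG \<eta> (map (\<lambda>s. {s}) ss) Z i j)\<^sup>2) \<le> (24 / \<kappa>) ^ length ss * (\<Sum>i<n. \<Sum>j<n. (Z i j)\<^sup>2)"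
  using ss
proof (induction ss rule: rev_induct)
  case Nil
  then show ?case by (simp add: bexp_const idx_def)
next
  case (snoc s ss)
  let ?W = "\<lambda>\<eta>. chainG \<eta> (map (\<lambda>s. {s}) ss) Z"
  let ?D = "{..<n} \<times> {..<n}"
  have ind: "indep_bits (cells {s}) ?W" using snoc.prems by (auto intro!: indep_chainG)
  have lp: "0 < lam k l" if "k < n" "l < n" for k l using lam_pos that by auto
  have "EE (\<lambda>\<eta>. \<Sum>i<n. \<Sum>j<n. (chainG \<eta> (map (\<lambda>s. {s}) (ss @ [s])) Z i j)\<^sup>2) =
     EE (\<lambda>\<eta>. nsq ?D (\<lambda>d. \<Sum>k<n. \<Sum>l<n. ker A B (fst d) (snd d) k l * (xi {s} \<eta> k l * ?W \<eta> k l)) ^ 1)"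
    by (simp add: chainG_snoc step_def PT_def had_def nsq_def sum_pairs)
  also have "\<dots> \<le> main_term {s} 1 ?W (\<lambda>k l. nsq ?D (\<lambda>d. ker A B (fst d) (snd d) k l))"
    by (rule linear_moment) (use snoc.prems ind in auto)
  also have "\<dots> \<le> main_term {s} 1 ?W lam"
  proof (rule main_term_mono, rule conjI)
    fix k l assume kl: "k < n" "l < n"
    have "nsq ?D (\<lambda>d. ker A B (fst d) (snd d) k l) = (\<Sum>i<n. \<Sum>j<n. (ker A B i j k l)\<^sup>2)"
      by (simp add: nsq_def sum_pairs)
    also have "\<dots> \<le> (\<Sum>i<n. (A i k)\<^sup>2 + (if i = k then B l l else 0))"
      by (intro sum_mono ker_row_sq) (use kl in auto)
    also have "\<dots> = (\<Sum>i<n. (A k i)\<^sup>2) + B l l" using kl A.sym[of k] by (simp add: sum.distrib)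
    also have "\<dots> = lam k l" using A.row_sq[OF kl(1)] by (simp add: lam_def)
    finally show "nsq ?D (\<lambda>d. ker A B (fst d) (snd d) k l) \<le> lam k l" .
  qed (rule nsq_nonneg)
  also have "\<dots> = 24 * EE (\<lambda>\<eta>. \<Sum>k<n. \<Sum>l<n. (?W \<eta> k l)\<^sup>2 * lam k l / \<rho> k l)"
    by (simp add: main_term_def)
  also have "\<dots> \<le> 24 * EE (\<lambda>\<eta>. \<Sum>k<n. \<Sum>l<n. 1 / \<kappa> * (?W \<eta> k l)\<^sup>2)"
  proof (intro mult_left_mono EE_mono sum_mono)
    fix \<eta> k l assume "k \<in> {..<n}" "l \<in> {..<n}"
    then have kl: "k < n" "l < n" by auto
    have "lam k l / \<rho> k l \<le> 1 / \<kappa>"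
      using \<kappa>(2)[OF kl] \<kappa>(1) \<rho>01[OF kl] by (simp add: field_simps)
    then have "(?W \<eta> k l)\<^sup>2 * (lam k l / \<rho> k l) \<le> (?W \<eta> k l)\<^sup>2 * (1 / \<kappa>)" by (intro mult_left_mono) auto
    then show "(?W \<eta> k l)\<^sup>2 * lam k l / \<rho> k l \<le> 1 / \<kappa> * (?W \<eta> k l)\<^sup>2" by simp
  qed auto
  also have "\<dots> = (24 / \<kappa>) * EE (\<lambda>\<eta>. \<Sum>k<n. \<Sum>l<n. (?W \<eta> k l)\<^sup>2)"
    by (simp only: sum_distrib_left[symmetric] bexp_cmult mult.assoc[symmetric] times_divide_eq_right mult_1_right)
  also have "\<dots> \<le> (24 / \<kappa>) * ((24 / \<kappa>) ^ length ss * (\<Sum>i<n. \<Sum>j<n. (Z i j)\<^sup>2))"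
    using snoc \<kappa>(1) by (intro mult_left_mono) auto
  finally show ?case by simp
qed

end

section \<open>Disjoint blocks of batches and the three random quantities to be controlled\<close>

definition unit_mat :: "nat \<Rightarrow> nat \<Rightarrow> rmat" where
  "unit_mat a b = (\<lambda>i j. if i = a \<and> j = b then 1 else 0)"

text \<open>An initial piece of the residue class of l modulo \<open>Suc t\<close>. It contains l
  itself, so batches 0 to t are representatives of the t + 1 disjoint blocks.\<close>

definition block :: "nat \<Rightarrow> nat \<Rightarrow> nat \<Rightarrow> nat set" where
  "block K t l = (\<lambda>j. l + Suc t * j) ` {..<K div Suc t}"

lemma block_subset: "l \<le> t \<Longrightarrow> block K t l \<subseteq> {..<K}"
proof
  fix x assume l: "l \<le> t" and "x \<in> block K t l"
  then obtain j where j: "x = l + Suc t * j" "j < K div Suc t" by (auto simp: block_def)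
  then have "Suc t * Suc j \<le> Suc t * (K div Suc t)" by (intro mult_le_mono) auto
  also have "\<dots> \<le> K" by (rule times_div_less_eq_dividend)
  finally show "x \<in> {..<K}" using j l by simp
qed
  
lemma block_disjoint: "l \<le> t \<Longrightarrow> l' \<le> t \<Longrightarrow> l \<noteq> l' \<Longrightarrow> block K t l \<inter> block K t l' = {}"
proof -
  assume l: "l \<le> t" "l' \<le> t" "l \<noteq> l'"
  have "x mod Suc t = l" if "x \<in> block K t l" "l \<le> t" for x l
    using that by (auto simp: block_def simp del: mult_Suc)
  then show ?thesis using l by blast
qed

lemma card_block: "card (block K t l) = K div Suc t"
  unfolding block_def by (subst card_image) (auto simp: inj_on_def simp del: mult_Suc)

lemma first_in_block: "t < K \<Longrightarrow> l \<in> block K t l"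
  unfolding block_def using div_greater_zero_iff[of K "Suc t"] by (intro image_eqI[of _ _ 0]) auto

context sampling
begin

definition avg :: "((nat \<Rightarrow> nat) \<Rightarrow> real) \<Rightarrow> real" where
  "avg f = (\<Sum>\<sigma>\<in>perms K. f \<sigma>) / fact K"

lemma avg_mono: "(\<And>\<sigma>. \<sigma> \<in> perms K \<Longrightarrow> f \<sigma> \<le> g \<sigma>) \<Longrightarrow> avg f \<le> avg g"
  unfolding avg_def by (intro divide_right_mono sum_mono) auto

lemma avg_const: "avg (\<lambda>_. c) = c"
  by (simp add: avg_def card_perms)

lemma EE_avg: "EE (\<lambda>\<eta>. avg (\<lambda>\<sigma>. f \<sigma> \<eta>)) = avg (\<lambda>\<sigma>. EE (f \<sigma>))"
proof -
  have "avg g = (1 / fact K) * (\<Sum>\<sigma>\<in>perms K. g \<sigma>)" for g by (simp add: avg_def)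
  then show ?thesis by (simp only: bexp_cmult bexp_sum)
qed

lemma EE_avg_le: "(\<And>\<sigma>. \<sigma> \<in> perms K \<Longrightarrow> EE (f \<sigma>) \<le> c) \<Longrightarrow> EE (\<lambda>\<eta>. avg (\<lambda>\<sigma>. f \<sigma> \<eta>)) \<le> c"
  using avg_mono[of "\<lambda>\<sigma>. EE (f \<sigma>)" "\<lambda>_. c"] by (simp add: EE_avg avg_const)

definition walk :: "(nat \<times> nat \<times> nat \<Rightarrow> bool) \<Rightarrow> (nat \<Rightarrow> nat) \<Rightarrow> nat \<Rightarrow> rmat \<Rightarrow> rmat" where
  "walk \<eta> \<sigma> t Z = chainG \<eta> (map (\<lambda>l. {\<sigma> l}) [0..<t]) Z"

lemma walk_0 [simp]: "walk \<eta> \<sigma> 0 Z = Z" by (simp add: walk_def)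

lemma walk_Suc: "walk \<eta> \<sigma> (Suc t) Z = step n A B (xi {\<sigma> t} \<eta>) (walk \<eta> \<sigma> t Z)"
  by (simp add: walk_def chainG_snoc)

text \<open>A Hilbert-Schmidt bound on the final residual as a linear map. Summing over all matrix
  units gives control of every starting matrix at once, as is necessary when the tested perturbation
  depends on the sample.\<close>

definition T1 :: "(nat \<times> nat \<times> nat \<Rightarrow> bool) \<Rightarrow> real" where
  "T1 \<eta> = (\<Sum>a<n. \<Sum>b<n. avg (\<lambda>\<sigma>. \<Sum>i<n. \<Sum>j<n. (walk \<eta> \<sigma> K (PT n A B (unit_mat a b)) i j)\<^sup>2))"

text \<open>A crude bound, again for all starting matrices at once, on the sum of the absolute
  entries of the certificate. Polynomial size is enough, since it is multiplied by the tiny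
  residual.\<close>

definition T2 :: "(nat \<times> nat \<times> nat \<Rightarrow> bool) \<Rightarrow> real" where
  "T2 \<eta> = (\<Sum>a<n. \<Sum>b<n. \<Sum>t<K. avg (\<lambda>\<sigma>. \<Sum>i<n. \<Sum>j<n. (1 + xi {\<sigma> t} \<eta> i j) * \<bar>walk \<eta> \<sigma> t (PT n A B (unit_mat a b)) i j\<bar>))"

text \<open>The moment order is the block size \<open>K div Suc t\<close>, which balances the order
  of the moment against the rate of a block.\<close>

definition T3 :: "rmat \<Rightarrow> nat \<Rightarrow> (nat \<times> nat \<times> nat \<Rightarrow> bool) \<Rightarrow> real" where
  "T3 Z t \<eta> = avg (\<lambda>\<sigma>. schatten n (K div Suc t) (incr \<eta> (map (\<lambda>l. \<sigma> ` block K t l) [0..<Suc t]) Z))"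

lemma PT_unit_sq:
  assumes "a < n" "b < n"
  shows "(\<Sum>i<n. \<Sum>j<n. (PT n A B (unit_mat a b) i j)\<^sup>2) \<le> 2"
proof -
  have u: "PT n A B (unit_mat a b) i j = ker A B i j a b" for i j
  proof -
    have "PT n A B (unit_mat a b) i j = (\<Sum>k<n. \<Sum>l<n. if l = b then (if k = a then ker A B i j a b else 0) else 0)"
      unfolding PT_def unit_mat_def by (intro sum.cong refl) auto
    then show ?thesis using assms by simp
  qed
  have "(\<Sum>i<n. \<Sum>j<n. (PT n A B (unit_mat a b) i j)\<^sup>2) \<le> (\<Sum>i<n. (A i a)\<^sup>2 + (if i = a then B b b else 0))"
    unfolding u by (intro sum_mono ker_row_sq) (use assms in auto)
  also have "\<dots> = A a a + B b b"
  proof -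
    have "(\<Sum>i<n. (A i a)\<^sup>2) = (\<Sum>i<n. (A a i)\<^sup>2)"
      by (intro sum.cong refl arg_cong[where f = "\<lambda>x. x\<^sup>2"] A.sym)
    then show ?thesis using assms A.row_sq[of a] by (simp add: sum.distrib)
  qed
  also have "\<dots> \<le> 2" using A.diag_le_1[OF assms(1)] B.diag_le_1[OF assms(2)] by simp
  finally show ?thesis .
qed

lemma perms_inj: "\<sigma> \<in> perms K \<Longrightarrow> inj \<sigma>"
  by (auto simp: perms_def permutes_inj)

lemma perms_less: "\<sigma> \<in> perms K \<Longrightarrow> t < K \<Longrightarrow> \<sigma> t < K"
  using permutes_in_image[of \<sigma> "{..<K}" t] by (auto simp: perms_def)

lemma perms_image: "\<sigma> \<in> perms K \<Longrightarrow> G \<subseteq> {..<K} \<Longrightarrow> \<sigma> ` G \<subseteq> {..<K}"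
  using perms_less by fastforce

context
  fixes \<kappa> :: real
  assumes \<kappa>: "24 \<le> \<kappa>" "\<And>k l. k < n \<Longrightarrow> l < n \<Longrightarrow> \<kappa> * lam k l \<le> \<rho> k l"
begin

lemma walk_fro:
  assumes "\<sigma> \<in> perms K" "t \<le> K" "a < n" "b < n"
  shows "EE (\<lambda>\<eta>. \<Sum>i<n. \<Sum>j<n. (walk \<eta> \<sigma> t (PT n A B (unit_mat a b)) i j)\<^sup>2) \<le> (24 / \<kappa>) ^ t * 2"
proof -
  have d: "distinct (map \<sigma> [0..<t])" "set (map \<sigma> [0..<t]) \<subseteq> {..<K}"
    using perms_inj[OF assms(1)] perms_less[OF assms(1)] assms(2)
    by (auto simp: distinct_map intro: inj_on_subset)
  have "EE (\<lambda>\<eta>. \<Sum>i<n. \<Sum>j<n. (walk \<eta> \<sigma> t (PT n A B (unit_mat a b)) i j)\<^sup>2)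
     \<le> (24 / \<kappa>) ^ t * (\<Sum>i<n. \<Sum>j<n. (PT n A B (unit_mat a b) i j)\<^sup>2)"
    using chain_fro[OF _ \<kappa>(2) d, of "PT n A B (unit_mat a b)"] \<kappa>(1) by (simp add: walk_def comp_def)
  also have "\<dots> \<le> (24 / \<kappa>) ^ t * 2"
    using \<kappa>(1) by (intro mult_left_mono PT_unit_sq assms) auto
  finally show ?thesis .
qed

lemma EE_T1: "EE T1 \<le> (real n)\<^sup>2 * ((24 / \<kappa>) ^ K * 2)"
proof -
  have "EE T1 = (\<Sum>a<n. \<Sum>b<n. EE (\<lambda>\<eta>. avg (\<lambda>\<sigma>. \<Sum>i<n. \<Sum>j<n. (walk \<eta> \<sigma> K (PT n A B (unit_mat a b)) i j)\<^sup>2)))"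
    unfolding T1_def[abs_def] by (simp add: bexp_sum)
  also have "\<dots> \<le> (\<Sum>a<n. \<Sum>b<n. (24 / \<kappa>) ^ K * 2)"
    by (intro sum_mono EE_avg_le walk_fro) auto
  finally show ?thesis by (simp add: power2_eq_square mult.assoc)
qed

text \<open>The weight \<open>1 + xi {s}\<close> at one cell has mean 1 and is independent of
  f.\<close>

lemma EE_weight:
  assumes s: "s < K" "i < n" "j < n" and f: "indep_bits (cells {s}) f"
  shows "EE (\<lambda>\<eta>. (1 + xi {s} \<eta> i j) * f \<eta>) = EE f"
proof -
  have mem: "(s, i, j) \<in> idx" "finite idx" using s by (auto simp: idx_def)
  have up: "f (\<eta>((s, i, j) := v)) = f \<eta>" for \<eta> v
    using f s by (auto simp: indep_bits_def cells_def)
  have p: "0 < \<rho> i j" using \<rho>01 s by auto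
  have x: "1 + xi {s} \<eta> i j = of_bool (\<eta> (s, i, j)) / \<rho> i j" for \<eta>
    by (simp add: xi_def zeta_def rt_def)
  have "EE (\<lambda>\<eta>. (1 + xi {s} \<eta> i j) * f \<eta>) = EE (\<lambda>\<eta>. rt (s, i, j) * (f \<eta> / \<rho> i j))"
    unfolding x by (subst bexp_split[OF mem(2,1)]) (simp add: up)
  also have "\<dots> = EE f" using p by (simp add: rt_def)
  finally show ?thesis .
qed

lemma EE_T2: "EE T2 \<le> 2 * real K * (real n) ^ 4"
proof (cases "n = 0")
  case True
  have z: "T2 = (\<lambda>_. 0)" unfolding T2_def[abs_def] using True by simp
  have "EE T2 = 0" unfolding z by (rule bexp_const) (simp add: idx_def)
  then show ?thesis by simp
next
  case False
  have n1: "1 \<le> (real n)\<^sup>2" using False by (intro one_le_power) simp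
  have le: "EE (\<lambda>\<eta>. \<Sum>i<n. \<Sum>j<n. (1 + xi {\<sigma> t} \<eta> i j) * \<bar>walk \<eta> \<sigma> t (PT n A B (unit_mat a b)) i j\<bar>) \<le> 2 * (real n)\<^sup>2"
    if \<sigma>: "\<sigma> \<in> perms K" and t: "t < K" and ab: "a < n" "b < n" for \<sigma> t a b
  proof -
    let ?W = "\<lambda>\<eta>. walk \<eta> \<sigma> t (PT n A B (unit_mat a b))"
    have ind: "indep_bits (cells {\<sigma> t}) ?W"
      unfolding walk_def by (intro indep_chainG) (auto simp: inj_eq[OF perms_inj[OF \<sigma>]])
    have "EE (\<lambda>\<eta>. \<Sum>i<n. \<Sum>j<n. (1 + xi {\<sigma> t} \<eta> i j) * \<bar>?W \<eta> i j\<bar>) = (\<Sum>i<n. \<Sum>j<n. EE (\<lambda>\<eta>. \<bar>?W \<eta> i j\<bar>))"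
    proof -
      have "EE (\<lambda>\<eta>. (1 + xi {\<sigma> t} \<eta> i j) * \<bar>?W \<eta> i j\<bar>) = EE (\<lambda>\<eta>. \<bar>?W \<eta> i j\<bar>)" if "i < n" "j < n" for i j
        by (rule EE_weight[OF perms_less[OF \<sigma> t] that]) (use ind in \<open>simp add: indep_bits_def\<close>)
      then show ?thesis unfolding bexp_sum by simp
    qed
    \<comment> \<open>First moments are replaced by second moments, for which
      \<open>walk_fro\<close> applies.\<close>
    also have "\<dots> \<le> (\<Sum>i<n. \<Sum>j<n. EE (\<lambda>\<eta>. 1 + (?W \<eta> i j)\<^sup>2 / 2))"
    proof (intro sum_mono EE_mono)
      fix \<eta> i j
      have "\<bar>x\<bar> \<le> 1 + x\<^sup>2 / 2" for x :: real
        using zero_le_power2[of "\<bar>x\<bar> - 1"] by (simp add: power2_diff)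
      then show "\<bar>?W \<eta> i j\<bar> \<le> 1 + (?W \<eta> i j)\<^sup>2 / 2" .
    qed auto
    also have "\<dots> = (real n)\<^sup>2 + EE (\<lambda>\<eta>. \<Sum>i<n. \<Sum>j<n. (?W \<eta> i j)\<^sup>2) / 2"
    proof -
      have "EE (\<lambda>\<eta>. 1 + (?W \<eta> i j)\<^sup>2 / 2) = 1 + (1 / 2) * EE (\<lambda>\<eta>. (?W \<eta> i j)\<^sup>2)" for i j
        unfolding bexp_cmult[symmetric] by (simp add: bexp_add bexp_const idx_def)
      then show ?thesis
        unfolding bexp_sum by (simp add: sum.distrib power2_eq_square sum_divide_distrib)
    qed
    also have "\<dots> \<le> (real n)\<^sup>2 + 1"
    proof -
      have "(24 / \<kappa>) ^ t \<le> 1" using \<kappa>(1) by (intro power_le_one) auto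
      then show ?thesis using walk_fro[OF \<sigma> less_imp_le[OF t] ab] by simp
    qed
    finally show ?thesis using n1 by simp
  qed
  have "EE T2 = (\<Sum>a<n. \<Sum>b<n. \<Sum>t<K. EE (\<lambda>\<eta>. avg (\<lambda>\<sigma>. \<Sum>i<n. \<Sum>j<n. (1 + xi {\<sigma> t} \<eta> i j) * \<bar>walk \<eta> \<sigma> t (PT n A B (unit_mat a b)) i j\<bar>)))"
    unfolding T2_def[abs_def] by (simp add: bexp_sum)
  also have "\<dots> \<le> (\<Sum>a<n. \<Sum>b<n. \<Sum>t<K. 2 * (real n)\<^sup>2)"
    by (intro sum_mono EE_avg_le le) auto
  also have "\<dots> = 2 * real K * (real n) ^ 4" by (simp add: power2_eq_square power4_eq_xxxx)
  finally show ?thesis .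
qed

lemma EE_T3:
  assumes t: "t < K" and Z: "moments (K div Suc t) (\<lambda>_. Z) x x"
    and R: "(\<Sum>k<n. A k k) \<le> R" "(\<Sum>l<n. B l l) \<le> R"
  shows "EE (T3 Z t) \<le> real n * (((288 / \<kappa>) ^ (K div Suc t)) ^ Suc t * (x + real (Suc t) * R * x))"
proof -
  define g where "g = K div Suc t"
  have g: "1 \<le> g" using t div_greater_zero_iff[of K "Suc t"] by (simp add: g_def Suc_le_eq)
  have "EE (\<lambda>\<eta>. schatten n g (incr \<eta> (map (\<lambda>l. \<sigma> ` block K t l) [0..<Suc t]) Z)) \<le>
    real n * (((288 / \<kappa>) ^ g) ^ Suc t * (x + real (Suc t) * R * x))" if \<sigma>: "\<sigma> \<in> perms K" for \<sigma>
  proof -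
    let ?Gs = "map (\<lambda>l. \<sigma> ` block K t l) [0..<Suc t]"
    have "EE (\<lambda>\<eta>. schatten n g (incr \<eta> ?Gs Z)) \<le> real n * (((288 * (1 / \<kappa>)) ^ g) ^ length ?Gs * (x + real (length ?Gs) * R * x))"
    \<comment> \<open>With moment order and block size both equal to g, the block rate is
      \<open>g * \<kappa>\<close> and \<tau> becomes \<open>1 / \<kappa>\<close>, free of g and
      t.\<close>
    proof (rule schatten_incr[where \<kappa> = "real g * \<kappa>", OF g g])
      show "0 < real g * \<kappa>" using g \<kappa>(1) by simp
      show "real g * \<kappa> * lam k l \<le> real g * \<rho> k l" if "k < n" "l < n" for k l
        using \<kappa>(2)[OF that] by (simp add: mult.assoc mult_left_mono)
      show "real g \<le> 1 / \<kappa> * (real g * \<kappa>)" "1 / \<kappa> \<le> 1" using \<kappa>(1) by auto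
      show "moments g (\<lambda>_. Z) x x" using Z by (simp add: g_def)
      show "G \<subseteq> {..<K} \<and> card G = g" if "G \<in> set ?Gs" for G
      proof -
        obtain l where l: "l \<le> t" "G = \<sigma> ` block K t l" using \<open>G \<in> set ?Gs\<close> by (auto simp: less_Suc_eq_le simp del: upt_Suc)
        then show ?thesis using perms_image[OF \<sigma> block_subset[OF l(1)]] card_image[of \<sigma> "block K t l"] perms_inj[OF \<sigma>]
          by (auto simp: card_block g_def intro: inj_on_subset)
      qed
      show "sorted_wrt (\<lambda>G G'. G \<inter> G' = {}) ?Gs"
        unfolding sorted_wrt_map
        by (rule sorted_wrt_mono_rel[of _ "(<)"])
          (auto simp: image_Int[OF perms_inj[OF \<sigma>], symmetric] block_disjoint simp del: upt_Suc)
    qed (use R in auto)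
    then show ?thesis by simp
  qed
  then show ?thesis unfolding T3_def[abs_def] g_def by (intro EE_avg_le)
qed

end

end

section \<open>The nuclear norm\<close>

abbreviation ip :: "nat \<Rightarrow> rmat \<Rightarrow> rmat \<Rightarrow> real" where
  "ip n \<equiv> frob_inner n n"

lemma ip_commute: "ip n X Y = ip n Y X"
  by (simp add: frob_inner_def mult.commute)

lemma ip_add_right: "ip n X (\<lambda>i j. Y i j + Z i j) = ip n X Y + ip n X Z"
  by (simp add: frob_inner_def distrib_left sum.distrib)

lemma ip_diff_left: "ip n (\<lambda>i j. X i j - Y i j) Z = ip n X Z - ip n Y Z"
  by (simp add: frob_inner_def left_diff_distrib sum_subtractf)

lemma ip_cong: "(\<And>i j. i < n \<Longrightarrow> j < n \<Longrightarrow> X i j = X' i j) \<Longrightarrow> (\<And>i j. i < n \<Longrightarrow> j < n \<Longrightarrow> Y i j = Y' i j) \<Longrightarrow> ip n X Y = ip n X' Y'"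
  unfolding frob_inner_def by (intro sum.cong refl) auto

lemma ip_sum_left: "ip n (\<lambda>i j. \<Sum>c\<in>C. z c * X c i j) Y = (\<Sum>c\<in>C. z c * ip n (X c) Y)"
  using sum_swap_mat[where n = n and f = Y and z = z and g = X and C = C] by (simp add: frob_inner_def mult.commute)

lemma fro_sq: "(fro_norm n n X)\<^sup>2 = (\<Sum>i<n. \<Sum>j<n. (X i j)\<^sup>2)"
  by (simp add: fro_norm_def sum_nonneg)

lemma fro_nonneg: "0 \<le> fro_norm n n X"
  by (simp add: fro_norm_def sum_nonneg)

lemma ip_self: "ip n X X = (fro_norm n n X)\<^sup>2"
  unfolding fro_sq by (simp add: frob_inner_def power2_eq_square)

lemma ip_pairs: "ip n X Y = (\<Sum>c\<in>{..<n} \<times> {..<n}. X (fst c) (snd c) * Y (fst c) (snd c))"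
  by (simp add: frob_inner_def sum.cartesian_product split_def)

lemma fro_pairs: "(fro_norm n n X)\<^sup>2 = (\<Sum>c\<in>{..<n} \<times> {..<n}. (X (fst c) (snd c))\<^sup>2)"
  by (simp add: fro_sq sum.cartesian_product split_def)

lemma ip_cauchy: "\<bar>ip n X Y\<bar> \<le> fro_norm n n X * fro_norm n n Y"
proof -
  have "(ip n X Y)\<^sup>2 \<le> (fro_norm n n X * fro_norm n n Y)\<^sup>2"
    unfolding ip_pairs power_mult_distrib fro_pairs by (rule Cauchy_Schwarz_ineq_sum)
  then show ?thesis by (metis abs_le_square_iff abs_of_nonneg fro_nonneg mult_nonneg_nonneg)
qed

lemma entry_le_fro: "i < n \<Longrightarrow> j < n \<Longrightarrow> \<bar>X i j\<bar> \<le> fro_norm n n X"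
proof -
  assume ij: "i < n" "j < n"
  have "(X (fst (i, j)) (snd (i, j)))\<^sup>2 \<le> (fro_norm n n X)\<^sup>2"
    unfolding fro_pairs by (rule member_le_sum) (use ij in auto)
  then show ?thesis by (metis abs_le_square_iff abs_of_nonneg fro_nonneg fst_conv snd_conv)
qed

lemma fro_zero: "fro_norm n n X = 0 \<Longrightarrow> i < n \<Longrightarrow> j < n \<Longrightarrow> X i j = 0"
  using entry_le_fro[of i n j X] by simp

lemma vnorm_nonneg [simp]: "0 \<le> vnorm m x"
  by (simp add: vnorm_def sum_nonneg)

lemma vnorm_sq: "(vnorm m x)\<^sup>2 = (\<Sum>i<m. (x i)\<^sup>2)"
  by (simp add: vnorm_def sum_nonneg)

lemma vdot_le: "(\<Sum>i<m. \<bar>x i * y i\<bar>) \<le> vnorm m x * vnorm m y"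
proof -
  have "(\<Sum>i<m. \<bar>x i\<bar> * \<bar>y i\<bar>)\<^sup>2 \<le> (\<Sum>i<m. \<bar>x i\<bar>\<^sup>2) * (\<Sum>i<m. \<bar>y i\<bar>\<^sup>2)"
    by (rule Cauchy_Schwarz_ineq_sum)
  also have "\<dots> = (vnorm m x * vnorm m y)\<^sup>2" by (simp add: power_mult_distrib vnorm_sq)
  finally show ?thesis
    unfolding abs_mult by (rule power2_le_imp_le) simp
qed

lemma vdot_abs_le: "\<bar>\<Sum>i<m. x i * y i\<bar> \<le> vnorm m x * vnorm m y"
  by (rule order_trans[OF sum_abs vdot_le])

lemma vnorm_bessel: "orthonormal_cols m k U \<Longrightarrow> vnorm k (\<lambda>t. \<Sum>i<m. U i t * x i) \<le> vnorm m x"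
  unfolding vnorm_def by (intro real_sqrt_le_mono bessel)

lemma vnorm_col: "orthonormal_cols m k U \<Longrightarrow> t < k \<Longrightarrow> vnorm m (\<lambda>i. U i t) = 1"
  using orthonormal_colsD[of m k U t t] by (simp add: vnorm_def power2_eq_square)

text \<open>Spectral norm at most b, stated through the bilinear form so that no supremum has to be
  handled.\<close>

definition opb :: "nat \<Rightarrow> real \<Rightarrow> rmat \<Rightarrow> bool" where
  "opb n b Z \<longleftrightarrow> (\<forall>x y. \<bar>bil n Z x y\<bar> \<le> b * vnorm n x * vnorm n y)"

lemma ip_svd:
  assumes "is_svd n N P Q s"
  shows "ip n Y N = (\<Sum>k<n. s k * bil n Y (\<lambda>i. P i k) (\<lambda>j. Q j k))"
proof -
  have "ip n Y N = (\<Sum>i<n. \<Sum>j<n. Y i j * (\<Sum>k<n. s k * (P i k * Q j k)))"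
    unfolding frob_inner_def by (intro sum.cong refl) (simp add: is_svdD(4)[OF assms] mult.assoc)
  also have "\<dots> = (\<Sum>k<n. s k * (\<Sum>i<n. \<Sum>j<n. Y i j * (P i k * Q j k)))"
    by (rule sum_swap_mat)
  finally show ?thesis by (simp add: bil_def mult_ac)
qed

lemma ip_opb_le:
  assumes "is_svd n N P Q s" "opb n b Y"
  shows "\<bar>ip n Y N\<bar> \<le> b * (\<Sum>k<n. s k)"
proof -
  have "\<bar>ip n Y N\<bar> \<le> (\<Sum>k<n. \<bar>s k * bil n Y (\<lambda>i. P i k) (\<lambda>j. Q j k)\<bar>)"
    unfolding ip_svd[OF assms(1)] by (rule sum_abs)
  also have "\<dots> \<le> (\<Sum>k<n. s k * b)"
  proof (rule sum_mono)
    fix k assume "k \<in> {..<n}"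
    then have k: "k < n" by simp
    have "\<bar>bil n Y (\<lambda>i. P i k) (\<lambda>j. Q j k)\<bar> \<le> b * 1 * 1"
      using assms(2) vnorm_col[OF is_svdD(1)[OF assms(1)] k] vnorm_col[OF is_svdD(2)[OF assms(1)] k]
      unfolding opb_def by metis
    then show "\<bar>s k * bil n Y (\<lambda>i. P i k) (\<lambda>j. Q j k)\<bar> \<le> s k * b"
      using is_svdD(3)[OF assms(1) k] by (simp add: abs_mult mult_left_mono)
  qed
  finally show ?thesis by (simp add: sum_distrib_left mult.commute)
qed

lemma opb_outer:
  assumes "orthonormal_cols n r U" "orthonormal_cols n r V"
  shows "opb n 1 (\<lambda>i j. \<Sum>t<r. U i t * V j t)"
  unfolding opb_def
proof (intro allI)
  fix x y
  have "bil n (\<lambda>i j. \<Sum>t<r. U i t * V j t) x y = (\<Sum>i<n. \<Sum>j<n. (\<Sum>a<r. 1 * U i a * V j a) * (\<Sum>b<Suc 0. 1 * x i * y j))"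
    unfolding bil_def by (intro sum.cong refl) (simp add: sum_distrib_left sum_distrib_right mult_ac)
  also have "\<dots> = (\<Sum>t<r. (\<Sum>i<n. U i t * x i) * (\<Sum>j<n. V j t * y j))"
    unfolding inner_low_rank by simp
  finally have "\<bar>bil n (\<lambda>i j. \<Sum>t<r. U i t * V j t) x y\<bar> \<le> vnorm r (\<lambda>t. \<Sum>i<n. U i t * x i) * vnorm r (\<lambda>t. \<Sum>j<n. V j t * y j)"
    using vdot_abs_le by simp
  also have "\<dots> \<le> vnorm n x * vnorm n y"
    by (intro mult_mono vnorm_bessel assms) auto
  finally show "\<bar>bil n (\<lambda>i j. \<Sum>t<r. U i t * V j t) x y\<bar> \<le> 1 * vnorm n x * vnorm n y" by simp
qed

lemma nuc_norm_decomp: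
  "mat_eq n n A (mmul n (mmul n P (diagm s)) (mtrans Q)) \<longleftrightarrow> (\<forall>i<n. \<forall>j<n. A i j = (\<Sum>k<n. s k * P i k * Q j k))"
proof -
  have "mmul n (mmul n P (diagm s)) (mtrans Q) i j = (\<Sum>k<n. s k * P i k * Q j k)" for i j
  proof -
    have "(\<Sum>t<n. P i t * (if t = k then s t else 0)) = (\<Sum>t<n. if t = k then P i k * s k else 0)" for k
      by (intro sum.cong) auto
    then show ?thesis by (simp add: mmul_def diagm_def mtrans_def) (intro sum.cong, auto simp: mult_ac)
  qed
  then show ?thesis by (simp add: mat_eq_def)
qed

text \<open>The choice in \<open>nuc_norm\<close> is well defined: testing A against the product
  \<open>P Q^T\<close> from one decomposition shows that its sum is at most that of any
  other.\<close>

lemma nuc_norm_eq: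
  assumes "is_svd n A P Q s"
  shows "nuc_norm n A = (\<Sum>k<n. s k)"
proof -
  have nn: "(\<exists>P Q s. orthogonal_mat n P \<and> orthogonal_mat n Q \<and> (\<forall>k<n. 0 \<le> s k) \<and>
      mat_eq n n A (mmul n (mmul n P (diagm s)) (mtrans Q)) \<and> t = (\<Sum>k<n. s k)) \<longleftrightarrow> (\<exists>P Q s. is_svd n A P Q s \<and> t = (\<Sum>k<n. s k))" for t
    unfolding nuc_norm_decomp is_svd_def orthogonal_mat_def by blast
  have le: "sum s {..<n} \<le> sum s' {..<n}" if "is_svd n A P Q s" "is_svd n A P' Q' s'" for P Q s P' Q' s'
  proof -
    let ?Y = "\<lambda>i j. \<Sum>t<n. P i t * Q j t"
    have "bil n ?Y (\<lambda>i. P i k) (\<lambda>j. Q j k) = 1" if "k < n" for k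
    proof -
      have "is_svd n ?Y P Q (\<lambda>_. 1)" using \<open>is_svd n A P Q s\<close> by (simp add: is_svd_def)
      from bil_svd_left[OF this \<open>k < n\<close>] show ?thesis
        using orthonormal_colsD[OF is_svdD(2)[OF \<open>is_svd n A P Q s\<close>] \<open>k < n\<close> \<open>k < n\<close>] by simp
    qed
    then have "sum s {..<n} = ip n ?Y A" unfolding ip_svd[OF that(1)] by simp
    also have "\<dots> \<le> 1 * sum s' {..<n}"
      using ip_opb_le[OF that(2) opb_outer[OF is_svdD(1,2)[OF that(1)]]] by linarith
    finally show ?thesis by simp
  qed
  show ?thesis
    unfolding nuc_norm_def nn
  proof (rule some_equality)
    show "\<exists>P Q s'. is_svd n A P Q s' \<and> sum s {..<n} = sum s' {..<n}" using assms by blast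
    fix t assume "\<exists>P Q s'. is_svd n A P Q s' \<and> t = sum s' {..<n}"
    then show "t = sum s {..<n}" using le assms by (metis order_antisym)
  qed
qed

lemma nuc_norm_svv: "nuc_norm n A = (\<Sum>k<n. svv n A k)"
  by (rule nuc_norm_eq[OF is_svd_svd])

lemma ip_le_nuc: "opb n b Y \<Longrightarrow> \<bar>ip n Y N\<bar> \<le> b * nuc_norm n N"
  unfolding nuc_norm_svv by (rule ip_opb_le[OF is_svd_svd])

lemma nuc_nonneg: "0 \<le> nuc_norm n A"
  unfolding nuc_norm_svv using is_svdD(3)[OF is_svd_svd] by (intro sum_nonneg) auto

lemma fro_le_nuc: "fro_norm n n A \<le> nuc_norm n A"
proof -
  note sv = is_svdD[OF is_svd_svd[of n A]]
  have "(fro_norm n n A)\<^sup>2 = ip n A A" by (simp add: ip_self)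
  also have "\<dots> = (\<Sum>k<n. svv n A k * svv n A k)"
    unfolding ip_svd[OF is_svd_svd]
    by (intro sum.cong refl) (simp add: bil_svd_left[OF is_svd_svd] orthonormal_colsD[OF sv(2)])
  also have "\<dots> \<le> (\<Sum>k<n. svv n A k * nuc_norm n A)"
    unfolding nuc_norm_svv using sv(3) by (intro sum_mono mult_left_mono member_le_sum) auto
  also have "\<dots> = (nuc_norm n A)\<^sup>2" by (simp add: nuc_norm_svv power2_eq_square sum_distrib_right)
  finally show ?thesis using nuc_nonneg by (rule power2_le_imp_le)
qed

definition smax :: "nat \<Rightarrow> rmat \<Rightarrow> real" where
  "smax n A = Max (insert 0 (svv n A ` {..<n}))"

lemma smax_nonneg: "0 \<le> smax n A"
  unfolding smax_def by (intro Max_ge) auto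

lemma opb_smax: "opb n (smax n A) A"
  unfolding opb_def
proof (intro allI)
  fix x y
  let ?P = "svl n A" and ?Q = "svr n A" and ?s = "svv n A"
  note sv = is_svdD[OF is_svd_svd[of n A]]
  define u v where "u k = (\<Sum>i<n. ?P i k * x i)" and "v k = (\<Sum>j<n. ?Q j k * y j)" for k
  have "\<bar>bil n A x y\<bar> \<le> (\<Sum>k<n. \<bar>?s k * u k * v k\<bar>)"
    unfolding bil_svd[OF is_svd_svd] u_def v_def by (rule sum_abs)
  also have "\<dots> \<le> (\<Sum>k<n. smax n A * \<bar>u k * v k\<bar>)"
  proof (rule sum_mono)
    fix k assume k: "k \<in> {..<n}"
    then have "?s k \<le> smax n A" "0 \<le> ?s k" using sv(3) by (auto simp: smax_def)
    then show "\<bar>?s k * u k * v k\<bar> \<le> smax n A * \<bar>u k * v k\<bar>"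
      by (simp add: abs_mult mult.assoc mult_right_mono)
  qed
  also have "\<dots> = smax n A * (\<Sum>k<n. \<bar>u k * v k\<bar>)" by (simp add: sum_distrib_left)
  also have "\<dots> \<le> smax n A * (vnorm n x * vnorm n y)"
  proof (rule mult_left_mono[OF _ smax_nonneg])
    have "(\<Sum>k<n. \<bar>u k * v k\<bar>) \<le> vnorm n u * vnorm n v" by (rule vdot_le)
    also have "\<dots> \<le> vnorm n x * vnorm n y"
      unfolding u_def v_def by (intro mult_mono vnorm_bessel sv) auto
    finally show "(\<Sum>k<n. \<bar>u k * v k\<bar>) \<le> vnorm n x * vnorm n y" .
  qed
  finally show "\<bar>bil n A x y\<bar> \<le> smax n A * vnorm n x * vnorm n y" by (simp add: mult.assoc)
qed

lemma smax_power_le: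
  assumes "1 \<le> m"
  shows "(smax n A) ^ (2 * m) \<le> schatten n m A"
proof -
  have "smax n A \<in> insert 0 (svv n A ` {..<n})"
    unfolding smax_def by (rule Max_in) auto
  then consider "smax n A = 0" | k where "k < n" "smax n A = svv n A k" by auto
  then show ?thesis
  proof cases
    case 1
    then show ?thesis using assms schatten_nonneg by (simp add: power_0_left)
  next
    case 2
    have "((svv n A k)\<^sup>2) ^ m \<le> schatten n m A"
      unfolding schatten_def using 2 by (intro member_le_sum) auto
    then show ?thesis using 2 by (simp add: power_mult)
  qed
qed

section \<open>The dual certificate\<close>

definition cp :: "rmat \<Rightarrow> rmat" where
  "cp A = (\<lambda>i k. (if i = k then 1 else 0) - A i k)"

text \<open>The projection onto the normal space, \<open>(I - A) Z (I - B)\<close>.\<close>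

definition PP :: "nat \<Rightarrow> rmat \<Rightarrow> rmat \<Rightarrow> rmat \<Rightarrow> rmat" where
  "PP n A B Z = (\<lambda>i j. \<Sum>k<n. \<Sum>l<n. cp A i k * cp B j l * Z k l)"

context proj
begin

lemma cp_idem:
  assumes "i < n" "k < n"
  shows "(\<Sum>a<n. cp A i a * cp A a k) = cp A i k"
proof -
  have "(\<Sum>a<n. cp A i a * cp A a k) = (\<Sum>a<n. (if a = i then (if i = k then 1 else 0) - A i k else 0)
      - (if a = k then A i k else 0) + A i a * A a k)"
    unfolding cp_def by (intro sum.cong refl) (auto simp: algebra_simps)
  also have "\<dots> = cp A i k"
    using assms by (simp add: sum.distrib sum_subtractf idem cp_def)
  finally show ?thesis .
qed

end

context proj2
begin

lemma PP_PT:
  assumes "i < n" "j < n"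
  shows "PP n A B Z i j = Z i j - PT n A B Z i j"
proof -
  have "PP n A B Z i j + PT n A B Z i j = (\<Sum>k<n. \<Sum>l<n. if l = j then (if k = i then Z i j else 0) else 0)"
    unfolding PP_def PT_def sum.distrib[symmetric]
    by (intro sum.cong refl) (auto simp: cp_def ker_def algebra_simps)
  then show ?thesis using assms by simp
qed

lemma PP_idem:
  assumes "i < n" "j < n"
  shows "PP n A B (PP n A B Z) i j = PP n A B Z i j"
proof -
  have "PP n A B (PP n A B Z) i j = (\<Sum>k<n. \<Sum>l<n. \<Sum>a<n. \<Sum>b<n. cp A i k * cp B j l * (cp A k a * cp B l b * Z a b))"
    by (simp add: PP_def sum_distrib_left)
  also have "\<dots> = (\<Sum>a<n. \<Sum>b<n. \<Sum>k<n. \<Sum>l<n. cp A i k * cp B j l * (cp A k a * cp B l b * Z a b))"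
    by (rule sum_swap4)
  also have "\<dots> = (\<Sum>a<n. \<Sum>b<n. (\<Sum>k<n. cp A i k * cp A k a) * (\<Sum>l<n. cp B j l * cp B l b) * Z a b)"
  proof (intro sum.cong refl)
    fix a b
    have e: "(\<Sum>k<n. f k) * (\<Sum>l<n. g l) * z = (\<Sum>k<n. \<Sum>l<n. f k * g l * z)" for f g :: "nat \<Rightarrow> real" and z
      unfolding sum_product by (simp only: sum_distrib_right)
    show "(\<Sum>k<n. \<Sum>l<n. cp A i k * cp B j l * (cp A k a * cp B l b * Z a b)) = (\<Sum>k<n. cp A i k * cp A k a) * (\<Sum>l<n. cp B j l * cp B l b) * Z a b"
      unfolding e by (intro sum.cong refl) (simp add: mult_ac)
  qed
  also have "\<dots> = PP n A B Z i j"
    unfolding PP_def by (intro sum.cong refl) (simp add: A.cp_idem B.cp_idem assms)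
  finally show ?thesis .
qed

lemma PP_cong: "(\<And>i j. i < n \<Longrightarrow> j < n \<Longrightarrow> Z i j = Z' i j) \<Longrightarrow> PP n A B Z = PP n A B Z'"
  unfolding PP_def by (intro ext sum.cong refl) auto

lemma PT_cong: "(\<And>i j. i < n \<Longrightarrow> j < n \<Longrightarrow> Z i j = Z' i j) \<Longrightarrow> PT n A B Z = PT n A B Z'"
  unfolding PT_def by (intro ext sum.cong refl) auto

lemma PP_PT_zero:
  assumes "i < n" "j < n"
  shows "PP n A B (PT n A B Z) i j = 0"
proof -
  have 1: "PP n A B (PT n A B Z) = PP n A B (\<lambda>i j. Z i j - PP n A B Z i j)"
    by (rule PP_cong) (simp add: PP_PT)
  have 2: "PP n A B (\<lambda>i j. Z i j - Y i j) i j = PP n A B Z i j - PP n A B Y i j" for Y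
    by (simp add: PP_def right_diff_distrib sum_subtractf)
  show ?thesis unfolding 1 2 using PP_idem[OF assms] by simp
qed

lemma PT_idem:
  assumes "i < n" "j < n"
  shows "PT n A B (PT n A B Z) i j = PT n A B Z i j"
  using PP_PT[OF assms, of "PT n A B Z"] PP_PT_zero[OF assms] by simp

text \<open>Idempotence holds for indices below n, whereas one application of \<open>PT\<close>
  already reads only those entries. Two applications therefore give a matrix that is fixed as a
  function on all indices.\<close>

lemma PT_PT_fix: "PT n A B (PT n A B (PT n A B Z)) = PT n A B (PT n A B Z)"
  by (rule PT_cong) (rule PT_idem)

lemma ker_sym: "ker A B i j k l = ker A B k l i j"
  using A.sym[of i k] B.sym[of j l] by (auto simp: ker_def)

lemma ip_PT: "ip n (PT n A B X) Y = ip n X (PT n A B Y)"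
proof -
  have "ip n (PT n A B X) Y = (\<Sum>i<n. \<Sum>j<n. \<Sum>k<n. \<Sum>l<n. ker A B i j k l * X k l * Y i j)"
    by (simp add: frob_inner_def PT_def sum_distrib_right)
  also have "\<dots> = (\<Sum>k<n. \<Sum>l<n. \<Sum>i<n. \<Sum>j<n. ker A B i j k l * X k l * Y i j)"
    by (rule sum_swap4)
  also have "\<dots> = (\<Sum>k<n. \<Sum>l<n. X k l * (\<Sum>i<n. \<Sum>j<n. ker A B k l i j * Y i j))"
    by (simp add: sum_distrib_left mult_ac) (subst ker_sym, simp add: mult_ac)
  finally show ?thesis by (simp add: frob_inner_def PT_def)
qed

lemma ip_PP: "ip n (PP n A B X) Y = ip n X (PP n A B Y)"
proof -
  have "ip n (PP n A B X) Y = ip n X Y - ip n (PT n A B X) Y"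
    unfolding ip_diff_left[symmetric] by (rule ip_cong) (auto simp: PP_PT)
  also have "\<dots> = ip n Y X - ip n (PT n A B Y) X"
    using ip_PT[of X Y] by (simp add: ip_commute)
  also have "\<dots> = ip n (PP n A B Y) X"
    unfolding ip_diff_left[symmetric] by (rule ip_cong) (auto simp: PP_PT)
  finally show ?thesis by (simp add: ip_commute)
qed

lemma ip_PT_PP: "ip n (PT n A B X) (PP n A B Y) = 0"
proof -
  have "ip n (PT n A B X) (PP n A B Y) = ip n (PP n A B (PT n A B X)) Y" by (simp add: ip_PP)
  also have "\<dots> = ip n (\<lambda>_ _. 0) Y" by (rule ip_cong) (auto simp: PP_PT_zero)
  finally show ?thesis by (simp add: frob_inner_def)
qed

end

section \<open>The certificate averaged over all orders of the batches\<close>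

context sampling
begin

lemma PT_expand: "PT n A B Z = (\<lambda>i j. \<Sum>c\<in>{..<n} \<times> {..<n}. Z (fst c) (snd c) * PT n A B (unit_mat (fst c) (snd c)) i j)"
proof -
  have u: "PT n A B (unit_mat a b) i j = ker A B i j a b" if "a < n" "b < n" for a b i j
  proof -
    have "PT n A B (unit_mat a b) i j = (\<Sum>k<n. \<Sum>l<n. if l = b then (if k = a then ker A B i j a b else 0) else 0)"
      unfolding PT_def unit_mat_def by (intro sum.cong refl) auto
    then show ?thesis using that by simp
  qed
  show ?thesis
  proof (intro ext)
    fix i j
    have "PT n A B Z i j = (\<Sum>k<n. \<Sum>l<n. Z k l * PT n A B (unit_mat k l) i j)"
      unfolding PT_def[of n A B Z] by (intro sum.cong refl) (simp add: u mult.commute)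
    then show "PT n A B Z i j = (\<Sum>c\<in>{..<n} \<times> {..<n}. Z (fst c) (snd c) * PT n A B (unit_mat (fst c) (snd c)) i j)"
      by (simp add: sum.cartesian_product split_def)
  qed
qed

lemma walk_sum: "walk \<eta> \<sigma> t (\<lambda>i j. \<Sum>c\<in>C. z c * Z c i j) = (\<lambda>i j. \<Sum>c\<in>C. z c * walk \<eta> \<sigma> t (Z c) i j)"
  by (simp add: walk_def chainG_sum)

lemma walk_fixed:
  assumes Z: "PT n A B Z = Z" and ij: "i < n" "j < n"
  shows "PT n A B (walk \<eta> \<sigma> t Z) i j = walk \<eta> \<sigma> t Z i j"
proof (cases t)
  case 0
  then show ?thesis using Z by simp
next
  case (Suc u)
  let ?Y = "had (xi {\<sigma> u} \<eta>) (walk \<eta> \<sigma> u Z)"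
  have e: "walk \<eta> \<sigma> t Z = (\<lambda>i j. - PT n A B ?Y i j)" by (simp add: Suc walk_Suc step_def)
  have "PT n A B (\<lambda>i j. - PT n A B ?Y i j) i j = - PT n A B (PT n A B ?Y) i j"
    by (simp add: PT_def[of n A B "\<lambda>i j. - PT n A B ?Y i j"] sum_negf) (simp add: PT_def[of n A B "PT n A B ?Y"])
  then show ?thesis unfolding e by (simp add: PT_idem[OF ij])
qed

lemma avg_sum: "avg (\<lambda>\<sigma>. \<Sum>c\<in>C. f c \<sigma>) = (\<Sum>c\<in>C. avg (f c))"
  unfolding avg_def by (subst sum.swap) (simp add: sum_divide_distrib)

lemma sum_swap3: "(\<Sum>i<n. \<Sum>j<n. \<Sum>c\<in>C. F c i j) = (\<Sum>c\<in>C. \<Sum>i<n. \<Sum>j<n. F c i j)" for F :: "'c \<Rightarrow> nat \<Rightarrow> nat \<Rightarrow> real"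
proof -
  have "(\<Sum>i<n. \<Sum>j<n. \<Sum>c\<in>C. F c i j) = (\<Sum>i<n. \<Sum>c\<in>C. \<Sum>j<n. F c i j)"
    by (intro sum.cong refl sum.swap)
  also have "\<dots> = (\<Sum>c\<in>C. \<Sum>i<n. \<Sum>j<n. F c i j)" by (rule sum.swap)
  finally show ?thesis .
qed

lemma avg_cmult: "avg (\<lambda>\<sigma>. c * f \<sigma>) = c * avg f"
  by (simp add: avg_def sum_distrib_left)

lemma avg_add: "avg (\<lambda>\<sigma>. f \<sigma> + g \<sigma>) = avg f + avg g"
  by (simp add: avg_def sum.distrib add_divide_distrib)

lemma abs_avg_le: "\<bar>avg f\<bar> \<le> avg (\<lambda>\<sigma>. \<bar>f \<sigma>\<bar>)"
  unfolding avg_def by (simp add: divide_right_mono sum_abs)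

lemma avg_power_le:
  assumes "1 \<le> m" "\<And>\<sigma>. \<sigma> \<in> perms K \<Longrightarrow> 0 \<le> f \<sigma>"
  shows "avg f ^ m \<le> avg (\<lambda>\<sigma>. f \<sigma> ^ m)"
proof -
  have "(\<Sum>\<sigma>\<in>perms K. 1 / fact K * f \<sigma>) ^ m \<le> (\<Sum>\<sigma>\<in>perms K. 1 / fact K) ^ (m - 1) * (\<Sum>\<sigma>\<in>perms K. 1 / fact K * f \<sigma> ^ m)"
    by (rule weighted_power_mean) (use assms in auto)
  then show ?thesis by (simp add: avg_def sum_divide_distrib card_perms)
qed

definition Xbar :: "(nat \<times> nat \<times> nat \<Rightarrow> bool) \<Rightarrow> rmat \<Rightarrow> rmat" where
  "Xbar \<eta> Z = (\<lambda>i j. avg (\<lambda>\<sigma>. walk \<eta> \<sigma> K Z i j))"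

definition Wbar :: "(nat \<times> nat \<times> nat \<Rightarrow> bool) \<Rightarrow> nat \<Rightarrow> rmat \<Rightarrow> rmat" where
  "Wbar \<eta> t Z = (\<lambda>i j. avg (\<lambda>\<sigma>. walk \<eta> \<sigma> t Z i j))"

definition Cbar :: "(nat \<times> nat \<times> nat \<Rightarrow> bool) \<Rightarrow> nat \<Rightarrow> rmat \<Rightarrow> rmat" where
  "Cbar \<eta> t Z = (\<lambda>i j. avg (\<lambda>\<sigma>. xi {\<sigma> t} \<eta> i j * walk \<eta> \<sigma> t Z i j))"

text \<open>At time t the residual is reweighted by the sample of batch \<open>\<sigma> t\<close>,
  so every summand is supported on sampled cells.\<close>

definition Abar :: "(nat \<times> nat \<times> nat \<Rightarrow> bool) \<Rightarrow> rmat \<Rightarrow> rmat" where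
  "Abar \<eta> Z = (\<lambda>i j. \<Sum>t<K. avg (\<lambda>\<sigma>. (1 + xi {\<sigma> t} \<eta> i j) * walk \<eta> \<sigma> t Z i j))"

lemma Abar_alt: "Abar \<eta> Z = (\<lambda>i j. \<Sum>t<K. Wbar \<eta> t Z i j + Cbar \<eta> t Z i j)"
  by (simp add: Abar_def Wbar_def Cbar_def distrib_right avg_add)

lemma Xbar_alt: "Xbar \<eta> Z = Wbar \<eta> K Z"
  by (simp add: Xbar_def Wbar_def)

lemma PT_avg: "PT n A B (\<lambda>i j. avg (\<lambda>\<sigma>. f \<sigma> i j)) i j = avg (\<lambda>\<sigma>. PT n A B (f \<sigma>) i j)"
  by (simp add: PT_def avg_sum avg_cmult)

lemma Wbar_fixed: "PT n A B Z = Z \<Longrightarrow> i < n \<Longrightarrow> j < n \<Longrightarrow> PT n A B (Wbar \<eta> t Z) i j = Wbar \<eta> t Z i j"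
  unfolding Wbar_def PT_avg by (simp add: walk_fixed)

lemma Wbar_Suc: "Wbar \<eta> (Suc t) Z i j = - PT n A B (Cbar \<eta> t Z) i j"
proof -
  have "PT n A B (Cbar \<eta> t Z) i j = avg (\<lambda>\<sigma>. PT n A B (had (xi {\<sigma> t} \<eta>) (walk \<eta> \<sigma> t Z)) i j)"
    unfolding Cbar_def PT_avg by (simp add: had_def)
  then show ?thesis
    using avg_cmult[of "- 1"] by (simp add: Wbar_def walk_Suc step_def)
qed

lemma Abar_support:
  assumes "\<And>s. s < K \<Longrightarrow> \<not> \<eta> (s, i, j)"
  shows "Abar \<eta> Z i j = 0"
proof -
  have "(1 + xi {\<sigma> t} \<eta> i j) = 0" if "\<sigma> \<in> perms K" "t < K" for \<sigma> t
    using assms[OF perms_less[OF that]] by (simp add: xi_def zeta_def)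
  then show ?thesis by (simp add: Abar_def avg_def)
qed

text \<open>The projected summands telescope, because the residual at time \<open>Suc t\<close> is
  minus the projection of the noise at time t.\<close>

lemma PT_Abar:
  assumes Z: "PT n A B Z = Z" and ij: "i < n" "j < n"
  shows "PT n A B (Abar \<eta> Z) i j = Z i j - Xbar \<eta> Z i j"
proof -
  have "PT n A B (Abar \<eta> Z) i j = (\<Sum>t<K. PT n A B (\<lambda>i j. Wbar \<eta> t Z i j + Cbar \<eta> t Z i j) i j)"
    unfolding Abar_alt using PT_sum[where n = n and A = A and B = B and C = "{..<K}" and z = "\<lambda>_. 1" and Z = "\<lambda>t i j. Wbar \<eta> t Z i j + Cbar \<eta> t Z i j"] by (simp add: fun_eq_iff)
  also have "\<dots> = (\<Sum>t<K. Wbar \<eta> t Z i j - Wbar \<eta> (Suc t) Z i j)"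
  proof (rule sum.cong[OF refl])
    fix t
    have "PT n A B (\<lambda>i j. Wbar \<eta> t Z i j + Cbar \<eta> t Z i j) i j = PT n A B (Wbar \<eta> t Z) i j + PT n A B (Cbar \<eta> t Z) i j"
      by (simp add: PT_def distrib_left sum.distrib)
    then show "PT n A B (\<lambda>i j. Wbar \<eta> t Z i j + Cbar \<eta> t Z i j) i j = Wbar \<eta> t Z i j - Wbar \<eta> (Suc t) Z i j"
      by (simp add: Wbar_fixed[OF Z ij] Wbar_Suc)
  qed
  also have "\<dots> = Wbar \<eta> 0 Z i j - Wbar \<eta> K Z i j"
    by (rule sum_lessThan_telescope')
  finally show ?thesis by (simp add: Xbar_alt) (simp add: Wbar_def avg_const)
qed

text \<open>Z is expanded in projected matrix units and Cauchy-Schwarz is applied; convexity of the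
  square moves the average over orders outside.\<close>

lemma Xbar_fro:
  assumes Z: "PT n A B Z = Z"
  shows "(fro_norm n n (Xbar \<eta> Z))\<^sup>2 \<le> (fro_norm n n Z)\<^sup>2 * T1 \<eta>"
proof -
  let ?C = "{..<n} \<times> {..<n}"
  let ?u = "\<lambda>c. PT n A B (unit_mat (fst c) (snd c))"
  have "Xbar \<eta> Z i j = (\<Sum>c\<in>?C. Z (fst c) (snd c) * Xbar \<eta> (?u c) i j)" for i j
    by (subst Z[symmetric], subst PT_expand) (simp add: Xbar_def walk_sum avg_sum avg_cmult)
  then have sq: "(Xbar \<eta> Z i j)\<^sup>2 \<le> (fro_norm n n Z)\<^sup>2 * (\<Sum>c\<in>?C. avg (\<lambda>\<sigma>. (walk \<eta> \<sigma> K (?u c) i j)\<^sup>2))" for i j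
  proof -
    have "(Xbar \<eta> Z i j)\<^sup>2 \<le> (\<Sum>c\<in>?C. (Z (fst c) (snd c))\<^sup>2) * (\<Sum>c\<in>?C. (Xbar \<eta> (?u c) i j)\<^sup>2)"
      unfolding \<open>\<And>i j. Xbar \<eta> Z i j = _\<close> by (rule Cauchy_Schwarz_ineq_sum)
    also have "\<dots> \<le> (fro_norm n n Z)\<^sup>2 * (\<Sum>c\<in>?C. avg (\<lambda>\<sigma>. (walk \<eta> \<sigma> K (?u c) i j)\<^sup>2))"
      unfolding fro_pairs[symmetric]
    proof (intro mult_left_mono sum_mono)
      fix c
      have "(Xbar \<eta> (?u c) i j)\<^sup>2 \<le> (avg (\<lambda>\<sigma>. \<bar>walk \<eta> \<sigma> K (?u c) i j\<bar>))\<^sup>2"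
        unfolding Xbar_def using power_mono[OF abs_avg_le abs_ge_zero, of "\<lambda>\<sigma>. walk \<eta> \<sigma> K (?u c) i j" 2] by simp
      also have "\<dots> \<le> avg (\<lambda>\<sigma>. \<bar>walk \<eta> \<sigma> K (?u c) i j\<bar>\<^sup>2)"
        by (rule avg_power_le) auto
      finally show "(Xbar \<eta> (?u c) i j)\<^sup>2 \<le> avg (\<lambda>\<sigma>. (walk \<eta> \<sigma> K (?u c) i j)\<^sup>2)" by simp
    qed simp
    finally show ?thesis .
  qed
  have "(fro_norm n n (Xbar \<eta> Z))\<^sup>2 \<le> (\<Sum>i<n. \<Sum>j<n. (fro_norm n n Z)\<^sup>2 * (\<Sum>c\<in>?C. avg (\<lambda>\<sigma>. (walk \<eta> \<sigma> K (?u c) i j)\<^sup>2)))"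
    unfolding fro_sq by (intro sum_mono) (use sq in \<open>simp add: fro_sq\<close>)
  also have "\<dots> = (fro_norm n n Z)\<^sup>2 * (\<Sum>c\<in>?C. avg (\<lambda>\<sigma>. \<Sum>i<n. \<Sum>j<n. (walk \<eta> \<sigma> K (?u c) i j)\<^sup>2))"
    by (simp only: sum_distrib_left[symmetric] sum_swap3 avg_sum)
  also have "(\<Sum>c\<in>?C. avg (\<lambda>\<sigma>. \<Sum>i<n. \<Sum>j<n. (walk \<eta> \<sigma> K (?u c) i j)\<^sup>2)) = T1 \<eta>"
    by (simp add: T1_def sum.cartesian_product split_def)
  finally show ?thesis .
qed

lemma one_plus_xi_nonneg: "s < K \<Longrightarrow> i < n \<Longrightarrow> j < n \<Longrightarrow> 0 \<le> 1 + xi {s} \<eta> i j"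
  using \<rho>01[of i j] by (simp add: xi_def zeta_def rt_def)

lemma Abar_sum_le:
  assumes Z: "PT n A B Z = Z"
  shows "(\<Sum>i<n. \<Sum>j<n. \<bar>Abar \<eta> Z i j\<bar>) \<le> fro_norm n n Z * T2 \<eta>"
proof -
  let ?C = "{..<n} \<times> {..<n}"
  let ?u = "\<lambda>c. PT n A B (unit_mat (fst c) (snd c))"
  have e: "Abar \<eta> Z i j = (\<Sum>c\<in>?C. Z (fst c) (snd c) * Abar \<eta> (?u c) i j)" for i j
  proof -
    have w: "walk \<eta> \<sigma> t Z i j = (\<Sum>c\<in>?C. Z (fst c) (snd c) * walk \<eta> \<sigma> t (?u c) i j)" for \<sigma> t
      by (subst Z[symmetric], subst PT_expand) (simp add: walk_sum)
    have "avg (\<lambda>\<sigma>. (1 + xi {\<sigma> t} \<eta> i j) * walk \<eta> \<sigma> t Z i j)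
      = (\<Sum>c\<in>?C. Z (fst c) (snd c) * avg (\<lambda>\<sigma>. (1 + xi {\<sigma> t} \<eta> i j) * walk \<eta> \<sigma> t (?u c) i j))" for t
      unfolding w avg_cmult[symmetric] avg_sum[symmetric] by (simp add: sum_distrib_left mult_ac)
    then have "Abar \<eta> Z i j = (\<Sum>t<K. \<Sum>c\<in>?C. Z (fst c) (snd c) * avg (\<lambda>\<sigma>. (1 + xi {\<sigma> t} \<eta> i j) * walk \<eta> \<sigma> t (?u c) i j))"
      by (simp add: Abar_def)
    then show ?thesis by (subst (asm) sum.swap) (simp add: Abar_def sum_distrib_left)
  qed
  have "\<bar>Abar \<eta> Z i j\<bar> \<le> (\<Sum>c\<in>?C. fro_norm n n Z * (\<Sum>t<K. avg (\<lambda>\<sigma>. (1 + xi {\<sigma> t} \<eta> i j) * \<bar>walk \<eta> \<sigma> t (?u c) i j\<bar>)))"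
    if ij: "i < n" "j < n" for i j
  proof -
    have "\<bar>Abar \<eta> Z i j\<bar> \<le> (\<Sum>c\<in>?C. \<bar>Z (fst c) (snd c) * Abar \<eta> (?u c) i j\<bar>)"
      unfolding e by (rule sum_abs)
    also have "\<dots> \<le> (\<Sum>c\<in>?C. fro_norm n n Z * (\<Sum>t<K. avg (\<lambda>\<sigma>. (1 + xi {\<sigma> t} \<eta> i j) * \<bar>walk \<eta> \<sigma> t (?u c) i j\<bar>)))"
      unfolding abs_mult
    proof (intro sum_mono mult_mono)
      fix c assume "c \<in> ?C"
      then show "\<bar>Z (fst c) (snd c)\<bar> \<le> fro_norm n n Z" by (intro entry_le_fro) auto
      have "\<bar>Abar \<eta> (?u c) i j\<bar> \<le> (\<Sum>t<K. \<bar>avg (\<lambda>\<sigma>. (1 + xi {\<sigma> t} \<eta> i j) * walk \<eta> \<sigma> t (?u c) i j)\<bar>)"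
        unfolding Abar_def by (rule sum_abs)
      also have "\<dots> \<le> (\<Sum>t<K. avg (\<lambda>\<sigma>. (1 + xi {\<sigma> t} \<eta> i j) * \<bar>walk \<eta> \<sigma> t (?u c) i j\<bar>))"
      proof (intro sum_mono order_trans[OF abs_avg_le] avg_mono)
        fix t \<sigma> assume "t \<in> {..<K}" "\<sigma> \<in> perms K"
        then have "0 \<le> 1 + xi {\<sigma> t} \<eta> i j" using one_plus_xi_nonneg ij perms_less by auto
        then show "\<bar>(1 + xi {\<sigma> t} \<eta> i j) * walk \<eta> \<sigma> t (?u c) i j\<bar> \<le> (1 + xi {\<sigma> t} \<eta> i j) * \<bar>walk \<eta> \<sigma> t (?u c) i j\<bar>"
          by (simp add: abs_mult)
      qed
      finally show "\<bar>Abar \<eta> (?u c) i j\<bar> \<le> (\<Sum>t<K. avg (\<lambda>\<sigma>. (1 + xi {\<sigma> t} \<eta> i j) * \<bar>walk \<eta> \<sigma> t (?u c) i j\<bar>))" .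
    qed (auto simp: fro_nonneg)
    finally show ?thesis .
  qed
  then have "(\<Sum>i<n. \<Sum>j<n. \<bar>Abar \<eta> Z i j\<bar>) \<le> (\<Sum>i<n. \<Sum>j<n. \<Sum>c\<in>?C. fro_norm n n Z * (\<Sum>t<K. avg (\<lambda>\<sigma>. (1 + xi {\<sigma> t} \<eta> i j) * \<bar>walk \<eta> \<sigma> t (?u c) i j\<bar>)))"
    by (intro sum_mono) auto
  also have "\<dots> = (\<Sum>c\<in>?C. fro_norm n n Z * (\<Sum>t<K. avg (\<lambda>\<sigma>. \<Sum>i<n. \<Sum>j<n. (1 + xi {\<sigma> t} \<eta> i j) * \<bar>walk \<eta> \<sigma> t (?u c) i j\<bar>)))"
    unfolding sum_swap3 by (simp only: sum_distrib_left[symmetric] sum_swap3 avg_sum)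
  also have "\<dots> = fro_norm n n Z * T2 \<eta>"
    by (simp only: sum_distrib_left[symmetric] T2_def sum_pairs)
  finally show ?thesis .
qed

lemma Cbar_blocks:
  assumes t: "t < K"
  shows "Cbar \<eta> t Z i j = avg (\<lambda>\<sigma>. incr \<eta> (map (\<lambda>l. \<sigma> ` block K t l) [0..<Suc t]) Z i j)"
proof -
  have "(\<Sum>\<sigma>\<in>perms K. incr \<eta> (map (\<lambda>l. \<sigma> ` block K t l) [0..<Suc t]) Z i j)
    = (\<Sum>\<sigma>\<in>perms K. incr \<eta> (map (\<lambda>l. {\<sigma> l}) [0..<Suc t]) Z i j)"
    by (rule sum_perms_blocks[OF slot_linear_incr, where a = "\<lambda>l. l"])
      (use t block_subset first_in_block block_disjoint in \<open>auto simp: less_Suc_eq_le\<close>)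
  also have "\<dots> = (\<Sum>\<sigma>\<in>perms K. xi {\<sigma> t} \<eta> i j * walk \<eta> \<sigma> t Z i j)"
    by (simp add: incr_def had_def walk_def)
  finally show ?thesis by (simp add: Cbar_def avg_def)
qed

text \<open>A spectral norm is at most the root of order 2m of the Schatten sum, and convexity
  passes from each order of the blocks to their average. The block form is used only inside this
  estimate.\<close>

lemma opb_Cbar:
  assumes t: "t < K" and T3: "T3 Z t \<eta> \<le> e ^ (2 * (K div Suc t))" and e: "0 \<le> e"
  shows "opb n e (Cbar \<eta> t Z)"
  unfolding opb_def
proof (intro allI)
  fix x y
  let ?I = "\<lambda>\<sigma>. incr \<eta> (map (\<lambda>l. \<sigma> ` block K t l) [0..<Suc t]) Z"
  define m where "m = K div Suc t"
  have m: "1 \<le> m" using t div_greater_zero_iff[of K "Suc t"] by (simp add: m_def Suc_le_eq)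
  have "avg (\<lambda>\<sigma>. smax n (?I \<sigma>)) ^ (2 * m) \<le> avg (\<lambda>\<sigma>. smax n (?I \<sigma>) ^ (2 * m))"
    using m smax_nonneg by (intro avg_power_le) auto
  also have "\<dots> \<le> avg (\<lambda>\<sigma>. schatten n m (?I \<sigma>))"
    by (intro avg_mono smax_power_le m)
  also have "\<dots> \<le> e ^ (2 * m)" using T3 by (simp add: T3_def m_def)
  finally have le: "avg (\<lambda>\<sigma>. smax n (?I \<sigma>)) \<le> e"
    using m e by (subst (asm) power_mono_iff) (auto intro: order_trans[OF _ avg_mono[of "\<lambda>_. 0"]] simp: smax_nonneg avg_const)
  have "bil n (Cbar \<eta> t Z) x y = avg (\<lambda>\<sigma>. bil n (?I \<sigma>) x y)"
    unfolding bil_def Cbar_blocks[OF t] avg_sum avg_cmult[symmetric]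
    by (simp add: avg_cmult mult.commute[of _ "y _"] del: upt_Suc)
  then have "\<bar>bil n (Cbar \<eta> t Z) x y\<bar> \<le> avg (\<lambda>\<sigma>. \<bar>bil n (?I \<sigma>) x y\<bar>)"
    using abs_avg_le by simp
  also have "\<dots> \<le> avg (\<lambda>\<sigma>. (vnorm n x * vnorm n y) * smax n (?I \<sigma>))"
    using opb_smax unfolding opb_def by (intro avg_mono) (simp add: mult_ac)
  also have "\<dots> = (vnorm n x * vnorm n y) * avg (\<lambda>\<sigma>. smax n (?I \<sigma>))" by (rule avg_cmult)
  also have "\<dots> \<le> (vnorm n x * vnorm n y) * e" by (intro mult_left_mono le) auto
  finally show "\<bar>bil n (Cbar \<eta> t Z) x y\<bar> \<le> e * vnorm n x * vnorm n y" by (simp add: mult_ac)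
qed

text \<open>The dual certificate \<open>Abar \<eta> W\<close> is supported on the sampled entries; testing it against a
  matrix \<open>H\<close> that vanishes there controls the tangential part of \<open>H\<close> by its normal part.\<close>

lemma certificate:
  assumes H: "\<And>i j s. i < n \<Longrightarrow> j < n \<Longrightarrow> s < K \<Longrightarrow> \<eta> (s, i, j) \<Longrightarrow> H i j = 0"
    and W: "PT n A B W = W"
    and T1: "T1 \<eta> \<le> d1\<^sup>2" "0 \<le> d1" "d1 \<le> 1 / 2" and T2: "T2 \<eta> \<le> d2"
    and T3: "\<And>t. t < K \<Longrightarrow> T3 W t \<eta> \<le> e t ^ (2 * (K div Suc t))" "\<And>t. 0 \<le> e t" "(\<Sum>t<K. e t) \<le> \<epsilon>"
  shows "\<bar>ip n W H\<bar> \<le> (\<epsilon> + 2 * d1 * d2 * fro_norm n n W) * nuc_norm n (PP n A B H)"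
    and "nuc_norm n (PP n A B H) = 0 \<Longrightarrow> i < n \<Longrightarrow> j < n \<Longrightarrow> H i j = 0"
proof -
  let ?P = "PT n A B" and ?N = "PP n A B H"
  define M where "M = ?P (?P H)"
  have M: "?P M = M" unfolding M_def by (rule PT_PT_fix)
  have dec: "H i j = M i j + ?N i j" if "i < n" "j < n" for i j
    using PP_PT[OF that, of H] PT_idem[OF that, of H] by (simp add: M_def)
  \<comment> \<open>A tangential matrix sees only the tangential part M of H.\<close>
  have zM: "ip n Z H = ip n Z M" if "\<And>i j. i < n \<Longrightarrow> j < n \<Longrightarrow> ?P Z i j = Z i j" for Z
  proof -
    have "ip n Z H = ip n (?P (?P Z)) H"
      by (rule ip_cong) (simp_all add: PT_cong[OF that] that)
    also have "\<dots> = ip n Z M" unfolding ip_PT M_def ..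
    finally show ?thesis .
  qed
  have zero: "ip n (Abar \<eta> Z) H = 0" for Z
  proof -
    have "Abar \<eta> Z i j * H i j = 0" if "i < n" "j < n" for i j
      using H[OF that] Abar_support[of \<eta> i j Z] by (cases "\<exists>s<K. \<eta> (s, i, j)") auto
    then show ?thesis unfolding frob_inner_def by (intro sum.neutral ballI) auto
  qed
  \<comment> \<open>The certificate annihilates H; splitting H into tangential and normal parts and
    projecting the certificate leaves only the final residual and the normal part.\<close>
  have main: "ip n Z H = ip n (Xbar \<eta> Z) M - ip n (Abar \<eta> Z) ?N" if Z: "?P Z = Z" for Z
  proof -
    have "0 = ip n (Abar \<eta> Z) H" by (simp add: zero)
    also have "\<dots> = ip n (Abar \<eta> Z) (\<lambda>i j. M i j + ?N i j)"
      by (rule ip_cong) (auto intro: dec)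
    also have "\<dots> = ip n (Abar \<eta> Z) (?P (?P H)) + ip n (Abar \<eta> Z) ?N" by (simp add: ip_add_right M_def)
    also have "ip n (Abar \<eta> Z) (?P (?P H)) = ip n (?P (Abar \<eta> Z)) (?P H)" by (simp add: ip_PT)
    also have "\<dots> = ip n (\<lambda>i j. Z i j - Xbar \<eta> Z i j) (?P H)"
      by (rule ip_cong) (simp_all add: PT_Abar[OF Z])
    also have "\<dots> = ip n Z (?P H) - ip n (Xbar \<eta> Z) (?P H)" by (rule ip_diff_left)
    also have "ip n Z (?P H) = ip n Z H" using ip_PT[of Z H] Z by simp
    also have "ip n (Xbar \<eta> Z) (?P H) = ip n (Xbar \<eta> Z) M"
      by (rule ip_cong) (simp_all add: M_def PT_idem)
    finally show ?thesis by simp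
  qed
  have Xb: "\<bar>ip n (Xbar \<eta> Z) M\<bar> \<le> d1 * fro_norm n n Z * fro_norm n n M" if Z: "?P Z = Z" for Z
  proof -
    have "(fro_norm n n (Xbar \<eta> Z))\<^sup>2 \<le> (fro_norm n n Z)\<^sup>2 * d1\<^sup>2"
      using Xbar_fro[OF Z, of \<eta>] T1(1) by (meson mult_left_mono order_trans zero_le_power2)
    then have "fro_norm n n (Xbar \<eta> Z) \<le> fro_norm n n Z * d1"
      unfolding power_mult_distrib[symmetric] by (rule power2_le_imp_le) (simp add: T1(2) fro_nonneg)
    then have "fro_norm n n (Xbar \<eta> Z) * fro_norm n n M \<le> fro_norm n n Z * d1 * fro_norm n n M"
      by (rule mult_right_mono) (rule fro_nonneg)
    then show ?thesis using ip_cauchy[of n "Xbar \<eta> Z" M] by (simp add: mult.commute)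
  qed
  have T20: "0 \<le> T2 \<eta>"
    unfolding T2_def avg_def
    by (intro sum_nonneg divide_nonneg_nonneg mult_nonneg_nonneg one_plus_xi_nonneg)
      (auto intro: perms_less)
  have d20: "0 \<le> d2" using T20 T2 by linarith
  have Ab: "\<bar>ip n (Abar \<eta> Z) ?N\<bar> \<le> d2 * fro_norm n n Z * fro_norm n n ?N" if Z: "?P Z = Z" for Z
  proof -
    have "\<bar>ip n (Abar \<eta> Z) ?N\<bar> \<le> (\<Sum>i<n. \<Sum>j<n. \<bar>Abar \<eta> Z i j * ?N i j\<bar>)"
      unfolding frob_inner_def by (intro order_trans[OF sum_abs] sum_mono order_refl)
    also have "\<dots> \<le> (\<Sum>i<n. \<Sum>j<n. \<bar>Abar \<eta> Z i j\<bar> * fro_norm n n ?N)"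
      unfolding abs_mult by (intro sum_mono mult_left_mono entry_le_fro) auto
    also have "\<dots> = (\<Sum>i<n. \<Sum>j<n. \<bar>Abar \<eta> Z i j\<bar>) * fro_norm n n ?N" by (simp add: sum_distrib_right)
    also have "\<dots> \<le> (fro_norm n n Z * d2) * fro_norm n n ?N"
      using Abar_sum_le[OF Z, of \<eta>] T2 by (intro mult_right_mono fro_nonneg) (meson fro_nonneg mult_left_mono order_trans)
    finally show ?thesis by (simp add: mult_ac)
  qed
  \<comment> \<open>Testing with \<open>Z = M\<close> itself: the residual term is at most half of
    the squared norm and is absorbed on the left.\<close>
  have Mle: "fro_norm n n M \<le> 2 * d2 * fro_norm n n ?N"
  proof (cases "fro_norm n n M = 0")
    case True
    then show ?thesis using d20 by (simp add: fro_nonneg)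
  next
    case False
    then have Mp: "0 < fro_norm n n M" using fro_nonneg[of n M] by simp
    have fx: "?P M i j = M i j" for i j by (simp add: M)
    have "(fro_norm n n M)\<^sup>2 = ip n M H" using zM[of M] fx by (simp add: ip_self)
    also have "\<dots> \<le> d1 * fro_norm n n M * fro_norm n n M + d2 * fro_norm n n M * fro_norm n n ?N"
      unfolding main[OF M] using Xb[OF M] Ab[OF M] by linarith
    also have "\<dots> \<le> (1 / 2) * fro_norm n n M * fro_norm n n M + d2 * fro_norm n n M * fro_norm n n ?N"
      using T1(3) by (intro add_right_mono mult_right_mono) (auto simp: fro_nonneg)
    finally have "fro_norm n n M * fro_norm n n M \<le> fro_norm n n M * (2 * d2 * fro_norm n n ?N)"
      by (simp add: power2_eq_square algebra_simps)
    then show ?thesis using Mp by (simp only: mult_le_cancel_left_pos)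
  qed
  \<comment> \<open>Against the normal part the residuals \<open>Wbar\<close> vanish, and only the
    noise terms \<open>Cbar\<close> remain.\<close>
  have Cb: "\<bar>ip n (Abar \<eta> W) ?N\<bar> \<le> \<epsilon> * nuc_norm n ?N"
  proof -
    have w0: "ip n (Wbar \<eta> t W) ?N = 0" for t
    proof -
      have "ip n (Wbar \<eta> t W) ?N = ip n (?P (Wbar \<eta> t W)) ?N"
        by (rule ip_cong) (simp_all add: Wbar_fixed[OF W])
      then show ?thesis by (simp add: ip_PT_PP)
    qed
    have "ip n (Abar \<eta> W) ?N = (\<Sum>t<K. ip n (\<lambda>i j. Wbar \<eta> t W i j + Cbar \<eta> t W i j) ?N)"
      unfolding Abar_alt using ip_sum_left[where n = n and z = "\<lambda>_. 1" and X = "\<lambda>t i j. Wbar \<eta> t W i j + Cbar \<eta> t W i j" and C = "{..<K}" and Y = ?N] by simp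
    also have "\<dots> = (\<Sum>t<K. ip n (Cbar \<eta> t W) ?N)"
    proof (rule sum.cong[OF refl])
      fix t
      have "ip n (\<lambda>i j. Wbar \<eta> t W i j + Cbar \<eta> t W i j) ?N = ip n (Wbar \<eta> t W) ?N + ip n (Cbar \<eta> t W) ?N"
        by (simp add: frob_inner_def distrib_right sum.distrib)
      then show "ip n (\<lambda>i j. Wbar \<eta> t W i j + Cbar \<eta> t W i j) ?N = ip n (Cbar \<eta> t W) ?N" by (simp add: w0)
    qed
    finally have "\<bar>ip n (Abar \<eta> W) ?N\<bar> \<le> (\<Sum>t<K. \<bar>ip n (Cbar \<eta> t W) ?N\<bar>)" by simp
    also have "\<dots> \<le> (\<Sum>t<K. e t * nuc_norm n ?N)"
      by (intro sum_mono ip_le_nuc opb_Cbar T3) auto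
    also have "\<dots> \<le> \<epsilon> * nuc_norm n ?N"
      unfolding sum_distrib_right[symmetric] by (intro mult_right_mono T3 nuc_nonneg)
    finally show ?thesis .
  qed
  have "\<bar>ip n W H\<bar> \<le> d1 * fro_norm n n W * fro_norm n n M + \<epsilon> * nuc_norm n ?N"
    unfolding main[OF W] using Xb[OF W] Cb by linarith
  also have "\<dots> \<le> d1 * fro_norm n n W * (2 * d2 * nuc_norm n ?N) + \<epsilon> * nuc_norm n ?N"
  proof (intro add_right_mono mult_left_mono)
    have "2 * d2 * fro_norm n n ?N \<le> 2 * d2 * nuc_norm n ?N"
      using d20 fro_le_nuc by (intro mult_left_mono) auto
    then show "fro_norm n n M \<le> 2 * d2 * nuc_norm n ?N" using Mle by linarith
  qed (simp add: T1(2) fro_nonneg)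
  finally show "\<bar>ip n W H\<bar> \<le> (\<epsilon> + 2 * d1 * d2 * fro_norm n n W) * nuc_norm n ?N"
    by (simp add: algebra_simps)
  assume N0: "nuc_norm n ?N = 0" and ij: "i < n" "j < n"
  have f0: "fro_norm n n ?N = 0" using fro_le_nuc[of n ?N] fro_nonneg[of n ?N] N0 by simp
  then have "fro_norm n n M = 0" using Mle fro_nonneg[of n M] by simp
  then show "H i j = 0" using dec[OF ij] fro_zero[of n M, OF _ ij] fro_zero[OF f0 ij] by simp
qed

end

section \<open>Projections onto column spans and subgradients of the nuclear norm\<close>

definition gram :: "nat \<Rightarrow> rmat \<Rightarrow> rmat" where
  "gram r U = (\<lambda>i j. \<Sum>t<r. U i t * U j t)"

lemma gram_eq: "gram r U i j = (\<Sum>t<r. U i t * U j t)"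
  by (simp add: gram_def)

lemma gram_sym: "gram r U i j = gram r U j i"
  by (simp add: gram_def mult.commute)

lemma gram_apply: "(\<Sum>j<n. gram r U i j * x j) = (\<Sum>t<r. U i t * (\<Sum>j<n. U j t * x j))"
proof -
  have "(\<Sum>j<n. gram r U i j * x j) = (\<Sum>j<n. \<Sum>t<r. U i t * (U j t * x j))"
    by (simp add: gram_def sum_distrib_right mult.assoc)
  also have "\<dots> = (\<Sum>t<r. \<Sum>j<n. U i t * (U j t * x j))" by (rule sum.swap)
  finally show ?thesis by (simp add: sum_distrib_left)
qed

lemma gram_col:
  assumes "orthonormal_cols n r U" "t < r"
  shows "(\<Sum>j<n. gram r U i j * U j t) = U i t"
proof -
  have "(\<Sum>j<n. gram r U i j * U j t) = (\<Sum>s<r. if s = t then U i t else 0)"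
    unfolding gram_apply by (intro sum.cong refl) (use assms in \<open>auto simp: orthonormal_colsD\<close>)
  then show ?thesis using assms(2) by simp
qed

lemma gram_idem:
  assumes "orthonormal_cols n r U"
  shows "(\<Sum>k<n. gram r U i k * gram r U k j) = gram r U i j"
proof -
  have "(\<Sum>k<n. gram r U i k * gram r U k j) = (\<Sum>k<n. \<Sum>t<r. U j t * (gram r U i k * U k t))"
    by (simp add: gram_eq[of r U _ j] sum_distrib_left mult_ac)
  also have "\<dots> = (\<Sum>t<r. \<Sum>k<n. U j t * (gram r U i k * U k t))" by (rule sum.swap)
  also have "\<dots> = (\<Sum>t<r. U j t * U i t)"
    by (intro sum.cong refl) (simp add: sum_distrib_left[symmetric] gram_col[OF assms])
  finally show ?thesis by (simp add: gram_def mult.commute)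
qed

lemma proj_gram: "orthonormal_cols n r U \<Longrightarrow> (\<And>i. i < n \<Longrightarrow> 0 < gram r U i i) \<Longrightarrow> proj n (gram r U)"
  by unfold_locales (rule gram_sym, rule gram_idem, auto)

lemma gram_diag: "gram r U i i = (vnorm r (U i))\<^sup>2"
  unfolding vnorm_sq by (simp add: gram_def power2_eq_square)

lemma gram_trace: "orthonormal_cols n r U \<Longrightarrow> (\<Sum>i<n. gram r U i i) = real r"
  unfolding gram_def by (subst sum.swap) (simp add: orthonormal_colsD)

lemma cp_gram_col: "orthonormal_cols n r U \<Longrightarrow> t < r \<Longrightarrow> i < n \<Longrightarrow> (\<Sum>k<n. cp (gram r U) i k * U k t) = 0"
proof -
  assume a: "orthonormal_cols n r U" "t < r" "i < n"
  have "(\<Sum>k<n. cp (gram r U) i k * U k t) = (\<Sum>k<n. (if k = i then U i t else 0) - gram r U i k * U k t)"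
    unfolding cp_def by (intro sum.cong refl) (auto simp: algebra_simps)
  then show ?thesis using a by (simp add: sum_subtractf gram_col)
qed

lemma PP_low_rank:
  fixes r :: nat
  shows "PP n A B (\<lambda>k l. \<Sum>t<r. c t * P k t * Q l t) = (\<lambda>i j. \<Sum>t<r. c t * (\<Sum>k<n. cp A i k * P k t) * (\<Sum>l<n. cp B j l * Q l t))"
proof (intro ext)
  fix i j
  have "PP n A B (\<lambda>k l. \<Sum>t<r. c t * P k t * Q l t) i j = (\<Sum>k<n. \<Sum>l<n. (\<Sum>b<r. c b * P k b * Q l b) * (\<Sum>a<Suc 0. 1 * cp A i k * cp B j l))"
    unfolding PP_def by (intro sum.cong refl) simp
  also have "\<dots> = (\<Sum>t<r. c t * (\<Sum>k<n. cp A i k * P k t) * (\<Sum>l<n. cp B j l * Q l t))"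
    unfolding inner_low_rank by (simp add: mult.commute)
  finally show "PP n A B (\<lambda>k l. \<Sum>t<r. c t * P k t * Q l t) i j = (\<Sum>t<r. c t * (\<Sum>k<n. cp A i k * P k t) * (\<Sum>l<n. cp B j l * Q l t))" .
qed

lemma PP_zero_left:
  assumes "orthonormal_cols n r U" "i < n"
  shows "PP n (gram r U) B (\<lambda>k l. \<Sum>t<r. c t * U k t * Q l t) i j = 0"
  unfolding PP_low_rank by (intro sum.neutral) (use assms in \<open>auto simp: cp_gram_col\<close>)

lemma bil_PP:
  "bil n (PP n A B Z) x y = bil n Z (\<lambda>k. \<Sum>i<n. cp A i k * x i) (\<lambda>l. \<Sum>j<n. cp B j l * y j)"
proof -
  have "bil n (PP n A B Z) x y = (\<Sum>i<n. \<Sum>j<n. \<Sum>k<n. \<Sum>l<n. (cp A i k * x i) * (cp B j l * y j) * Z k l)"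
    unfolding bil_def PP_def sum_distrib_left sum_distrib_right by (intro sum.cong refl) (simp add: mult_ac)
  also have "\<dots> = (\<Sum>k<n. \<Sum>l<n. \<Sum>i<n. \<Sum>j<n. (cp A i k * x i) * (cp B j l * y j) * Z k l)"
    by (rule sum_swap4)
  also have "\<dots> = bil n Z (\<lambda>k. \<Sum>i<n. cp A i k * x i) (\<lambda>l. \<Sum>j<n. cp B j l * y j)"
    unfolding bil_def
  proof (intro sum.cong refl)
    fix k l
    have e: "(\<Sum>i<n. f i) * z * (\<Sum>j<n. g j) = (\<Sum>i<n. \<Sum>j<n. f i * g j * z)" for f g :: "nat \<Rightarrow> real" and z
    proof -
      have "(\<Sum>i<n. f i) * z * (\<Sum>j<n. g j) = ((\<Sum>i<n. f i) * (\<Sum>j<n. g j)) * z" by simp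
      then show ?thesis unfolding sum_product by (simp only: sum_distrib_right)
    qed
    show "(\<Sum>i<n. \<Sum>j<n. cp A i k * x i * (cp B j l * y j) * Z k l) = (\<Sum>i<n. cp A i k * x i) * Z k l * (\<Sum>j<n. cp B j l * y j)"
      by (rule e[symmetric])
  qed
  finally show ?thesis .
qed

lemma pythagoras_gram:
  assumes U: "orthonormal_cols n r U"
  shows "(vnorm r (\<lambda>t. \<Sum>i<n. U i t * x i))\<^sup>2 + (vnorm n (\<lambda>k. \<Sum>i<n. cp (gram r U) i k * x i))\<^sup>2 = (vnorm n x)\<^sup>2"
proof -
  define u where "u t = (\<Sum>i<n. U i t * x i)" for t
  have c: "(\<Sum>i<n. cp (gram r U) i k * x i) = x k - (\<Sum>t<r. U k t * u t)" if "k < n" for k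
  proof -
    have "(\<Sum>i<n. cp (gram r U) i k * x i) = (\<Sum>i<n. (if i = k then x k else 0) - gram r U k i * x i)"
      unfolding cp_def by (intro sum.cong refl) (auto simp: algebra_simps gram_sym[of r U k])
    then show ?thesis using that by (simp add: sum_subtractf gram_apply u_def)
  qed
  have 1: "(\<Sum>k<n. x k * (\<Sum>t<r. U k t * u t)) = (\<Sum>t<r. (u t)\<^sup>2)"
  proof -
    have "(\<Sum>k<n. x k * (\<Sum>t<r. U k t * u t)) = (\<Sum>k<n. \<Sum>t<r. u t * (U k t * x k))"
      by (simp add: sum_distrib_left mult_ac)
    also have "\<dots> = (\<Sum>t<r. \<Sum>k<n. u t * (U k t * x k))" by (rule sum.swap)
    finally show ?thesis by (simp add: sum_distrib_left[symmetric] u_def power2_eq_square)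
  qed
  have 2: "(\<Sum>k<n. (\<Sum>t<r. U k t * u t)\<^sup>2) = (\<Sum>t<r. (u t)\<^sup>2)"
  proof -
    have "(\<Sum>k<n. (\<Sum>t<r. U k t * u t)\<^sup>2) = (\<Sum>k<n. \<Sum>t<r. u t * (U k t * (\<Sum>s<r. U k s * u s)))"
      by (simp add: power2_eq_square sum_distrib_right mult_ac)
    also have "\<dots> = (\<Sum>t<r. \<Sum>k<n. u t * (U k t * (\<Sum>s<r. U k s * u s)))" by (rule sum.swap)
    also have "\<dots> = (\<Sum>t<r. u t * (\<Sum>k<n. \<Sum>s<r. u s * (U k t * U k s)))"
      by (simp add: sum_distrib_left mult_ac)
    also have "\<dots> = (\<Sum>t<r. u t * (\<Sum>s<r. u s * (\<Sum>k<n. U k t * U k s)))"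
    proof (rule sum.cong[OF refl])
      fix t
      have "(\<Sum>k<n. \<Sum>s<r. u s * (U k t * U k s)) = (\<Sum>s<r. \<Sum>k<n. u s * (U k t * U k s))" by (rule sum.swap)
      then show "u t * (\<Sum>k<n. \<Sum>s<r. u s * (U k t * U k s)) = u t * (\<Sum>s<r. u s * (\<Sum>k<n. U k t * U k s))"
        by (simp add: sum_distrib_left)
    qed
    also have "\<dots> = (\<Sum>t<r. u t * (\<Sum>s<r. if s = t then u t else 0))"
      by (intro sum.cong refl arg_cong2[where f = "(*)"]) (auto simp: orthonormal_colsD[OF U])
    finally show ?thesis by (simp add: power2_eq_square)
  qed
  have "(vnorm n (\<lambda>k. \<Sum>i<n. cp (gram r U) i k * x i))\<^sup>2 = (\<Sum>k<n. (x k)\<^sup>2 - 2 * (x k * (\<Sum>t<r. U k t * u t)) + (\<Sum>t<r. U k t * u t)\<^sup>2)"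
    unfolding vnorm_sq by (intro sum.cong refl) (simp add: c power2_diff)
  also have "\<dots> = (\<Sum>k<n. (x k)\<^sup>2) - (\<Sum>t<r. (u t)\<^sup>2)"
    by (simp add: sum.distrib sum_subtractf sum_distrib_left[symmetric] 1 2)
  finally show ?thesis by (simp add: vnorm_sq u_def)
qed

text \<open>The two summands act on orthogonal ranges on both sides. By Pythagoras the form is at
  most \<open>a * b + a' * b'\<close>, and Cauchy-Schwarz in the plane finishes.\<close>

lemma opb_subgradient:
  assumes U: "orthonormal_cols n r U" and V: "orthonormal_cols n r V" and Y: "opb n 1 Y"
  shows "opb n 1 (\<lambda>i j. (\<Sum>t<r. U i t * V j t) + PP n (gram r U) (gram r V) Y i j)"
  unfolding opb_def
proof (intro allI)
  fix x y
  define a a' where "a = vnorm r (\<lambda>t. \<Sum>i<n. U i t * x i)" and "a' = vnorm n (\<lambda>k. \<Sum>i<n. cp (gram r U) i k * x i)"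
  define b b' where "b = vnorm r (\<lambda>t. \<Sum>i<n. V i t * y i)" and "b' = vnorm n (\<lambda>k. \<Sum>i<n. cp (gram r V) i k * y i)"
  have nn: "0 \<le> a" "0 \<le> a'" "0 \<le> b" "0 \<le> b'" by (auto simp: a_def a'_def b_def b'_def)
  have sq: "a\<^sup>2 + a'\<^sup>2 = (vnorm n x)\<^sup>2" "b\<^sup>2 + b'\<^sup>2 = (vnorm n y)\<^sup>2"
    unfolding a_def a'_def b_def b'_def by (rule pythagoras_gram, fact)+
  have 1: "\<bar>bil n (\<lambda>i j. \<Sum>t<r. U i t * V j t) x y\<bar> \<le> a * b"
  proof -
    have "bil n (\<lambda>i j. \<Sum>t<r. U i t * V j t) x y = (\<Sum>i<n. \<Sum>j<n. (\<Sum>a<r. 1 * U i a * V j a) * (\<Sum>b<Suc 0. 1 * x i * y j))"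
      unfolding bil_def by (intro sum.cong refl) (simp add: sum_distrib_left sum_distrib_right mult_ac)
    also have "\<dots> = (\<Sum>t<r. (\<Sum>i<n. U i t * x i) * (\<Sum>j<n. V j t * y j))"
      unfolding inner_low_rank by simp
    finally show ?thesis using vdot_abs_le by (simp add: a_def b_def)
  qed
  have 2: "\<bar>bil n (PP n (gram r U) (gram r V) Y) x y\<bar> \<le> a' * b'"
    using Y unfolding bil_PP opb_def a'_def b'_def by (simp only: mult_1)
  have "(a * b + a' * b')\<^sup>2 \<le> (vnorm n x * vnorm n y)\<^sup>2"
  proof -
    have "(a * b + a' * b')\<^sup>2 + (a * b' - a' * b)\<^sup>2 = (a\<^sup>2 + a'\<^sup>2) * (b\<^sup>2 + b'\<^sup>2)"
      by (simp add: power2_eq_square algebra_simps)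
    then show ?thesis unfolding sq power_mult_distrib by (smt (verit) zero_le_power2)
  qed
  then have 3: "a * b + a' * b' \<le> vnorm n x * vnorm n y"
    by (rule power2_le_imp_le) simp
  have "bil n (\<lambda>i j. (\<Sum>t<r. U i t * V j t) + PP n (gram r U) (gram r V) Y i j) x y
    = bil n (\<lambda>i j. \<Sum>t<r. U i t * V j t) x y + bil n (PP n (gram r U) (gram r V) Y) x y"
    by (simp add: bil_def distrib_left distrib_right sum.distrib)
  then show "\<bar>bil n (\<lambda>i j. (\<Sum>t<r. U i t * V j t) + PP n (gram r U) (gram r V) Y i j) x y\<bar> \<le> 1 * vnorm n x * vnorm n y"
    using 1 2 3 by linarith
qed

text \<open>Duality gives this direction without completing the thin factors to square orthogonal
  matrices.\<close>

lemma nuc_norm_thin: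
  assumes U: "orthonormal_cols n r U" and V: "orthonormal_cols n r V" and \<sigma>: "\<And>k. k < r \<Longrightarrow> 0 \<le> \<sigma> k"
    and X: "\<And>i j. i < n \<Longrightarrow> j < n \<Longrightarrow> X i j = (\<Sum>k<r. \<sigma> k * U i k * V j k)"
  shows "nuc_norm n X \<le> ip n (\<lambda>i j. \<Sum>t<r. U i t * V j t) X"
proof -
  let ?P = "svl n X" and ?Q = "svr n X" and ?s = "svv n X"
  note sv = is_svdD[OF is_svd_svd[of n X]]
  let ?Y = "\<lambda>i j. \<Sum>t<n. ?P i t * ?Q j t"
  have inner: "ip n Y X = (\<Sum>k<r. \<sigma> k * bil n Y (\<lambda>i. U i k) (\<lambda>j. V j k))" for Y
  proof -
    have "ip n Y X = (\<Sum>i<n. \<Sum>j<n. Y i j * (\<Sum>k<r. \<sigma> k * (U i k * V j k)))"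
      unfolding frob_inner_def by (intro sum.cong refl) (simp add: X mult.assoc)
    also have "\<dots> = (\<Sum>k<r. \<sigma> k * (\<Sum>i<n. \<Sum>j<n. Y i j * (U i k * V j k)))"
      by (rule sum_swap_mat)
    finally show ?thesis by (simp add: bil_def mult_ac)
  qed
  have "nuc_norm n X = ip n ?Y X"
  proof -
    have "bil n ?Y (\<lambda>i. ?P i k) (\<lambda>j. ?Q j k) = 1" if k: "k < n" for k
    proof -
      have "is_svd n ?Y ?P ?Q (\<lambda>_. 1)" using sv by (simp add: is_svd_def)
      from bil_svd_left[OF this k] show ?thesis using orthonormal_colsD[OF sv(2) k k] by simp
    qed
    then show ?thesis unfolding nuc_norm_svv ip_svd[OF is_svd_svd[of n X]] by simp
  qed
  also have "\<dots> \<le> (\<Sum>k<r. \<sigma> k)"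
    unfolding inner
  proof (rule sum_mono)
    fix k assume "k \<in> {..<r}"
    then have k: "k < r" by simp
    have "\<bar>bil n ?Y (\<lambda>i. U i k) (\<lambda>j. V j k)\<bar> \<le> 1 * vnorm n (\<lambda>i. U i k) * vnorm n (\<lambda>j. V j k)"
      using opb_outer[OF sv(1,2)] unfolding opb_def by blast
    then have "bil n ?Y (\<lambda>i. U i k) (\<lambda>j. V j k) \<le> 1"
      by (simp add: vnorm_col[OF U k] vnorm_col[OF V k])
    then show "\<sigma> k * bil n ?Y (\<lambda>i. U i k) (\<lambda>j. V j k) \<le> \<sigma> k"
      using \<sigma>[OF k] by (simp add: mult_left_le)
  qed
  also have "\<dots> = ip n (\<lambda>i j. \<Sum>t<r. U i t * V j t) X"
    unfolding inner
  proof (rule sum.cong[OF refl])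
    fix k assume "k \<in> {..<r}"
    then have k: "k < r" by simp
    have "bil n (\<lambda>i j. \<Sum>t<r. U i t * V j t) (\<lambda>i. U i k) (\<lambda>j. V j k) = (\<Sum>i<n. \<Sum>j<n. (\<Sum>a<r. 1 * U i a * V j a) * (\<Sum>b<Suc 0. 1 * U i k * V j k))"
      unfolding bil_def by (intro sum.cong refl) (simp add: sum_distrib_left sum_distrib_right mult_ac)
    also have "\<dots> = (\<Sum>t<r. if t = k then 1 else 0)"
      unfolding inner_low_rank by (intro sum.cong refl) (use k in \<open>auto simp: orthonormal_colsD[OF U] orthonormal_colsD[OF V]\<close>)
    finally show "\<sigma> k = \<sigma> k * bil n (\<lambda>i j. \<Sum>t<r. U i t * V j t) (\<lambda>i. U i k) (\<lambda>j. V j k)" using k by simp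
  qed
  finally show ?thesis .
qed

text \<open>The subgradient is chosen with a normal part dual to the normal part of H, which gains
  its full nuclear norm. The normal part of D costs at most the fraction \<alpha> of it, and its
  tangential part is left for the certificate.\<close>

lemma objective_gap:
  fixes \<Psi> X :: rmat
  assumes P2: "proj2 n (gram r U) (gram r V)"
    and U: "orthonormal_cols n r U" and V: "orthonormal_cols n r V" and \<sigma>: "\<And>k. k < r \<Longrightarrow> 0 \<le> \<sigma> k"
    and Xs: "\<And>i j. i < n \<Longrightarrow> j < n \<Longrightarrow> Xs i j = (\<Sum>k<r. \<sigma> k * U i k * V j k)"
  defines "A \<equiv> gram r U" and "B \<equiv> gram r V"
  defines "D \<equiv> \<lambda>i j. (\<Sum>t<r. U i t * V j t) - \<Psi> i j" and "H \<equiv> \<lambda>i j. X i j - Xs i j"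
  assumes \<alpha>: "opb n \<alpha> (PP n A B D)"
  shows "nuc_norm n X - ip n \<Psi> X \<ge> nuc_norm n Xs - ip n \<Psi> Xs + (1 - \<alpha>) * nuc_norm n (PP n A B H) - \<bar>ip n (PT n A B (PT n A B D)) H\<bar>"
proof -
  interpret proj2 n A B using P2 by (simp add: A_def B_def)
  let ?N = "PP n A B H"
  let ?Q = "\<lambda>i j. \<Sum>t<n. svl n ?N i t * svr n ?N j t"
  let ?E = "\<lambda>i j. \<Sum>t<r. U i t * V j t"
  note sv = is_svdD[OF is_svd_svd[of n ?N]]
  have Q1: "opb n 1 ?Q" by (rule opb_outer[OF sv(1,2)])
  have QN: "ip n ?Q ?N = nuc_norm n ?N"
  proof -
    have "bil n ?Q (\<lambda>i. svl n ?N i k) (\<lambda>j. svr n ?N j k) = 1" if k: "k < n" for k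
    proof -
      have "is_svd n ?Q (svl n ?N) (svr n ?N) (\<lambda>_. 1)" using sv by (simp add: is_svd_def)
      from bil_svd_left[OF this k] show ?thesis using orthonormal_colsD[OF sv(2) k k] by simp
    qed
    then show ?thesis unfolding nuc_norm_svv ip_svd[OF is_svd_svd[of n ?N]] by simp
  qed
  have PXs: "PP n A B Xs i j = 0" if "i < n" for i j
  proof -
    have "PP n A B Xs = PP n A B (\<lambda>k l. \<Sum>t<r. \<sigma> t * U k t * V l t)" by (rule PP_cong) (simp add: Xs)
    then show ?thesis using PP_zero_left[OF U that, of B \<sigma> V] by (simp add: A_def)
  qed
  have "ip n (\<lambda>i j. ?E i j + PP n A B ?Q i j) X \<le> 1 * nuc_norm n X"
    using ip_le_nuc[OF opb_subgradient[OF U V Q1], of X] by (simp add: A_def B_def)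
  moreover have "ip n (\<lambda>i j. ?E i j + PP n A B ?Q i j) X = ip n ?E X + ip n (PP n A B ?Q) X"
    by (simp add: frob_inner_def distrib_right sum.distrib)
  moreover have "ip n (PP n A B ?Q) X = nuc_norm n ?N"
  proof -
    have "ip n (PP n A B ?Q) X = ip n ?Q (PP n A B X)" by (rule ip_PP)
    also have "\<dots> = ip n ?Q ?N"
    proof (rule ip_cong)
      fix i j assume ij: "i < n" "j < n"
      have "?N i j = PP n A B X i j - PP n A B Xs i j"
        by (simp add: H_def PP_def right_diff_distrib sum_subtractf)
      then show "PP n A B X i j = ?N i j" using PXs[OF ij(1)] by simp
    qed simp
    finally show ?thesis by (simp add: QN)
  qed
  moreover have "nuc_norm n Xs \<le> ip n ?E Xs" by (rule nuc_norm_thin[OF U V \<sigma> Xs])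
  moreover have "ip n ?E X - ip n \<Psi> X - (ip n ?E Xs - ip n \<Psi> Xs) = ip n D H"
    by (simp add: frob_inner_def D_def H_def algebra_simps sum.distrib sum_subtractf)
  moreover have "ip n D H = ip n (PT n A B (PT n A B D)) H + ip n (PP n A B D) ?N"
  proof -
    have "ip n D H = ip n (\<lambda>i j. PT n A B (PT n A B D) i j + PP n A B (PP n A B D) i j) H"
    proof (rule ip_cong)
      fix i j assume ij: "i < n" "j < n"
      show "D i j = PT n A B (PT n A B D) i j + PP n A B (PP n A B D) i j"
        unfolding PT_idem[OF ij] PP_idem[OF ij] using PP_PT[OF ij, of D] by simp
    qed simp
    also have "\<dots> = ip n (PT n A B (PT n A B D)) H + ip n (PP n A B (PP n A B D)) H"
      by (simp add: frob_inner_def distrib_right sum.distrib)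
    finally show ?thesis by (simp add: ip_PP)
  qed
  moreover have "\<bar>ip n (PP n A B D) ?N\<bar> \<le> \<alpha> * nuc_norm n ?N" by (rule ip_le_nuc[OF \<alpha>])
  ultimately show ?thesis by (simp add: algebra_simps)
qed

section \<open>Principal angles and leverage scores\<close>

lemma mmul_assoc: "mmul a (mmul b A B) C = mmul b A (mmul a B C)"
proof (intro ext)
  fix i j
  have "mmul a (mmul b A B) C i j = (\<Sum>t<a. \<Sum>s<b. A i s * (B s t * C t j))"
    by (simp add: mmul_def sum_distrib_right mult.assoc)
  also have "\<dots> = (\<Sum>s<b. \<Sum>t<a. A i s * (B s t * C t j))" by (rule sum.swap)
  finally show "mmul a (mmul b A B) C i j = mmul b A (mmul a B C) i j"
    by (simp add: mmul_def sum_distrib_left)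
qed

lemma mtrans_mmul: "mtrans (mmul k A B) = mmul k (mtrans B) (mtrans A)"
  by (simp add: mmul_def mtrans_def mult.commute)

lemma mtrans_mtrans [simp]: "mtrans (mtrans A) = A"
  by (simp add: mtrans_def)

lemma mtrans_diagm [simp]: "mtrans (diagm d) = diagm d"
  by (auto simp: mtrans_def diagm_def fun_eq_iff)

lemma mmul_diagm: "j < r \<Longrightarrow> mmul r M (diagm d) i j = M i j * d j"
  unfolding mmul_def diagm_def by (subst sum.cong[OF refl, where h = "\<lambda>t. if t = j then M i j * d j else 0"]) auto

lemma mmul_cong_left: "(\<And>t. t < k \<Longrightarrow> A i t = A' i t) \<Longrightarrow> mmul k A B i j = mmul k A' B i j"
  unfolding mmul_def by (intro sum.cong) auto

lemma mmul_cong_right: "(\<And>t. t < k \<Longrightarrow> B t j = B' t j) \<Longrightarrow> mmul k A B i j = mmul k A B' i j"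
  unfolding mmul_def by (intro sum.cong) auto

lemma mmul_orth_right:
  assumes "orthogonal_mat r Q" "s < r"
  shows "mmul r (mmul r M Q) (mtrans Q) i s = M i s"
proof -
  have "mmul r (mmul r M Q) (mtrans Q) i s = (\<Sum>u<r. M i u * (\<Sum>t<r. Q u t * Q s t))"
    unfolding mmul_assoc by (simp add: mmul_def mtrans_def)
  also have "\<dots> = (\<Sum>u<r. if u = s then M i s else 0)"
    by (intro sum.cong refl) (use assms in \<open>auto simp: orthonormal_rows orthogonal_mat_def\<close>)
  finally show ?thesis using assms(2) by simp
qed

lemma mmul_orth_right':
  assumes "orthogonal_mat r Q" "s < r"
  shows "mmul r (mmul r M (mtrans Q)) Q i s = M i s"
proof -
  have "mmul r (mmul r M (mtrans Q)) Q i s = (\<Sum>u<r. M i u * (\<Sum>t<r. Q t u * Q t s))"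
    unfolding mmul_assoc by (simp add: mmul_def mtrans_def)
  also have "\<dots> = (\<Sum>u<r. if u = s then M i s else 0)"
    by (intro sum.cong refl) (use assms in \<open>auto simp: orthonormal_colsD orthogonal_mat_def\<close>)
  finally show ?thesis using assms(2) by simp
qed

lemma rotate_gram:
  assumes Q: "orthogonal_mat r Q"
  shows "gram r (mmul r M Q) i j = gram r M i j"
proof -
  have "gram r (mmul r M Q) i j = mmul r (mmul r M Q) (mtrans (mmul r M Q)) i j"
    by (simp add: gram_def mmul_def mtrans_def)
  also have "\<dots> = mmul r (mmul r (mmul r M Q) (mtrans Q)) (mtrans M) i j"
    by (simp add: mtrans_mmul mmul_assoc)
  also have "\<dots> = mmul r M (mtrans M) i j"
    by (rule mmul_cong_left) (rule mmul_orth_right[OF Q])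
  finally show ?thesis by (simp add: gram_def mmul_def mtrans_def)
qed

lemma rotate_vnorm:
  assumes Q: "orthogonal_mat r Q"
  shows "vnorm r (mmul r M Q i) = vnorm r (M i)"
  using rotate_gram[OF Q, of M i i] by (simp add: gram_diag)

lemma orthogonal_mtrans: "orthogonal_mat r Q \<Longrightarrow> orthogonal_mat r (mtrans Q)"
  unfolding orthogonal_mat_def mtrans_def orthonormal_cols_def[of _ _ "\<lambda>i j. Q j i"] by (simp add: orthonormal_rows)

lemma orthonormal_cols_mmul: "orthonormal_cols n r U \<longleftrightarrow> (\<forall>a<r. \<forall>b<r. mmul n (mtrans U) U a b = (if a = b then 1 else 0))"
  by (simp add: orthonormal_cols_def mmul_def mtrans_def)

lemma mmul_idm: "s < r \<Longrightarrow> mmul r M idm i s = M i s"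
  by (simp add: idm_def mmul_diagm)

lemma orthonormal_rotate:
  assumes U: "orthonormal_cols n r U" and Q: "orthogonal_mat r Q"
  shows "orthonormal_cols n r (mmul r U Q)"
  unfolding orthonormal_cols_mmul
proof (intro allI impI)
  fix a b assume ab: "a < r" "b < r"
  have "mmul n (mtrans (mmul r U Q)) (mmul r U Q) a b = mmul r (mmul r (mtrans Q) (mmul n (mtrans U) U)) Q a b"
    by (simp add: mtrans_mmul mmul_assoc)
  also have "\<dots> = mmul r (mmul r (mtrans Q) idm) Q a b"
    using U unfolding orthonormal_cols_mmul by (intro mmul_cong_left mmul_cong_right) (auto simp: idm_def diagm_def)
  also have "\<dots> = mmul r (mtrans Q) Q a b"
    by (intro mmul_cong_left mmul_idm)
  finally show "mmul n (mtrans (mmul r U Q)) (mmul r U Q) a b = (if a = b then 1 else 0)"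
    using Q ab by (simp add: orthogonal_mat_def orthonormal_cols_mmul)
qed

text \<open>Bessel's inequality for orthogonal columns of squared norm e at most 1. It is applied
  with columns of norm 0 or 1, zero columns arising where a sine vanishes.\<close>

lemma bessel_weighted:
  assumes Q: "\<And>a b. a < r \<Longrightarrow> b < r \<Longrightarrow> (\<Sum>i<n. Q i a * Q i b) = (if a = b then e a else 0)"
    and e: "\<And>a. a < r \<Longrightarrow> e a \<le> 1"
  shows "vnorm r (\<lambda>t. \<Sum>i<n. Q i t * x i) \<le> vnorm n x"
proof -
  define u where "u t = (\<Sum>i<n. Q i t * x i)" for t
  have 1: "(\<Sum>i<n. (\<Sum>t<r. u t * Q i t) * x i) = (vnorm r u)\<^sup>2"
  proof -
    have "(\<Sum>i<n. (\<Sum>t<r. u t * Q i t) * x i) = (\<Sum>i<n. \<Sum>t<r. u t * (Q i t * x i))"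
      by (simp add: sum_distrib_right mult.assoc)
    also have "\<dots> = (\<Sum>t<r. \<Sum>i<n. u t * (Q i t * x i))" by (rule sum.swap)
    finally show ?thesis unfolding vnorm_sq by (simp add: sum_distrib_left[symmetric] u_def[symmetric] power2_eq_square)
  qed
  have 2: "(\<Sum>i<n. (\<Sum>t<r. u t * Q i t)\<^sup>2) = (\<Sum>t<r. (u t)\<^sup>2 * e t)"
  proof -
    have "(\<Sum>i<n. (\<Sum>t<r. u t * Q i t)\<^sup>2) = (\<Sum>i<n. \<Sum>t<r. \<Sum>s<r. (u t * u s) * (Q i t * Q i s))"
      by (simp add: power2_eq_square sum_product mult_ac)
    also have "\<dots> = (\<Sum>t<r. \<Sum>i<n. \<Sum>s<r. (u t * u s) * (Q i t * Q i s))" by (rule sum.swap)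
    also have "\<dots> = (\<Sum>t<r. \<Sum>s<r. \<Sum>i<n. (u t * u s) * (Q i t * Q i s))" by (intro sum.cong refl sum.swap)
    also have "\<dots> = (\<Sum>t<r. \<Sum>s<r. if s = t then (u t)\<^sup>2 * e t else 0)"
      by (intro sum.cong refl) (auto simp: sum_distrib_left[symmetric] Q power2_eq_square)
    finally show ?thesis by simp
  qed
  have "0 \<le> (\<Sum>i<n. (x i - (\<Sum>t<r. u t * Q i t))\<^sup>2)" by (intro sum_nonneg) simp
  also have "\<dots> = (\<Sum>i<n. (x i)\<^sup>2) - 2 * (\<Sum>i<n. (\<Sum>t<r. u t * Q i t) * x i) + (\<Sum>i<n. (\<Sum>t<r. u t * Q i t)\<^sup>2)"
    by (simp add: power2_diff sum.distrib sum_subtractf sum_distrib_left mult_ac)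
  also have "\<dots> \<le> (vnorm n x)\<^sup>2 - 2 * (vnorm r u)\<^sup>2 + (vnorm r u)\<^sup>2"
  proof -
    have "(\<Sum>t<r. (u t)\<^sup>2 * e t) \<le> (\<Sum>t<r. (u t)\<^sup>2)"
      by (intro sum_mono) (auto intro!: mult_left_le e)
    then show ?thesis unfolding 1 2 vnorm_sq by simp
  qed
  finally have "(vnorm r u)\<^sup>2 \<le> (vnorm n x)\<^sup>2" by simp
  then show ?thesis unfolding u_def by (rule power2_le_imp_le) simp
qed

text \<open>The component of \<open>Ut\<close> orthogonal to \<open>U\<close>, written as \<open>Z\<close> times the sine factor.
  Where a sine vanishes the column of \<open>Y\<close> below vanishes too, so the division by zero is harmless.\<close>

lemma principal_angles:
  assumes U: "orthonormal_cols n r U" and Ut: "orthonormal_cols n r Ut"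
    and L: "orthogonal_mat r L" and R: "orthogonal_mat r R"
    and svd: "mat_eq r r (mmul n (mtrans U) Ut) (mmul r (mmul r L (diagm (\<lambda>k. cos (g k)))) (mtrans R))"
  obtains Z where
    "\<And>i t. i < n \<Longrightarrow> t < r \<Longrightarrow> Ut i t = mmul r U (mmul r (mmul r L (diagm (\<lambda>k. cos (g k)))) (mtrans R)) i t
      + mmul r Z (mmul r (mmul r L (diagm (\<lambda>k. sin (g k)))) (mtrans R)) i t"
    "\<And>s t. s < r \<Longrightarrow> t < r \<Longrightarrow> (\<Sum>i<n. U i s * Z i t) = 0"
    "\<And>x. vnorm r (\<lambda>t. \<Sum>i<n. Z i t * x i) \<le> vnorm n x"
    "\<And>M i. (\<And>s t. s < r \<Longrightarrow> (\<Sum>j<n. M j * U j s) = U i s) \<Longrightarrow> (\<And>s t. s < r \<Longrightarrow> (\<Sum>j<n. M j * Ut j s) = Ut i s)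
      \<Longrightarrow> vnorm r (Z i) \<le> vnorm n M"
proof -
  define c s where "c k = cos (g k)" and "s k = sin (g k)" for k
  define U' T' where "U' = mmul r U L" and "T' = mmul r Ut R"
  define Y Q where "Y i k = T' i k - U' i k * c k" and "Q i k = Y i k / s k" for i k
  define Z where "Z = mmul r Q (mtrans L)"
  have U': "orthonormal_cols n r U'" and T': "orthonormal_cols n r T'"
    unfolding U'_def T'_def by (intro orthonormal_rotate U Ut L R)+
  \<comment> \<open>After both bases are rotated to principal vectors, their overlap is the diagonal
    matrix of cosines.\<close>
  have UT: "(\<Sum>i<n. U' i a * T' i b) = (if a = b then c a else 0)" if "a < r" "b < r" for a b
  proof -
    have "(\<Sum>i<n. U' i a * T' i b) = mmul n (mtrans U') T' a b" by (simp add: mmul_def mtrans_def)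
    also have "\<dots> = mmul r (mmul r (mtrans L) (mmul n (mtrans U) Ut)) R a b"
      by (simp add: U'_def T'_def mtrans_mmul mmul_assoc)
    also have "\<dots> = mmul r (mmul r (mtrans L) (mmul r (mmul r L (diagm c)) (mtrans R))) R a b"
      using svd unfolding mat_eq_def c_def by (intro mmul_cong_left mmul_cong_right) auto
    also have "\<dots> = mmul r (mmul r (mmul r (mmul r (mtrans L) L) (diagm c)) (mtrans R)) R a b"
      by (simp add: mmul_assoc)
    also have "\<dots> = mmul r (mmul r (mtrans L) L) (diagm c) a b" by (rule mmul_orth_right'[OF R that(2)])
    finally show ?thesis using L that by (auto simp: mmul_diagm orthogonal_mat_def orthonormal_cols_mmul)
  qed
  have TU: "(\<Sum>i<n. T' i a * U' i b) = (if a = b then c a else 0)" if "a < r" "b < r" for a b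
    using UT[OF that(2,1)] by (auto simp: mult.commute)
  have UY: "(\<Sum>i<n. U' i a * Y i b) = 0" if "a < r" "b < r" for a b
  proof -
    have "(\<Sum>i<n. U' i a * Y i b) = (\<Sum>i<n. U' i a * T' i b) - (\<Sum>i<n. U' i a * U' i b) * c b"
      by (simp add: Y_def right_diff_distrib sum_subtractf sum_distrib_right mult.assoc)
    then show ?thesis using UT[OF that] orthonormal_colsD[OF U' that] by simp
  qed
  have YY: "(\<Sum>i<n. Y i a * Y i b) = (if a = b then (s a)\<^sup>2 else 0)" if "a < r" "b < r" for a b
  proof -
    have "(\<Sum>i<n. Y i a * Y i b) = (\<Sum>i<n. T' i a * Y i b - c a * (U' i a * Y i b))"
      by (intro sum.cong refl) (simp add: Y_def algebra_simps)
    also have "\<dots> = (\<Sum>i<n. T' i a * Y i b) - c a * (\<Sum>i<n. U' i a * Y i b)"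
      by (simp add: sum_subtractf sum_distrib_left)
    also have "\<dots> = (\<Sum>i<n. T' i a * T' i b) - (\<Sum>i<n. T' i a * U' i b) * c b"
      unfolding UY[OF that] by (simp add: Y_def right_diff_distrib sum_subtractf sum_distrib_right mult.assoc)
    finally show ?thesis using TU[OF that] orthonormal_colsD[OF T' that] sin_cos_squared_add[of "g a"]
      by (auto simp: c_def s_def power2_eq_square)
  qed
  have YQ: "Y i k = Q i k * s k" if "i < n" "k < r" for i k
  proof (cases "s k = 0")
    case True
    then have "(\<Sum>i<n. (Y i k)\<^sup>2) = 0" using YY[OF that(2,2)] by (simp add: power2_eq_square)
    then have "Y i k = 0" using that(1) by (subst (asm) sum_nonneg_eq_0_iff) auto
    then show ?thesis using True by simp
  qed (simp add: Q_def)
  have QQ: "(\<Sum>i<n. Q i a * Q i b) = (if a = b then if s a = 0 then 0 else 1 else 0)" if "a < r" "b < r" for a b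
  proof -
    have "(\<Sum>i<n. Q i a * Q i b) = (\<Sum>i<n. Y i a * Y i b) / (s a * s b)"
      by (simp add: Q_def sum_divide_distrib)
    then show ?thesis using YY[OF that] by (auto simp: power2_eq_square)
  qed
  have bes: "vnorm r (\<lambda>t. \<Sum>i<n. Q i t * x i) \<le> vnorm n x" for x
    by (rule bessel_weighted[OF QQ]) auto
  have Zv: "(\<lambda>t. \<Sum>i<n. Z i t * x i) = mmul r (\<lambda>_ t. \<Sum>i<n. Q i t * x i) (mtrans L) 0" for x
  proof
    fix t
    have "(\<Sum>i<n. Z i t * x i) = (\<Sum>i<n. \<Sum>k<r. Q i k * x i * L t k)"
      by (simp add: Z_def mmul_def mtrans_def sum_distrib_left mult_ac)
    also have "\<dots> = (\<Sum>k<r. \<Sum>i<n. Q i k * x i * L t k)" by (rule sum.swap)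
    finally show "(\<Sum>i<n. Z i t * x i) = mmul r (\<lambda>_ t. \<Sum>i<n. Q i t * x i) (mtrans L) 0 t"
      by (simp add: mmul_def mtrans_def sum_distrib_right)
  qed
  show ?thesis
  proof (rule that[of Z])
    fix i t assume it: "i < n" "t < r"
    have "Ut i t = mmul r T' (mtrans R) i t" unfolding T'_def by (rule mmul_orth_right[OF R it(2), symmetric])
    also have "\<dots> = mmul r (\<lambda>i k. U' i k * c k + Q i k * s k) (mtrans R) i t"
      by (rule mmul_cong_left) (use YQ[OF it(1)] in \<open>simp add: Y_def algebra_simps\<close>)
    also have "\<dots> = mmul r (\<lambda>i k. U' i k * c k) (mtrans R) i t + mmul r (\<lambda>i k. Q i k * s k) (mtrans R) i t"
      by (simp add: mmul_def distrib_right sum.distrib)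
    also have "mmul r (\<lambda>i k. U' i k * c k) (mtrans R) i t = mmul r (mmul r U' (diagm c)) (mtrans R) i t"
      by (rule mmul_cong_left) (simp add: mmul_diagm)
    also have "\<dots> = mmul r U (mmul r (mmul r L (diagm c)) (mtrans R)) i t"
      by (simp add: U'_def mmul_assoc)
    also have "mmul r (\<lambda>i k. Q i k * s k) (mtrans R) i t = mmul r (mmul r (mmul r Z L) (diagm s)) (mtrans R) i t"
      unfolding Z_def by (rule mmul_cong_left) (simp add: mmul_diagm mmul_orth_right'[OF L])
    also have "\<dots> = mmul r Z (mmul r (mmul r L (diagm s)) (mtrans R)) i t"
      by (simp add: mmul_assoc)
    finally show "Ut i t = mmul r U (mmul r (mmul r L (diagm (\<lambda>k. cos (g k)))) (mtrans R)) i t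
      + mmul r Z (mmul r (mmul r L (diagm (\<lambda>k. sin (g k)))) (mtrans R)) i t"
      by (simp add: c_def[abs_def] s_def[abs_def])
  next
    fix a b assume ab: "a < r" "b < r"
    have "(\<Sum>i<n. U i a * Z i b) = (\<Sum>i<n. mmul r U' (mtrans L) i a * Z i b)"
      unfolding U'_def by (simp add: mmul_orth_right[OF L ab(1)])
    also have "\<dots> = mmul n (mtrans (mmul r U' (mtrans L))) Z a b" by (simp add: mmul_def mtrans_def)
    also have "\<dots> = mmul r L (mmul r (mmul n (mtrans U') Q) (mtrans L)) a b"
      by (simp add: Z_def mtrans_mmul mmul_assoc)
    also have "\<dots> = mmul r L (\<lambda>_ _. 0) a b"
    proof (rule mmul_cong_right)
      fix u assume u: "u < r"
      have "mmul r (mmul n (mtrans U') Q) (mtrans L) u b = mmul r (\<lambda>_ _. 0) (mtrans L) u b"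
      proof (rule mmul_cong_left)
        fix v assume v: "v < r"
        have "mmul n (mtrans U') Q u v = (\<Sum>i<n. U' i u * Y i v) / s v"
          by (simp add: mmul_def mtrans_def Q_def sum_divide_distrib)
        then show "mmul n (mtrans U') Q u v = 0" by (simp add: UY[OF u v])
      qed
      then show "mmul r (mmul n (mtrans U') Q) (mtrans L) u b = 0" by (simp add: mmul_def)
    qed
    finally show "(\<Sum>i<n. U i a * Z i b) = 0" by (simp add: mmul_def)
  next
    fix x
    show "vnorm r (\<lambda>t. \<Sum>i<n. Z i t * x i) \<le> vnorm n x"
      unfolding Zv rotate_vnorm[OF orthogonal_mtrans[OF L]] by (rule bes)
  next
    \<comment> \<open>M plays the role of row i of a projection that fixes the columns of U and Ut.
      It then reproduces row i of every linear combination of them, and Bessel's inequality bounds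
      that row by the norm of M.\<close>
    fix M i
    assume MU: "\<And>s t. s < r \<Longrightarrow> (\<Sum>j<n. M j * U j s) = U i s"
      and MT: "\<And>s t. s < r \<Longrightarrow> (\<Sum>j<n. M j * Ut j s) = Ut i s"
    have rot: "(\<Sum>j<n. M j * mmul r B P j k) = mmul r B P i k" if "\<And>s. s < r \<Longrightarrow> (\<Sum>j<n. M j * B j s) = B i s" for B P k
    proof -
      have "(\<Sum>j<n. M j * mmul r B P j k) = mmul n (\<lambda>_. M) (mmul r B P) 0 k" by (simp add: mmul_def)
      also have "\<dots> = mmul r (mmul n (\<lambda>_. M) B) P 0 k" by (simp add: mmul_assoc)
      also have "\<dots> = mmul r (\<lambda>_. B i) P 0 k" by (rule mmul_cong_left) (simp add: mmul_def that)
      finally show ?thesis by (simp add: mmul_def)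
    qed
    have "(\<Sum>j<n. Q j k * M j) = Q i k" for k
    proof -
      have "(\<Sum>j<n. Q j k * M j) = ((\<Sum>j<n. M j * T' j k) - (\<Sum>j<n. M j * U' j k) * c k) / s k"
        by (simp add: Q_def Y_def algebra_simps sum_subtractf sum_distrib_left sum_divide_distrib[symmetric])
      also have "\<dots> = Q i k"
        unfolding T'_def U'_def using MU MT by (simp add: rot Q_def Y_def T'_def U'_def)
      finally show ?thesis .
    qed
    then have "vnorm r (Q i) \<le> vnorm n M" using bes[of M] by simp
    then show "vnorm r (Z i) \<le> vnorm n M"
      unfolding Z_def rotate_vnorm[OF orthogonal_mtrans[OF L]] .
  qed
qed

section \<open>Leverage scores and the row bound for the prior information\<close>

lemma gram_fixes_span:
  assumes S: "orthonormal_cols n d S" and x: "x \<in> col_span n d S"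
  shows "i < n \<Longrightarrow> (\<Sum>j<n. gram d S i j * x j) = x i"
proof -
  assume i: "i < n"
  from x obtain c where c: "\<And>i. i < n \<Longrightarrow> x i = (\<Sum>t<d. S i t * c t)" by (auto simp: col_span_def)
  have "(\<Sum>j<n. gram d S i j * x j) = (\<Sum>j<n. \<Sum>t<d. c t * (gram d S i j * S j t))"
    by (simp add: c sum_distrib_left mult_ac)
  also have "\<dots> = (\<Sum>t<d. \<Sum>j<n. c t * (gram d S i j * S j t))" by (rule sum.swap)
  also have "\<dots> = x i"
    unfolding c[OF i] by (intro sum.cong refl) (simp add: sum_distrib_left[symmetric] gram_col[OF S])
  finally show ?thesis .
qed

lemma gram_fixes_col:
  assumes S: "orthonormal_cols n d S" and E: "col_span n d S = col_span n k M" and t: "t < k" and i: "i < n"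
  shows "(\<Sum>j<n. gram d S i j * M j t) = M i t"
proof -
  define x where "x j = (if j < n then M j t else 0)" for j
  have "x \<in> col_span n k M"
    unfolding col_span_def using t
    by (auto simp: x_def intro!: exI[of _ "\<lambda>s. if s = t then 1 else 0"] simp: if_distrib[where f = "\<lambda>a. _ * a"] cong: if_cong)
  then have "(\<Sum>j<n. gram d S i j * x j) = x i" using gram_fixes_span[OF S _ i, of x] E by simp
  then show ?thesis using i by (simp add: x_def)
qed

text \<open>Each projection fixes the range of the other, so both products collapse and symmetry
  makes the projections equal. The dimensions agree because they are the traces.\<close>

lemma gram_unique:
  assumes S: "orthonormal_cols n d S" and S': "orthonormal_cols n d' S'" and E: "col_span n d S = col_span n d' S'"
  shows "i < n \<Longrightarrow> j < n \<Longrightarrow> gram d S i j = gram d' S' i j" and "d = d'"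
proof -
  have prod: "(\<Sum>k<n. gram a T i k * gram b T' k j) = gram b T' i j"
    if "orthonormal_cols n a T" "col_span n a T = col_span n b T'" "i < n" for a b T T' i j
  proof -
    have "(\<Sum>k<n. gram a T i k * gram b T' k j) = (\<Sum>k<n. \<Sum>t<b. T' j t * (gram a T i k * T' k t))"
      by (simp add: gram_eq[of b] sum_distrib_left mult_ac)
    also have "\<dots> = (\<Sum>t<b. \<Sum>k<n. T' j t * (gram a T i k * T' k t))" by (rule sum.swap)
    also have "\<dots> = (\<Sum>t<b. T' j t * T' i t)"
      by (intro sum.cong refl) (simp add: sum_distrib_left[symmetric] gram_fixes_col[OF that(1,2) _ that(3)])
    finally show ?thesis by (simp add: gram_eq mult.commute)
  qed
  show g: "gram d S i j = gram d' S' i j" if "i < n" "j < n" for i j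
  proof -
    have "gram d' S' i j = (\<Sum>k<n. gram d S i k * gram d' S' k j)" by (rule prod[OF S E that(1), symmetric])
    also have "\<dots> = (\<Sum>k<n. gram d' S' j k * gram d S k i)"
      by (intro sum.cong refl) (simp add: gram_sym[of d S i] gram_sym[of d' S' j] mult.commute)
    also have "\<dots> = gram d S j i" by (rule prod[OF S' E[symmetric] that(2)])
    finally show ?thesis by (simp add: gram_sym)
  qed
  have "real d = (\<Sum>i<n. gram d S i i)" by (simp add: gram_trace[OF S])
  also have "\<dots> = real d'" by (simp add: g gram_trace[OF S'])
  finally show "d = d'" by simp
qed

text \<open>Gram-Schmidt, one column at a time; a column already in the span leaves the basis
  unchanged.\<close>

lemma orthonormal_basis_exists:
  "\<exists>d S. d \<le> k \<and> orthonormal_cols n d S \<and> col_span n d S = col_span n k M"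
proof (induction k)
  case 0
  then show ?case by (intro exI[of _ 0] exI[of _ "\<lambda>_ _. 0"]) (auto simp: orthonormal_cols_def col_span_def)
next
  case (Suc k)
  then obtain d S where d: "d \<le> k" and S: "orthonormal_cols n d S" and E: "col_span n d S = col_span n k M" by blast
  define c0 where "c0 t = (\<Sum>j<n. S j t * M j k)" for t
  define v where "v i = M i k - (\<Sum>t<d. S i t * c0 t)" for i
  define q where "q = vnorm n v"
  have Sv: "(\<Sum>i<n. S i a * v i) = 0" if "a < d" for a
  proof -
    have "(\<Sum>i<n. S i a * v i) = c0 a - (\<Sum>i<n. \<Sum>t<d. c0 t * (S i a * S i t))"
      by (simp add: v_def c0_def right_diff_distrib sum_subtractf sum_distrib_left mult_ac)
    also have "(\<Sum>i<n. \<Sum>t<d. c0 t * (S i a * S i t)) = (\<Sum>t<d. \<Sum>i<n. c0 t * (S i a * S i t))" by (rule sum.swap)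
    also have "\<dots> = (\<Sum>t<d. if t = a then c0 a else 0)"
      by (intro sum.cong refl) (use that in \<open>auto simp: sum_distrib_left[symmetric] orthonormal_colsD[OF S]\<close>)
    finally show ?thesis using that by simp
  qed
  have Mk: "M i k = v i + (\<Sum>t<d. S i t * c0 t)" for i by (simp add: v_def)
  have split: "x \<in> col_span n (Suc k) M \<longleftrightarrow> (\<forall>i\<ge>n. x i = 0) \<and> (\<exists>c a. \<forall>i<n. x i = (\<Sum>t<d. S i t * c t) + v i * a)" for x
  proof
    assume x: "x \<in> col_span n (Suc k) M"
    then obtain c where c: "\<And>i. i < n \<Longrightarrow> x i = (\<Sum>t<Suc k. M i t * c t)" and x0: "\<forall>i\<ge>n. x i = 0"
      by (auto simp: col_span_def)
    define y where "y i = (if i < n then \<Sum>t<k. M i t * c t else 0)" for i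
    have "y \<in> col_span n d S" unfolding E by (auto simp: col_span_def y_def)
    then obtain c' where c': "\<And>i. i < n \<Longrightarrow> y i = (\<Sum>t<d. S i t * c' t)" by (auto simp: col_span_def)
    have "x i = (\<Sum>t<d. S i t * (c' t + c0 t * c k)) + v i * c k" if "i < n" for i
    proof -
      have "x i = y i + M i k * c k" using that by (simp add: c y_def)
      also have "\<dots> = (\<Sum>t<d. S i t * c' t) + (v i + (\<Sum>t<d. S i t * c0 t)) * c k"
        unfolding c'[OF that] Mk[symmetric] by simp
      finally show ?thesis by (simp add: distrib_left distrib_right sum.distrib sum_distrib_left sum_distrib_right mult_ac)
    qed
    then show "(\<forall>i\<ge>n. x i = 0) \<and> (\<exists>c a. \<forall>i<n. x i = (\<Sum>t<d. S i t * c t) + v i * a)"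
      using x0 by (intro conjI exI[of _ "\<lambda>t. c' t + c0 t * c k"] exI[of _ "c k"]) auto
  next
    assume "(\<forall>i\<ge>n. x i = 0) \<and> (\<exists>c a. \<forall>i<n. x i = (\<Sum>t<d. S i t * c t) + v i * a)"
    then obtain c a where x0: "\<forall>i\<ge>n. x i = 0" and c: "\<And>i. i < n \<Longrightarrow> x i = (\<Sum>t<d. S i t * c t) + v i * a" by blast
    define y where "y i = (if i < n then \<Sum>t<d. S i t * (c t - c0 t * a) else 0)" for i
    have "y \<in> col_span n k M" unfolding E[symmetric] by (auto simp: col_span_def y_def)
    then obtain c' where c': "\<And>i. i < n \<Longrightarrow> y i = (\<Sum>t<k. M i t * c' t)" by (auto simp: col_span_def)
    have "x i = (\<Sum>t<Suc k. M i t * (c'(k := a)) t)" if "i < n" for i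
    proof -
      have "x i = y i + M i k * a"
        using that unfolding c[OF that] Mk
        by (simp add: y_def algebra_simps sum_subtractf sum_distrib_left)
      then show ?thesis by (simp add: c'[OF that])
    qed
    then show "x \<in> col_span n (Suc k) M" using x0 unfolding col_span_def by blast
  qed
  show ?case
  proof (cases "q = 0")
    case True
    then have v0: "v i = 0" if "i < n" for i
      using that vnorm_sq[of n v] by (simp add: q_def sum_nonneg_eq_0_iff)
    have "col_span n d S = col_span n (Suc k) M"
      unfolding set_eq_iff split by (auto simp: col_span_def v0)
    then show ?thesis using d S by (intro exI[of _ d] exI[of _ S]) auto
  next
    case False
    then have q: "0 < q" using vnorm_nonneg[of n v] by (simp add: q_def less_le)
    define S' where "S' i t = (if t < d then S i t else v i / q)" for i t
    have vv: "(\<Sum>i<n. v i * v i) = q * q"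
      using vnorm_sq[of n v] by (simp add: q_def power2_eq_square)
    have S'o: "orthonormal_cols n (Suc d) S'"
      unfolding orthonormal_cols_def
    proof (intro allI impI)
      fix a b assume ab: "a < Suc d" "b < Suc d"
      consider "a < d" "b < d" | "a < d" "b = d" | "a = d" "b < d" | "a = d" "b = d" using ab by linarith
      then show "(\<Sum>i<n. S' i a * S' i b) = (if a = b then 1 else 0)"
      proof cases
        case 1 then show ?thesis by (simp add: S'_def orthonormal_colsD[OF S])
      next
        case 2 then show ?thesis using Sv[of a] by (simp add: S'_def sum_divide_distrib[symmetric])
      next
        case 3 then show ?thesis using Sv[of b] by (simp add: S'_def sum_divide_distrib[symmetric] mult.commute)
      next
        case 4 then show ?thesis using vv q by (simp add: S'_def sum_divide_distrib[symmetric])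
      qed
    qed
    have "x \<in> col_span n (Suc d) S' \<longleftrightarrow> x \<in> col_span n (Suc k) M" for x
    proof
      assume "x \<in> col_span n (Suc d) S'"
      then obtain c where "\<forall>i\<ge>n. x i = 0" "\<And>i. i < n \<Longrightarrow> x i = (\<Sum>t<Suc d. S' i t * c t)" by (auto simp: col_span_def)
      then show "x \<in> col_span n (Suc k) M"
        unfolding split by (intro conjI exI[of _ c] exI[of _ "c d / q"]) (auto simp: S'_def)
    next
      assume "x \<in> col_span n (Suc k) M"
      then obtain c a where "\<forall>i\<ge>n. x i = 0" "\<And>i. i < n \<Longrightarrow> x i = (\<Sum>t<d. S i t * c t) + v i * a" unfolding split by blast
      then show "x \<in> col_span n (Suc d) S'"
        using q by (auto simp: col_span_def S'_def intro!: exI[of _ "c(d := a * q)"])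
    qed
    then show ?thesis using d S'o by (intro exI[of _ "Suc d"] exI[of _ S']) auto
  qed
qed

text \<open>The choice in \<open>lev_score\<close> leaves the dimension d open; uniqueness of d
  transfers the bound by k from one constructed basis to the chosen one.\<close>

lemma lev_score_basis:
  obtains d S where "d \<le> k" "orthonormal_cols n d S" "col_span n d S = col_span n k M"
    "lev_score n (col_span n k M) i = real n / real d * gram d S i i"
proof -
  let ?W = "col_span n k M"
  let ?P = "\<lambda>l. \<exists>d S. orthonormal_cols n d S \<and> col_span n d S = ?W \<and> l = real n / real d * (\<Sum>t<d. (S i t)\<^sup>2)"
  obtain d0 S0 where 0: "d0 \<le> k" "orthonormal_cols n d0 S0" "col_span n d0 S0 = ?W"
    using orthonormal_basis_exists by blast
  then have "\<exists>l. ?P l" by blast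
  then have "?P (lev_score n ?W i)" unfolding lev_score_def by (rule someI_ex)
  then obtain d S where S: "orthonormal_cols n d S" "col_span n d S = ?W"
    "lev_score n ?W i = real n / real d * (\<Sum>t<d. (S i t)\<^sup>2)" by blast
  have "d = d0" by (rule gram_unique(2)[OF S(1) 0(2)]) (simp add: S(2) 0(3))
  then show ?thesis using that[of d S] S 0(1) by (simp add: gram_def power2_eq_square)
qed

lemma lev_score_gram:
  assumes U: "orthonormal_cols n r U" and i: "i < n"
  shows "lev_score n (col_span n r U) i = real n / real r * gram r U i i"
proof -
  obtain d S where S: "orthonormal_cols n d S" "col_span n d S = col_span n r U"
    "lev_score n (col_span n r U) i = real n / real d * gram d S i i"
    by (rule lev_score_basis)
  then show ?thesis using gram_unique[OF S(1) U S(2)] i by simp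
qed

text \<open>The row of Z is bounded by the row of the projection onto the joint span, whose squared
  norm is its diagonal entry. The joint leverage score is normalised by a dimension of at most
  \<open>2 * r\<close>, which is where the factor 2 under the root in \<beta> comes from.\<close>

lemma prior_row_bound:
  assumes U: "orthonormal_cols n r U" and Ut: "orthonormal_cols n r Ut" and r: "1 \<le> r"
    and pos: "0 < lev_score n (col_span n r U) i" and i: "i < n"
    and Z: "\<And>M. (\<And>s. s < r \<Longrightarrow> (\<Sum>j<n. M j * U j s) = U i s) \<Longrightarrow> (\<And>s. s < r \<Longrightarrow> (\<Sum>j<n. M j * Ut j s) = Ut i s)
      \<Longrightarrow> vnorm r (Z i) \<le> vnorm n M"
    and b: "2 * (lev_score n (col_span n (2 * r) (hcat r U Ut)) i / lev_score n (col_span n r U) i) \<le> b\<^sup>2" and b0: "0 \<le> b"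
  shows "vnorm r (Z i) \<le> b * vnorm r (U i)"
proof -
  obtain d S where d: "d \<le> 2 * r" and S: "orthonormal_cols n d S" and E: "col_span n d S = col_span n (2 * r) (hcat r U Ut)"
    and l: "lev_score n (col_span n (2 * r) (hcat r U Ut)) i = real n / real d * gram d S i i"
    by (rule lev_score_basis)
  have lU: "lev_score n (col_span n r U) i = real n / real r * gram r U i i" by (rule lev_score_gram[OF U i])
  have n: "0 < real n" using i by simp
  have gU: "0 < gram r U i i" using pos n r unfolding lU by (simp add: zero_less_mult_iff zero_less_divide_iff)
  have "vnorm r (Z i) \<le> vnorm n (gram d S i)"
  proof (rule Z)
    fix s assume s: "s < r"
    show "(\<Sum>j<n. gram d S i j * U j s) = U i s"
      using gram_fixes_col[OF S E, of s i] s i by (simp add: hcat_def)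
    show "(\<Sum>j<n. gram d S i j * Ut j s) = Ut i s"
      using gram_fixes_col[OF S E, of "r + s" i] s i by (simp add: hcat_def)
  qed
  then have "(vnorm r (Z i))\<^sup>2 \<le> (vnorm n (gram d S i))\<^sup>2" by (intro power_mono) auto
  also have "\<dots> = gram d S i i"
  proof -
    have "(vnorm n (gram d S i))\<^sup>2 = (\<Sum>k<n. gram d S i k * gram d S k i)"
      unfolding vnorm_sq by (intro sum.cong refl) (metis gram_sym power2_eq_square)
    then show ?thesis by (simp add: gram_idem[OF S])
  qed
  also have "\<dots> \<le> b\<^sup>2 * gram r U i i"
  proof (cases "d = 0")
    case True
    then show ?thesis using gU by (simp add: gram_def)
  next
    case False
    have g0: "0 \<le> gram d S i i" by (simp add: gram_diag)
    have "real r * (real n / real d * gram d S i i) * 2 \<ge> real n * gram d S i i"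
    proof -
      have "real d * (real n * gram d S i i) \<le> 2 * real r * (real n * gram d S i i)"
        using d g0 n by (intro mult_right_mono) auto
      then show ?thesis using False by (simp add: field_simps)
    qed
    moreover have "2 * (real r * (real n / real d * gram d S i i)) \<le> b\<^sup>2 * (real n * gram r U i i)"
    proof -
      define x y where "x = real n / real d * gram d S i i" and "y = real n / real r * gram r U i i"
      have y: "0 < y" "real r * y = real n * gram r U i i" using gU n r by (simp_all add: y_def)
      have "2 * x \<le> b\<^sup>2 * y"
        using b y(1) unfolding l lU x_def[symmetric] y_def[symmetric] by (simp add: field_simps)
      then have "real r * (2 * x) \<le> real r * (b\<^sup>2 * y)" by (intro mult_left_mono) auto
      then show ?thesis unfolding y(2)[symmetric] x_def[symmetric] by (simp add: mult_ac)
    qed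
    ultimately have "real n * gram d S i i \<le> real n * (b\<^sup>2 * gram r U i i)" by (simp add: mult_ac)
    then show ?thesis using n by simp
  qed
  also have "\<dots> = (b * vnorm r (U i))\<^sup>2" by (simp add: power_mult_distrib gram_diag)
  finally show ?thesis by (rule power2_le_imp_le) (simp add: b0)
qed

section \<open>Coupling batches with a single sample\<close>

lemma bexp_cong_prob: "(\<And>i. i \<in> I \<Longrightarrow> p i = q i) \<Longrightarrow> bexp I p f = bexp I q f"
  unfolding bexp_def by (intro sum.cong refl arg_cong2[where f = "(*)"] prod.cong) auto

text \<open>Switching on a cell with any of several independent attempts is dominated by a single attempt
  with the summed probability; the attempts are merged one after the other.\<close>

lemma bexp_union_le:
  fixes f :: "('c \<Rightarrow> bool) \<Rightarrow> real"
  assumes "finite I" "finite C"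
    and "\<And>i. i \<in> I \<Longrightarrow> 0 \<le> r i \<and> \<pi> i \<in> C"
    and "\<And>c. c \<in> C \<Longrightarrow> (\<Sum>i | i \<in> I \<and> \<pi> i = c. r i) \<le> p c \<and> p c \<le> 1"
    and "\<And>\<theta> \<theta>'. \<theta> \<le> \<theta>' \<Longrightarrow> f \<theta> \<le> f \<theta>'"
  shows "bexp I r (\<lambda>\<eta>. f (\<lambda>c. \<exists>i\<in>I. \<pi> i = c \<and> \<eta> i)) \<le> bexp C p f"
  using assms(1,3-)
proof (induction I arbitrary: p f rule: finite_induct)
  case empty
  have "bexp C p (\<lambda>_. f (\<lambda>_. False)) \<le> bexp C p f"
    by (rule bexp_mono) (use empty in \<open>auto simp: le_fun_def\<close>)
  then show ?case by (simp add: bexp_const[OF assms(2)])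
next
  case (insert x I)
  define c where "c = \<pi> x"
  have cC: "c \<in> C" and rx: "0 \<le> r x" using insert.prems(1)[of x] by (auto simp: c_def)
  obtain C' where C: "C = insert c C'" "c \<notin> C'" "finite C'"
    using cC assms(2) by (metis finite_insert mk_disjoint_insert)
  \<comment> \<open>The attempt x is taken out of the budget of its cell; the remaining attempts are
    merged at the reduced probability by induction.\<close>
  define p' where "p' = p(c := p c - r x)"
  have sums: "(\<Sum>i | i \<in> insert x I \<and> \<pi> i = d. r i) = (if d = c then r x else 0) + (\<Sum>i | i \<in> I \<and> \<pi> i = d. r i)" for d
  proof -
    have "{i. i \<in> insert x I \<and> \<pi> i = d} = (if d = c then {x} else {}) \<union> {i. i \<in> I \<and> \<pi> i = d}"
      by (auto simp: c_def)
    then show ?thesis using insert.hyps by (auto simp: c_def)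
  qed
  have nn: "0 \<le> (\<Sum>i | i \<in> I \<and> \<pi> i = d. r i)" for d
    using insert.prems(1) by (intro sum_nonneg) auto
  have p': "(\<Sum>i | i \<in> I \<and> \<pi> i = d. r i) \<le> p' d \<and> p' d \<le> 1" if "d \<in> C" for d
    using insert.prems(2)[OF that] rx unfolding sums by (auto simp: p'_def split: if_splits)
  have p'01: "0 \<le> p' d \<and> p' d \<le> 1" if "d \<in> C" for d using p'[OF that] nn[of d] by linarith
  have IH: "bexp I r (\<lambda>\<eta>. g (\<lambda>c. \<exists>i\<in>I. \<pi> i = c \<and> \<eta> i)) \<le> bexp C p' g" if "\<And>\<theta> \<theta>'. \<theta> \<le> \<theta>' \<Longrightarrow> g \<theta> \<le> g \<theta>'" for g
    by (rule insert.IH) (use insert.prems(1) p' that in auto)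
  have IH': "bexp I r (\<lambda>\<eta>. f ((\<lambda>c. \<exists>i\<in>I. \<pi> i = c \<and> \<eta> i)(c := True))) \<le> bexp C p' (\<lambda>\<theta>. f (\<theta>(c := True)))"
    by (rule IH) (auto intro!: insert.prems(3) simp: le_fun_def)
  define F1 F0 where "F1 = bexp C' p' (\<lambda>\<theta>. f (\<theta>(c := True)))" and "F0 = bexp C' p' (\<lambda>\<theta>. f (\<theta>(c := False)))"
  have F: "F0 \<le> F1" unfolding F0_def F1_def
    by (rule bexp_mono) (use p'01 C in \<open>auto intro!: insert.prems(3) simp: le_fun_def\<close>)
  have C'p: "bexp C' p g = bexp C' p' g" for g
    by (rule bexp_cong_prob) (use C in \<open>auto simp: p'_def\<close>)
  have rx1: "r x \<le> 1" using p'01[OF cC] insert.prems(2)[OF cC] by (simp add: p'_def)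
  have upT: "(\<lambda>d. \<exists>i\<in>insert x I. \<pi> i = d \<and> (\<eta>(x := True)) i) = (\<lambda>d. \<exists>i\<in>I. \<pi> i = d \<and> \<eta> i)(c := True)" for \<eta>
    using insert.hyps by (auto simp: fun_eq_iff c_def)
  have upF: "(\<lambda>d. \<exists>i\<in>insert x I. \<pi> i = d \<and> (\<eta>(x := False)) i) = (\<lambda>d. \<exists>i\<in>I. \<pi> i = d \<and> \<eta> i)" for \<eta>
    using insert.hyps by (auto simp: fun_eq_iff)
  have "bexp (insert x I) r (\<lambda>\<eta>. f (\<lambda>d. \<exists>i\<in>insert x I. \<pi> i = d \<and> \<eta> i)) =
      r x * bexp I r (\<lambda>\<eta>. f ((\<lambda>d. \<exists>i\<in>I. \<pi> i = d \<and> \<eta> i)(c := True))) + (1 - r x) * bexp I r (\<lambda>\<eta>. f (\<lambda>d. \<exists>i\<in>I. \<pi> i = d \<and> \<eta> i))"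
    unfolding bexp_insert[OF insert.hyps] upT upF ..
  also have "\<dots> \<le> r x * bexp C p' (\<lambda>\<theta>. f (\<theta>(c := True))) + (1 - r x) * bexp C p' f"
    using rx rx1 by (intro add_mono mult_left_mono IH' IH insert.prems(3)) auto
  also have "\<dots> = r x * F1 + (1 - r x) * (p' c * F1 + (1 - p' c) * F0)"
    unfolding C(1) bexp_insert[OF C(3,2)] by (simp add: F1_def F0_def algebra_simps)
  \<comment> \<open>Two independent attempts succeed together with probability
    \<open>r x + p' c - r x * p' c\<close>, which falls short of \<open>p c\<close> by the overlap.
    Monotonicity gives the sign.\<close>
  also have "\<dots> = (p c * F1 + (1 - p c) * F0) - (F1 - F0) * (r x * p' c)"
    by (simp add: p'_def algebra_simps)
  also have "\<dots> \<le> p c * F1 + (1 - p c) * F0"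
    using F rx p'01[OF cC] by simp
  also have "\<dots> = bexp C p f"
    unfolding C(1) bexp_insert[OF C(3,2)] C'p by (simp add: F1_def F0_def)
  finally show ?case .
qed

lemma prob_Pi_bernoulli:
  assumes "finite C" "\<And>c. c \<in> C \<Longrightarrow> 0 \<le> p c \<and> p c \<le> 1"
  shows "measure_pmf.prob (Pi_pmf C False (\<lambda>c. bernoulli_pmf (p c))) S = bexp C p (\<lambda>\<eta>. of_bool (\<eta> \<in> S))"
  using assms
proof (induction C arbitrary: S rule: finite_induct)
  case empty
  then show ?case by (simp add: indicator_def)
next
  case (insert x C)
  have IH: "measure_pmf.prob (Pi_pmf C False (\<lambda>c. bernoulli_pmf (p c))) T = bexp C p (\<lambda>\<eta>. of_bool (\<eta> \<in> T))" for T
    using insert by simp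
  let ?M = "Pi_pmf C False (\<lambda>c. bernoulli_pmf (p c))"
  have "measure_pmf.prob (Pi_pmf (insert x C) False (\<lambda>c. bernoulli_pmf (p c))) S =
     measure_pmf.prob (bind_pmf (bernoulli_pmf (p x)) (\<lambda>b. map_pmf (\<lambda>\<eta>. \<eta>(x := b)) ?M)) S"
    by (simp add: Pi_pmf_insert'[OF insert.hyps] map_pmf_def)
  also have "\<dots> = measure_pmf.expectation (bernoulli_pmf (p x)) (\<lambda>b. measure_pmf.prob (map_pmf (\<lambda>\<eta>. \<eta>(x := b)) ?M) S)"
    unfolding measure_pmf_bind
    by (rule measure_pmf.measure_bind[where N = "count_space UNIV"]) (auto simp: space_subprob_algebra intro!: subprob_space_measure_pmf)
  also have "\<dots> = p x * measure_pmf.prob (map_pmf (\<lambda>\<eta>. \<eta>(x := True)) ?M) S + (1 - p x) * measure_pmf.prob (map_pmf (\<lambda>\<eta>. \<eta>(x := False)) ?M) S"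
    using insert.prems by (simp add: integral_bernoulli_pmf)
  also have "\<dots> = bexp (insert x C) p (\<lambda>\<eta>. of_bool (\<eta> \<in> S))"
    unfolding bexp_insert[OF insert.hyps] by (simp add: IH vimage_def)
  finally show ?case .
qed

section \<open>The prior information in block form\<close>

lemma vnorm_scale: "vnorm m (\<lambda>i. c * x i) = \<bar>c\<bar> * vnorm m x"
  unfolding vnorm_def by (simp add: power_mult_distrib sum_distrib_left[symmetric] real_sqrt_mult)

lemma vnorm_mult_le_fro: "vnorm m (\<lambda>i. \<Sum>j<k. M i j * x j) \<le> fro_norm m k M * vnorm k x"
proof -
  have "(\<Sum>i<m. (\<Sum>j<k. M i j * x j)\<^sup>2) \<le> (\<Sum>i<m. (\<Sum>j<k. (M i j)\<^sup>2) * (vnorm k x)\<^sup>2)"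
    unfolding vnorm_sq by (intro sum_mono Cauchy_Schwarz_ineq_sum)
  then have "(vnorm m (\<lambda>i. \<Sum>j<k. M i j * x j))\<^sup>2 \<le> (fro_norm m k M * vnorm k x)\<^sup>2"
    unfolding power_mult_distrib by (simp add: vnorm_sq[of m] sum_distrib_right[symmetric] fro_norm_def sum_nonneg)
  then show ?thesis by (rule power2_le_imp_le) (simp add: fro_norm_def sum_nonneg)
qed

text \<open>The Frobenius norm bounds the set, so the supremum is attained as an upper bound and not
  an arbitrary value.\<close>

lemma spec_norm_ge:
  assumes "vnorm k x \<le> 1"
  shows "vnorm m (\<lambda>i. \<Sum>j<k. M i j * x j) \<le> spec_norm m k M"
  unfolding spec_norm_def
proof (rule cSup_upper)
  show "bdd_above {vnorm m (\<lambda>i. \<Sum>j<k. M i j * x j) |x. vnorm k x \<le> 1}"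
  proof (rule bdd_aboveI, clarify)
    fix x assume x: "vnorm k x \<le> 1"
    have "vnorm m (\<lambda>i. \<Sum>j<k. M i j * x j) \<le> fro_norm m k M * vnorm k x" by (rule vnorm_mult_le_fro)
    also have "\<dots> \<le> fro_norm m k M * 1" using x by (intro mult_left_mono) (auto simp: fro_norm_def sum_nonneg)
    finally show "vnorm m (\<lambda>i. \<Sum>j<k. M i j * x j) \<le> fro_norm m k M" by simp
  qed
qed (use assms in blast)

lemma spec_norm_nonneg: "0 \<le> spec_norm m k M"
  using order_trans[OF vnorm_nonneg spec_norm_ge[of k "\<lambda>_. 0" m M]] by (simp add: vnorm_def)

lemma vnorm_mult_le: "vnorm m (\<lambda>i. \<Sum>j<k. M i j * x j) \<le> spec_norm m k M * vnorm k x"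
proof (cases "vnorm k x = 0")
  case True
  then have "vnorm m (\<lambda>i. \<Sum>j<k. M i j * x j) \<le> 0" using vnorm_mult_le_fro[where m = m and k = k and M = M and x = x] by simp
  then show ?thesis using True by simp
next
  case False
  then have v: "0 < vnorm k x" using vnorm_nonneg[of k x] by (simp add: less_le)
  have "vnorm m (\<lambda>i. \<Sum>j<k. M i j * (inverse (vnorm k x) * x j)) \<le> spec_norm m k M"
    by (rule spec_norm_ge) (use v in \<open>simp add: vnorm_scale\<close>)
  moreover have "(\<lambda>i. \<Sum>j<k. M i j * (inverse (vnorm k x) * x j)) = (\<lambda>i. inverse (vnorm k x) * (\<Sum>j<k. M i j * x j))"
    by (simp add: sum_distrib_left mult.left_commute)
  ultimately have "inverse (vnorm k x) * vnorm m (\<lambda>i. \<Sum>j<k. M i j * x j) \<le> spec_norm m k M"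
    using v by (simp add: vnorm_scale)
  then show ?thesis using v by (simp add: field_simps)
qed

definition dbil :: "nat \<Rightarrow> rmat \<Rightarrow> (nat \<Rightarrow> real) \<Rightarrow> (nat \<Rightarrow> real) \<Rightarrow> real" where
  "dbil r M a b = (\<Sum>s<r. \<Sum>t<r. a s * M s t * b t)"

lemma dbil_le: "\<bar>dbil r M a b\<bar> \<le> spec_norm r r M * (vnorm r a * vnorm r b)"
proof -
  have "dbil r M a b = (\<Sum>s<r. a s * (\<Sum>t<r. M s t * b t))"
    by (simp add: dbil_def sum_distrib_left mult.assoc)
  then have "\<bar>dbil r M a b\<bar> \<le> vnorm r a * vnorm r (\<lambda>s. \<Sum>t<r. M s t * b t)"
    using vdot_abs_le by simp
  also have "\<dots> \<le> vnorm r a * (spec_norm r r M * vnorm r b)"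
    by (intro mult_left_mono vnorm_mult_le) simp
  finally show ?thesis by (simp add: mult_ac)
qed

lemma dbil_zero_left: "(\<And>s. s < r \<Longrightarrow> a s = 0) \<Longrightarrow> dbil r M a b = 0"
  unfolding dbil_def by (intro sum.neutral) auto

lemma dbil_zero_right: "(\<And>s. s < r \<Longrightarrow> b s = 0) \<Longrightarrow> dbil r M a b = 0"
  unfolding dbil_def by (intro sum.neutral) auto

lemma bil_factored: "bil n (mmul r P (mmul r M (mtrans Q))) x y = dbil r M (\<lambda>s. \<Sum>i<n. P i s * x i) (\<lambda>t. \<Sum>j<n. Q j t * y j)"
proof -
  have "bil n (mmul r P (mmul r M (mtrans Q))) x y = (\<Sum>i<n. \<Sum>j<n. \<Sum>s<r. \<Sum>t<r. P i s * x i * M s t * (Q j t * y j))"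
    unfolding bil_def by (intro sum.cong refl) (simp add: mmul_def mtrans_def sum_distrib_left sum_distrib_right mult_ac)
  also have "\<dots> = (\<Sum>i<n. \<Sum>s<r. \<Sum>j<n. \<Sum>t<r. P i s * x i * M s t * (Q j t * y j))"
    by (intro sum.cong refl sum.swap)
  also have "\<dots> = (\<Sum>s<r. \<Sum>i<n. \<Sum>t<r. \<Sum>j<n. P i s * x i * M s t * (Q j t * y j))"
    by (subst sum.swap) (intro sum.cong refl sum.swap)
  also have "\<dots> = (\<Sum>s<r. \<Sum>t<r. \<Sum>i<n. \<Sum>j<n. P i s * x i * M s t * (Q j t * y j))"
    by (intro sum.cong refl sum.swap)
  also have "\<dots> = dbil r M (\<lambda>s. \<Sum>i<n. P i s * x i) (\<lambda>t. \<Sum>j<n. Q j t * y j)"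
    unfolding dbil_def by (intro sum.cong refl) (simp add: sum_distrib_left sum_distrib_right mult_ac)
  finally show ?thesis .
qed

lemma bil_cong: "(\<And>i j. i < n \<Longrightarrow> j < n \<Longrightarrow> Z i j = Z' i j) \<Longrightarrow> bil n Z x y = bil n Z' x y"
  unfolding bil_def by (intro sum.cong refl) auto

lemma bil_lin: "bil n (\<lambda>i j. Z i j - Z' i j) x y = bil n Z x y - bil n Z' x y"
  by (simp add: bil_def algebra_simps sum_subtractf)

lemma bil_unit:
  assumes "i < n"
  shows "bil n Z (\<lambda>k. if k = i then 1 else 0) y = (\<Sum>l<n. Z i l * y l)"
proof -
  have "bil n Z (\<lambda>k. if k = i then 1 else 0) y = (\<Sum>k<n. if k = i then \<Sum>l<n. Z i l * y l else 0)"
    unfolding bil_def by (intro sum.cong refl) auto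
  then show ?thesis using assms by simp
qed

lemma bil_transpose: "bil n Z x y = bil n (mtrans Z) y x"
  unfolding bil_def mtrans_def by (subst sum.swap) (simp add: mult_ac)

lemma sum_unit: "(i::nat) < n \<Longrightarrow> (\<Sum>k<n. f k * (if k = i then 1 else 0)) = (f i :: real)"
  by (subst sum.cong[OF refl, where h = "\<lambda>k. if k = i then f i else 0"]) auto

text \<open>\<open>E\<close>, \<open>F\<close>, \<open>G\<close> and \<open>S\<close> are the blocks of the matrix \<open>D\<close> with respect to the ranges of
  \<open>U\<close>, \<open>Z\<close> on the left and \<open>V\<close>, \<open>Y\<close> on the right.\<close>

locale prior_blocks =
  fixes n r :: nat and U V Z Y D E F G S :: rmat and b :: real
  assumes U: "orthonormal_cols n r U" and V: "orthonormal_cols n r V"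
    and gpos: "\<And>i. i < n \<Longrightarrow> 0 < gram r U i i" "\<And>i. i < n \<Longrightarrow> 0 < gram r V i i"
    and UZ: "\<And>s t. s < r \<Longrightarrow> t < r \<Longrightarrow> (\<Sum>i<n. U i s * Z i t) = 0"
    and VY: "\<And>s t. s < r \<Longrightarrow> t < r \<Longrightarrow> (\<Sum>i<n. V i s * Y i t) = 0"
    and Zb: "\<And>x. vnorm r (\<lambda>t. \<Sum>i<n. Z i t * x i) \<le> vnorm n x"
    and Yb: "\<And>x. vnorm r (\<lambda>t. \<Sum>i<n. Y i t * x i) \<le> vnorm n x"
    and b: "1 \<le> b" and Zr: "\<And>i. i < n \<Longrightarrow> vnorm r (Z i) \<le> b * vnorm r (U i)"
    and Yr: "\<And>i. i < n \<Longrightarrow> vnorm r (Y i) \<le> b * vnorm r (V i)"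
    and D: "\<And>i j. i < n \<Longrightarrow> j < n \<Longrightarrow> D i j = mmul r U (mmul r E (mtrans V)) i j - mmul r U (mmul r F (mtrans Y)) i j
       - mmul r Z (mmul r G (mtrans V)) i j - mmul r Z (mmul r S (mtrans Y)) i j"
begin

abbreviation "A \<equiv> gram r U"
abbreviation "B \<equiv> gram r V"

sublocale P2: proj2 n A B
proof -
  interpret a: proj n A by (rule proj_gram[OF U gpos(1)])
  interpret b: proj n B by (rule proj_gram[OF V gpos(2)])
  show "proj2 n A B" by unfold_locales
qed

definition \<alpha> :: real where "\<alpha> = spec_norm r r E + spec_norm r r G + spec_norm r r F"
definition W :: rmat where "W = PT n A B (PT n A B D)"

lemma bil_D: "bil n D x y = dbil r E (\<lambda>s. \<Sum>i<n. U i s * x i) (\<lambda>t. \<Sum>j<n. V j t * y j)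
    - dbil r F (\<lambda>s. \<Sum>i<n. U i s * x i) (\<lambda>t. \<Sum>j<n. Y j t * y j)
    - dbil r G (\<lambda>s. \<Sum>i<n. Z i s * x i) (\<lambda>t. \<Sum>j<n. V j t * y j)
    - dbil r S (\<lambda>s. \<Sum>i<n. Z i s * x i) (\<lambda>t. \<Sum>j<n. Y j t * y j)"
  by (subst bil_cong[OF D]) (simp_all add: bil_lin bil_factored)

lemma cp_zero:
  assumes "orthonormal_cols n r U'" "t < r"
  shows "(\<Sum>k<n. U' k t * (\<Sum>i<n. cp (gram r U') i k * x i)) = 0"
proof -
  have "(\<Sum>k<n. U' k t * (\<Sum>i<n. cp (gram r U') i k * x i)) = (\<Sum>k<n. \<Sum>i<n. x i * (cp (gram r U') i k * U' k t))"
    by (simp add: sum_distrib_left mult_ac)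
  also have "\<dots> = (\<Sum>i<n. \<Sum>k<n. x i * (cp (gram r U') i k * U' k t))" by (rule sum.swap)
  also have "\<dots> = 0"
    by (intro sum.neutral) (use assms in \<open>auto simp: sum_distrib_left[symmetric] cp_gram_col\<close>)
  finally show ?thesis .
qed

lemma cp_fix:
  assumes "\<And>s t. s < r \<Longrightarrow> t < r \<Longrightarrow> (\<Sum>i<n. U' i s * Z' i t) = 0" "t < r"
  shows "(\<Sum>k<n. Z' k t * (\<Sum>i<n. cp (gram r U') i k * x i)) = (\<Sum>i<n. Z' i t * x i)"
proof -
  have c: "(\<Sum>k<n. cp (gram r U') i k * Z' k t) = Z' i t" if "i < n" for i
  proof -
    have "(\<Sum>k<n. cp (gram r U') i k * Z' k t) = (\<Sum>k<n. (if k = i then Z' i t else 0) - gram r U' i k * Z' k t)"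
      unfolding cp_def by (intro sum.cong refl) (auto simp: algebra_simps)
    also have "\<dots> = Z' i t - (\<Sum>s<r. U' i s * (\<Sum>k<n. U' k s * Z' k t))"
      using that by (simp add: sum_subtractf gram_apply)
    finally show ?thesis using assms by simp
  qed
  have "(\<Sum>k<n. Z' k t * (\<Sum>i<n. cp (gram r U') i k * x i)) = (\<Sum>k<n. \<Sum>i<n. x i * (cp (gram r U') i k * Z' k t))"
    by (simp add: sum_distrib_left mult_ac)
  also have "\<dots> = (\<Sum>i<n. \<Sum>k<n. x i * (cp (gram r U') i k * Z' k t))" by (rule sum.swap)
  also have "\<dots> = (\<Sum>i<n. x i * Z' i t)"
    by (intro sum.cong refl) (simp add: sum_distrib_left[symmetric] c)
  also have "\<dots> = (\<Sum>i<n. Z' i t * x i)" by (simp add: mult.commute)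
  finally show ?thesis .
qed

lemma dbil_cong: "(\<And>s. s < r \<Longrightarrow> u s = u' s) \<Longrightarrow> (\<And>s. s < r \<Longrightarrow> v s = v' s) \<Longrightarrow> dbil r M u v = dbil r M u' v'"
  unfolding dbil_def by (intro sum.cong refl) auto

text \<open>The complementary projections annihilate U and V and fix Z and Y, so of the four blocks
  only S survives.\<close>

lemma bil_PP_D: "bil n (PP n A B D) x y = - dbil r S (\<lambda>s. \<Sum>i<n. Z i s * x i) (\<lambda>t. \<Sum>j<n. Y j t * y j)"
  unfolding bil_PP bil_D
  by (simp add: dbil_zero_left dbil_zero_right cp_zero[OF U] cp_zero[OF V] cong: dbil_cong)
     (intro dbil_cong cp_fix UZ VY)

lemma opb_PP_D: "opb n (spec_norm r r S) (PP n A B D)"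
  unfolding opb_def
proof (intro allI)
  fix x y
  have "\<bar>bil n (PP n A B D) x y\<bar> \<le> spec_norm r r S * (vnorm r (\<lambda>s. \<Sum>i<n. Z i s * x i) * vnorm r (\<lambda>t. \<Sum>j<n. Y j t * y j))"
    unfolding bil_PP_D abs_minus_cancel by (rule dbil_le)
  also have "\<dots> \<le> spec_norm r r S * (vnorm n x * vnorm n y)"
    by (intro mult_left_mono mult_mono Zb Yb spec_norm_nonneg) auto
  finally show "\<bar>bil n (PP n A B D) x y\<bar> \<le> spec_norm r r S * vnorm n x * vnorm n y" by (simp add: mult.assoc)
qed

lemma W_eq: "i < n \<Longrightarrow> j < n \<Longrightarrow> W i j = D i j - PP n A B D i j"
  unfolding W_def by (simp add: P2.PT_idem P2.PP_PT)

lemma bil_W: "bil n W x y = dbil r E (\<lambda>s. \<Sum>i<n. U i s * x i) (\<lambda>t. \<Sum>j<n. V j t * y j)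
    - dbil r F (\<lambda>s. \<Sum>i<n. U i s * x i) (\<lambda>t. \<Sum>j<n. Y j t * y j)
    - dbil r G (\<lambda>s. \<Sum>i<n. Z i s * x i) (\<lambda>t. \<Sum>j<n. V j t * y j)"
  by (subst bil_cong[OF W_eq]) (simp_all add: bil_lin bil_D bil_PP_D)

lemma alpha_nonneg: "0 \<le> \<alpha>"
  unfolding \<alpha>_def by (intro add_nonneg_nonneg spec_norm_nonneg)

text \<open>In each of the three tangential blocks at least one side is U or V; w is a common bound
  for the three products of coefficient norms.\<close>

lemma bil_W_le:
  assumes "vnorm r (\<lambda>s. \<Sum>i<n. U i s * x i) * vnorm r (\<lambda>t. \<Sum>j<n. V j t * y j) \<le> w"
    and "vnorm r (\<lambda>s. \<Sum>i<n. U i s * x i) * vnorm r (\<lambda>t. \<Sum>j<n. Y j t * y j) \<le> w"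
    and "vnorm r (\<lambda>s. \<Sum>i<n. Z i s * x i) * vnorm r (\<lambda>t. \<Sum>j<n. V j t * y j) \<le> w"
  shows "\<bar>bil n W x y\<bar> \<le> \<alpha> * w"
proof -
  have le: "\<bar>dbil r M u v\<bar> \<le> spec_norm r r M * w" if "vnorm r u * vnorm r v \<le> w" for M u v
    by (rule order_trans[OF dbil_le mult_left_mono[OF that spec_norm_nonneg]])
  show ?thesis
    using le[OF assms(1), of E] le[OF assms(2), of F] le[OF assms(3), of G]
    unfolding bil_W \<alpha>_def distrib_right by linarith
qed

lemma W_entry:
  assumes "i < n" "j < n"
  shows "\<bar>W i j\<bar> \<le> \<alpha> * b * (vnorm r (U i) * vnorm r (V j))"
proof -
  let ?e = "\<lambda>i k. if k = i then 1 else (0::real)"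
  have 1: "vnorm r (U i) * vnorm r (V j) \<le> b * (vnorm r (U i) * vnorm r (V j))"
    using mult_right_mono[OF b, of "vnorm r (U i) * vnorm r (V j)"] by simp
  have "\<bar>bil n W (?e i) (?e j)\<bar> \<le> \<alpha> * (b * (vnorm r (U i) * vnorm r (V j)))"
    by (rule bil_W_le) (use 1 mult_left_mono[OF Yr[OF assms(2)], of "vnorm r (U i)"] mult_right_mono[OF Zr[OF assms(1)], of "vnorm r (V j)"] in
        \<open>simp_all add: sum_unit[OF assms(1)] sum_unit[OF assms(2)] mult_ac\<close>)
  then show ?thesis by (simp add: bil_unit[OF assms(1)] sum_unit[OF assms(2)] mult.assoc)
qed

lemma W_row:
  assumes i: "i < n"
  shows "vnorm n (W i) \<le> \<alpha> * b * vnorm r (U i)"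
proof -
  \<comment> \<open>The row is tested against itself, after which one factor of its norm is
    cancelled.\<close>
  have "(vnorm n (W i))\<^sup>2 = bil n W (\<lambda>k. if k = i then 1 else 0) (W i)"
    unfolding vnorm_sq by (simp add: bil_unit[OF i] power2_eq_square)
  also have "\<dots> \<le> \<alpha> * (b * vnorm r (U i) * vnorm n (W i))"
  proof (rule order_trans[OF abs_ge_self bil_W_le])
    have bU: "vnorm r (U i) \<le> b * vnorm r (U i)" using mult_right_mono[OF b, of "vnorm r (U i)"] by simp
    show "vnorm r (\<lambda>s. \<Sum>k<n. U k s * (if k = i then 1 else 0)) * vnorm r (\<lambda>t. \<Sum>j<n. V j t * W i j) \<le> b * vnorm r (U i) * vnorm n (W i)"
      unfolding sum_unit[OF i] using b by (intro mult_mono bU vnorm_bessel V) auto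
    show "vnorm r (\<lambda>s. \<Sum>k<n. U k s * (if k = i then 1 else 0)) * vnorm r (\<lambda>t. \<Sum>j<n. Y j t * W i j) \<le> b * vnorm r (U i) * vnorm n (W i)"
      unfolding sum_unit[OF i] using b by (intro mult_mono bU Yb) auto
    show "vnorm r (\<lambda>s. \<Sum>k<n. Z k s * (if k = i then 1 else 0)) * vnorm r (\<lambda>t. \<Sum>j<n. V j t * W i j) \<le> b * vnorm r (U i) * vnorm n (W i)"
      unfolding sum_unit[OF i] using b by (intro mult_mono Zr i vnorm_bessel V) auto
  qed
  finally have 1: "vnorm n (W i) * vnorm n (W i) \<le> vnorm n (W i) * (\<alpha> * b * vnorm r (U i))"
    by (simp add: power2_eq_square mult_ac)
  show ?thesis
  proof (cases "vnorm n (W i) = 0")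
    case True
    then show ?thesis using alpha_nonneg b by simp
  next
    case False
    then have "0 < vnorm n (W i)" using vnorm_nonneg[of n "W i"] by (simp add: less_le)
    then show ?thesis using 1 by (simp only: mult_le_cancel_left_pos)
  qed
qed

lemma W_col:
  assumes j: "j < n"
  shows "vnorm n (\<lambda>i. W i j) \<le> \<alpha> * b * vnorm r (V j)"
proof -
  have "(vnorm n (\<lambda>i. W i j))\<^sup>2 = bil n W (\<lambda>i. W i j) (\<lambda>k. if k = j then 1 else 0)"
    unfolding bil_transpose[of n W] vnorm_sq by (simp add: bil_unit[OF j] power2_eq_square mtrans_def)
  also have "\<dots> \<le> \<alpha> * (b * vnorm r (V j) * vnorm n (\<lambda>i. W i j))"
  proof (rule order_trans[OF abs_ge_self bil_W_le])
    have bV: "vnorm r (V j) \<le> b * vnorm r (V j)" using mult_right_mono[OF b, of "vnorm r (V j)"] by simp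
    have c: "p * q \<le> s * t * u" if "p \<le> u" "q \<le> s * t" "0 \<le> p" "0 \<le> q" for p q s t u :: real
      using mult_mono[OF that(2,1) order_trans[OF that(4,2)] that(3)] by (simp add: mult.commute)
    show "vnorm r (\<lambda>s. \<Sum>i<n. U i s * W i j) * vnorm r (\<lambda>t. \<Sum>k<n. V k t * (if k = j then 1 else 0)) \<le> b * vnorm r (V j) * vnorm n (\<lambda>i. W i j)"
      unfolding sum_unit[OF j] by (rule c[OF vnorm_bessel[OF U] bV]) auto
    show "vnorm r (\<lambda>s. \<Sum>i<n. U i s * W i j) * vnorm r (\<lambda>t. \<Sum>k<n. Y k t * (if k = j then 1 else 0)) \<le> b * vnorm r (V j) * vnorm n (\<lambda>i. W i j)"
      unfolding sum_unit[OF j] by (rule c[OF vnorm_bessel[OF U] Yr[OF j]]) auto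
    show "vnorm r (\<lambda>s. \<Sum>i<n. Z i s * W i j) * vnorm r (\<lambda>t. \<Sum>k<n. V k t * (if k = j then 1 else 0)) \<le> b * vnorm r (V j) * vnorm n (\<lambda>i. W i j)"
      unfolding sum_unit[OF j] by (rule c[OF Zb bV]) auto
  qed
  finally have 1: "vnorm n (\<lambda>i. W i j) * vnorm n (\<lambda>i. W i j) \<le> vnorm n (\<lambda>i. W i j) * (\<alpha> * b * vnorm r (V j))"
    by (simp add: power2_eq_square mult_ac)
  show ?thesis
  proof (cases "vnorm n (\<lambda>i. W i j) = 0")
    case True
    then show ?thesis using alpha_nonneg b by simp
  next
    case False
    then have "0 < vnorm n (\<lambda>i. W i j)" using vnorm_nonneg[of n "\<lambda>i. W i j"] by (simp add: less_le)
    then show ?thesis using 1 by (simp only: mult_le_cancel_left_pos)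
  qed
qed

lemma W_sq:
  assumes w: "\<alpha> * b \<le> w"
  shows "i < n \<Longrightarrow> j < n \<Longrightarrow> (W i j)\<^sup>2 \<le> w\<^sup>2 * (A i i * B j j)"
    and "i < n \<Longrightarrow> (\<Sum>l<n. (W i l)\<^sup>2) \<le> w\<^sup>2 * A i i"
    and "j < n \<Longrightarrow> (\<Sum>k<n. (W k j)\<^sup>2) \<le> w\<^sup>2 * B j j"
proof -
  have ab: "0 \<le> \<alpha> * b" using alpha_nonneg b by simp
  show "(W i j)\<^sup>2 \<le> w\<^sup>2 * (A i i * B j j)" if "i < n" "j < n"
  proof -
    have "\<bar>W i j\<bar> \<le> w * (vnorm r (U i) * vnorm r (V j))"
      using W_entry[OF that] mult_right_mono[OF w, of "vnorm r (U i) * vnorm r (V j)"] by simp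
    then have "\<bar>W i j\<bar>\<^sup>2 \<le> (w * (vnorm r (U i) * vnorm r (V j)))\<^sup>2" by (intro power_mono) auto
    then show ?thesis by (simp add: power_mult_distrib gram_diag)
  qed
  show "(\<Sum>l<n. (W i l)\<^sup>2) \<le> w\<^sup>2 * A i i" if "i < n"
  proof -
    have "vnorm n (W i) \<le> w * vnorm r (U i)"
      using W_row[OF that] mult_right_mono[OF w, of "vnorm r (U i)"] by simp
    then have "(vnorm n (W i))\<^sup>2 \<le> (w * vnorm r (U i))\<^sup>2" by (intro power_mono) auto
    then show ?thesis by (simp add: power_mult_distrib gram_diag vnorm_sq[of n])
  qed
  show "(\<Sum>k<n. (W k j)\<^sup>2) \<le> w\<^sup>2 * B j j" if "j < n"
  proof -
    have "vnorm n (\<lambda>i. W i j) \<le> w * vnorm r (V j)"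
      using W_col[OF that] mult_right_mono[OF w, of "vnorm r (V j)"] by simp
    then have "(vnorm n (\<lambda>i. W i j))\<^sup>2 \<le> (w * vnorm r (V j))\<^sup>2" by (intro power_mono) auto
    then show ?thesis by (simp add: power_mult_distrib gram_diag vnorm_sq[of n])
  qed
qed

end

section \<open>Exact recovery\<close>

text \<open>Since e is below 3, N factors of one third beat \<open>n ^ j\<close> as soon as N
  reaches \<open>j * ln n\<close>.\<close>

lemma third_power_le:
  assumes n: "1 \<le> n" and N: "real j * ln (real n) \<le> real N"
  shows "(1 / 3) ^ N \<le> 1 / real n ^ j"
proof -
  have "real n ^ j = exp (real j * ln (real n))" using n by (simp add: exp_of_nat_mult)
  also have "\<dots> \<le> exp (real N * 1)" using N by simp
  also have "\<dots> = exp 1 ^ N" by (rule exp_of_nat_mult)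
  also have "\<dots> \<le> 3 ^ N" by (intro power_mono exp_le) auto
  finally show ?thesis using n by (simp add: power_divide field_simps)
qed

context sampling
begin

lemma avg_nonneg: "(\<And>\<sigma>. \<sigma> \<in> perms K \<Longrightarrow> 0 \<le> f \<sigma>) \<Longrightarrow> 0 \<le> avg f"
  unfolding avg_def by (intro divide_nonneg_nonneg sum_nonneg) auto

lemma T1_nonneg: "0 \<le> T1 \<eta>"
  unfolding T1_def by (intro sum_nonneg avg_nonneg) auto

lemma T2_nonneg: "0 \<le> T2 \<eta>"
  unfolding T2_def
proof (intro sum_nonneg avg_nonneg mult_nonneg_nonneg one_plus_xi_nonneg)
  fix \<sigma> t assume "\<sigma> \<in> perms K" "t \<in> {..<K}"
  then show "\<sigma> t < K" using permutes_in_image[of \<sigma> "{..<K}" t] by (auto simp: perms_def)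
qed auto

lemma T3_nonneg: "0 \<le> T3 Z t \<eta>"
  unfolding T3_def by (intro avg_nonneg schatten_nonneg)

text \<open>The first two thresholds make \<open>2 * d1 * d2 * n\<close> equal to
  \<open>1 / 64\<close> in the certificate; the last ones sum to less than \<open>1 / 32\<close>
  over t.\<close>

definition good :: "rmat \<Rightarrow> (nat \<times> nat \<times> nat \<Rightarrow> bool) \<Rightarrow> bool" where
  "good Z \<eta> \<longleftrightarrow> T1 \<eta> \<le> (1 / (128 * real n ^ 8))\<^sup>2 \<and> T2 \<eta> \<le> real n ^ 7 \<and>
    (\<forall>t<K. T3 Z t \<eta> \<le> (1 / (64 * 2 ^ t)) ^ (2 * (K div Suc t)))"

text \<open>Markov's inequality and the union bound before taking expectations: a violated threshold
  makes its own term at least 1.\<close>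

lemma bad_le:
  assumes n: "1 \<le> n"
  shows "1 - of_bool (good Z \<eta>) \<le> (128 * real n ^ 8)\<^sup>2 * T1 \<eta> + 1 / real n ^ 7 * T2 \<eta>
    + (\<Sum>t<K. (64 * 2 ^ t) ^ (2 * (K div Suc t)) * T3 Z t \<eta>)"
proof -
  let ?x = "(128 * real n ^ 8)\<^sup>2 * T1 \<eta>" and ?y = "1 / real n ^ 7 * T2 \<eta>"
    and ?z = "\<lambda>t. (64 * 2 ^ t) ^ (2 * (K div Suc t)) * T3 Z t \<eta>"
  have x: "0 \<le> ?x" using T1_nonneg by simp
  have y: "0 \<le> ?y" using T2_nonneg by simp
  have z: "0 \<le> ?z t" for t using T3_nonneg by simp
  have zs: "0 \<le> sum ?z {..<K}" by (intro sum_nonneg z)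
  have n0: "0 < real n ^ j" for j using n by simp
  show ?thesis
  proof (cases "good Z \<eta>")
    case True
    then show ?thesis using x y zs by simp
  next
    case False
    then have b: "of_bool (good Z \<eta>) = (0 :: real)" by simp
    from False consider "(1 / (128 * real n ^ 8))\<^sup>2 < T1 \<eta>" | "real n ^ 7 < T2 \<eta>"
      | t where "t < K" "(1 / (64 * 2 ^ t)) ^ (2 * (K div Suc t)) < T3 Z t \<eta>"
      by (auto simp: good_def not_le)
    then show ?thesis
    proof cases
      case 1
      then have "1 \<le> ?x" using n0[of 8] by (simp add: power_divide divide_less_eq mult.commute)
      then show ?thesis unfolding b using y zs by linarith
    next
      case 2
      then have "1 \<le> ?y" using n0[of 7] by (simp add: field_simps)
      then show ?thesis unfolding b using x zs by linarith
    next
      case 3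
      have "1 < ?z t" using 3(2) by (simp add: power_divide divide_less_eq mult.commute)
      moreover have "?z t \<le> sum ?z {..<K}" by (rule member_le_sum) (use 3 z in auto)
      ultimately have "1 \<le> sum ?z {..<K}" by linarith
      then show ?thesis unfolding b using x y by linarith
    qed
  qed
qed

text \<open>\<open>3538944 = 3 * 288 * 4096\<close>: the factor 288 is lost in \<open>EE_T3\<close>, \<open>4096 = 64\<^sup>2\<close> pays for the thresholds
  \<open>1 / (64 * 2 ^ t)\<close> in \<open>good\<close>, and the remaining \<open>3 \<ge> exp 1\<close> turns each of the at least \<open>10 * ln n\<close> factors
  into a gain.\<close>

lemma prob_good:
  fixes w :: real
  assumes n: "2 \<le> n" and K: "K = nat \<lceil>20 * ln (real n)\<rceil>" and w: "1 \<le> w"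
    and \<rho>: "\<And>k l. k < n \<Longrightarrow> l < n \<Longrightarrow> 3538944 * w\<^sup>2 * lam k l \<le> \<rho> k l"
    and tr: "(\<Sum>k<n. A k k) \<le> real n" "(\<Sum>l<n. B l l) \<le> real n"
    and Z: "\<And>k l. k < n \<Longrightarrow> l < n \<Longrightarrow> (Z k l)\<^sup>2 \<le> w\<^sup>2 * (A k k * B l l)"
      "\<And>k. k < n \<Longrightarrow> (\<Sum>l<n. (Z k l)\<^sup>2) \<le> w\<^sup>2 * A k k" "\<And>l. l < n \<Longrightarrow> (\<Sum>k<n. (Z k l)\<^sup>2) \<le> w\<^sup>2 * B l l"
  shows "1 - 33318 / real n \<le> EE (\<lambda>\<eta>. of_bool (good Z \<eta>))"
proof -
  define L where "L = ln (real n)"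
  define \<kappa> where "\<kappa> = 3538944 * w\<^sup>2"
  have w2: "1 \<le> w\<^sup>2" using w by (simp add: one_le_power)
  have \<kappa>: "3538944 \<le> \<kappa>" "24 \<le> \<kappa>" using w2 by (auto simp: \<kappa>_def)
  have \<kappa>l: "\<kappa> * lam k l \<le> \<rho> k l" if "k < n" "l < n" for k l using \<rho>[OF that] by (simp add: \<kappa>_def)
  have fin: "finite idx" by (simp add: idx_def)
  have L0: "0 \<le> L" using n by (simp add: L_def)
  have KL: "20 * L \<le> real K" "real K \<le> 20 * L + 1" using L0 by (auto simp: K L_def)
  have Ln: "L \<le> real n - 1" using n ln_le_minus_one[of "real n"] by (simp add: L_def)
  have Kn: "real K \<le> 22 * real n" using KL(2) Ln by simp
  have n2: "2 \<le> real n" using n by simp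
  have np: "1 \<le> real n ^ j" for j using n by simp
  \<comment> \<open>The squared threshold costs \<open>2^14 * n^16\<close> and the Hilbert-Schmidt
    sum \<open>2 * n^2\<close>, against a gain of \<open>n^20\<close> from the K steps.\<close>
  have e1: "(128 * real n ^ 8)\<^sup>2 * EE T1 \<le> 32768 / real n"
  proof -
    have "EE T1 \<le> (real n)\<^sup>2 * ((24 / \<kappa>) ^ K * 2)" by (rule EE_T1[OF \<kappa>(2) \<kappa>l])
    also have "\<dots> \<le> (real n)\<^sup>2 * ((1 / 3) ^ K * 2)"
      using \<kappa> by (intro mult_left_mono mult_right_mono power_mono) (auto simp: field_simps)
    also have "\<dots> \<le> (real n)\<^sup>2 * (1 / real n ^ 20 * 2)"
      by (intro mult_left_mono mult_right_mono third_power_le) (use n KL(1) in \<open>auto simp: L_def\<close>)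
    finally have "(128 * real n ^ 8)\<^sup>2 * EE T1 \<le> (128 * real n ^ 8)\<^sup>2 * ((real n)\<^sup>2 * (1 / real n ^ 20 * 2))"
      by (intro mult_left_mono) auto
    also have "\<dots> = 32768 / real n ^ 2"
      using n by (simp add: power_mult_distrib field_simps flip: power_add power_mult)
    also have "\<dots> \<le> 32768 / real n"
      using n2 by (intro divide_left_mono) (auto simp: power2_eq_square)
    finally show ?thesis .
  qed
  have e2: "1 / real n ^ 7 * EE T2 \<le> 44 / real n"
  proof -
    have "EE T2 \<le> 2 * real K * real n ^ 4" by (rule EE_T2[OF \<kappa>(2) \<kappa>l])
    also have "\<dots> \<le> 2 * (22 * real n) * real n ^ 4" using Kn by (intro mult_right_mono mult_left_mono) auto
    finally have "1 / real n ^ 7 * EE T2 \<le> 1 / real n ^ 7 * (2 * (22 * real n) * real n ^ 4)"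
      by (intro mult_left_mono) auto
    also have "\<dots> = 44 / real n ^ 2"
      using n by (simp add: field_simps flip: power_add power_Suc)
    also have "\<dots> \<le> 44 / real n"
      using n2 by (intro divide_left_mono) (auto simp: power2_eq_square)
    finally show ?thesis .
  qed
  have e3: "(64 * 2 ^ t) ^ (2 * (K div Suc t)) * EE (T3 Z t) \<le> 23 / real n ^ 7" if t: "t < K" for t
  proof -
    define m where "m = K div Suc t"
    define N where "N = m * Suc t"
    define x where "x = (w\<^sup>2) ^ m"
    have m1: "1 \<le> m" using t div_greater_zero_iff[of K "Suc t"] by (simp add: m_def Suc_le_eq)
    have mN: "m \<le> N" by (simp add: N_def)
    \<comment> \<open>Rounding in the block size loses less than one batch per block, hence at most
      half of all batches. So the exponent N is at least \<open>10 * ln n\<close> for every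
      t.\<close>
    have "K < 2 * N"
    proof -
      have "K = N + K mod Suc t" by (simp only: N_def m_def div_mult_mod_eq)
      also have "\<dots> < N + Suc t" by simp
      also have "\<dots> \<le> N + N" using m1 mult_le_mono1[OF m1, of "Suc t"] by (simp add: N_def)
      finally show ?thesis by simp
    qed
    then have N10: "10 * L \<le> real N" using KL(1) by linarith
    have x0: "0 \<le> x" by (simp add: x_def)
    have mom: "moments m (\<lambda>_. Z) x x"
      unfolding moments_def
    proof (intro conjI allI impI x0)
      show "EE (\<lambda>\<eta>. ((Z k l)\<^sup>2) ^ m) \<le> x * (A k k * B l l) ^ m" if "k < n" "l < n" for k l
        unfolding bexp_const[OF fin] x_def power_mult_distrib[where n = m, symmetric] by (intro power_mono Z that) simp
      show "EE (\<lambda>\<eta>. (\<Sum>l<n. (Z k l)\<^sup>2) ^ m) \<le> x * A k k ^ m" if "k < n" for k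
        unfolding bexp_const[OF fin] x_def power_mult_distrib[where n = m, symmetric] by (intro power_mono Z that sum_nonneg) simp
      show "EE (\<lambda>\<eta>. (\<Sum>k<n. (Z k l)\<^sup>2) ^ m) \<le> x * B l l ^ m" if "l < n" for l
        unfolding bexp_const[OF fin] x_def power_mult_distrib[where n = m, symmetric] by (intro power_mono Z that sum_nonneg) simp
    qed
    have tK: "real (Suc t) \<le> 22 * real n" using t Kn by linarith
    have "EE (T3 Z t) \<le> real n * (((288 / \<kappa>) ^ m) ^ Suc t * (x + real (Suc t) * real n * x))"
      using EE_T3[OF \<kappa>(2) \<kappa>l t _ tr] mom unfolding m_def by blast
    also have "\<dots> = real n * ((288 / \<kappa>) ^ N * (x * (1 + real (Suc t) * real n)))"
      unfolding N_def power_mult by (simp add: distrib_left mult_ac del: power_Suc of_nat_Suc)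
    also have "\<dots> \<le> real n * ((288 / \<kappa>) ^ N * ((w\<^sup>2) ^ N * (23 * (real n)\<^sup>2)))"
    proof (intro mult_left_mono mult_mono)
      \<comment> \<open>The power of w is raised from m to N so that it merges with the contraction
        factor; this is possible because w is at least 1.\<close>
      show "x \<le> (w\<^sup>2) ^ N" unfolding x_def by (rule power_increasing[OF mN w2])
      have "real (Suc t) * real n \<le> 22 * real n * real n" by (intro mult_right_mono tK) simp
      then show "1 + real (Suc t) * real n \<le> 23 * (real n)\<^sup>2" using np[of 2] by (simp add: power2_eq_square)
    qed (use \<kappa> in auto)
    finally have "(64 * 2 ^ t) ^ (2 * m) * EE (T3 Z t) \<le> 4096 ^ N * (real n * ((288 / \<kappa>) ^ N * ((w\<^sup>2) ^ N * (23 * (real n)\<^sup>2))))"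
    proof (intro mult_mono)
      have "(64 * 2 ^ t :: real) \<le> 64 ^ Suc t" by (simp add: power_mono)
      then have "(64 * 2 ^ t :: real) ^ (2 * m) \<le> (64 ^ Suc t) ^ (2 * m)" by (intro power_mono) auto
      also have "\<dots> = (64 ^ 2) ^ N" by (simp only: power_mult[symmetric] N_def mult_ac)
      finally show "(64 * 2 ^ t :: real) ^ (2 * m) \<le> 4096 ^ N" by simp
    qed (auto intro!: EE_nonneg T3_nonneg)
    also have "\<dots> = (4096 * (288 / \<kappa>) * w\<^sup>2) ^ N * (23 * real n ^ 3)"
      unfolding power_mult_distrib by (simp add: power2_eq_square power3_eq_cube)
    also have "4096 * (288 / \<kappa>) * w\<^sup>2 = 1 / 3" using w by (simp add: \<kappa>_def field_simps)
    also have "(1 / 3) ^ N * (23 * real n ^ 3) \<le> 1 / real n ^ 10 * (23 * real n ^ 3)"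
      by (intro mult_right_mono third_power_le) (use n N10 in \<open>auto simp: L_def\<close>)
    also have "\<dots> = 23 / real n ^ 7"
      using n by (simp add: field_simps flip: power_add)
    finally show ?thesis by (simp add: m_def)
  qed
  have "1 - EE (\<lambda>\<eta>. of_bool (good Z \<eta>)) = EE (\<lambda>\<eta>. 1 - of_bool (good Z \<eta>))"
    by (simp add: bexp_diff bexp_const[OF fin])
  also have "\<dots> \<le> EE (\<lambda>\<eta>. (128 * real n ^ 8)\<^sup>2 * T1 \<eta> + 1 / real n ^ 7 * T2 \<eta>
    + (\<Sum>t<K. (64 * 2 ^ t) ^ (2 * (K div Suc t)) * T3 Z t \<eta>))"
    by (intro EE_mono bad_le) (use n in auto)
  also have "\<dots> = (128 * real n ^ 8)\<^sup>2 * EE T1 + 1 / real n ^ 7 * EE T2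
    + (\<Sum>t<K. (64 * 2 ^ t) ^ (2 * (K div Suc t)) * EE (T3 Z t))"
    unfolding bexp_add bexp_sum bexp_cmult ..
  \<comment> \<open>The constants add up to 33318; \<open>506 = 22 * 23\<close>, from at most
    \<open>22 * n\<close> terms.\<close>
  also have "\<dots> \<le> 32768 / real n + 44 / real n + 506 / real n"
  proof (intro add_mono e1 e2)
    have "(\<Sum>t<K. (64 * 2 ^ t) ^ (2 * (K div Suc t)) * EE (T3 Z t)) \<le> (\<Sum>t<K. 23 / real n ^ 7)"
      by (intro sum_mono e3) simp
    also have "\<dots> = real K * (23 / real n ^ 7)" by simp
    also have "\<dots> \<le> 22 * real n * (23 / real n ^ 7)" by (intro mult_right_mono Kn) simp
    also have "\<dots> = 506 / real n ^ 6" using n by (simp add: field_simps flip: power_Suc)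
    also have "\<dots> \<le> 506 / real n" using n2 power_increasing[of 1 6 "real n"] by (intro divide_left_mono) auto
    finally show "(\<Sum>t<K. (64 * 2 ^ t) ^ (2 * (K div Suc t)) * EE (T3 Z t)) \<le> 506 / real n" .
  qed
  finally show ?thesis using n by (simp add: add_divide_distrib[symmetric])
qed

end

context prior_blocks
begin

text \<open>The normal part gains more than \<open>1 - 15 / 16 = 4 / 64\<close> of its nuclear norm,
  while the tangential part costs at most \<open>1 / 32 + 1 / 64 = 3 / 64\<close>. A vanishing
  normal part would force the perturbation to vanish.\<close>

lemma recovery:
  fixes K :: nat and \<rho> :: rmat
  assumes samp: "sampling n A B \<rho>" and good: "sampling.good n A B K \<rho> W \<eta>" and n: "1 \<le> n"
    and \<sigma>: "\<And>k. k < r \<Longrightarrow> 0 \<le> \<sigma> k"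
    and Xs: "\<And>i j. i < n \<Longrightarrow> j < n \<Longrightarrow> Xs i j = (\<Sum>k<r. \<sigma> k * U i k * V j k)"
    and D\<Psi>: "D = (\<lambda>i j. (\<Sum>t<r. U i t * V j t) - \<Psi> i j)"
    and S: "spec_norm r r S < 15 / 16" and Wn: "fro_norm n n W \<le> real n"
    and X: "\<And>i j s. i < n \<Longrightarrow> j < n \<Longrightarrow> s < K \<Longrightarrow> \<eta> (s, i, j) \<Longrightarrow> X i j = Xs i j"
    and ne: "\<not> mat_eq n n X Xs"
  shows "nuc_norm n Xs - ip n \<Psi> Xs < nuc_norm n X - ip n \<Psi> X"
proof -
  interpret s: sampling n A B K \<rho> by (rule samp)
  define H where "H = (\<lambda>i j. X i j - Xs i j)"
  let ?N = "nuc_norm n (PP n A B H)" and ?d1 = "1 / (128 * real n ^ 8)"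
  have Hz: "H i j = 0" if "i < n" "j < n" "t < K" "\<eta> (t, i, j)" for i j t using X[OF that] by (simp add: H_def)
  have WW: "PT n A B W = W" unfolding W_def by (rule P2.PT_PT_fix)
  have g1: "s.T1 \<eta> \<le> ?d1\<^sup>2" and g2: "s.T2 \<eta> \<le> real n ^ 7"
    and g3: "\<And>t. t < K \<Longrightarrow> s.T3 W t \<eta> \<le> (1 / (64 * 2 ^ t)) ^ (2 * (K div Suc t))"
    using good by (auto simp: s.good_def)
  have n8: "1 \<le> real n ^ 8" using n by simp
  have "2 \<le> 128 * real n ^ 8" using n8 by linarith
  then have "?d1 \<le> 1 / 2" by (rule frac_le[rotated 3]) auto
  then have d1: "0 \<le> ?d1" "?d1 \<le> 1 / 2" by auto
  have es: "(\<Sum>t<K. 1 / (64 * 2 ^ t)) \<le> (1 / 32 :: real)"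
  proof -
    have "(\<Sum>t<K. 1 / (64 * 2 ^ t)) = (1 - (1 / 2) ^ K) / (32 :: real)" by (induction K) (auto simp: field_simps)
    then show ?thesis by simp
  qed
  have "\<bar>ip n W H\<bar> \<le> (1 / 32 + 2 * ?d1 * real n ^ 7 * fro_norm n n W) * ?N"
    by (rule s.certificate(1)[where H = H, OF _ WW g1 d1 g2 g3 _ es]) (auto intro: Hz)
  also have "\<dots> \<le> (1 / 32 + 1 / 64) * ?N"
  proof (intro mult_right_mono add_left_mono nuc_nonneg)
    have "2 * ?d1 * real n ^ 7 * fro_norm n n W \<le> 2 * ?d1 * real n ^ 7 * real n" by (intro mult_left_mono Wn) simp
    also have "\<dots> = 1 / 64" using n by (simp add: field_simps flip: power_Suc)
    finally show "2 * ?d1 * real n ^ 7 * fro_norm n n W \<le> 1 / 64" .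
  qed
  finally have ip: "\<bar>ip n W H\<bar> \<le> 3 / 64 * ?N" by simp
  have gap: "nuc_norm n Xs - ip n \<Psi> Xs + (1 - spec_norm r r S) * ?N - \<bar>ip n W H\<bar> \<le> nuc_norm n X - ip n \<Psi> X"
    using objective_gap[OF P2.proj2_axioms U V \<sigma> Xs, where \<Psi> = \<Psi> and \<alpha> = "spec_norm r r S" and X = X] opb_PP_D
    unfolding H_def W_def D\<Psi>[symmetric] by blast
  have "?N \<noteq> 0"
  proof
    assume "?N = 0"
    then have "H i j = 0" if "i < n" "j < n" for i j
      by (rule s.certificate(2)[where H = H, OF _ WW g1 d1 g2 g3 _ es, rotated 3]) (auto intro: Hz that)
    then show False using ne by (simp add: mat_eq_def H_def)
  qed
  then have "0 < ?N" using nuc_nonneg[of n "PP n A B H"] by simp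
  then have "1 / 16 * ?N < (1 - spec_norm r r S) * ?N" using S by (intro mult_strict_right_mono) auto
  then show ?thesis using gap ip \<open>0 < ?N\<close> by linarith
qed

end

section \<open>Assembly of the block form, the sampling rates and the coupling\<close>

lemma mmul_mscale_mid: "mmul r P (mmul r (mscale c M) Q) i j = c * mmul r P (mmul r M Q) i j"
  by (simp add: mmul_def mscale_def sum_distrib_left mult_ac)

lemma mmul_msub_mid: "mmul r P (mmul r (msub M M') Q) i j = mmul r P (mmul r M Q) i j - mmul r P (mmul r M' Q) i j"
  by (simp add: mmul_def msub_def left_diff_distrib right_diff_distrib sum_subtractf)

lemma mmul_idm_mid: "mmul r P (mmul r idm Q) i j = mmul r P Q i j"
proof -
  have "mmul r P (mmul r idm Q) i j = mmul r (mmul r P idm) Q i j" by (simp add: mmul_assoc)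
  also have "\<dots> = mmul r P Q i j" by (rule mmul_cong_left) (rule mmul_idm)
  finally show ?thesis .
qed

text \<open>\<open>77856768 = 22 * 3538944\<close>, since at most \<open>22 * ln n\<close> batches share the sampling rate.\<close>

lemma exact_recovery:
  fixes n r :: nat and Xs U V Ut Vt LL RL LR RR p :: rmat and \<sigma> g h :: "nat \<Rightarrow> real" and lam :: real
  assumes Acc: "Acc = mmul r (mmul r (mmul r (mmul r LL (diagm (\<lambda>k. cos (g k)))) (mtrans RL)) RR)
               (mmul r (diagm (\<lambda>k. cos (h k))) (mtrans LR))"
    and Acs: "Acs = mmul r (mmul r (mmul r (mmul r LL (diagm (\<lambda>k. cos (g k)))) (mtrans RL)) RR)
               (mmul r (diagm (\<lambda>k. sin (h k))) (mtrans LR))"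
    and Asc: "Asc = mmul r (mmul r (mmul r (mmul r LL (diagm (\<lambda>k. sin (g k)))) (mtrans RL)) RR)
               (mmul r (diagm (\<lambda>k. cos (h k))) (mtrans LR))"
    and Ass: "Ass = mmul r (mmul r (mmul r (mmul r LL (diagm (\<lambda>k. sin (g k)))) (mtrans RL)) RR)
               (mmul r (diagm (\<lambda>k. sin (h k))) (mtrans LR))"
    and \<alpha>3: "\<alpha>3 = spec_norm r r (msub idm (mscale lam Acc)) + spec_norm r r (mscale lam Asc)
              + spec_norm r r (mscale lam Acs)"
    and \<mu>: "\<mu> = lev_score n (col_span n r U)" and \<nu>: "\<nu> = lev_score n (col_span n r V)"
    and b\<mu>: "b\<mu> = lev_score n (col_span n (2 * r) (hcat r U Ut))"
    and b\<nu>: "b\<nu> = lev_score n (col_span n (2 * r) (hcat r V Vt))"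
    and \<beta>: "\<beta> = max 1 (max (sqrt (2 * Max ((\<lambda>i. b\<mu> i / \<mu> i) ` {..<n})))
                      (sqrt (2 * Max ((\<lambda>j. b\<nu> j / \<nu> j) ` {..<n}))))"
    and obj: "obj = (\<lambda>X. nuc_norm n X - lam * frob_inner n n (mmul r Ut (mtrans Vt)) X)"
    and r: "1 \<le> r" "2 * r \<le> n"
    and U: "orthonormal_cols n r U" and V: "orthonormal_cols n r V" and \<sigma>: "\<forall>k<r. 0 < \<sigma> k"
    and Xs: "mat_eq n n Xs (mmul r (mmul r U (diagm \<sigma>)) (mtrans V))"
    and Ut: "orthonormal_cols n r Ut" and Vt: "orthonormal_cols n r Vt"
    and LL: "orthogonal_mat r LL" and RL: "orthogonal_mat r RL" and LR: "orthogonal_mat r LR" and RR: "orthogonal_mat r RR"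
    and svdL: "mat_eq r r (mmul n (mtrans U) Ut) (mmul r (mmul r LL (diagm (\<lambda>k. cos (g k)))) (mtrans RL))"
    and svdR: "mat_eq r r (mmul n (mtrans V) Vt) (mmul r (mmul r LR (diagm (\<lambda>k. cos (h k)))) (mtrans RR))"
    and pos: "\<forall>i<n. 0 < \<mu> i" "\<forall>j<n. 0 < \<nu> j"
    and p: "\<forall>i<n. \<forall>j<n. 0 < p i j \<and> p i j \<le> 1 \<and>
          p i j \<ge> 77856768 * max \<gamma> 1 * ((\<mu> i + \<nu> j) * real r * ln (real n) / real n) * max (\<alpha>3\<^sup>2 * \<beta>\<^sup>2) 1"
    and \<alpha>2: "spec_norm r r (mscale lam Ass) < 15 / 16"
  shows "measure_pmf.prob (bern_sampling n p)
         {\<delta>. \<forall>X. mat_eq n n (sampling_op p \<delta> X) (sampling_op p \<delta> Xs) \<and> \<not> mat_eq n n X Xs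
                \<longrightarrow> obj Xs < obj X} \<ge> 1 - 33318 * real n powr (- 1)"
proof -
  let ?Mc = "mmul r (mmul r LL (diagm (\<lambda>k. cos (g k)))) (mtrans RL)"
  let ?Ms = "mmul r (mmul r LL (diagm (\<lambda>k. sin (g k)))) (mtrans RL)"
  let ?Nc = "mmul r (mmul r LR (diagm (\<lambda>k. cos (h k)))) (mtrans RR)"
  let ?Ns = "mmul r (mmul r LR (diagm (\<lambda>k. sin (h k)))) (mtrans RR)"
  let ?E = "msub idm (mscale lam Acc)" and ?F = "mscale lam Acs" and ?G = "mscale lam Asc" and ?S = "mscale lam Ass"
  define \<Psi> where "\<Psi> = (\<lambda>i j. lam * mmul r Ut (mtrans Vt) i j)"
  define D where "D = (\<lambda>i j. (\<Sum>t<r. U i t * V j t) - \<Psi> i j)"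
  obtain Z where Z: "\<And>i t. i < n \<Longrightarrow> t < r \<Longrightarrow> Ut i t = mmul r U ?Mc i t + mmul r Z ?Ms i t"
    and UZ: "\<And>s t. s < r \<Longrightarrow> t < r \<Longrightarrow> (\<Sum>i<n. U i s * Z i t) = 0"
    and Zb: "\<And>x. vnorm r (\<lambda>t. \<Sum>i<n. Z i t * x i) \<le> vnorm n x"
    and Zr: "\<And>M i. (\<And>s t. s < r \<Longrightarrow> (\<Sum>j<n. M j * U j s) = U i s) \<Longrightarrow> (\<And>s t. s < r \<Longrightarrow> (\<Sum>j<n. M j * Ut j s) = Ut i s)
      \<Longrightarrow> vnorm r (Z i) \<le> vnorm n M"
    by (rule principal_angles[OF U Ut LL RL svdL]) blast
  obtain Y where Y: "\<And>i t. i < n \<Longrightarrow> t < r \<Longrightarrow> Vt i t = mmul r V ?Nc i t + mmul r Y ?Ns i t"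
    and VY: "\<And>s t. s < r \<Longrightarrow> t < r \<Longrightarrow> (\<Sum>i<n. V i s * Y i t) = 0"
    and Yb: "\<And>x. vnorm r (\<lambda>t. \<Sum>i<n. Y i t * x i) \<le> vnorm n x"
    and Yr: "\<And>M i. (\<And>s t. s < r \<Longrightarrow> (\<Sum>j<n. M j * V j s) = V i s) \<Longrightarrow> (\<And>s t. s < r \<Longrightarrow> (\<Sum>j<n. M j * Vt j s) = Vt i s)
      \<Longrightarrow> vnorm r (Y i) \<le> vnorm n M"
    by (rule principal_angles[OF V Vt LR RR svdR]) blast
  have n: "2 \<le> n" "0 < real n" "0 < real r" using r by auto
  have \<beta>1: "1 \<le> \<beta>" by (simp add: \<beta>)
  have \<beta>M: "2 * (q i) \<le> \<beta>\<^sup>2" if "sqrt (2 * Max (q ` {..<n})) \<le> \<beta>" "i < n" for q :: "nat \<Rightarrow> real" and i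
  proof -
    have "q i \<le> Max (q ` {..<n})" using that(2) by (intro Max_ge) auto
    then show ?thesis using sqrt_le_D[OF that(1)] by linarith
  qed
  have gU: "\<mu> i = real n / real r * gram r U i i" if "i < n" for i unfolding \<mu> by (rule lev_score_gram[OF U that])
  have gV: "\<nu> i = real n / real r * gram r V i i" if "i < n" for i unfolding \<nu> by (rule lev_score_gram[OF V that])
  interpret pb: prior_blocks n r U V Z Y D ?E ?F ?G ?S \<beta>
  proof unfold_locales
    show "0 < gram r U i i" if "i < n" for i
      using pos(1) that n unfolding gU[OF that, symmetric] by (metis gU zero_less_mult_pos zero_less_divide_iff)
    show "0 < gram r V i i" if "i < n" for i
      using pos(2) that n by (metis gV zero_less_mult_pos zero_less_divide_iff)
    show "vnorm r (Z i) \<le> \<beta> * vnorm r (U i)" if "i < n" for i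
    proof (rule prior_row_bound[OF U Ut r(1) _ that])
      show "2 * (lev_score n (col_span n (2 * r) (hcat r U Ut)) i / lev_score n (col_span n r U) i) \<le> \<beta>\<^sup>2"
        using \<beta>M[of "\<lambda>i. b\<mu> i / \<mu> i" i] that unfolding b\<mu>[symmetric] \<mu>[symmetric] by (simp add: \<beta>)
    qed (use pos(1) \<mu> that \<beta>1 Zr in auto)
    show "vnorm r (Y i) \<le> \<beta> * vnorm r (V i)" if "i < n" for i
    proof (rule prior_row_bound[OF V Vt r(1) _ that])
      show "2 * (lev_score n (col_span n (2 * r) (hcat r V Vt)) i / lev_score n (col_span n r V) i) \<le> \<beta>\<^sup>2"
        using \<beta>M[of "\<lambda>i. b\<nu> i / \<nu> i" i] that unfolding b\<nu>[symmetric] \<nu>[symmetric] by (simp add: \<beta>)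
    qed (use pos(2) \<nu> that \<beta>1 Yr in auto)
    fix i j assume ij: "i < n" "j < n"
    have exp: "mmul r P (mmul r (mmul r M (mtrans N)) (mtrans Q)) i j = (\<Sum>t<r. mmul r P M i t * mmul r Q N j t)" for P M N Q
    proof -
      have "mmul r P (mmul r (mmul r M (mtrans N)) (mtrans Q)) = mmul r (mmul r P M) (mtrans (mmul r Q N))"
        by (simp add: mtrans_mmul mmul_assoc)
      then show ?thesis by (simp add: mmul_def[of r "mmul r P M"] mtrans_def)
    qed
    \<comment> \<open>Every block is a left factor times the transpose of a right factor, so the
      product of Ut with the transpose of Vt expands into exactly these four blocks.\<close>
    have A: "Acc = mmul r ?Mc (mtrans ?Nc)" "Acs = mmul r ?Mc (mtrans ?Ns)" "Asc = mmul r ?Ms (mtrans ?Nc)" "Ass = mmul r ?Ms (mtrans ?Ns)"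
      unfolding Acc Acs Asc Ass by (simp_all add: mtrans_mmul mmul_assoc)
    have "mmul r Ut (mtrans Vt) i j = (\<Sum>t<r. (mmul r U ?Mc i t + mmul r Z ?Ms i t) * (mmul r V ?Nc j t + mmul r Y ?Ns j t))"
      by (simp add: mmul_def[of r Ut] mtrans_def[of Vt] Z[OF ij(1)] Y[OF ij(2)])
    also have "\<dots> = mmul r U (mmul r Acc (mtrans V)) i j + mmul r U (mmul r Acs (mtrans Y)) i j
        + mmul r Z (mmul r Asc (mtrans V)) i j + mmul r Z (mmul r Ass (mtrans Y)) i j"
      unfolding A exp by (simp add: distrib_left distrib_right sum.distrib)
    finally have \<Phi>: "mmul r Ut (mtrans Vt) i j = mmul r U (mmul r Acc (mtrans V)) i j + mmul r U (mmul r Acs (mtrans Y)) i j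
        + mmul r Z (mmul r Asc (mtrans V)) i j + mmul r Z (mmul r Ass (mtrans Y)) i j" .
    have UV: "mmul r U (mtrans V) i j = (\<Sum>t<r. U i t * V j t)" by (simp add: mmul_def mtrans_def)
    show "D i j = mmul r U (mmul r ?E (mtrans V)) i j - mmul r U (mmul r ?F (mtrans Y)) i j
       - mmul r Z (mmul r ?G (mtrans V)) i j - mmul r Z (mmul r ?S (mtrans Y)) i j"
      unfolding mmul_msub_mid mmul_mscale_mid mmul_idm_mid UV D_def \<Psi>_def \<Phi> by (simp add: algebra_simps)
  qed (fact U V UZ VY Zb Yb \<beta>1)+
  let ?A = "gram r U" and ?B = "gram r V"
  have \<alpha>: "pb.\<alpha> = \<alpha>3" by (simp add: pb.\<alpha>_def \<alpha>3)
  \<comment> \<open>The maximum with 1 matches the last factor of the rate condition and provides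
    the bound \<open>1 <= w\<close> for merging powers.\<close>
  define w where "w = max 1 (\<alpha>3 * \<beta>)"
  have w1: "1 \<le> w" and ww: "pb.\<alpha> * \<beta> \<le> w" by (auto simp: w_def \<alpha>)
  have w2: "w\<^sup>2 \<le> max (\<alpha>3\<^sup>2 * \<beta>\<^sup>2) 1"
    by (auto simp: w_def max_def power_mult_distrib)
  have w21: "1 \<le> w\<^sup>2" using w1 by (simp add: one_le_power)
  note Wb = pb.W_sq[OF ww]
  define K where "K = nat \<lceil>20 * ln (real n)\<rceil>"
  define L where "L = ln (real n)"
  have "ln 2 \<le> L" using n by (simp add: L_def)
  \<comment> \<open>With this, rounding up costs at most \<open>1 <= 2 * L\<close>, so K is at most
    \<open>22 * L\<close>.\<close>
  then have L: "1 / 2 \<le> L" using ln2_ge_two_thirds by linarith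
  have KL: "real K \<le> 22 * L" "1 \<le> K" using L unfolding K_def L_def[symmetric] by linarith+
  \<comment> \<open>The K attempts at a cell then have total probability exactly
    \<open>p i j\<close>, as the coupling requires.\<close>
  define \<rho> where "\<rho> = (\<lambda>i j. p i j / real K)"
  have lamp: "0 < pb.P2.lam k l" if "k < n" "l < n" for k l by (rule pb.P2.lam_pos[OF that])
  have p\<rho>: "3538944 * w\<^sup>2 * pb.P2.lam k l \<le> \<rho> k l" if kl: "k < n" "l < n" for k l
  proof -
    have e: "(\<mu> k + \<nu> l) * real r * ln (real n) / real n = pb.P2.lam k l * L"
      using n by (simp add: gU[OF kl(1)] gV[OF kl(2)] pb.P2.lam_def L_def field_simps)
    have lL: "0 \<le> pb.P2.lam k l * L" using lamp[OF kl] L by simp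
    have "real K * (3538944 * w\<^sup>2 * pb.P2.lam k l) \<le> 22 * L * (3538944 * w\<^sup>2 * pb.P2.lam k l)"
      using KL lamp[OF kl] by (intro mult_right_mono) auto
    also have "\<dots> = 77856768 * 1 * (pb.P2.lam k l * L) * w\<^sup>2" by simp
    also have "\<dots> \<le> 77856768 * max \<gamma> 1 * (pb.P2.lam k l * L) * max (\<alpha>3\<^sup>2 * \<beta>\<^sup>2) 1"
      using lL less_imp_le[OF lamp[OF kl]] L by (intro mult_mono w2) auto
    also have "\<dots> \<le> p k l" using p kl unfolding e[symmetric] by blast
    finally show ?thesis using KL(2) by (simp add: \<rho>_def field_simps)
  qed
  have samp: "sampling n ?A ?B \<rho>"
  proof (intro sampling.intro sampling_axioms.intro pb.P2.proj2_axioms)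
    fix i j assume "i < n" "j < n"
    then have "0 < p i j" "p i j \<le> 1" using p by auto
    then show "0 < \<rho> i j \<and> \<rho> i j \<le> 1" using KL(2) by (simp add: \<rho>_def divide_le_eq)
  qed
  interpret s: sampling n ?A ?B K \<rho> by (rule samp)
  have tr: "(\<Sum>k<n. ?A k k) \<le> real n" "(\<Sum>k<n. ?B k k) \<le> real n"
    using r by (simp_all add: gram_trace[OF U] gram_trace[OF V])
  have prob: "1 - 33318 / real n \<le> s.EE (\<lambda>\<eta>. of_bool (s.good pb.W \<eta>))"
    by (rule s.prob_good[OF n(1) K_def w1 p\<rho> tr Wb])
  have Wn: "fro_norm n n pb.W \<le> real n"
  proof -
    \<comment> \<open>The rate condition and \<open>\<rho> <= 1\<close> force the row bound of W
      below 1, so the Frobenius norm is polynomial without further assumptions on the prior.\<close>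
    have "(\<Sum>j<n. (pb.W i j)\<^sup>2) \<le> 1" if i: "i < n" for i
    proof -
      have "w\<^sup>2 * ?A i i \<le> 3538944 * w\<^sup>2 * pb.P2.lam i i"
        using w21 pb.gpos[OF i] by (simp add: pb.P2.lam_def distrib_left)
      also have "\<dots> \<le> 1" using p\<rho>[OF i i] s.\<rho>01[OF i i] by linarith
      finally show ?thesis using Wb(2)[OF i] by linarith
    qed
    then have "(fro_norm n n pb.W)\<^sup>2 \<le> (\<Sum>i<n. 1)" unfolding fro_sq by (intro sum_mono) simp
    also have "\<dots> \<le> (real n)\<^sup>2" using n by (simp add: power2_eq_square)
    finally show ?thesis by (rule power2_le_imp_le) simp
  qed
  define R where "R = {\<delta>. \<forall>X. mat_eq n n (sampling_op p \<delta> X) (sampling_op p \<delta> Xs) \<and> \<not> mat_eq n n X Xs \<longrightarrow> obj Xs < obj X}"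
  define un where "un \<eta> = (\<lambda>c::nat \<times> nat. \<exists>i\<in>s.idx. snd i = c \<and> \<eta> i)" for \<eta> :: "nat \<times> nat \<times> nat \<Rightarrow> bool"
  have obj': "obj X = nuc_norm n X - ip n \<Psi> X" for X
    by (simp add: obj \<Psi>_def frob_inner_def sum_distrib_left mult.assoc)
  have Xs': "Xs i j = (\<Sum>k<r. \<sigma> k * U i k * V j k)" if "i < n" "j < n" for i j
  proof -
    have "Xs i j = (\<Sum>k<r. mmul r U (diagm \<sigma>) i k * V j k)"
      using Xs that by (simp add: mat_eq_def mmul_def[of r "mmul r U (diagm \<sigma>)"] mtrans_def)
    then show ?thesis by (simp add: mmul_diagm mult_ac)
  qed
  have rec: "un \<eta> \<in> R" if good: "s.good pb.W \<eta>" for \<eta>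
    unfolding R_def
  proof (intro CollectI allI impI, elim conjE)
    fix X assume eq: "mat_eq n n (sampling_op p (un \<eta>) X) (sampling_op p (un \<eta>) Xs)" and ne: "\<not> mat_eq n n X Xs"
    show "obj Xs < obj X"
      unfolding obj'
    proof (rule pb.recovery[OF samp good _ _ Xs' D_def \<alpha>2 Wn _ ne])
      fix i j t assume a: "i < n" "j < n" "t < K" "\<eta> (t, i, j)"
      then have "un \<eta> (i, j)" by (auto simp: un_def s.idx_def intro!: bexI[of _ "(t, i, j)"])
      moreover have "p i j \<noteq> 0" using p a(1,2) by force
      moreover have "sampling_op p (un \<eta>) X i j = sampling_op p (un \<eta>) Xs i j" using eq a(1,2) by (simp add: mat_eq_def)
      ultimately show "X i j = Xs i j" by (simp add: sampling_op_def)
    qed (use n \<sigma> in \<open>auto intro: less_imp_le\<close>)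
  qed
  \<comment> \<open>More samples mean more constraints, so fewer competitors are feasible.\<close>
  have mono: "(of_bool (\<theta> \<in> R) :: real) \<le> of_bool (\<theta>' \<in> R)" if le: "\<theta> \<le> \<theta>'" for \<theta> \<theta>'
  proof -
    have "mat_eq n n (sampling_op p \<theta> X) (sampling_op p \<theta> Xs)" if "mat_eq n n (sampling_op p \<theta>' X) (sampling_op p \<theta>' Xs)" for X
      unfolding mat_eq_def
    proof (intro allI impI)
      fix i j assume ij: "i < n" "j < n"
      have "\<theta> (i, j) \<Longrightarrow> \<theta>' (i, j)" using le by (auto simp: le_fun_def)
      moreover have "sampling_op p \<theta>' X i j = sampling_op p \<theta>' Xs i j" using that ij by (auto simp: mat_eq_def)
      ultimately show "sampling_op p \<theta> X i j = sampling_op p \<theta> Xs i j" by (auto simp: sampling_op_def)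
    qed
    then have "\<theta> \<in> R \<Longrightarrow> \<theta>' \<in> R" unfolding R_def by blast
    then show ?thesis by auto
  qed
  let ?C = "{..<n} \<times> {..<n}" and ?p = "\<lambda>(i, j). p i j"
  have "s.EE (\<lambda>\<eta>. of_bool (s.good pb.W \<eta>)) \<le> s.EE (\<lambda>\<eta>. of_bool (un \<eta> \<in> R))"
    by (rule s.EE_mono) (use rec in auto)
  also have "\<dots> \<le> bexp ?C ?p (\<lambda>\<theta>. of_bool (\<theta> \<in> R))"
    unfolding un_def
  proof (rule bexp_union_le[where f = "\<lambda>\<theta>. of_bool (\<theta> \<in> R)"])
    show "finite s.idx" "finite ?C" by (auto simp: s.idx_def)
    show "0 \<le> s.rt i \<and> snd i \<in> ?C" if "i \<in> s.idx" for i
      using that s.\<rho>01 by (auto simp: s.idx_def s.rt_def intro: less_imp_le)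
    fix c assume c: "c \<in> ?C"
    then obtain i j where ij: "c = (i, j)" "i < n" "j < n" by auto
    have "{x. x \<in> s.idx \<and> snd x = c} = (\<lambda>t. (t, i, j)) ` {..<K}" using ij by (auto simp: s.idx_def)
    then have "(\<Sum>x | x \<in> s.idx \<and> snd x = c. s.rt x) = (\<Sum>t<K. \<rho> i j)"
      by (simp add: sum.reindex inj_on_def s.rt_def)
    also have "\<dots> = p i j" using KL(2) by (simp add: \<rho>_def)
    finally show "(\<Sum>x | x \<in> s.idx \<and> snd x = c. s.rt x) \<le> ?p c \<and> ?p c \<le> 1" using ij p by simp
  qed (rule mono)
  also have "\<dots> = measure_pmf.prob (bern_sampling n p) R"
  proof -
    have "(\<lambda>(i, j). bernoulli_pmf (p i j)) = (\<lambda>c. bernoulli_pmf (?p c))" by (simp add: split_def)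
    then show ?thesis
      unfolding bern_sampling_def using p by (subst prob_Pi_bernoulli[symmetric]) (auto intro: less_imp_le)
  qed
  finally show ?thesis using prob n by (simp add: R_def powr_minus divide_inverse)
qed

theorem theorem3:
  shows "\<exists>C>0. \<exists>c1>0. \<exists>c2>0. \<forall>(n::nat) (r::nat) Xs U \<sigma> V Ut Vt LL RL LR RR
      (g::nat \<Rightarrow> real) (h::nat \<Rightarrow> real) (lam::real) p.
    (let
       Acc = mmul r (mmul r (mmul r (mmul r LL (diagm (\<lambda>k. cos (g k)))) (mtrans RL)) RR)
               (mmul r (diagm (\<lambda>k. cos (h k))) (mtrans LR));
       Acs = mmul r (mmul r (mmul r (mmul r LL (diagm (\<lambda>k. cos (g k)))) (mtrans RL)) RR)
               (mmul r (diagm (\<lambda>k. sin (h k))) (mtrans LR));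
       Asc = mmul r (mmul r (mmul r (mmul r LL (diagm (\<lambda>k. sin (g k)))) (mtrans RL)) RR)
               (mmul r (diagm (\<lambda>k. cos (h k))) (mtrans LR));
       Ass = mmul r (mmul r (mmul r (mmul r LL (diagm (\<lambda>k. sin (g k)))) (mtrans RL)) RR)
               (mmul r (diagm (\<lambda>k. sin (h k))) (mtrans LR));
       \<Phi> = mmul r Ut (mtrans Vt);
       \<alpha>1sq = (fro_norm r r (msub idm (mscale lam Acc)))\<^sup>2 + (fro_norm r r (mscale lam Acs))\<^sup>2
              + (fro_norm r r (mscale lam Asc))\<^sup>2;
       \<alpha>2 = spec_norm r r (mscale lam Ass);
       \<alpha>3 = spec_norm r r (msub idm (mscale lam Acc)) + spec_norm r r (mscale lam Asc)
              + spec_norm r r (mscale lam Acs);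
       \<mu> = lev_score n (col_span n r U);
       \<nu> = lev_score n (col_span n r V);
       b\<mu> = lev_score n (col_span n (2 * r) (hcat r U Ut));
       b\<nu> = lev_score n (col_span n (2 * r) (hcat r V Vt));
       \<beta> = max 1 (max (sqrt (2 * Max ((\<lambda>i. b\<mu> i / \<mu> i) ` {..<n})))
                      (sqrt (2 * Max ((\<lambda>j. b\<nu> j / \<nu> j) ` {..<n}))));
       obj = (\<lambda>X. nuc_norm n X - lam * frob_inner n n \<Phi> X)
     in
       1 \<le> r \<and> 2 * r \<le> n \<and>
       orthonormal_cols n r U \<and> orthonormal_cols n r V \<and> (\<forall>k<r. 0 < \<sigma> k) \<and>
       mat_eq n n Xs (mmul r (mmul r U (diagm \<sigma>)) (mtrans V)) \<and>
       orthonormal_cols n r Ut \<and> orthonormal_cols n r Vt \<and>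
       orthogonal_mat r LL \<and> orthogonal_mat r RL \<and> orthogonal_mat r LR \<and> orthogonal_mat r RR \<and>
       (\<forall>k<r. 0 \<le> g k \<and> g k \<le> pi / 2) \<and> (\<forall>k<r. 0 \<le> h k \<and> h k \<le> pi / 2) \<and>
       mat_eq r r (mmul n (mtrans U) Ut) (mmul r (mmul r LL (diagm (\<lambda>k. cos (g k)))) (mtrans RL)) \<and>
       mat_eq r r (mmul n (mtrans V) Vt) (mmul r (mmul r LR (diagm (\<lambda>k. cos (h k)))) (mtrans RR)) \<and>
       0 \<le> lam \<and> lam \<le> 1 \<and>
       (\<forall>i<n. 0 < \<mu> i) \<and> (\<forall>j<n. 0 < \<nu> j) \<and>
       (\<forall>i<n. \<forall>j<n. 0 < p i j \<and> p i j \<le> 1 \<and>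
          p i j \<ge> C * max (ln (\<alpha>1sq * real n / (real r * ln (real n)))) 1
                    * ((\<mu> i + \<nu> j) * real r * ln (real n) / real n)
                    * max (\<alpha>3\<^sup>2 * \<beta>\<^sup>2) 1) \<and>
       \<alpha>2 < 15 / 16
     \<longrightarrow>
       measure_pmf.prob (bern_sampling n p)
         {\<delta>. \<forall>X. mat_eq n n (sampling_op p \<delta> X) (sampling_op p \<delta> Xs) \<and> \<not> mat_eq n n X Xs
                \<longrightarrow> obj Xs < obj X}
       \<ge> 1 - c1 * real n powr (- c2))"
  unfolding Let_def
\<comment> \<open>The witnesses are \<open>22 * 3538944\<close> for the rate, and 33318 and exponent
  1 for the failure probability.\<close>
proof (rule exI[of _ 77856768], rule conjI[rotated], rule exI[of _ 33318], rule conjI[rotated],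
    rule exI[of _ 1], rule conjI[rotated], intro allI impI, goal_cases)
  case (1 n r Xs U \<sigma> V Ut Vt LL RL LR RR g h lam p)
  then show ?case
    by (elim conjE) (rule exact_recovery[OF refl refl refl refl refl refl refl refl refl refl refl], assumption+)
qed simp_all

end
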